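(* Fix an integer $q\geq 1$ and let $F\in C_q$ (the $q$-th Poisson Wiener chaos associated with the Poisson random measure $\eta$) be such that $\sigma^2:=\mathbb{E}[F^2]>0$ (with $\sigma>0$) and $\mathbb{E}[F^4]<\infty$. Then, with $N$ denoting a standard normal random variable, we have the bounds $$d_{\mathcal{W}}(F,\sigma N)\leq \left(\frac{2q-1}{\sigma q\sqrt{2\pi}}+\frac{2}{3\sigma}\sqrt{\frac{4q-3}{q}}\right)\sqrt{\mathbb{E}[F^4]-3\sigma^4}\leq\left(\frac{1}{\sigma}\sqrt{\frac{2}{\pi}}+\frac{4}{3\sigma}\right)\sqrt{\mathbb{E}[F^4]-3\sigma^4}\,.$$
   Context: $(\mathcal{Z},\mathscr{Z},\mu)$ is a $\sigma$-finite measure space and $\eta$ is a Poisson random measure on it with control $\mu$, defined on a probability space $(\Omega,\mathcal{F},\mathbb{P})$: for pairwise disjoint $B_1,\dots,B_m\in\mathscr{Z}$ the variables $\eta(B_1),\dots,\eta(B_m)$ are independent, and $\eta(B)$ is Poisson distributed with mean $\mu(B)$ for all $B\in\mathscr{Z}$ (with values in $[0,+\infty]$ allowed for the mean). The compensated measure is $\widehat\eta(B)=\eta(B)-\mu(B)$ for $\mu(B)<\infty$. Multiple integrals: for $q\ge1$ and $f\in L^2(\mu^q)$, $I^\eta_q(f)$ is the multiple Wiener-It\^o integral of order $q$ of $f$ with respect to $\widehat\eta$; $I^\eta_0(c)=c$ for $c\in\mathbb{R}$. Concretely, for symmetric $f\in L^1(\mu^q)\cap L^2(\mu^q)$, $I_q^\eta(f)=\sum_{k=0}^q(-1)^{q-k}\binom{q}{k}\int\int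 f\,d\eta^{(k)}\,d\mu^{q-k}$, where $\eta^{(k)}$ is the $k$-th factorial measure of $\eta$ (sum of unit masses at $k$-tuples of atoms of $\eta$ with distinct indices); this extends by $L^2$-continuity to symmetric $f\in L^2(\mu^q)$, and $I_q^\eta(f)=I_q^\eta(\tilde f)$ with $\tilde f$ the symmetrization of $f$. One has $\mathbb{E}[I^\eta_p(f)I^\eta_q(g)]=\delta_{p,q}\,p!\,\langle\tilde f,\tilde g\rangle_{L^2(\mu^p)}$. The $q$-th Poisson Wiener chaos is $C_q=\{I_q^\eta(f): f\in L^2(\mu^q)\}$. The Wasserstein distance between (the laws of) integrable real random variables $X,Y$ is $d_{\mathcal{W}}(X,Y)=\sup_h|\mathbb{E}[h(X)]-\mathbb{E}[h(Y)]|$, the supremum being over all $1$-Lipschitz functions $h:\mathbb{R}\to\mathbb{R}$. *)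

theory Defs
  imports "HOL-Probability.Probability"
begin

section \<open>Poisson random measures\<close>

text \<open>
  Every realisation \<open>\<eta> \<omega>\<close> is a measure with values in \<open>{0, 1, 2, \<dots>, \<infinity>}\<close>; this is the usual
  notion of a point process, and it is what makes factorial measures available.  The Poisson
  probabilities are written out because \<open>poisson_pmf\<close> does not cover mean \<open>0\<close>; the Poisson law
  with mean \<open>\<infinity>\<close> is the point mass at \<open>\<infinity>\<close>.
\<close>

definition poisson_random_measure ::
  "'w measure \<Rightarrow> 'z measure \<Rightarrow> ('w \<Rightarrow> 'z measure) \<Rightarrow> bool" where
  "poisson_random_measure P M \<eta> \<longleftrightarrow>
     (\<forall>\<omega>\<in>space P. sets (\<eta> \<omega>) = sets M \<and>
        (\<forall>B\<in>sets M. emeasure (\<eta> \<omega>) B \<in> insert \<infinity> (range of_nat))) \<and>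
     (\<forall>B\<in>sets M. (\<lambda>\<omega>. emeasure (\<eta> \<omega>) B) \<in> borel_measurable P) \<and>
     (\<forall>(m::nat) B. (\<forall>i<m. B i \<in> sets M) \<and> disjoint_family_on B {..<m} \<longrightarrow>
        prob_space.indep_vars P (\<lambda>_. borel) (\<lambda>i \<omega>. emeasure (\<eta> \<omega>) (B i)) {..<m}) \<and>
     (\<forall>B\<in>sets M. emeasure M B < \<infinity> \<longrightarrow>
        (\<forall>k::nat. measure P {\<omega>\<in>space P. emeasure (\<eta> \<omega>) B = of_nat k} =
           measure M B ^ k / fact k * exp (- measure M B))) \<and>
     (\<forall>B\<in>sets M. emeasure M B = \<infinity> \<longrightarrow> (AE \<omega> in P. emeasure (\<eta> \<omega>) B = \<infinity>))"


section \<open>Factorial measures\<close>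

text \<open>
  On an arbitrary measurable space an integer-valued \<open>\<sigma>\<close>-finite measure is a countable sum of
  \<open>{0,1}\<close>-valued probability measures, but these need not be Dirac measures \<open>return M x\<close>.
  Such measures therefore play the role of the unit masses sitting at the (indexed) atoms,
  so that the Poisson random measure does not have to be assumed proper.
\<close>

definition unit_mass :: "'z measure \<Rightarrow> 'z measure \<Rightarrow> bool" where
  "unit_mass M \<nu> \<longleftrightarrow>
     prob_space \<nu> \<and> sets \<nu> = sets M \<and> (\<forall>A\<in>sets M. emeasure \<nu> A \<in> {0, 1})"

definition atom_decomposition ::
  "'z measure \<Rightarrow> 'z measure \<Rightarrow> nat set \<Rightarrow> (nat \<Rightarrow> 'z measure) \<Rightarrow> bool" where
  "atom_decomposition M N J \<nu> \<longleftrightarrow>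
     (\<forall>i\<in>J. unit_mass M (\<nu> i)) \<and>
     (\<forall>A\<in>sets M. emeasure N A = (\<integral>\<^sup>+i. emeasure (\<nu> i) A \<partial>count_space J))"

text \<open>The sum of the unit masses at all \<open>k\<close>-tuples of atoms with pairwise distinct indices in \<open>J\<close>.\<close>

definition distinct_tuples_measure ::
  "nat \<Rightarrow> 'z measure \<Rightarrow> nat set \<Rightarrow> (nat \<Rightarrow> 'z measure) \<Rightarrow> (nat \<Rightarrow> 'z) measure" where
  "distinct_tuples_measure k M J \<nu> =
     measure_of (space (PiM {..<k} (\<lambda>_. M))) (sets (PiM {..<k} (\<lambda>_. M)))
       (\<lambda>A. \<integral>\<^sup>+i. emeasure (PiM {..<k} (\<lambda>j. \<nu> (i j))) A
          \<partial>count_space {i \<in> {..<k} \<rightarrow>\<^sub>E J. inj_on i {..<k}})"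

text \<open>
  The result does not depend on the decomposition: on a rectangle
  \<open>A\<^sub>0 \<times> \<dots> \<times> A\<^sub>k\<^sub>-\<^sub>1\<close> of finite \<open>N\<close>-measure it is a polynomial in the values of \<open>N\<close> on intersections
  of the \<open>A\<^sub>j\<close>, since \<open>\<nu> A * \<nu> B = \<nu> (A \<inter> B)\<close> for a unit mass \<open>\<nu>\<close>.
\<close>

definition factorial_measure ::
  "nat \<Rightarrow> 'z measure \<Rightarrow> 'z measure \<Rightarrow> (nat \<Rightarrow> 'z) measure" where
  "factorial_measure k M N =
     (let (J, \<nu>) = (SOME (J, \<nu>). atom_decomposition M N J \<nu>)
      in distinct_tuples_measure k M J \<nu>)"

text \<open>For genuine points \<open>x i\<close> one gets the sum of the Dirac masses at the tuples of points.\<close>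

lemma unit_mass_return: "x \<in> space M \<Longrightarrow> unit_mass M (return M x)"
  by (auto simp: unit_mass_def prob_space_return indicator_def)

lemma PiM_return_finite:
  assumes "finite K" and "\<And>j. j \<in> K \<Longrightarrow> y j \<in> space M"
  shows "PiM K (\<lambda>j. return M (y j)) = return (PiM K (\<lambda>_. M)) (restrict y K)"
proof -
  define z where "z j = (if j \<in> K then return M (y j) else return (count_space UNIV) (y j))" for j
  have "prob_space (z j)" for j
    using assms(2) by (auto simp: z_def intro!: prob_space_return)
  then interpret product_prob_space z K
    by (simp add: product_prob_space_def product_prob_space_axioms_def product_sigma_finite_def
        prob_space_imp_sigma_finite)
  have eq: "PiM K z = PiM K (\<lambda>j. return M (y j))"
    by (rule PiM_cong) (auto simp: z_def)
  have "return (PiM K (\<lambda>_. M)) (restrict y K) = PiM K z"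
  proof (rule PiM_eqI)
    show "finite K" by fact
    show "sets (return (PiM K (\<lambda>_. M)) (restrict y K)) = sets (PiM K z)"
      unfolding eq sets_return by (rule sets_PiM_cong) auto
    fix A assume A: "\<And>j. j \<in> K \<Longrightarrow> A j \<in> sets (z j)"
    then have A': "\<And>j. j \<in> K \<Longrightarrow> A j \<in> sets M" by (auto simp: z_def)
    have "emeasure (return (PiM K (\<lambda>_. M)) (restrict y K)) (PiE K A) =
        indicator (PiE K A) (restrict y K)"
      using A' \<open>finite K\<close> by (intro emeasure_return sets_PiM_I_finite) auto
    also have "\<dots> = (\<Prod>j\<in>K. indicator (A j) (y j))"
      using \<open>finite K\<close> by (auto simp: indicator_def PiE_iff)
    also have "\<dots> = (\<Prod>j\<in>K. emeasure (z j) (A j))"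
      using A' by (intro prod.cong) (auto simp: z_def)
    finally show "emeasure (return (PiM K (\<lambda>_. M)) (restrict y K)) (PiE K A) =
        (\<Prod>j\<in>K. emeasure (z j) (A j))" .
  qed
  with eq show ?thesis by simp
qed

lemma distinct_tuples_measure_points:
  assumes x: "\<And>i. i \<in> J \<Longrightarrow> x i \<in> space M"
  shows "distinct_tuples_measure k M J (\<lambda>i. return M (x i)) =
    distr (count_space {i \<in> {..<k} \<rightarrow>\<^sub>E J. inj_on i {..<k}}) (PiM {..<k} (\<lambda>_. M))
      (\<lambda>i. \<lambda>j\<in>{..<k}. x (i j))"
proof -
  let ?I = "{i \<in> {..<k} \<rightarrow>\<^sub>E J. inj_on i {..<k}}"
  let ?t = "\<lambda>i. \<lambda>j\<in>{..<k}. x (i j)"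
  let ?\<Pi> = "PiM {..<k} (\<lambda>_. M)"
  have t: "?t \<in> measurable (count_space ?I) ?\<Pi>"
    using x by (auto simp: space_PiM PiE_iff)
  have "(\<integral>\<^sup>+i. emeasure (PiM {..<k} (\<lambda>j. return M (x (i j)))) A \<partial>count_space ?I) =
      emeasure (count_space ?I) (?t -` A \<inter> space (count_space ?I))" if A: "A \<in> sets ?\<Pi>" for A
  proof -
    have "(\<integral>\<^sup>+i. emeasure (PiM {..<k} (\<lambda>j. return M (x (i j)))) A \<partial>count_space ?I) =
        (\<integral>\<^sup>+i. indicator (?t -` A \<inter> space (count_space ?I)) i \<partial>count_space ?I)"
    proof (rule nn_integral_cong)
      fix i assume "i \<in> space (count_space ?I)"
      moreover from this have "PiM {..<k} (\<lambda>j. return M (x (i j))) = return ?\<Pi> (?t i)"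
        using x by (intro PiM_return_finite) auto
      ultimately show "emeasure (PiM {..<k} (\<lambda>j. return M (x (i j)))) A =
          indicator (?t -` A \<inter> space (count_space ?I)) i"
        using A by (simp add: indicator_def)
    qed
    then show ?thesis by (simp add: nn_integral_indicator)
  qed
  then show ?thesis
    unfolding distinct_tuples_measure_def distr_def
    by (intro measure_of_eq) (auto simp: sets.space_closed sets.sigma_sets_eq)
qed


section \<open>Multiple Wiener--Ito integrals and Poisson chaos\<close>

definition square_integrable :: "'a measure \<Rightarrow> ('a \<Rightarrow> real) \<Rightarrow> bool" where
  "square_integrable M f \<longleftrightarrow> f \<in> borel_measurable M \<and> integrable M (\<lambda>x. (f x)\<^sup>2)"

text \<open>Points of \<open>Z\<^sup>q\<close> are extensional functions on \<open>{..<q}\<close>, and \<open>\<mu>\<^sup>q\<close> is \<open>PiM {..<q} (\<lambda>_. \<mu>)\<close>.\<close>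

definition symmetric_kernel :: "nat \<Rightarrow> 'z measure \<Rightarrow> ((nat \<Rightarrow> 'z) \<Rightarrow> real) \<Rightarrow> bool" where
  "symmetric_kernel q M f \<longleftrightarrow>
     (\<forall>x\<in>space (PiM {..<q} (\<lambda>_. M)). \<forall>\<pi>. \<pi> permutes {..<q} \<longrightarrow> f (x \<circ> \<pi>) = f x)"

definition symmetrization :: "nat \<Rightarrow> ((nat \<Rightarrow> 'z) \<Rightarrow> real) \<Rightarrow> (nat \<Rightarrow> 'z) \<Rightarrow> real" where
  "symmetrization q f x = (\<Sum>\<pi> | \<pi> permutes {..<q}. f (x \<circ> \<pi>)) / fact q"

text \<open>
  The pathwise formula for symmetric kernels in \<open>L\<^sup>1 \<inter> L\<^sup>2\<close>, evaluated at a realisation \<open>N\<close> of the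
  random measure: the first \<open>k\<close> arguments of \<open>f\<close> are integrated against the factorial measure,
  the remaining \<open>q - k\<close> against the control.
\<close>

definition pathwise_integral ::
  "nat \<Rightarrow> 'z measure \<Rightarrow> 'z measure \<Rightarrow> ((nat \<Rightarrow> 'z) \<Rightarrow> real) \<Rightarrow> real" where
  "pathwise_integral q M N f =
     (\<Sum>k\<le>q. (-1) ^ (q - k) * real (q choose k) *
        (LINT y|PiM {k..<q} (\<lambda>_. M). LINT x|factorial_measure k M N.
           f (merge {..<k} {k..<q} (x, y))))"

text \<open>
  \<open>F\<close> is (a version of) \<open>I\<^sub>q(f)\<close>: it is the \<open>L\<^sup>2(P)\<close>-limit of the integrals \<open>G n\<close> of symmetric
  kernels \<open>g n\<close> in \<open>L\<^sup>1 \<inter> L\<^sup>2\<close> that converge in \<open>L\<^sup>2\<close> to the symmetrization of \<open>f\<close>.  The pathwise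
  formula is only meaningful almost surely, hence the measurable versions \<open>G n\<close>.
\<close>

definition is_multiple_integral ::
  "'w measure \<Rightarrow> 'z measure \<Rightarrow> ('w \<Rightarrow> 'z measure) \<Rightarrow> nat \<Rightarrow> ((nat \<Rightarrow> 'z) \<Rightarrow> real) \<Rightarrow>
    ('w \<Rightarrow> real) \<Rightarrow> bool" where
  "is_multiple_integral P M \<eta> q f F \<longleftrightarrow>
     square_integrable P F \<and>
     (\<exists>g G.
        (\<forall>n::nat. symmetric_kernel q M (g n) \<and>
           integrable (PiM {..<q} (\<lambda>_. M)) (g n) \<and>
           square_integrable (PiM {..<q} (\<lambda>_. M)) (g n) \<and>
           square_integrable P (G n) \<and>
           (AE \<omega> in P. G n \<omega> = pathwise_integral q M (\<eta> \<omega>) (g n))) \<and>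
        (\<lambda>n. LINT x|PiM {..<q} (\<lambda>_. M). (g n x - symmetrization q f x)\<^sup>2) \<longlonglongrightarrow> 0 \<and>
        (\<lambda>n. LINT \<omega>|P. (G n \<omega> - F \<omega>)\<^sup>2) \<longlonglongrightarrow> 0)"

definition poisson_chaos ::
  "'w measure \<Rightarrow> 'z measure \<Rightarrow> ('w \<Rightarrow> 'z measure) \<Rightarrow> nat \<Rightarrow> ('w \<Rightarrow> real) set" where
  "poisson_chaos P M \<eta> q =
     {F. \<exists>f. square_integrable (PiM {..<q} (\<lambda>_. M)) f \<and> is_multiple_integral P M \<eta> q f F}"


section \<open>Wasserstein distance\<close>

text \<open>The random variables may live on different spaces; the supremum is taken in \<open>[-\<infinity>, \<infinity>]\<close>.\<close>

definition wasserstein_dist ::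
  "'a measure \<Rightarrow> ('a \<Rightarrow> real) \<Rightarrow> 'b measure \<Rightarrow> ('b \<Rightarrow> real) \<Rightarrow> ereal" where
  "wasserstein_dist P X Q Y =
     (SUP h\<in>{h::real \<Rightarrow> real. 1-lipschitz_on UNIV h}.
        ereal \<bar>(LINT \<omega>|P. h (X \<omega>)) - (LINT \<omega>|Q. h (Y \<omega>))\<bar>)"

end

theory Submission
  imports Defs
begin

text \<open>
  Project \<open>F\<close> onto the functions of the values of \<open>\<eta>\<close> on finitely many disjoint cells. By the
  Mecke formula, a pathwise integral tested against such a function becomes an alternating sum of
  shifts of that function, which cancels off the cells; so the projection \<open>U\<close> is a linear
  combination of Charlier polynomials of degree \<open>q\<close> in a vector of independent Poisson variables.

  For \<open>U\<close>, Stein's method with the generator \<open>L\<close> of the Ornstein--Uhlenbeck semigroup and the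
  carre du champ \<open>\<Gamma>\<close> leaves the variance of \<open>\<Gamma>(U, U)\<close> and the sum of the fourth moments of the
  discrete derivatives of \<open>U\<close>. Both are read off from the decomposition of \<open>U\<^sup>2\<close> into chaoses of order
  \<open>p \<le> 2 q\<close>, on which \<open>L\<close> acts as \<open>- p\<close>: the components of order \<open>0\<close> and \<open>2 q\<close> have squared norms
  \<open>s\<^sup>4\<close> and at least \<open>2 s\<^sup>4\<close>, where \<open>s\<^sup>2\<close> is the second moment of \<open>U\<close>, so that the fourth cumulant of
  \<open>U\<close> dominates all the other components.

  Projecting does not increase the fourth moment, and \<open>F\<close> is a limit of such projections in \<open>L\<^sup>2\<close>.
\<close>

section \<open>Stein's equation\<close>

text \<open>A finite fourth moment gives no control of the difference operator applied to
  \<open>F\<close>, so that neither a product formula nor the domain of the generator is at hand for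
  \<open>F\<close> itself. After projection every function in sight has polynomial growth in
  finitely many counts, all moments exist, and the calculus rests on the one-point Mecke identity.
  The projection U is determined by testing \<open>F\<close> against functions of polynomial growth;
  the test function U^3 is what controls the fourth moment of U. The constants have two sources. The
  derivative of the Stein solution is bounded by sqrt(2/pi)/\<sigma> and has Lipschitz constant
  2/\<sigma>^2, which gives a cubic Taylor remainder with constant 1/(3 \<sigma>^2). Passing from
  U^2 to \<Gamma>(U, U) multiplies the component of order p by (2q - p)/2, which is at most (2q -
  1)/2 for p between 1 and 2q - 1. The fourth moments of the differences weight the same component
  by 4q - 3p, which is at most 4q - 3.\<close>

definition partial_gauss :: "(real \<Rightarrow> real) \<Rightarrow> real \<Rightarrow> real" where
  "partial_gauss k w = (\<integral>z. indicator {..w} z *\<^sub>R (k z * std_normal_density z) \<partial>lborel)"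

definition linear_growth :: "(real \<Rightarrow> real) \<Rightarrow> bool" where
  "linear_growth k \<longleftrightarrow> continuous_on UNIV k \<and> (\<exists>C. \<forall>z. \<bar>k z\<bar> \<le> C * (1 + z\<^sup>2))"

lemma gauss_integrable:
  assumes "linear_growth k"
  shows "integrable lborel (\<lambda>z. k z * std_normal_density z)"
proof -
  from assms obtain C where C: "\<And>z. \<bar>k z\<bar> \<le> C * (1 + z\<^sup>2)" and c: "continuous_on UNIV k"
    by (auto simp: linear_growth_def)
  have [measurable]: "k \<in> borel_measurable borel"
    using c by (rule borel_measurable_continuous_onI)
  show ?thesis
  proof (rule Bochner_Integration.integrable_bound)
    have "integrable lborel (\<lambda>z. C * (std_normal_density z * z ^ 0 + std_normal_density z * z ^ 2))"
      by (intro integrable_mult_right Bochner_Integration.integrable_add integrable_std_normal_moment)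
    then show "integrable lborel (\<lambda>z. C * (1 + z\<^sup>2) * std_normal_density z)"
      by (simp add: algebra_simps)
    show "AE z in lborel. norm (k z * std_normal_density z) \<le> norm (C * (1 + z\<^sup>2) * std_normal_density z)"
    proof (rule AE_I2)
      fix z :: real
      have "\<bar>k z\<bar> * std_normal_density z \<le> C * (1 + z\<^sup>2) * std_normal_density z"
        by (intro mult_right_mono C) simp
      then show "norm (k z * std_normal_density z) \<le> norm (C * (1 + z\<^sup>2) * std_normal_density z)"
        using abs_ge_self[of "C * (1 + z\<^sup>2) * std_normal_density z"] by (simp add: abs_mult)
    qed
  qed measurable
qed

lemma partial_gauss_integrable:
  assumes "linear_growth k"
  shows "integrable lborel (\<lambda>z. indicator {..w} z *\<^sub>R (k z * std_normal_density z))"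
  by (rule integrable_real_mult_indicator[where f="\<lambda>z. k z * std_normal_density z", THEN back_subst[where P="integrable lborel"]])
     (use gauss_integrable[OF assms] in \<open>auto simp: mult.commute\<close>)

lemma std_normal_density_deriv:
  "(std_normal_density has_real_derivative (- w * std_normal_density w)) (at w)"
  unfolding std_normal_density_def[abs_def]
  by (auto intro!: derivative_eq_intros simp: field_simps power2_eq_square)

lemma partial_gauss_deriv:
  assumes k: "linear_growth k"
  shows "(partial_gauss k has_real_derivative k w * std_normal_density w) (at w)"
proof -
  let ?g = "\<lambda>z. k z * std_normal_density z"
  have ck: "continuous_on UNIV k" using k by (auto simp: linear_growth_def)
  have cg: "continuous_on S ?g" for S
    by (intro continuous_intros continuous_on_subset[OF ck] subset_UNIV
        DERIV_continuous_on[OF has_field_derivative_at_within[OF std_normal_density_deriv]])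
  \<comment> \<open>Splitting off the constant integral up to w - 1 reduces the derivative of the
    improper integral to the fundamental theorem on a compact interval.\<close>
  define a b where "a = w - 1" and "b = w + 1"
  have "((\<lambda>x. integral {a..x} ?g) has_real_derivative ?g w) (at w within {a..b})"
    using cg by (intro integral_has_real_derivative) (auto simp: a_def b_def)
  then have "((\<lambda>x. integral {a..x} ?g) has_real_derivative ?g w) (at w within {a<..<b})"
    by (rule DERIV_subset) auto
  moreover have "at w within {a<..<b} = at w"
    by (rule at_within_open) (auto simp: a_def b_def)
  ultimately have d: "((\<lambda>x. partial_gauss k a + integral {a..x} ?g) has_real_derivative ?g w) (at w)"
    by (auto intro!: derivative_eq_intros)
  have eq: "partial_gauss k x = partial_gauss k a + integral {a..x} ?g" if "x \<in> {a<..<b}" for x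
  proof -
    have i: "set_integrable lborel {..x} ?g" "set_integrable lborel {..a} ?g"
      unfolding set_integrable_def by (rule partial_gauss_integrable[OF k])+
    have j: "set_integrable lborel {a..x} ?g" "set_integrable lborel {a<..x} ?g"
      using i(1) by (auto intro: set_integrable_subset)
    have "partial_gauss k x = (LBINT z:{..a} \<union> {a<..x}. ?g z)"
      using that by (simp add: partial_gauss_def set_lebesgue_integral_def ivl_disj_un)
    also have "\<dots> = (LBINT z:{..a}. ?g z) + (LBINT z:{a<..x}. ?g z)"
      by (rule set_integral_Un) (use i j in auto)
    also have "(LBINT z:{a<..x}. ?g z) = (LBINT z:{a..x}. ?g z)"
    proof (rule set_integral_cong_set)
      show "AE z in lborel. (z \<in> {a..x}) = (z \<in> {a<..x})"
        using AE_lborel_singleton[of a] by eventually_elim auto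
      show "set_borel_measurable lborel {a<..x} ?g" "set_borel_measurable lborel {a..x} ?g"
        using j by (auto simp: set_integrable_def set_borel_measurable_def)
    qed
    also have "\<dots> = integral {a..x} ?g"
      by (rule set_borel_integral_eq_integral) (rule j)
    finally show ?thesis by (simp add: partial_gauss_def set_lebesgue_integral_def)
  qed
  show ?thesis
    by (rule has_field_derivative_transform_within_open[OF d, of "{a<..<b}"])
       (use eq in \<open>auto simp: a_def b_def\<close>)
qed

lemma partial_gauss_at_top:
  assumes "linear_growth k"
  shows "(partial_gauss k \<longlongrightarrow> (\<integral>z. k z * std_normal_density z \<partial>lborel)) at_top"
  unfolding partial_gauss_def[abs_def]
  by (rule tendsto_integral_at_top) (use gauss_integrable[OF assms] in auto)

lemma abs_le_one_plus_square: "\<bar>z\<bar> \<le> 1 + (z::real)\<^sup>2"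
  using zero_le_power2[of "\<bar>z\<bar> - 1"] by (simp add: power2_diff) 

lemma linear_growth_poly:
  "linear_growth (\<lambda>z. c0 + c1 * z + c2 * z\<^sup>2)"
  unfolding linear_growth_def
proof (intro conjI exI allI)
  show "continuous_on UNIV (\<lambda>z. c0 + c1 * z + c2 * z\<^sup>2)" by (intro continuous_intros)
  fix z :: real
  have "\<bar>z\<bar> \<le> 1 + z\<^sup>2" by (rule abs_le_one_plus_square)
  then have "\<bar>c1\<bar> * \<bar>z\<bar> \<le> \<bar>c1\<bar> * (1 + z\<^sup>2)" by (intro mult_left_mono) auto
  moreover have "\<bar>c0 + c1 * z + c2 * z\<^sup>2\<bar> \<le> \<bar>c0\<bar> + \<bar>c1 * z\<bar> + \<bar>c2 * z\<^sup>2\<bar>" by arith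
  moreover have "0 \<le> \<bar>c0\<bar> * z\<^sup>2" "0 \<le> \<bar>c2\<bar>" by auto
  moreover have "(\<bar>c0\<bar> + \<bar>c1\<bar> + \<bar>c2\<bar>) * (1 + z\<^sup>2) =
      \<bar>c0\<bar> + \<bar>c0\<bar> * z\<^sup>2 + \<bar>c1\<bar> * (1 + z\<^sup>2) + \<bar>c2\<bar> + \<bar>c2\<bar> * z\<^sup>2"
    by (simp add: algebra_simps)
  moreover have "\<bar>c1 * z\<bar> = \<bar>c1\<bar> * \<bar>z\<bar>" "\<bar>c2 * z\<^sup>2\<bar> = \<bar>c2\<bar> * z\<^sup>2"
    by (simp_all add: abs_mult)
  ultimately show "\<bar>c0 + c1 * z + c2 * z\<^sup>2\<bar> \<le> (\<bar>c0\<bar> + \<bar>c1\<bar> + \<bar>c2\<bar>) * (1 + z\<^sup>2)"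
    by linarith
qed

section \<open>Closed forms and bounds for Gaussian tail integrals\<close>

abbreviation "gcdf \<equiv> partial_gauss (\<lambda>_. 1)"

lemma lg_one: "linear_growth (\<lambda>_. 1)" and lg_id: "linear_growth (\<lambda>z. z)" and lg_sq: "linear_growth (\<lambda>z. z\<^sup>2)"
  using linear_growth_poly[of 1 0 0] linear_growth_poly[of 0 1 0] linear_growth_poly[of 0 0 1] by simp_all

lemma gcdf_deriv: "(gcdf has_real_derivative std_normal_density w) (at w)"
  using partial_gauss_deriv[OF lg_one, of w] by simp

lemma density_tendsto: "((\<lambda>w. std_normal_density w) \<longlongrightarrow> 0) at_top"
  and density_tendsto': "((\<lambda>w. w * std_normal_density w) \<longlongrightarrow> 0) at_top"
  unfolding std_normal_density_def by real_asymp+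

text \<open>Serves to identify truncated integrals in closed form: both sides have the same
  derivative, and the constant is read off at plus infinity, where the truncated integral becomes a
  known Gaussian moment.\<close>

lemma const_of_deriv:
  fixes f :: "real \<Rightarrow> real"
  assumes "\<And>x. (f has_real_derivative 0) (at x)" and "(f \<longlongrightarrow> c) at_top"
  shows "f x = c"
proof -
  have "f = (\<lambda>_. f x)" using DERIV_isconst_all assms(1) by blast
  then have "(f \<longlongrightarrow> f x) at_top" by (metis tendsto_const)
  with assms(2) show ?thesis by (metis tendsto_unique trivial_limit_at_top_linorder)
qed

lemma gauss_total: "(\<integral>z. std_normal_density z \<partial>lborel) = 1"
   "(\<integral>z. z * std_normal_density z \<partial>lborel) = 0"
   "(\<integral>z. z\<^sup>2 * std_normal_density z \<partial>lborel) = 1"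
  using integral_std_normal_moment_odd[of 0] integral_std_normal_moment_even[of 1]
  by (simp_all add: mult.commute fact_numeral)

lemma partial_gauss_id: "partial_gauss (\<lambda>z. z) w = - std_normal_density w"
proof -
  have "partial_gauss (\<lambda>z. z) w + std_normal_density w = 0 + 0"
  proof (rule const_of_deriv[where x=w])
    fix x show "((\<lambda>w. partial_gauss (\<lambda>z. z) w + std_normal_density w) has_real_derivative 0) (at x)"
      by (rule derivative_eq_intros partial_gauss_deriv[OF lg_id] std_normal_density_deriv refl)+ simp
    show "((\<lambda>w. partial_gauss (\<lambda>z. z) w + std_normal_density w) \<longlongrightarrow> 0 + 0) at_top"
      by (intro tendsto_add density_tendsto)
         (use partial_gauss_at_top[OF lg_id] gauss_total in simp)
  qed
  then show ?thesis by simp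
qed

lemma partial_gauss_sq: "partial_gauss (\<lambda>z. z\<^sup>2) w = gcdf w - w * std_normal_density w"
proof -
  have "partial_gauss (\<lambda>z. z\<^sup>2) w - gcdf w + w * std_normal_density w = 1 - 1 + 0"
  proof (rule const_of_deriv[where x=w])
    fix x show "((\<lambda>w. partial_gauss (\<lambda>z. z\<^sup>2) w - gcdf w + w * std_normal_density w) has_real_derivative 0) (at x)"
      by (rule derivative_eq_intros partial_gauss_deriv[OF lg_sq] gcdf_deriv std_normal_density_deriv refl)+
         (simp add: power2_eq_square)
    show "((\<lambda>w. partial_gauss (\<lambda>z. z\<^sup>2) w - gcdf w + w * std_normal_density w) \<longlongrightarrow> 1 - 1 + 0) at_top"
      by (intro tendsto_add tendsto_diff density_tendsto')
         (use partial_gauss_at_top[OF lg_sq] partial_gauss_at_top[OF lg_one] gauss_total in simp_all)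
  qed
  then show ?thesis by simp
qed

lemma partial_gauss_linear:
  assumes "linear_growth k" "linear_growth l"
  shows "partial_gauss (\<lambda>z. c * k z + d * l z) w = c * partial_gauss k w + d * partial_gauss l w"
proof -
  have "partial_gauss (\<lambda>z. c * k z + d * l z) w =
    (\<integral>z. c * (indicator {..w} z *\<^sub>R (k z * std_normal_density z)) + d * (indicator {..w} z *\<^sub>R (l z * std_normal_density z)) \<partial>lborel)"
    unfolding partial_gauss_def by (intro Bochner_Integration.integral_cong) (auto simp: algebra_simps)
  also have "\<dots> = c * partial_gauss k w + d * partial_gauss l w"
    unfolding partial_gauss_def using partial_gauss_integrable assms by simp
  finally show ?thesis .
qed

lemma partial_gauss_mono:
  assumes "linear_growth k" "linear_growth l" "\<And>z. z \<le> w \<Longrightarrow> k z \<le> l z"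
  shows "partial_gauss k w \<le> partial_gauss l w"
  unfolding partial_gauss_def
  by (intro integral_mono partial_gauss_integrable assms)
     (auto simp: indicator_def intro!: mult_right_mono assms(3))

text \<open>The integral over the half-line above w is represented as the total minus the truncated
  integral, so that \<open>partial_gauss\<close> serves for both tails.\<close>

lemma upper_gauss_mono:
  assumes "linear_growth k" "linear_growth l" "\<And>z. z > w \<Longrightarrow> k z \<le> l z"
  shows "(\<integral>z. k z * std_normal_density z \<partial>lborel) - partial_gauss k w
    \<le> (\<integral>z. l z * std_normal_density z \<partial>lborel) - partial_gauss l w"
proof -
  have "(\<integral>z. k z * std_normal_density z - indicator {..w} z *\<^sub>R (k z * std_normal_density z) \<partial>lborel) \<le>
    (\<integral>z. l z * std_normal_density z - indicator {..w} z *\<^sub>R (l z * std_normal_density z) \<partial>lborel)"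
    by (intro integral_mono Bochner_Integration.integrable_diff partial_gauss_integrable gauss_integrable assms)
       (auto simp: indicator_def intro!: mult_right_mono assms(3))
  then show ?thesis
    unfolding partial_gauss_def using partial_gauss_integrable gauss_integrable assms by simp
qed

text \<open>For N standard normal, \<open>gA w\<close> is the expectation of the positive part of w
  - N and \<open>gB w\<close> that of the positive part of N - w. Both solve y'' + w y' - y =
  0.\<close>

definition "gA w = w * gcdf w + std_normal_density w"
definition "gB w = std_normal_density w - w * (1 - gcdf w)"

lemma gcdf_range: "0 \<le> gcdf w" "gcdf w \<le> 1"
proof -
  have *: "linear_growth (\<lambda>z. 0)" using linear_growth_poly[of 0 0 0] by simp
  show "0 \<le> gcdf w" using partial_gauss_mono[OF * lg_one, of w] by (simp add: partial_gauss_def)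
  show "gcdf w \<le> 1" using upper_gauss_mono[OF * lg_one, of w] by (simp add: partial_gauss_def)
qed

text \<open>All four are integrals of nonnegative functions over a half-line: w - z and z - w give
  the first two, and (z - w)^2 over the lower and the upper half-line gives the two Mills-type
  inequalities.\<close>

lemma gA_nonneg: "0 \<le> gA w" and gB_nonneg: "0 \<le> gB w"
  and mills_left: "0 \<le> (1 + w\<^sup>2) * gcdf w + w * std_normal_density w"
  and mills_right: "0 \<le> (1 + w\<^sup>2) * (1 - gcdf w) - w * std_normal_density w"
proof -
  have 0: "linear_growth (\<lambda>z. 0)" using linear_growth_poly[of 0 0 0] by simp
  have 1: "linear_growth (\<lambda>z. w * 1 + (-1) * z)" using linear_growth_poly[of w "-1" 0] by simp
  have "0 \<le> partial_gauss (\<lambda>z. w * 1 + (-1) * z) w"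
    using partial_gauss_mono[OF 0 1, of w] by (simp add: partial_gauss_def)
  then show "0 \<le> gA w"
    unfolding partial_gauss_linear[OF lg_one lg_id] partial_gauss_id by (simp add: gA_def)
  have 2: "linear_growth (\<lambda>z. 1 * z + (-w) * 1)" using linear_growth_poly[of "-w" 1 0] by simp
  have i2: "(\<integral>z. (1 * z + (-w) * 1) * std_normal_density z \<partial>lborel) = -w"
    using gauss_total gauss_integrable[OF lg_id] gauss_integrable[OF lg_one] by (simp add: left_diff_distrib)
  have "partial_gauss (\<lambda>z. 1 * z + (-w) * 1) w \<le> -w"
    using upper_gauss_mono[OF 0 2, of w] i2 by (simp add: partial_gauss_def)
  then show "0 \<le> gB w"
    unfolding partial_gauss_linear[OF lg_id lg_one] partial_gauss_id by (simp add: gB_def algebra_simps)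
  define s where "s = (\<lambda>z. 1 * z\<^sup>2 + 1 * (w\<^sup>2 * 1 + (-2*w) * z))"
  have 3: "linear_growth (\<lambda>z. w\<^sup>2 * 1 + (-2*w) * z)" using linear_growth_poly[of "w\<^sup>2" "-2*w" 0] by simp
  have 4: "linear_growth s" using linear_growth_poly[of "w\<^sup>2" "-2*w" 1] by (simp add: s_def add.commute)
  have s: "s z = (z - w)\<^sup>2" for z by (simp add: s_def power2_eq_square algebra_simps)
  have e: "partial_gauss s w = (1 + w\<^sup>2) * gcdf w + w * std_normal_density w"
    unfolding s_def partial_gauss_linear[OF lg_sq 3] partial_gauss_linear[OF lg_one lg_id] partial_gauss_sq partial_gauss_id
    by (simp add: algebra_simps power2_eq_square)
  show "0 \<le> (1 + w\<^sup>2) * gcdf w + w * std_normal_density w"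
    unfolding e[symmetric] using partial_gauss_mono[OF 0 4, of w] by (simp add: partial_gauss_def s)
  have "(\<integral>z. s z * std_normal_density z \<partial>lborel) =
     (\<integral>z. z\<^sup>2 * std_normal_density z + w\<^sup>2 * std_normal_density z - 2 * w * (z * std_normal_density z) \<partial>lborel)"
    by (rule Bochner_Integration.integral_cong) (auto simp: s_def algebra_simps)
  also have "\<dots> = 1 + w\<^sup>2"
    using gauss_total gauss_integrable[OF lg_id] gauss_integrable[OF lg_one] gauss_integrable[OF lg_sq] by simp
  finally show "0 \<le> (1 + w\<^sup>2) * (1 - gcdf w) - w * std_normal_density w"
    using upper_gauss_mono[OF 0 4, of w] e by (simp add: partial_gauss_def s algebra_simps)
qed

section \<open>The sharp bound behind the derivative of the Stein solution\<close>

lemma gcdf_0: "gcdf 0 = 1 / 2"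
proof -
  let ?d = "std_normal_density"
  have s: "?d (- z) = ?d z" for z by (simp add: std_normal_density_def)
  have "gcdf 0 = (\<integral>z. indicator {..0} (0 + (-1) * z) *\<^sub>R (?d (0 + (-1) * z)) \<partial>lborel)"
    unfolding partial_gauss_def
    by (subst lborel_integral_real_affine[where c="-1" and t=0]) auto
  also have "\<dots> = (\<integral>z. ?d z - indicator {..0} z *\<^sub>R ?d z \<partial>lborel)"
    by (rule integral_cong_AE)
       (use AE_lborel_singleton[of 0] in \<open>auto elim!: eventually_mono simp: s indicator_def\<close>)
  also have "\<dots> = 1 - gcdf 0"
    unfolding partial_gauss_def using partial_gauss_integrable[OF lg_one, of 0] gauss_total by simp
  finally show ?thesis by simp
qed

text \<open>At an interior maximum of \<open>g\<close> with positive value the equation would make the second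
  derivative of \<open>g\<close> positive; so a positive value of \<open>g\<close> forces linear growth of \<open>K\<close>.\<close>

lemma ode_max_principle:
  fixes K g g1 :: "real \<Rightarrow> real"
  assumes K: "\<And>w. (K has_real_derivative g w) (at w)"
    and g: "\<And>w. (g has_real_derivative g1 w) (at w)"
    and g1: "\<And>w. (g1 has_real_derivative (w\<^sup>2 + 6) * g w + w * K w) (at w)"
    and pos: "\<And>w. 0 \<le> K w" and bdd: "\<And>w. 0 \<le> w \<Longrightarrow> K w \<le> C" and g0: "g 0 = 0" and w: "0 \<le> w"
  shows "K w \<le> K 0"
proof -
  have cg: "continuous_on S g" for S
    by (rule DERIV_continuous_on[OF has_field_derivative_at_within[OF g]])
  have neg: "g \<xi> \<le> 0" if "0 < \<xi>" for \<xi>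
  proof (rule ccontr)
    assume "\<not> g \<xi> \<le> 0"
    then have gp: "0 < g \<xi>" by simp
    have ge: "g \<xi> \<le> g b" if b: "\<xi> < b" for b
    proof -
      obtain c where c: "c \<in> {0..b}" "\<And>y. y \<in> {0..b} \<Longrightarrow> g y \<le> g c"
        using continuous_attains_sup[of "{0..b}" g] cg b \<open>0 < \<xi>\<close> by auto
      have c0: "c \<noteq> 0" using c(2)[of \<xi>] gp b \<open>0 < \<xi>\<close> g0 by force
      have gc: "0 < g c" using c(2)[of \<xi>] gp b \<open>0 < \<xi>\<close> by force
      have "c = b"
      proof (rule ccontr)
        assume "c \<noteq> b"
        with c c0 have ci: "0 < c" "c < b" by auto
        have z: "g1 c = 0"
          by (rule DERIV_local_max[OF g, of "min c (b - c)"]) (use ci c(2) in \<open>auto simp: abs_if split: if_splits\<close>)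
        have "0 < (c\<^sup>2 + 6) * g c + c * K c"
          using gc ci pos[of c] by (intro add_pos_nonneg mult_pos_pos) (auto simp: add_nonneg_pos)
        from DERIV_pos_inc_right[OF g1 this] obtain d where d: "0 < d" "\<And>h. 0 < h \<Longrightarrow> h < d \<Longrightarrow> g1 c < g1 (c + h)"
          by auto
        define e where "e = min (d / 2) ((b - c) / 2)"
        have e: "0 < e" "e < d" "c + e \<le> b" using d ci by (auto simp: e_def min_def field_simps)
        obtain x where x: "c < x" "x < c + e" "g (c + e) - g c = (c + e - c) * g1 x"
          using MVT2[of c "c + e" g g1] g e by auto
        have "0 < g1 x" using d(2)[of "x - c"] x e z by auto
        then have "0 < e * g1 x" using e by simp
        then have "g c < g (c + e)" using x by simp
        with c(2)[of "c + e"] e ci show False by auto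
      qed
      with c(2)[of \<xi>] b \<open>0 < \<xi>\<close> show ?thesis by auto
    qed
    \<comment> \<open>By the mean value theorem K would rise by at least C + 1 between \<xi> and
      this point, against 0 \<le> K \<le> C.\<close>
    define b where "b = \<xi> + (C + 1) / g \<xi>"
    have "0 \<le> C" using pos[of 0] bdd[of 0] by simp
    then have b: "\<xi> < b" using gp by (simp add: b_def)
    obtain x where x: "\<xi> < x" "x < b" "K b - K \<xi> = (b - \<xi>) * g x"
      using MVT2[of \<xi> b K g] K b by auto
    have "(b - \<xi>) * g \<xi> \<le> (b - \<xi>) * g x" using ge[OF x(1)] b by (intro mult_left_mono) auto
    moreover have "(b - \<xi>) * g \<xi> = C + 1" using gp by (simp add: b_def)
    ultimately show False using x pos[of \<xi>] bdd[of b] b \<open>0 < \<xi>\<close> by auto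
  qed
  show ?thesis
  proof (cases "w = 0")
    case False
    then obtain x where "0 < x" "x < w" "K w - K 0 = (w - 0) * g x"
      using MVT2[of 0 w K g] K w by auto
    moreover from \<open>0 < x\<close> w have "w * g x \<le> 0" by (intro mult_nonneg_nonpos neg)
    ultimately show ?thesis by simp
  qed simp
qed

lemma gA_deriv: "(gA has_real_derivative gcdf w) (at w)"
  unfolding gA_def[abs_def]
  by (rule derivative_eq_intros gcdf_deriv std_normal_density_deriv refl)+ simp

lemma gB_deriv: "(gB has_real_derivative - (1 - gcdf w)) (at w)"
  unfolding gB_def[abs_def]
  by (rule derivative_eq_intros gcdf_deriv std_normal_density_deriv refl)+ simp

lemma gA_minus_gB: "gA w - gB w = w"
  by (simp add: gA_def gB_def algebra_simps)

text \<open>The quotient K is largest at 0, where it equals the density. Up to a constant it is the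
  product of \<open>gA\<close> and \<open>gB\<close>, each multiplied by exp(w^2/4); both factors
  solve u'' = r u with r = w^2/4 + 3/2, and a product of two such solutions satisfies K''' = 4 r K'
  + 2 r' K, here (w^2 + 6) K' + w K. This is the equation of the maximum principle. The bound is the
  source of the constant sqrt(2/pi) for the derivative of the Stein solution.\<close>

lemma gA_gB_bound: "gA w * gB w / std_normal_density w \<le> 1 / sqrt (2 * pi)"
proof -
  let ?d = "std_normal_density" and ?F = gcdf
  define E where "E w = 1 / ?d w" for w
  have dpos: "0 < ?d w" for w by (rule normal_density_pos) simp
  have E: "(E has_real_derivative w * E w) (at w)" for w
    unfolding E_def[abs_def] using dpos[of w]
    by - ((rule derivative_eq_intros std_normal_density_deriv refl)+, simp_all add: field_simps)
  have Epos: "0 < E w" for w using dpos[of w] by (simp add: E_def)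
  define K where "K w = gA w * gB w * E w" for w
  \<comment> \<open>R is the derivative of the product of \<open>gA\<close> and \<open>gB\<close>, g
    is the derivative of K, and Q is the second derivative of K up to the factor E.\<close>
  define R where "R w = ?F w * gB w - (1 - ?F w) * gA w" for w
  define g where "g w = (R w + w * gA w * gB w) * E w" for w
  define Q where "Q w = ?d w * (gA w + gB w) - 2 * ?F w * (1 - ?F w) + gA w * gB w + 2 * w * R w + w\<^sup>2 * gA w * gB w" for w
  define g1 where "g1 w = Q w * E w" for w
  note ds = gcdf_deriv std_normal_density_deriv gA_deriv gB_deriv E
  have R: "(R has_real_derivative ?d w * gB w - 2 * ?F w * (1 - ?F w) + ?d w * gA w) (at w)" for w
    unfolding R_def[abs_def] by (rule derivative_eq_intros ds refl)+ (simp add: algebra_simps)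
  have K': "(K has_real_derivative g w) (at w)" for w
    unfolding K_def[abs_def] by (rule derivative_eq_intros ds refl)+ (simp add: algebra_simps g_def R_def)
  have g': "(g has_real_derivative g1 w) (at w)" for w
    unfolding g_def[abs_def]
    by (rule derivative_eq_intros ds R refl)+ (simp add: algebra_simps g1_def Q_def R_def power2_eq_square)
  have g1': "(g1 has_real_derivative (w\<^sup>2 + 6) * g w + w * K w) (at w)" for w
  proof -
    have "(Q has_real_derivative - w * ?d w * (gA w + gB w) + ?d w * (?F w - (1 - ?F w))
       - 2 * ?d w * (1 - ?F w) + 2 * ?F w * ?d w + 3 * R w
       + 2 * w * (?d w * gB w - 2 * ?F w * (1 - ?F w) + ?d w * gA w) + 2 * w * gA w * gB w + w\<^sup>2 * R w) (at w)"
      unfolding Q_def[abs_def]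
      by (rule derivative_eq_intros ds R refl)+ (simp add: algebra_simps R_def)
    from DERIV_mult[OF this E[of w]] show ?thesis
      unfolding g1_def[abs_def]
    proof (rule DERIV_cong)
      have b: "gB w = gA w - w" using gA_minus_gB[of w] by simp
      show "(- w * ?d w * (gA w + gB w) + ?d w * (?F w - (1 - ?F w))
       - 2 * ?d w * (1 - ?F w) + 2 * ?F w * ?d w + 3 * R w
       + 2 * w * (?d w * gB w - 2 * ?F w * (1 - ?F w) + ?d w * gA w) + 2 * w * gA w * gB w + w\<^sup>2 * R w) * E w
        + w * E w * Q w = (w\<^sup>2 + 6) * g w + w * K w"
        unfolding g_def K_def Q_def R_def gA_def gB_def by algebra
    qed
  qed
  have K0: "K 0 = 1 / sqrt (2 * pi)"
  proof -
    have "K 0 = ?d 0" using dpos[of 0] by (simp add: K_def gA_def gB_def E_def)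
    also have "\<dots> = 1 / sqrt (2 * pi)" unfolding std_normal_density_def by (simp only: power_zero_numeral) simp
    finally show ?thesis .
  qed
  \<comment> \<open>By symmetry of the normal law \<open>gA\<close> and \<open>gB\<close> agree at 0
    and both tails have mass 1/2.\<close>
  have g0: "g 0 = 0" by (simp add: g_def R_def gcdf_0 gA_def gB_def)
  have Kpos: "0 \<le> K w" for w using gA_nonneg[of w] gB_nonneg[of w] Epos[of w] by (simp add: K_def)
  have d1: "?d w \<le> 1" for w
  proof -
    have "exp (- (w\<^sup>2) / 2) \<le> 1" by simp
    moreover have "1 \<le> sqrt (2 * pi)" using pi_gt3 by (simp add: real_le_rsqrt)
    ultimately have "exp (- (w\<^sup>2) / 2) \<le> sqrt (2 * pi)" by (rule order_trans)
    then show ?thesis unfolding std_normal_density_def by (simp add: divide_le_eq)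
  qed
  \<comment> \<open>The Mills-type bound makes (1 + w^2) \<open>gB w\<close> at most the density,
    which absorbs the linear growth of \<open>gA\<close>.\<close>
  have bR: "K w \<le> 2" if "0 \<le> w" for w
  proof -
    have "(1 + w\<^sup>2) * gB w \<le> ?d w"
      using mult_nonneg_nonneg[OF that mills_right[of w]] by (simp add: gB_def algebra_simps power2_eq_square)
    then have "(1 + w\<^sup>2) * gB w * E w \<le> 1" using Epos[of w] dpos[of w] by (simp add: E_def field_simps)
    moreover have "gA w \<le> 2 * (1 + w\<^sup>2)"
    proof -
      have "w * ?F w \<le> w" using gcdf_range[of w] that by (simp add: mult_left_le)
      moreover have "w \<le> 1 + w\<^sup>2" using abs_le_one_plus_square[of w] by simp
      ultimately show ?thesis using d1[of w] unfolding gA_def by (smt (verit) zero_le_power2)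
    qed
    then have "gA w * (gB w * E w) \<le> 2 * (1 + w\<^sup>2) * (gB w * E w)"
      using gB_nonneg[of w] Epos[of w] by (intro mult_right_mono) auto
    ultimately show ?thesis unfolding K_def by (simp add: algebra_simps)
  qed
  have bL: "K (- w) \<le> 2" if "0 \<le> w" for w
  proof -
    have "(1 + w\<^sup>2) * gA (-w) \<le> ?d (-w)"
      using mult_nonneg_nonneg[OF that mills_left[of "-w"]] by (simp add: gA_def algebra_simps power2_eq_square)
    then have "(1 + w\<^sup>2) * gA (-w) * E (-w) \<le> 1" using Epos[of "-w"] dpos[of "-w"] by (simp add: E_def field_simps)
    moreover have "gB (-w) \<le> 2 * (1 + w\<^sup>2)"
    proof -
      have "w * (1 - ?F (-w)) \<le> w" using gcdf_range[of "-w"] that by (simp add: mult_left_le)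
      moreover have "w \<le> 1 + w\<^sup>2" using abs_le_one_plus_square[of w] by simp
      ultimately show ?thesis using d1[of "-w"] unfolding gB_def by (smt (verit) zero_le_power2 mult_minus_left)
    qed
    then have "gB (-w) * (gA (-w) * E (-w)) \<le> 2 * (1 + w\<^sup>2) * (gA (-w) * E (-w))"
      using gA_nonneg[of "-w"] Epos[of "-w"] by (intro mult_right_mono) auto
    ultimately show ?thesis unfolding K_def by (simp add: algebra_simps)
  qed
  have "K w \<le> K 0"
  proof (cases "0 \<le> w")
    case True
    show ?thesis by (rule ode_max_principle[OF K' g' g1' Kpos bR g0 True])
  next
    case False
    have neg: "((\<lambda>w. f (- w)) has_real_derivative - f' (- w)) (at w)"
      if "\<And>w. (f has_real_derivative f' w) (at w)" for f f' w
      using DERIV_chain2[OF that DERIV_minus[OF DERIV_ident]] by simp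
    \<comment> \<open>The equation K''' = (w^2 + 6) K' + w K is invariant under reflection, so the
      negative half-line follows from the maximum principle for K(-w).\<close>
    have "(\<lambda>w. K (- w)) (- w) \<le> (\<lambda>w. K (- w)) 0"
    proof (rule ode_max_principle[where g="\<lambda>w. - g (- w)" and ?g1.0="\<lambda>w. g1 (- w)" and C=2])
      show "((\<lambda>w. K (- w)) has_real_derivative - g (- w)) (at w)" for w by (rule neg[OF K'])
      show "((\<lambda>w. - g (- w)) has_real_derivative g1 (- w)) (at w)" for w
        using DERIV_minus[OF neg[OF g']] by simp
      show "((\<lambda>w. g1 (- w)) has_real_derivative (w\<^sup>2 + 6) * - g (- w) + w * K (- w)) (at w)" for w
        using neg[OF g1', of w] by (simp add: algebra_simps)
    qed (use Kpos bL g0 False in auto)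
    then show ?thesis by simp
  qed
  then show ?thesis using K0 by (simp add: K_def E_def)
qed

section \<open>The Stein solution of a Lipschitz function\<close>

lemma lipschitz_linear_growth:
  assumes "1-lipschitz_on UNIV (h :: real \<Rightarrow> real)"
  shows "linear_growth h"
  unfolding linear_growth_def
proof (intro conjI exI allI)
  show "continuous_on UNIV h" using assms by (rule lipschitz_on_continuous_on)
  fix z :: real
  have "\<bar>h z - h 0\<bar> \<le> \<bar>z\<bar>"
    using lipschitz_onD[OF assms, of z 0] by (simp add: dist_real_def)
  moreover have "\<bar>z\<bar> \<le> 1 + z\<^sup>2" by (rule abs_le_one_plus_square)
  moreover have "(\<bar>h 0\<bar> + 1) * (1 + z\<^sup>2) = \<bar>h 0\<bar> + \<bar>h 0\<bar> * z\<^sup>2 + (1 + z\<^sup>2)" by (simp add: algebra_simps)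
  moreover have "0 \<le> \<bar>h 0\<bar> * z\<^sup>2" by simp
  ultimately show "\<bar>h z\<bar> \<le> (\<bar>h 0\<bar> + 1) * (1 + z\<^sup>2)" by linarith
qed

text \<open>The solution is the classical one, the truncated integral of h - m divided by the
  density. It and its derivative are combinations of two tail integrals a, b of increments of h with
  Gaussian tails, and the Lipschitz property bounds a by \<open>gA\<close> and b by
  \<open>gB\<close>. No derivative of h is taken: f' is the sum of h and w f - m, each of which is
  1-Lipschitz.\<close>

lemma stein_solution_std:
  fixes h :: "real \<Rightarrow> real"
  assumes lip: "1-lipschitz_on UNIV h"
  defines "m \<equiv> \<integral>z. h z * std_normal_density z \<partial>lborel"
  shows "\<exists>f f'. (\<forall>x. (f has_real_derivative f' x) (at x)) \<and> (\<forall>x. f' x - x * f x = h x - m) \<and>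
    (\<forall>x. \<bar>f' x\<bar> \<le> sqrt (2 / pi)) \<and> (\<forall>x y. \<bar>f' x - f' y\<bar> \<le> 2 * \<bar>x - y\<bar>)"
proof -
  let ?d = std_normal_density and ?T = "partial_gauss h"
  have lg: "linear_growth h" by (rule lipschitz_linear_growth[OF lip])
  have hl: "\<bar>h x - h y\<bar> \<le> \<bar>x - y\<bar>" for x y
    using lipschitz_onD[OF lip, of x y] by (simp add: dist_real_def)
  have dpos: "0 < ?d w" for w by (rule normal_density_pos) simp
  have 3: "linear_growth (\<lambda>z. h w * 1 + (-1) * h z)" for w
  proof (rule lipschitz_linear_growth, rule lipschitz_onI)
    fix x y :: real
    show "dist (h w * 1 + (-1) * h x) (h w * 1 + (-1) * h y) \<le> 1 * dist x y"
      using hl[of y x] by (simp add: dist_real_def abs_minus_commute)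
  qed simp
  have hl': "z - w \<le> h w - h z" "h w - h z \<le> w - z" if "z \<le> w" for z w
    using hl[of w z] that by (auto simp: abs_le_iff)
  have hl'': "w - z \<le> h w - h z" "h w - h z \<le> z - w" if "w \<le> z" for z w
    using hl[of w z] that by (auto simp: abs_le_iff)
  \<comment> \<open>Against the normal density, a integrates h w - h z over z \<le> w, and b
    integrates h z - h w over z > w.\<close>
  define a where "a w = h w * gcdf w - ?T w" for w
  define b where "b w = m - ?T w - h w * (1 - gcdf w)" for w
  have ha: "\<bar>a w\<bar> \<le> gA w" for w
  proof -
    have 1: "linear_growth (\<lambda>z. w * 1 + (-1) * z)" using linear_growth_poly[of w "-1" 0] by simp
    have 2: "linear_growth (\<lambda>z. (- w) * 1 + 1 * z)" using linear_growth_poly[of "-w" 1 0] by simp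
    have "partial_gauss (\<lambda>z. h w * 1 + (-1) * h z) w \<le> partial_gauss (\<lambda>z. w * 1 + (-1) * z) w"
      by (rule partial_gauss_mono[OF 3 1]) (use hl' in simp)
    moreover have "partial_gauss (\<lambda>z. (-w) * 1 + 1 * z) w \<le> partial_gauss (\<lambda>z. h w * 1 + (-1) * h z) w"
      by (rule partial_gauss_mono[OF 2 3]) (use hl' in simp)
    ultimately show ?thesis
      unfolding partial_gauss_linear[OF lg_one lg_id] partial_gauss_linear[OF lg_one lg] partial_gauss_id
      by (simp add: a_def gA_def abs_le_iff)
  qed
  have hb: "\<bar>b w\<bar> \<le> gB w" for w
  proof -
    have 1: "linear_growth (\<lambda>z. w * 1 + (-1) * z)" using linear_growth_poly[of w "-1" 0] by simp
    have 2: "linear_growth (\<lambda>z. (- w) * 1 + 1 * z)" using linear_growth_poly[of "-w" 1 0] by simp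
    have i: "(\<integral>z. (w * 1 + (-1) * z) * ?d z \<partial>lborel) = w" "(\<integral>z. ((-w) * 1 + 1 * z) * ?d z \<partial>lborel) = - w"
      "(\<integral>z. (h w * 1 + (-1) * h z) * ?d z \<partial>lborel) = h w - m"
      using gauss_total gauss_integrable[OF lg_id] gauss_integrable[OF lg_one] gauss_integrable[OF lg]
      by (simp_all add: algebra_simps m_def)
    have "h w - m - partial_gauss (\<lambda>z. h w * 1 + (-1) * h z) w \<le> - w - partial_gauss (\<lambda>z. (-w) * 1 + 1 * z) w"
      by (rule upper_gauss_mono[OF 3[of w] 2, unfolded i]) (use hl'' in simp)
    moreover have "w - partial_gauss (\<lambda>z. w * 1 + (-1) * z) w \<le> h w - m - partial_gauss (\<lambda>z. h w * 1 + (-1) * h z) w"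
      by (rule upper_gauss_mono[OF 1 3[of w], unfolded i]) (use hl'' in simp)
    ultimately show ?thesis
      unfolding partial_gauss_linear[OF lg_one lg_id] partial_gauss_linear[OF lg_one lg] partial_gauss_id
      by (simp add: b_def gB_def abs_le_iff algebra_simps)
  qed
  define f where "f w = (?T w - m * gcdf w) / ?d w" for w
  define f' where "f' w = h w - m + w * f w" for w
  have fab: "f w * ?d w = - a w * (1 - gcdf w) - b w * gcdf w" for w
  proof -
    have "f w * ?d w = ?T w - m * gcdf w" using dpos[of w] by (simp add: f_def)
    then show ?thesis by (simp add: a_def b_def algebra_simps)
  qed
  have hm: "h w - m = a w - b w" for w by (simp add: a_def b_def algebra_simps)
  have df: "(f has_real_derivative f' w) (at w)" for w
  proof -
    have "(f has_real_derivative ((h w * ?d w - m * ?d w) * ?d w - (?T w - m * gcdf w) * (- w * ?d w)) / (?d w * ?d w)) (at w)"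
      unfolding f_def[abs_def] using dpos[of w]
      by (intro DERIV_divide DERIV_diff DERIV_cmult partial_gauss_deriv[OF lg] gcdf_deriv std_normal_density_deriv) auto
    then show ?thesis
      by (rule DERIV_cong) (use dpos[of w] in \<open>simp add: f'_def f_def field_simps\<close>)
  qed
  have f'ab: "f' w * ?d w = a w * gB w - b w * gA w" for w
  proof -
    have "f' w * ?d w = (a w - b w) * ?d w + w * (f w * ?d w)" by (simp add: f'_def hm algebra_simps)
    then show ?thesis by (simp add: fab gA_def gB_def algebra_simps)
  qed
  have f'b: "\<bar>f' w\<bar> \<le> sqrt (2 / pi)" for w
  proof -
    have "\<bar>f' w\<bar> * ?d w = \<bar>a w * gB w - b w * gA w\<bar>"
      using dpos[of w] by (simp flip: f'ab add: abs_mult)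
    also have "\<dots> \<le> \<bar>a w\<bar> * gB w + \<bar>b w\<bar> * gA w"
      using abs_triangle_ineq4[of "a w * gB w" "b w * gA w"] gA_nonneg[of w] gB_nonneg[of w] by (simp add: abs_mult)
    also have "\<dots> \<le> gA w * gB w + gB w * gA w"
      by (intro add_mono mult_right_mono ha hb gA_nonneg gB_nonneg)
    finally have "\<bar>f' w\<bar> \<le> 2 * (gA w * gB w / ?d w)"
      using dpos[of w] by (simp add: field_simps)
    also have "\<dots> \<le> 2 * (1 / sqrt (2 * pi))"
      by (intro mult_left_mono gA_gB_bound) simp
    also have "\<dots> = sqrt (2 / pi)"
    proof -
      have "2 / pi = 2\<^sup>2 / (2 * pi)" by simp
      then have "sqrt (2 / pi) = sqrt (2\<^sup>2) / sqrt (2 * pi)" by (simp only: real_sqrt_divide)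
      moreover have "sqrt (2\<^sup>2) = (2::real)" by simp
      ultimately show ?thesis by (simp only: times_divide_eq_right mult_1_right)
    qed
    finally show ?thesis .
  qed
  define r where "r w = w * f w - m" for w
  have dr: "(r has_real_derivative (f w + w * f' w)) (at w)" for w
    unfolding r_def[abs_def] by (rule derivative_eq_intros df refl)+ simp
  have drb: "\<bar>f w + w * f' w\<bar> \<le> 1" for w
  proof -
    \<comment> \<open>These weights are the integrals of (z - w)^2 over the upper and the lower
      half-line; combined with \<open>gA\<close> and \<open>gB\<close> below they collapse to the
      density, which gives exactly the constant 1.\<close>
    let ?p = "(1 + w\<^sup>2) * (1 - gcdf w) - w * ?d w" and ?q = "(1 + w\<^sup>2) * gcdf w + w * ?d w"
    have "(f w + w * f' w) * ?d w = (f w * ?d w) + w * (f' w * ?d w)" by (simp add: algebra_simps)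
    also have "\<dots> = - a w * ?p - b w * ?q"
      by (simp add: fab f'ab gA_def gB_def algebra_simps power2_eq_square)
    finally have "(f w + w * f' w) * ?d w = - (a w * ?p + b w * ?q)" by simp
    moreover have "\<bar>f w + w * f' w\<bar> * ?d w = \<bar>(f w + w * f' w) * ?d w\<bar>"
      using dpos[of w] by (simp add: abs_mult)
    ultimately have "\<bar>f w + w * f' w\<bar> * ?d w = \<bar>a w * ?p + b w * ?q\<bar>"
      by (simp only: abs_minus_cancel)
    also have "\<dots> \<le> \<bar>a w\<bar> * ?p + \<bar>b w\<bar> * ?q"
      using abs_triangle_ineq[of "a w * ?p" "b w * ?q"] mills_left[of w] mills_right[of w] by (simp add: abs_mult)
    also have "\<dots> \<le> gA w * ?p + gB w * ?q"
      by (intro add_mono mult_right_mono ha hb mills_left mills_right)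
    also have "\<dots> = ?d w"
      by (simp add: gA_def gB_def algebra_simps power2_eq_square)
    finally show ?thesis using dpos[of w] by simp
  qed
  have rl: "\<bar>r x - r y\<bar> \<le> 1 * \<bar>x - y\<bar>" for x y
    using field_differentiable_bound[of UNIV r "\<lambda>w. f w + w * f' w" 1 x y] dr drb by auto
  have "\<bar>f' x - f' y\<bar> \<le> 2 * \<bar>x - y\<bar>" for x y
    using rl[of x y] hl[of x y] by (simp add: f'_def r_def abs_le_iff)
  with df f'b show ?thesis
    by (intro exI[of _ f] exI[of _ f']) (auto simp: f'_def)
qed

text \<open>Monotonicity of c (x - u)^(n+1) / (n + 1) minus or plus H replaces integration of the
  derivative; the case v < u is reduced to the other one by reflection. Two applications in a row
  turn the Lipschitz property of a derivative into a third-order Taylor remainder.\<close>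

lemma bound_from_deriv:
  fixes H h :: "real \<Rightarrow> real"
  assumes d: "\<And>v. (H has_real_derivative h v) (at v)" and "H u = 0" and b: "\<And>v. \<bar>h v\<bar> \<le> c * \<bar>v - u\<bar> ^ n"
  shows "\<bar>H v\<bar> \<le> c / (real n + 1) * \<bar>v - u\<bar> ^ Suc n"
proof -
  have *: "\<bar>H v\<bar> \<le> c / (real n + 1) * (v - u) ^ Suc n"
    if d: "\<And>v. (H has_real_derivative h v) (at v)" and 0: "H u = 0" and b: "\<And>v. \<bar>h v\<bar> \<le> c * \<bar>v - u\<bar> ^ n"
      and "u \<le> v" for H h :: "real \<Rightarrow> real" and u v
  proof -
    have "s * H v \<le> c / (real n + 1) * (v - u) ^ Suc n" if "s \<in> {1, -1}" for s
    proof -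
      define S where "S x = c / (real n + 1) * (x - u) ^ Suc n - s * H x" for x
      have dS: "(S has_real_derivative c * (x - u) ^ n - s * h x) (at x)" for x
        unfolding S_def[abs_def]
        by (rule derivative_eq_intros d refl)+ (simp add: add_eq_0_iff field_simps del: power_Suc)
      have "S u \<le> S v"
      proof (rule DERIV_nonneg_imp_nondecreasing[OF \<open>u \<le> v\<close>])
        fix x assume "u \<le> x"
        then have "s * h x \<le> c * (x - u) ^ n" using b[of x] that by (auto simp: abs_le_iff)
        with dS[of x] show "\<exists>y. (S has_real_derivative y) (at x) \<and> 0 \<le> y" by (intro exI conjI) auto
      qed
      then show ?thesis using 0 by (simp add: S_def)
    qed
    from this[of 1] this[of "-1"] show ?thesis by (simp add: abs_le_iff)
  qed
  show ?thesis
  proof (cases "u \<le> v")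
    case True
    then show ?thesis using *[OF d \<open>H u = 0\<close> b True] by simp
  next
    case False
    have d': "((\<lambda>x. H (- x)) has_real_derivative - h (- x)) (at x)" for x
      using DERIV_chain2[OF d DERIV_minus[OF DERIV_ident]] by simp
    have "\<bar>H (- (- v))\<bar> \<le> c / (real n + 1) * (- v - (- u)) ^ Suc n"
    proof (rule *[OF d'])
      show "\<bar>- h (- x)\<bar> \<le> c * \<bar>x - (- u)\<bar> ^ n" for x
      proof -
        have "\<bar>- x - u\<bar> = \<bar>x - (- u)\<bar>" by arith
        then show ?thesis using b[of "-x"] by simp
      qed
    qed (use False \<open>H u = 0\<close> in auto)
    with False show ?thesis by (simp add: abs_if)
  qed
qed

text \<open>The antiderivative \<open>G\<close> of the Stein solution is what the generator is applied to.\<close>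

lemma stein_solution:
  fixes h :: "real \<Rightarrow> real"
  assumes lip: "1-lipschitz_on UNIV h" and \<sigma>: "0 < \<sigma>"
  defines "m \<equiv> \<integral>z. h (\<sigma> * z) * std_normal_density z \<partial>lborel"
  obtains G f f' where "\<And>x. (G has_real_derivative f x) (at x)" "\<And>x. (f has_real_derivative f' x) (at x)"
    "\<And>x. \<sigma>\<^sup>2 * f' x - x * f x = h x - m" "\<And>x. \<bar>f' x\<bar> \<le> sqrt (2 / pi) / \<sigma>"
    "\<And>u v. \<bar>G v - G u - f u * (v - u) - f' u * (v - u)\<^sup>2 / 2\<bar> \<le> 1 / (3 * \<sigma>\<^sup>2) * \<bar>v - u\<bar> ^ 3"
proof -
  \<comment> \<open>The rescaling keeps the Lipschitz constant 1 and moves the problem from variance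
    \<sigma>^2 to variance 1.\<close>
  define k where "k z = h (\<sigma> * z) / \<sigma>" for z
  have lk: "1-lipschitz_on UNIV k"
  proof (rule lipschitz_onI)
    fix x y :: real
    have "dist (h (\<sigma> * x)) (h (\<sigma> * y)) \<le> dist (\<sigma> * x) (\<sigma> * y)"
      using lipschitz_onD[OF lip] by simp
    also have "\<dots> = \<sigma> * dist x y" using \<sigma> by (simp add: dist_real_def abs_mult flip: right_diff_distrib)
    finally show "dist (k x) (k y) \<le> 1 * dist x y"
      using \<sigma> by (simp add: k_def dist_real_def abs_mult field_simps flip: diff_divide_distrib)
  qed simp
  have km: "(\<integral>z. k z * std_normal_density z \<partial>lborel) = m / \<sigma>"
    by (simp add: k_def m_def)
  from stein_solution_std[OF lk, unfolded km] obtain f1 f1' where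
    f1: "\<And>x. (f1 has_real_derivative f1' x) (at x)" "\<And>x. f1' x - x * f1 x = k x - m / \<sigma>"
    "\<And>x. \<bar>f1' x\<bar> \<le> sqrt (2 / pi)" "\<And>x y. \<bar>f1' x - f1' y\<bar> \<le> 2 * \<bar>x - y\<bar>" by blast
  define f where "f x = f1 (x / \<sigma>)" for x
  define f' where "f' x = f1' (x / \<sigma>) / \<sigma>" for x
  have f: "(f has_real_derivative f' x) (at x)" for x
    using DERIV_chain2[OF f1(1), of "\<lambda>x. x / \<sigma>" "1 / \<sigma>" x] DERIV_cdivide[OF DERIV_ident, of \<sigma> x]
    by (simp add: f_def[abs_def] f'_def)
  have st: "\<sigma>\<^sup>2 * f' x - x * f x = h x - m" for x
  proof -
    have "\<sigma>\<^sup>2 * f' x - x * f x = \<sigma> * (f1' (x / \<sigma>) - x / \<sigma> * f1 (x / \<sigma>))"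
      using \<sigma> by (simp add: f_def f'_def power2_eq_square field_simps)
    also have "\<dots> = h x - m" unfolding f1(2) using \<sigma> by (simp add: k_def right_diff_distrib)
    finally show ?thesis .
  qed
  have fb: "\<bar>f' x\<bar> \<le> sqrt (2 / pi) / \<sigma>" for x
    using f1(3)[of "x / \<sigma>"] \<sigma> by (simp add: f'_def divide_right_mono)
  have fl: "\<bar>f' x - f' y\<bar> \<le> 2 / \<sigma>\<^sup>2 * \<bar>x - y\<bar>" for x y
  proof -
    have "\<bar>f' x - f' y\<bar> = \<bar>f1' (x / \<sigma>) - f1' (y / \<sigma>)\<bar> / \<sigma>"
      using \<sigma> by (simp add: f'_def flip: diff_divide_distrib)
    also have "\<dots> \<le> 2 * \<bar>x / \<sigma> - y / \<sigma>\<bar> / \<sigma>" using \<sigma> by (intro divide_right_mono f1) simp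
    also have "\<dots> = 2 / \<sigma>\<^sup>2 * \<bar>x - y\<bar>" using \<sigma> by (simp add: power2_eq_square flip: diff_divide_distrib)
    finally show ?thesis .
  qed
  have "\<exists>G. \<forall>x::real. - \<infinity> < ereal x \<longrightarrow> ereal x < \<infinity> \<longrightarrow> (G has_vector_derivative f x) (at x)"
    by (rule einterval_antiderivative) (use f in \<open>auto intro: DERIV_isCont\<close>)
  then obtain G where G: "\<And>x. (G has_real_derivative f x) (at x)"
    by (auto simp: has_real_derivative_iff_has_vector_derivative)
  have "\<bar>G v - G u - f u * (v - u) - f' u * (v - u)\<^sup>2 / 2\<bar> \<le> 1 / (3 * \<sigma>\<^sup>2) * \<bar>v - u\<bar> ^ 3" for u v
  proof -
    \<comment> \<open>The two integrations turn the Lipschitz constant 2/\<sigma>^2 of f' into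
      1/\<sigma>^2 and then into 1/(3 \<sigma>^2).\<close>
    have 1: "\<bar>f x - f u - f' u * (x - u)\<bar> \<le> (2 / \<sigma>\<^sup>2) / (real 1 + 1) * \<bar>x - u\<bar> ^ Suc 1" for x
    proof (rule bound_from_deriv[where h="\<lambda>x. f' x - f' u"])
      show "((\<lambda>x. f x - f u - f' u * (x - u)) has_real_derivative f' x - f' u) (at x)" for x
        by (rule derivative_eq_intros f refl)+ simp
    qed (use fl in auto)
    have "\<bar>G v - G u - f u * (v - u) - f' u * (v - u)\<^sup>2 / 2\<bar> \<le> (1 / \<sigma>\<^sup>2) / (real 2 + 1) * \<bar>v - u\<bar> ^ Suc 2"
    proof (rule bound_from_deriv[where h="\<lambda>x. f x - f u - f' u * (x - u)"])
      show "((\<lambda>x. G x - G u - f u * (x - u) - f' u * (x - u)\<^sup>2 / 2) has_real_derivative f x - f u - f' u * (x - u)) (at x)" for x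
      proof -
        have "((\<lambda>x. G x - G u - f u * (x - u) - (f' u / 2) * (x - u)\<^sup>2) has_real_derivative
            f x - f u - f' u * (x - u)) (at x)"
          by (rule derivative_eq_intros G refl)+ simp
        then show ?thesis by simp
      qed
    qed (use 1 in \<open>auto simp: numeral_2_eq_2\<close>)
    then show ?thesis by (simp add: numeral_3_eq_3 mult.commute)
  qed
  with G f st fb show ?thesis by (rule that)
qed

section \<open>Squares of homogeneous elements of a symmetric Fock space\<close>

text \<open>The quadruple (b, x, y, d) is a 2 by 2 table with row sums a, c and column sums a', c'.
  The weight is (a + c)! times the hypergeometric probability of the table given its
  margins.\<close>

definition table_weight :: "nat \<Rightarrow> nat \<Rightarrow> nat \<Rightarrow> nat \<Rightarrow> nat \<times> nat \<times> nat \<times> nat \<Rightarrow> real" where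
  "table_weight a c a' c' t = (case t of (b, x, y, d) \<Rightarrow>
     if b + x = a \<and> y + d = c \<and> b + y = a' \<and> x + d = c'
     then fact a * fact c * fact a' * fact c' / (fact b * fact x * fact y * fact d) else 0)"

abbreviation tables :: "nat \<Rightarrow> (nat \<times> nat \<times> nat \<times> nat) set" where
  "tables K \<equiv> {..K} \<times> {..K} \<times> {..K} \<times> {..K}"

text \<open>The Vandermonde identity, read as a count of \<open>2 \<times> 2\<close> contingency tables.\<close>

lemma sum_table_weight:
  assumes K: "a \<le> K" "c \<le> K" "a' \<le> K" "c' \<le> K"
  shows "(\<Sum>t\<in>tables K. table_weight a c a' c' t) = (if a + c = a' + c' then fact (a + c) else 0)"
proof (cases "a + c = a' + c'")
  case False
  then have "table_weight a c a' c' t = 0" for t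
    by (auto simp: table_weight_def split: prod.splits)
  then show ?thesis using False by simp
next
  case True
  \<comment> \<open>With the margins fixed, a table is determined by its upper left entry.\<close>
  define \<phi> where "\<phi> b = (b, a - b, a' - b, c - (a' - b))" for b
  define S where "S = {b. b \<le> a \<and> b \<le> a' \<and> a' - b \<le> c}"
  have "(\<Sum>t\<in>tables K. table_weight a c a' c' t) = (\<Sum>t\<in>\<phi> ` S. table_weight a c a' c' t)"
  proof (rule sum.mono_neutral_right)
    show "\<phi> ` S \<subseteq> tables K" using K True by (auto simp: \<phi>_def S_def)
    show "\<forall>i\<in>tables K - \<phi> ` S. table_weight a c a' c' i = 0"
    proof
      fix i assume i: "i \<in> tables K - \<phi> ` S"
      obtain b x y d where bxyd: "i = (b, x, y, d)" by (cases i) auto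
      show "table_weight a c a' c' i = 0"
      proof (rule ccontr)
        assume "table_weight a c a' c' i \<noteq> 0"
        then have "b + x = a" "y + d = c" "b + y = a'" "x + d = c'"
          by (auto simp: table_weight_def bxyd split: if_splits)
        then have "i = \<phi> b" "b \<in> S" by (auto simp: bxyd \<phi>_def S_def)
        with i show False by auto
      qed
    qed
  qed auto
  also have "\<dots> = (\<Sum>b\<in>S. table_weight a c a' c' (\<phi> b))"
    by (subst sum.reindex) (auto simp: \<phi>_def inj_on_def)
  also have "\<dots> = (\<Sum>b\<in>S. fact a' * fact c' * real ((a choose b) * (c choose (a' - b))))"
  proof (rule sum.cong)
    fix b assume b: "b \<in> S"
    then have "real (a choose b) = fact a / (fact b * fact (a - b))"
      "real (c choose (a' - b)) = fact c / (fact (a' - b) * fact (c - (a' - b)))"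
      by (auto simp: S_def binomial_fact)
    then show "table_weight a c a' c' (\<phi> b) = fact a' * fact c' * real ((a choose b) * (c choose (a' - b)))"
      using b True by (auto simp: table_weight_def \<phi>_def S_def mult_ac)
  qed simp
  also have "\<dots> = fact a' * fact c' * (\<Sum>b\<in>S. real ((a choose b) * (c choose (a' - b))))"
    by (simp add: sum_distrib_left)
  also have "(\<Sum>b\<in>S. real ((a choose b) * (c choose (a' - b)))) = (\<Sum>b\<le>a'. real ((a choose b) * (c choose (a' - b))))"
    by (rule sum.mono_neutral_left) (auto simp: S_def)
  also have "\<dots> = real ((a + c) choose a')"
    unfolding vandermonde[symmetric] by simp
  also have "\<dots> = fact (a + c) / (fact a' * fact c')"
    using True by (subst binomial_fact) auto
  finally show ?thesis using True by simp
qed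

context
  fixes I :: "'i set" and l :: "'i \<Rightarrow> real"
begin

definition multi_indices :: "nat \<Rightarrow> ('i \<Rightarrow> nat) set" where
  "multi_indices p = {\<alpha>. (\<forall>i. i \<notin> I \<longrightarrow> \<alpha> i = 0) \<and> sum \<alpha> I = p}"

text \<open>The squared norm of the product of Charlier polynomials of degrees \<alpha> in the L2
  space of a Poisson vector with means l.\<close>

definition index_norm :: "('i \<Rightarrow> nat) \<Rightarrow> real" where
  "index_norm \<alpha> = (\<Prod>i\<in>I. fact (\<alpha> i) * l i ^ \<alpha> i)"

lemma multi_indices_le: 
  assumes "finite I" "\<alpha> \<in> multi_indices p" shows "\<alpha> i \<le> p"
  using assms member_le_sum[of i I \<alpha>] by (cases "i \<in> I") (auto simp: multi_indices_def)

lemma finite_multi_indices: 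
  assumes "finite I" shows "finite (multi_indices p)"
proof (rule finite_subset)
  show "multi_indices p \<subseteq> {\<alpha>. \<forall>i. (i \<in> I \<longrightarrow> \<alpha> i \<in> {..p}) \<and> (i \<notin> I \<longrightarrow> \<alpha> i = 0)}"
    using multi_indices_le[OF assms] by (auto simp: multi_indices_def)
  show "finite {\<alpha>. \<forall>i. (i \<in> I \<longrightarrow> \<alpha> i \<in> {..p}) \<and> (i \<notin> I \<longrightarrow> \<alpha> i = 0)}"
    using assms by (intro finite_set_of_finite_funs) auto
qed

text \<open>Expanding \<open>(\<alpha> + \<beta>)!\<close> by contingency tables turns the norm of a square of a homogeneous
  polynomial into a sum of squares; the two extreme tables (no overlap, complete overlap) each
  contribute the square of the norm.\<close>

lemma homogeneous_square_norm:
  fixes c :: "('i \<Rightarrow> nat) \<Rightarrow> real"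
  assumes I: "finite I" and l: "\<And>i. i \<in> I \<Longrightarrow> 0 \<le> l i" and q: "0 < q"
  defines "A \<equiv> multi_indices q"
  defines "dd \<equiv> \<lambda>\<gamma>. \<Sum>\<alpha>\<in>A. \<Sum>\<beta>\<in>A. if (\<lambda>i. \<alpha> i + \<beta> i) = \<gamma> then c \<alpha> * c \<beta> else 0"
  shows "2 * (\<Sum>\<alpha>\<in>A. (c \<alpha>)\<^sup>2 * index_norm \<alpha>)\<^sup>2 \<le> (\<Sum>\<gamma>\<in>multi_indices (2 * q). (dd \<gamma>)\<^sup>2 * index_norm \<gamma>)"
proof -
  have finA: "finite A" unfolding A_def by (rule finite_multi_indices[OF I])
  have finA2: "finite (multi_indices (2 * q))" by (rule finite_multi_indices[OF I])
  define lp where "lp \<alpha> = (\<Prod>i\<in>I. l i ^ \<alpha> i)" for \<alpha> :: "'i \<Rightarrow> nat"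
  define fc where "fc \<alpha> = (\<Prod>i\<in>I. fact (\<alpha> i) :: real)" for \<alpha> :: "'i \<Rightarrow> nat"
  have nrm: "index_norm \<alpha> = fc \<alpha> * lp \<alpha>" for \<alpha> by (simp add: index_norm_def fc_def lp_def prod.distrib)
  have lp_nn: "0 \<le> lp \<alpha>" for \<alpha> using l by (auto simp: lp_def intro!: prod_nonneg)
  have fc_pos: "0 < fc \<alpha>" for \<alpha> by (auto simp: fc_def intro!: prod_pos)
  have lp_add: "lp (\<lambda>i. \<alpha> i + \<beta> i) = lp \<alpha> * lp \<beta>" for \<alpha> \<beta> by (simp add: lp_def power_add prod.distrib)
  have addA: "(\<lambda>i. \<alpha> i + \<beta> i) \<in> multi_indices (2 * q)" if "\<alpha> \<in> A" "\<beta> \<in> A" for \<alpha> \<beta>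
    using that by (auto simp: A_def multi_indices_def sum.distrib)
  have sq: "(dd \<gamma>)\<^sup>2 = (\<Sum>\<alpha>\<in>A. \<Sum>\<beta>\<in>A. \<Sum>\<alpha>'\<in>A. \<Sum>\<beta>'\<in>A. if (\<lambda>i. \<alpha> i + \<beta> i) = \<gamma> \<and> (\<lambda>i. \<alpha>' i + \<beta>' i) = \<gamma> then c \<alpha> * c \<beta> * c \<alpha>' * c \<beta>' else 0)" for \<gamma>
  proof -
    have "(dd \<gamma>)\<^sup>2 = (\<Sum>\<alpha>\<in>A. \<Sum>\<beta>\<in>A. (if (\<lambda>i. \<alpha> i + \<beta> i) = \<gamma> then c \<alpha> * c \<beta> else 0) * dd \<gamma>)"
      by (subst power2_eq_square, subst dd_def) (simp add: sum_distrib_right)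
    also have "\<dots> = (\<Sum>\<alpha>\<in>A. \<Sum>\<beta>\<in>A. \<Sum>\<alpha>'\<in>A. \<Sum>\<beta>'\<in>A. (if (\<lambda>i. \<alpha> i + \<beta> i) = \<gamma> then c \<alpha> * c \<beta> else 0) * (if (\<lambda>i. \<alpha>' i + \<beta>' i) = \<gamma> then c \<alpha>' * c \<beta>' else 0))"
      unfolding dd_def sum_distrib_left by simp
    also have "\<dots> = (\<Sum>\<alpha>\<in>A. \<Sum>\<beta>\<in>A. \<Sum>\<alpha>'\<in>A. \<Sum>\<beta>'\<in>A. if (\<lambda>i. \<alpha> i + \<beta> i) = \<gamma> \<and> (\<lambda>i. \<alpha>' i + \<beta>' i) = \<gamma> then c \<alpha> * c \<beta> * c \<alpha>' * c \<beta>' else 0)"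
      by (intro sum.cong refl) auto
    finally show ?thesis .
  qed
  have "(\<Sum>\<gamma>\<in>multi_indices (2 * q). (dd \<gamma>)\<^sup>2 * index_norm \<gamma>) =
    (\<Sum>\<gamma>\<in>multi_indices (2 * q). \<Sum>\<alpha>\<in>A. \<Sum>\<beta>\<in>A. \<Sum>\<alpha>'\<in>A. \<Sum>\<beta>'\<in>A. if (\<lambda>i. \<alpha> i + \<beta> i) = \<gamma> \<and> (\<lambda>i. \<alpha>' i + \<beta>' i) = \<gamma> then c \<alpha> * c \<beta> * c \<alpha>' * c \<beta>' * index_norm \<gamma> else 0)"
    unfolding sq sum_distrib_right by (intro sum.cong refl) auto
  also have "\<dots> = (\<Sum>\<alpha>\<in>A. \<Sum>\<beta>\<in>A. \<Sum>\<alpha>'\<in>A. \<Sum>\<beta>'\<in>A. \<Sum>\<gamma>\<in>multi_indices (2 * q). if (\<lambda>i. \<alpha> i + \<beta> i) = \<gamma> \<and> (\<lambda>i. \<alpha>' i + \<beta>' i) = \<gamma> then c \<alpha> * c \<beta> * c \<alpha>' * c \<beta>' * index_norm \<gamma> else 0)"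
    unfolding sum.swap[of _ A "multi_indices (2 * q)"] by simp
  also have "\<dots> = (\<Sum>\<alpha>\<in>A. \<Sum>\<beta>\<in>A. \<Sum>\<alpha>'\<in>A. \<Sum>\<beta>'\<in>A. c \<alpha> * c \<beta> * c \<alpha>' * c \<beta>' * (lp \<alpha> * lp \<beta>) *
      (if (\<lambda>i. \<alpha> i + \<beta> i) = (\<lambda>i. \<alpha>' i + \<beta>' i) then fc (\<lambda>i. \<alpha> i + \<beta> i) else 0))"
  proof (intro sum.cong refl)
    fix \<alpha> \<beta> \<alpha>' \<beta>' assume "\<alpha> \<in> A" "\<beta> \<in> A" "\<alpha>' \<in> A" "\<beta>' \<in> A"
    let ?g = "\<lambda>i. \<alpha> i + \<beta> i"
    have "(\<Sum>\<gamma>\<in>multi_indices (2 * q). if ?g = \<gamma> \<and> (\<lambda>i. \<alpha>' i + \<beta>' i) = \<gamma> then c \<alpha> * c \<beta> * c \<alpha>' * c \<beta>' * index_norm \<gamma> else 0)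
      = (\<Sum>\<gamma>\<in>multi_indices (2 * q). if \<gamma> = ?g then (if ?g = (\<lambda>i. \<alpha>' i + \<beta>' i) then c \<alpha> * c \<beta> * c \<alpha>' * c \<beta>' * index_norm ?g else 0) else 0)"
      by (intro sum.cong refl) auto
    also have "\<dots> = (if ?g = (\<lambda>i. \<alpha>' i + \<beta>' i) then c \<alpha> * c \<beta> * c \<alpha>' * c \<beta>' * index_norm ?g else 0)"
      using addA[OF \<open>\<alpha> \<in> A\<close> \<open>\<beta> \<in> A\<close>] finA2 by (subst sum.delta) auto
    also have "\<dots> = c \<alpha> * c \<beta> * c \<alpha>' * c \<beta>' * (lp \<alpha> * lp \<beta>) * (if ?g = (\<lambda>i. \<alpha>' i + \<beta>' i) then fc ?g else 0)"
    proof -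
      have "index_norm ?g = fc ?g * (lp \<alpha> * lp \<beta>)" by (simp add: nrm lp_add)
      then show ?thesis
        by (cases "?g = (\<lambda>i. \<alpha>' i + \<beta>' i)") (simp_all only: simp_thms if_True if_False mult_zero_right mult_ac)
    qed
    finally show "(\<Sum>\<gamma>\<in>multi_indices (2 * q). if ?g = \<gamma> \<and> (\<lambda>i. \<alpha>' i + \<beta>' i) = \<gamma> then c \<alpha> * c \<beta> * c \<alpha>' * c \<beta>' * index_norm \<gamma> else 0) = \<dots>" .
  qed
  finally have lhs: "(\<Sum>\<gamma>\<in>multi_indices (2 * q). (dd \<gamma>)\<^sup>2 * index_norm \<gamma>) = \<dots>" .

  define T where "T = {\<alpha> :: 'i \<Rightarrow> nat. \<forall>i. (i \<in> I \<longrightarrow> \<alpha> i \<in> {..q}) \<and> (i \<notin> I \<longrightarrow> \<alpha> i = 0)}"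
  have finT: "finite T" unfolding T_def using I by (intro finite_set_of_finite_funs) auto
  have AT: "A \<subseteq> T" using multi_indices_le[OF I] by (auto simp: A_def T_def multi_indices_def)
  have tab: "(if (\<lambda>i. \<alpha> i + \<beta> i) = (\<lambda>i. \<alpha>' i + \<beta>' i) then fc (\<lambda>i. \<alpha> i + \<beta> i) else 0) =
     (\<Sum>b\<in>T. \<Sum>d\<in>T. \<Sum>x\<in>T. \<Sum>y\<in>T. if (\<lambda>i. b i + x i) = \<alpha> \<and> (\<lambda>i. y i + d i) = \<beta> \<and> (\<lambda>i. b i + y i) = \<alpha>' \<and> (\<lambda>i. x i + d i) = \<beta>'
        then fc \<alpha> * fc \<beta> * fc \<alpha>' * fc \<beta>' / (fc b * fc x * fc y * fc d) else 0)"
    if in_A: "\<alpha> \<in> A" "\<beta> \<in> A" "\<alpha>' \<in> A" "\<beta>' \<in> A" for \<alpha> \<beta> \<alpha>' \<beta>'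
  proof -
    have z: "\<alpha> i = 0" "\<beta> i = 0" "\<alpha>' i = 0" "\<beta>' i = 0" if "i \<notin> I" for i
      using in_A that by (auto simp: A_def multi_indices_def)
    let ?w = "\<lambda>i. table_weight (\<alpha> i) (\<beta> i) (\<alpha>' i) (\<beta>' i)"
    have "(if (\<lambda>i. \<alpha> i + \<beta> i) = (\<lambda>i. \<alpha>' i + \<beta>' i) then fc (\<lambda>i. \<alpha> i + \<beta> i) else 0) =
      (\<Prod>i\<in>I. if \<alpha> i + \<beta> i = \<alpha>' i + \<beta>' i then fact (\<alpha> i + \<beta> i) else 0)"
    proof (cases "(\<lambda>i. \<alpha> i + \<beta> i) = (\<lambda>i. \<alpha>' i + \<beta>' i)")
      case True
      then show ?thesis by (auto simp: fc_def fun_eq_iff intro!: prod.cong)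
    next
      case False
      then obtain i where "\<alpha> i + \<beta> i \<noteq> \<alpha>' i + \<beta>' i" by auto
      then have "\<exists>i\<in>I. (if \<alpha> i + \<beta> i = \<alpha>' i + \<beta>' i then fact (\<alpha> i + \<beta> i) else 0) = (0::real)"
        using z[of i] by (cases "i \<in> I") (auto intro!: bexI[of _ i])
      then have "(\<Prod>i\<in>I. if \<alpha> i + \<beta> i = \<alpha>' i + \<beta>' i then fact (\<alpha> i + \<beta> i) else 0) = (0::real)"
        using I by simp
      with False show ?thesis by simp
    qed
    \<comment> \<open>The equality of the two sums of multi-indices and the factorial both split
      over the coordinates, and each coordinate is expanded by its own tables. A family of tables is
      then a quadruple of multi-indices.\<close>
    also have "\<dots> = (\<Prod>i\<in>I. \<Sum>t\<in>tables q. ?w i t)"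
    proof (intro prod.cong refl)
      fix i
      have "\<alpha> i \<le> q" "\<beta> i \<le> q" "\<alpha>' i \<le> q" "\<beta>' i \<le> q"
        using in_A multi_indices_le[OF I] by (auto simp: A_def)
      then show "(if \<alpha> i + \<beta> i = \<alpha>' i + \<beta>' i then fact (\<alpha> i + \<beta> i) else 0) = (\<Sum>t\<in>tables q. ?w i t)"
        by (rule sum_table_weight[symmetric])
    qed
    also have "\<dots> = (\<Sum>f\<in>Pi\<^sub>E I (\<lambda>_. tables q). \<Prod>i\<in>I. ?w i (f i))"
      by (rule prod_sum_PiE[OF I]) auto
    also have "\<dots> = (\<Sum>(b, d, x, y)\<in>T \<times> T \<times> T \<times> T. \<Prod>i\<in>I. ?w i (b i, x i, y i, d i))"
    proof (rule sum.reindex_bij_witness[where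
        j = "\<lambda>f. (\<lambda>i. if i \<in> I then fst (f i) else 0, \<lambda>i. if i \<in> I then snd (snd (snd (f i))) else 0,
              \<lambda>i. if i \<in> I then fst (snd (f i)) else 0, \<lambda>i. if i \<in> I then fst (snd (snd (f i))) else 0)" and
        i = "\<lambda>(b, d, x, y). \<lambda>i\<in>I. (b i, x i, y i, d i)"], goal_cases)
      case (1 f) then show ?case by (auto simp: fun_eq_iff PiE_iff extensional_def)
    next
      case (2 f)
      then have "f i \<in> tables q" if "i \<in> I" for i using that by auto
      then show ?case by (force simp: T_def mem_Times_iff)
    next
      case (3 t) then show ?case by (auto simp: T_def fun_eq_iff split: prod.splits)
    next
      case (4 t) then show ?case by (auto simp: T_def split: prod.splits)
    next
      case (5 f) then show ?case by (auto intro!: prod.cong)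
    qed
    also have "\<dots> = (\<Sum>b\<in>T. \<Sum>d\<in>T. \<Sum>x\<in>T. \<Sum>y\<in>T. \<Prod>i\<in>I. ?w i (b i, x i, y i, d i))"
      by (simp add: sum.cartesian_product)
    also have "\<dots> = (\<Sum>b\<in>T. \<Sum>d\<in>T. \<Sum>x\<in>T. \<Sum>y\<in>T. if (\<lambda>i. b i + x i) = \<alpha> \<and> (\<lambda>i. y i + d i) = \<beta> \<and> (\<lambda>i. b i + y i) = \<alpha>' \<and> (\<lambda>i. x i + d i) = \<beta>'
        then fc \<alpha> * fc \<beta> * fc \<alpha>' * fc \<beta>' / (fc b * fc x * fc y * fc d) else 0)"
    proof (intro sum.cong refl)
      fix b d x y assume T: "b \<in> T" "d \<in> T" "x \<in> T" "y \<in> T"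
      show "(\<Prod>i\<in>I. ?w i (b i, x i, y i, d i)) = (if (\<lambda>i. b i + x i) = \<alpha> \<and> (\<lambda>i. y i + d i) = \<beta> \<and> (\<lambda>i. b i + y i) = \<alpha>' \<and> (\<lambda>i. x i + d i) = \<beta>'
        then fc \<alpha> * fc \<beta> * fc \<alpha>' * fc \<beta>' / (fc b * fc x * fc y * fc d) else 0)" (is "_ = (if ?c then ?v else 0)")
      proof (cases ?c)
        case True
        then have "b i + x i = \<alpha> i \<and> y i + d i = \<beta> i \<and> b i + y i = \<alpha>' i \<and> x i + d i = \<beta>' i" for i by (auto simp: fun_eq_iff)
        then have "(\<Prod>i\<in>I. ?w i (b i, x i, y i, d i)) = (\<Prod>i\<in>I. fact (\<alpha> i) * fact (\<beta> i) * fact (\<alpha>' i) * fact (\<beta>' i) / (fact (b i) * fact (x i) * fact (y i) * fact (d i)))"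
          by (intro prod.cong refl) (simp add: table_weight_def)
        also have "\<dots> = ?v" by (simp add: fc_def prod.distrib prod_dividef)
        finally show ?thesis using True by simp
      next
        case False
        then obtain i where i: "\<not> (b i + x i = \<alpha> i \<and> y i + d i = \<beta> i \<and> b i + y i = \<alpha>' i \<and> x i + d i = \<beta>' i)"
          by (auto simp: fun_eq_iff)
        have "i \<in> I"
        proof (rule ccontr)
          assume "i \<notin> I"
          with z T i show False by (auto simp: T_def)
        qed
        moreover have "?w i (b i, x i, y i, d i) = 0" using i by (auto simp: table_weight_def)
        ultimately have "(\<Prod>i\<in>I. ?w i (b i, x i, y i, d i)) = 0" using I by auto
        then show ?thesis unfolding if_not_P[OF False] .
      qed
    qed
    finally show ?thesis .
  qed

  \<comment> \<open>Extension by zero turns the constraints that the four margins lie in A into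
    vanishing terms; the factorials of the margins are absorbed here.\<close>
  define e where "e \<alpha> = (if \<alpha> \<in> A then c \<alpha> * fc \<alpha> else 0)" for \<alpha>
  define S where "S b d = (\<Sum>x\<in>T. lp x / fc x * (e (\<lambda>i. b i + x i) * e (\<lambda>i. x i + d i)))" for b d
  have "(\<Sum>\<gamma>\<in>multi_indices (2 * q). (dd \<gamma>)\<^sup>2 * index_norm \<gamma>) =
    (\<Sum>\<alpha>\<in>A. \<Sum>\<beta>\<in>A. \<Sum>\<alpha>'\<in>A. \<Sum>\<beta>'\<in>A. \<Sum>b\<in>T. \<Sum>d\<in>T. \<Sum>x\<in>T. \<Sum>y\<in>T.
       if (\<lambda>i. b i + x i) = \<alpha> \<and> (\<lambda>i. y i + d i) = \<beta> \<and> (\<lambda>i. b i + y i) = \<alpha>' \<and> (\<lambda>i. x i + d i) = \<beta>'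
       then e \<alpha> * e \<beta> * e \<alpha>' * e \<beta>' * (lp b * lp x * lp y * lp d) / (fc b * fc x * fc y * fc d) else 0)"
    unfolding lhs
  proof (intro sum.cong refl)
    fix \<alpha> \<beta> \<alpha>' \<beta>' assume in_A: "\<alpha> \<in> A" "\<beta> \<in> A" "\<alpha>' \<in> A" "\<beta>' \<in> A"
    show "c \<alpha> * c \<beta> * c \<alpha>' * c \<beta>' * (lp \<alpha> * lp \<beta>) *
      (if (\<lambda>i. \<alpha> i + \<beta> i) = (\<lambda>i. \<alpha>' i + \<beta>' i) then fc (\<lambda>i. \<alpha> i + \<beta> i) else 0) =
      (\<Sum>b\<in>T. \<Sum>d\<in>T. \<Sum>x\<in>T. \<Sum>y\<in>T.
       if (\<lambda>i. b i + x i) = \<alpha> \<and> (\<lambda>i. y i + d i) = \<beta> \<and> (\<lambda>i. b i + y i) = \<alpha>' \<and> (\<lambda>i. x i + d i) = \<beta>'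
       then e \<alpha> * e \<beta> * e \<alpha>' * e \<beta>' * (lp b * lp x * lp y * lp d) / (fc b * fc x * fc y * fc d) else 0)"
      unfolding tab[OF in_A] sum_distrib_left
      by (intro sum.cong refl) (use in_A in \<open>auto simp: e_def lp_add\<close>)
  qed
  also have "\<dots> = (\<Sum>b\<in>T. \<Sum>d\<in>T. \<Sum>x\<in>T. \<Sum>y\<in>T. \<Sum>\<alpha>\<in>A. \<Sum>\<beta>\<in>A. \<Sum>\<alpha>'\<in>A. \<Sum>\<beta>'\<in>A.
       if (\<lambda>i. b i + x i) = \<alpha> \<and> (\<lambda>i. y i + d i) = \<beta> \<and> (\<lambda>i. b i + y i) = \<alpha>' \<and> (\<lambda>i. x i + d i) = \<beta>'
       then e \<alpha> * e \<beta> * e \<alpha>' * e \<beta>' * (lp b * lp x * lp y * lp d) / (fc b * fc x * fc y * fc d) else 0)"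
    unfolding sum.swap[of _ T A] by simp
  also have "\<dots> = (\<Sum>b\<in>T. \<Sum>d\<in>T. \<Sum>x\<in>T. \<Sum>y\<in>T.
     e (\<lambda>i. b i + x i) * e (\<lambda>i. y i + d i) * e (\<lambda>i. b i + y i) * e (\<lambda>i. x i + d i) * (lp b * lp x * lp y * lp d) / (fc b * fc x * fc y * fc d))"
  proof (intro sum.cong refl)
    fix b d x y
    let ?r = "\<lambda>\<alpha> \<beta> \<alpha>' \<beta>'. e \<alpha> * e \<beta> * e \<alpha>' * e \<beta>' * (lp b * lp x * lp y * lp d) / (fc b * fc x * fc y * fc d)"
    let ?a = "\<lambda>i. b i + x i" and ?b = "\<lambda>i. y i + d i" and ?a' = "\<lambda>i. b i + y i" and ?b' = "\<lambda>i. x i + d i"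
    have "(\<Sum>\<alpha>\<in>A. \<Sum>\<beta>\<in>A. \<Sum>\<alpha>'\<in>A. \<Sum>\<beta>'\<in>A. if ?a = \<alpha> \<and> ?b = \<beta> \<and> ?a' = \<alpha>' \<and> ?b' = \<beta>' then ?r \<alpha> \<beta> \<alpha>' \<beta>' else 0) =
      (\<Sum>\<alpha>\<in>A. if ?a = \<alpha> then (\<Sum>\<beta>\<in>A. if ?b = \<beta> then (\<Sum>\<alpha>'\<in>A. if ?a' = \<alpha>' then (\<Sum>\<beta>'\<in>A. if ?b' = \<beta>' then ?r \<alpha> \<beta> \<alpha>' \<beta>' else 0) else 0) else 0) else 0)"
      by (intro sum.cong refl if_cong) (auto intro!: sum.cong sum.neutral)
    also have "\<dots> = ?r ?a ?b ?a' ?b'"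
      using finA by (simp add: e_def)
    finally show "(\<Sum>\<alpha>\<in>A. \<Sum>\<beta>\<in>A. \<Sum>\<alpha>'\<in>A. \<Sum>\<beta>'\<in>A. if ?a = \<alpha> \<and> ?b = \<beta> \<and> ?a' = \<alpha>' \<and> ?b' = \<beta>' then ?r \<alpha> \<beta> \<alpha>' \<beta>' else 0) = ?r ?a ?b ?a' ?b'" .
  qed
  \<comment> \<open>For fixed diagonal entries b and d the summand is a term in x times the same
    term in y, so the double sum is a square and every contribution is nonnegative.\<close>
  also have "\<dots> = (\<Sum>b\<in>T. \<Sum>d\<in>T. lp b * lp d / (fc b * fc d) * (S b d)\<^sup>2)"
  proof (intro sum.cong refl)
    fix b d
    have "(S b d)\<^sup>2 = (\<Sum>x\<in>T. \<Sum>y\<in>T. (lp x / fc x * (e (\<lambda>i. b i + x i) * e (\<lambda>i. x i + d i))) * (lp y / fc y * (e (\<lambda>i. b i + y i) * e (\<lambda>i. y i + d i))))"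
      unfolding S_def power2_eq_square by (rule sum_product)
    then show "(\<Sum>x\<in>T. \<Sum>y\<in>T.
     e (\<lambda>i. b i + x i) * e (\<lambda>i. y i + d i) * e (\<lambda>i. b i + y i) * e (\<lambda>i. x i + d i) * (lp b * lp x * lp y * lp d) / (fc b * fc x * fc y * fc d))
     = lp b * lp d / (fc b * fc d) * (S b d)\<^sup>2"
      by (simp add: sum_distrib_left mult_ac)
  qed
  finally have key: "(\<Sum>\<gamma>\<in>multi_indices (2 * q). (dd \<gamma>)\<^sup>2 * index_norm \<gamma>) = (\<Sum>(b, d)\<in>T \<times> T. lp b * lp d / (fc b * fc d) * (S b d)\<^sup>2)"
    by (simp add: sum.cartesian_product)

  let ?z = "\<lambda>_::'i. 0::nat"
  let ?N = "\<Sum>\<alpha>\<in>A. (c \<alpha>)\<^sup>2 * index_norm \<alpha>"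
  have zT: "?z \<in> T" by (auto simp: T_def)
  \<comment> \<open>Here q > 0 matters: it keeps the pair (0, 0) of diagonal entries apart from the
    pairs in A \<times> A, so that both extreme contributions count.\<close>
  have zA: "?z \<notin> A" using q by (auto simp: A_def multi_indices_def)
  have S0: "S ?z ?z = ?N"
  proof -
    have "S ?z ?z = (\<Sum>x\<in>A. lp x / fc x * (e x * e x))"
      unfolding S_def by (rule sum.mono_neutral_cong_right) (use finT AT in \<open>auto simp: e_def\<close>)
    also have "\<dots> = ?N"
      by (intro sum.cong refl) (use fc_pos in \<open>auto simp: e_def nrm power2_eq_square less_imp_neq[symmetric]\<close>)
    finally show ?thesis .
  qed
  \<comment> \<open>Once b has degree q, adding a nonzero x exceeds the degree, so only x = 0
    survives.\<close>
  have Sq: "S b d = e b * e d" if "b \<in> A" "d \<in> A" for b d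
  proof -
    have "e (\<lambda>i. b i + x i) = 0" if x: "x \<in> T" "x \<noteq> ?z" for x
    proof -
      obtain i where i: "x i \<noteq> 0" using x by (auto simp: fun_eq_iff)
      then have "i \<in> I" using x by (auto simp: T_def)
      then have "x i \<le> sum x I" using I by (intro member_le_sum) auto
      then have "sum (\<lambda>i. b i + x i) I \<noteq> q"
        using i \<open>b \<in> A\<close> by (auto simp: sum.distrib A_def multi_indices_def)
      then show ?thesis by (auto simp: e_def A_def multi_indices_def)
    qed
    then have "S b d = (\<Sum>x\<in>{?z}. lp x / fc x * (e (\<lambda>i. b i + x i) * e (\<lambda>i. x i + d i)))"
      unfolding S_def using finT zT by (intro sum.mono_neutral_right) auto
    then show ?thesis by (simp add: lp_def fc_def)
  qed
  have "2 * ?N\<^sup>2 = (\<Sum>(b, d)\<in>{(?z, ?z)}. lp b * lp d / (fc b * fc d) * (S b d)\<^sup>2) + (\<Sum>(b, d)\<in>A \<times> A. lp b * lp d / (fc b * fc d) * (S b d)\<^sup>2)"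
  proof -
    have "(\<Sum>(b, d)\<in>A \<times> A. lp b * lp d / (fc b * fc d) * (S b d)\<^sup>2) = (\<Sum>(b, d)\<in>A \<times> A. ((c b)\<^sup>2 * index_norm b) * ((c d)\<^sup>2 * index_norm d))"
    proof (intro sum.cong refl, clarify)
      fix b d assume "b \<in> A" "d \<in> A"
      then show "lp b * lp d / (fc b * fc d) * (S b d)\<^sup>2 = ((c b)\<^sup>2 * index_norm b) * ((c d)\<^sup>2 * index_norm d)"
        using fc_pos[of b] fc_pos[of d] by (simp add: Sq e_def nrm power2_eq_square)
    qed
    also have "\<dots> = ?N * ?N" by (simp add: sum_product sum.cartesian_product)
    finally have "(\<Sum>(b, d)\<in>A \<times> A. lp b * lp d / (fc b * fc d) * (S b d)\<^sup>2) = ?N\<^sup>2" by (simp add: power2_eq_square)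
    moreover have "(\<Sum>(b, d)\<in>{(?z, ?z)}. lp b * lp d / (fc b * fc d) * (S b d)\<^sup>2) = ?N\<^sup>2"
      by (simp add: S0) (simp add: lp_def fc_def)
    ultimately show ?thesis by simp
  qed
  also have "\<dots> = (\<Sum>(b, d)\<in>{(?z, ?z)} \<union> A \<times> A. lp b * lp d / (fc b * fc d) * (S b d)\<^sup>2)"
    using zA finA by (subst sum.union_disjoint) auto
  also have "\<dots> \<le> (\<Sum>(b, d)\<in>T \<times> T. lp b * lp d / (fc b * fc d) * (S b d)\<^sup>2)"
  proof (rule sum_mono2)
    show "{(?z, ?z)} \<union> A \<times> A \<subseteq> T \<times> T" using AT zT by auto
    show "0 \<le> (case t of (b, d) \<Rightarrow> lp b * lp d / (fc b * fc d) * (S b d)\<^sup>2)" for t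
      using lp_nn fc_pos[THEN less_imp_le] by (cases t) (simp add: divide_nonneg_nonneg)
  qed (use finT in auto)
  finally show ?thesis unfolding key .
qed

end

section \<open>Charlier polynomials of a Poisson vector\<close>

text \<open>The discriminant argument behind the Cauchy--Schwarz estimates below, in a form that
  covers y = 0 and either sign of z.\<close>

lemma quadratic_nonneg_imp:
  fixes x y z :: real
  assumes "\<And>t. 0 \<le> x - 2 * z * t + y * t\<^sup>2" "0 \<le> y"
  shows "z \<le> sqrt (x * y)"
proof (rule real_le_rsqrt)
  show "z\<^sup>2 \<le> x * y"
  proof (cases "y = 0")
    case True
    have "z = 0"
    proof (rule ccontr)
      assume "z \<noteq> 0"
      then show False using assms(1)[of "(x + 1) / (2 * z)"] True by simp
    qed
    then show ?thesis using True by simp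
  next
    case False
    then show ?thesis using assms(1)[of "z / y"] assms(2) by (simp add: field_simps power2_eq_square)
  qed
qed

text \<open>The monic Charlier polynomials for the Poisson law with mean l. The recursion is the
  creation operator, the adjoint of the difference operator; at n = 0 the truncated predecessor is
  harmless because of the factor n.\<close>

fun charlier :: "real \<Rightarrow> nat \<Rightarrow> nat \<Rightarrow> real" where
  "charlier l 0 n = 1"
| "charlier l (Suc a) n = real n * charlier l a (n - 1) - l * charlier l a n"

text \<open>Under the forward difference the Charlier polynomials behave like powers under
  differentiation. In the induction step the differences at n and at n - 1 are lowered separately
  and recombined by the recursion.\<close>

lemma charlier_diff: "charlier l a (Suc n) - charlier l a n = real a * charlier l (a - 1) n"
proof (induction a arbitrary: n)
  case (Suc a)
  have 1: "real n * (charlier l a n - charlier l a (n - 1)) = real n * (real a * charlier l (a - 1) (n - 1))"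
    using Suc.IH[of "n - 1"] by (cases n) auto
  have 2: "real a * (real n * charlier l (a - 1) (n - 1) - l * charlier l (a - 1) n) = real a * charlier l a n"
    by (cases a) auto
  have "charlier l (Suc a) (Suc n) - charlier l (Suc a) n =
    charlier l a n + real n * (charlier l a n - charlier l a (n - 1)) - l * (charlier l a (Suc n) - charlier l a n)"
    by (simp add: algebra_simps)
  also have "\<dots> = charlier l a n + real a * (real n * charlier l (a - 1) (n - 1) - l * charlier l (a - 1) n)"
    unfolding 1 Suc.IH by (simp add: algebra_simps)
  finally show ?case unfolding 2 by (simp add: algebra_simps)
qed simp

text \<open>The law enters through the Mecke identity; orthogonality, integration by parts and the
  existence of all moments are derived from it. With the full power set as sigma-algebra every
  function of the counts is measurable. The value l j = 0 is allowed since a cell may be a null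
  set.\<close>

locale poisson_vector = prob_space D for D :: "('i \<Rightarrow> nat) measure" +
  fixes I :: "'i set" and l :: "'i \<Rightarrow> real"
  assumes finite_I: "finite I" and l_nonneg: "\<And>i. i \<in> I \<Longrightarrow> 0 \<le> l i" and sets_D: "sets D = UNIV"
    and mecke_nn: "\<And>j \<psi>. j \<in> I \<Longrightarrow>
      (\<integral>\<^sup>+n. of_nat (n j) * \<psi> n \<partial>D) = ennreal (l j) * (\<integral>\<^sup>+n. \<psi> (n(j := Suc (n j))) \<partial>D)"
begin

lemma space_D: "space D = UNIV"
  using sets_eq_imp_space_eq[of D "count_space UNIV"] sets_D by simp

lemma measurable_D [simp]: "(f :: _ \<Rightarrow> 'b :: topological_space) \<in> borel_measurable D"
  by (simp add: measurable_def sets_D space_D)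

section \<open>Functions of polynomial growth\<close>

definition total :: "('i \<Rightarrow> nat) \<Rightarrow> real" where
  "total n = 1 + (\<Sum>i\<in>I. real (n i))"

text \<open>One criterion for all integrability questions: the class contains the Charlier
  polynomials and is closed under products and under adding or removing a point. The summand 1 in
  \<open>total\<close> makes its powers monotone in the exponent.\<close>

definition tame :: "(('i \<Rightarrow> nat) \<Rightarrow> real) \<Rightarrow> bool" where
  "tame u \<longleftrightarrow> (\<exists>C k. \<forall>n. \<bar>u n\<bar> \<le> C * total n ^ k)"

lemma total_ge_1: "1 \<le> total n"
  by (simp add: total_def sum_nonneg)

lemma total_Suc: "j \<in> I \<Longrightarrow> total (n(j := Suc (n j))) = total n + 1"
  unfolding total_def using finite_I by (simp add: sum.remove[of I j])

lemma total_minus: "total (n(j := n j - 1)) \<le> total n"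
  unfolding total_def by (auto intro!: sum_mono)

lemma tameI: "(\<And>n. \<bar>u n\<bar> \<le> C * total n ^ k) \<Longrightarrow> tame u"
  by (auto simp: tame_def)

lemma tameE:
  assumes "tame u"
  obtains C k where "0 \<le> C" "\<And>n k'. k \<le> k' \<Longrightarrow> \<bar>u n\<bar> \<le> C * total n ^ k'"
proof -
  from assms obtain C k where C: "\<And>n. \<bar>u n\<bar> \<le> C * total n ^ k" by (auto simp: tame_def)
  have "\<bar>u n\<bar> \<le> \<bar>C\<bar> * total n ^ k'" if "k \<le> k'" for n k'
  proof -
    have "\<bar>u n\<bar> \<le> C * total n ^ k" by (rule C)
    also have "\<dots> \<le> \<bar>C\<bar> * total n ^ k'"
      using total_ge_1[of n] that by (intro mult_mono power_increasing) auto
    finally show ?thesis .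
  qed
  then show ?thesis using that[of "\<bar>C\<bar>" k] by simp
qed

lemma tame_const [simp]: "tame (\<lambda>_. c)"
  by (rule tameI[where C="\<bar>c\<bar>" and k=0]) simp

lemma tame_coord [simp]: "tame (\<lambda>n. real (n j))" if "j \<in> I"
proof (rule tameI)
  fix n
  have "real (n j) \<le> (\<Sum>i\<in>I. real (n i))"
    using that finite_I by (intro member_le_sum[where f="\<lambda>i. real (n i)"]) auto
  then show "\<bar>real (n j)\<bar> \<le> 1 * total n ^ 1" by (simp add: total_def)
qed

lemma tame_add [simp, intro]:
  assumes "tame u" "tame v" shows "tame (\<lambda>n. u n + v n)"
proof -
  obtain C k where C: "0 \<le> C" "\<And>n k'. k \<le> k' \<Longrightarrow> \<bar>u n\<bar> \<le> C * total n ^ k'" using tameE[OF assms(1)] by blast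
  obtain C' m where C': "0 \<le> C'" "\<And>n k'. m \<le> k' \<Longrightarrow> \<bar>v n\<bar> \<le> C' * total n ^ k'" using tameE[OF assms(2)] by blast
  show ?thesis
  proof (rule tameI)
    fix n show "\<bar>u n + v n\<bar> \<le> (C + C') * total n ^ (max k m)"
      using C(2)[of "max k m" n] C'(2)[of "max k m" n] by (simp add: algebra_simps)
  qed
qed

lemma tame_mult [simp, intro]:
  assumes "tame u" "tame v" shows "tame (\<lambda>n. u n * v n)"
proof -
  obtain C k where C: "0 \<le> C" "\<And>n k'. k \<le> k' \<Longrightarrow> \<bar>u n\<bar> \<le> C * total n ^ k'" using tameE[OF assms(1)] by blast
  obtain C' m where C': "0 \<le> C'" "\<And>n k'. m \<le> k' \<Longrightarrow> \<bar>v n\<bar> \<le> C' * total n ^ k'" using tameE[OF assms(2)] by blast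
  show ?thesis
  proof (rule tameI)
    fix n
    have "\<bar>u n\<bar> * \<bar>v n\<bar> \<le> (C * total n ^ k) * (C' * total n ^ m)"
      using C C' total_ge_1[of n] by (intro mult_mono) auto
    then show "\<bar>u n * v n\<bar> \<le> (C * C') * total n ^ (k + m)"
      by (simp add: abs_mult power_add mult_ac)
  qed
qed

lemma tame_bound:
  assumes "tame u" "\<And>n. \<bar>v n\<bar> \<le> \<bar>u n\<bar>" shows "tame v"
  using assms unfolding tame_def by (meson order_trans)

lemma tame_uminus [simp, intro]: "tame u \<Longrightarrow> tame (\<lambda>n. - u n)"
  and tame_abs [simp, intro]: "tame u \<Longrightarrow> tame (\<lambda>n. \<bar>u n\<bar>)"
  by (auto elim!: tame_bound)

lemma tame_diff [simp, intro]: "tame u \<Longrightarrow> tame v \<Longrightarrow> tame (\<lambda>n. u n - v n)"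
  using tame_add[of u "\<lambda>n. - v n"] by simp

lemma tame_power [simp, intro]: "tame u \<Longrightarrow> tame (\<lambda>n. u n ^ k)"
  by (induction k) auto

lemma tame_divide [simp, intro]: "tame u \<Longrightarrow> tame (\<lambda>n. u n / c)"
  using tame_mult[of u "\<lambda>_. 1 / c"] by simp

lemma tame_sum [simp, intro]: "(\<And>i. i \<in> A \<Longrightarrow> tame (u i)) \<Longrightarrow> tame (\<lambda>n. \<Sum>i\<in>A. u i n)"
  by (induction A rule: infinite_finite_induct) auto

lemma tame_prod [simp, intro]: "(\<And>i. i \<in> A \<Longrightarrow> tame (u i)) \<Longrightarrow> tame (\<lambda>n. \<Prod>i\<in>A. u i n)"
  by (induction A rule: infinite_finite_induct) auto

lemma tame_up [simp, intro]:
  assumes "tame u" "j \<in> I" shows "tame (\<lambda>n. u (n(j := Suc (n j))))"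
proof -
  obtain C k where C: "0 \<le> C" "\<And>n k'. k \<le> k' \<Longrightarrow> \<bar>u n\<bar> \<le> C * total n ^ k'" using tameE[OF assms(1)] by blast
  show ?thesis
  proof (rule tameI)
    fix n
    have "\<bar>u (n(j := Suc (n j)))\<bar> \<le> C * (total n + 1) ^ k"
      using C(2)[of k "n(j := Suc (n j))"] total_Suc[OF assms(2)] by simp
    also have "\<dots> \<le> C * (2 * total n) ^ k"
      using C(1) total_ge_1[of n] by (intro mult_left_mono power_mono) auto
    finally show "\<bar>u (n(j := Suc (n j)))\<bar> \<le> (C * 2 ^ k) * total n ^ k"
      by (simp add: power_mult_distrib)
  qed
qed

lemma tame_down [simp, intro]:
  assumes "tame u" shows "tame (\<lambda>n. u (n(j := n j - 1)))"
proof -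
  obtain C k where C: "0 \<le> C" "\<And>n k'. k \<le> k' \<Longrightarrow> \<bar>u n\<bar> \<le> C * total n ^ k'" using tameE[OF assms(1)] by blast
  show ?thesis
  proof (rule tameI)
    fix n
    have "\<bar>u (n(j := n j - 1))\<bar> \<le> C * total (n(j := n j - 1)) ^ k" using C(2) by blast
    also have "\<dots> \<le> C * total n ^ k"
      using C(1) total_ge_1[of "n(j := n j - 1)"] total_minus[of n j] by (intro mult_left_mono power_mono) auto
    finally show "\<bar>u (n(j := n j - 1))\<bar> \<le> C * total n ^ k" .
  qed
qed

lemmas tame_down_Suc [simp, intro] = tame_down[unfolded One_nat_def]

text \<open>Induction on the exponent: the Mecke identity trades one factor \<open>total\<close> for
  the shift by one point, which costs at most the factor 2 ^ k.\<close>

lemma nn_total_finite: "(\<integral>\<^sup>+n. ennreal (total n ^ k) \<partial>D) < \<infinity>"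
proof (induction k)
  case 0
  then show ?case by (simp add: emeasure_space_1)
next
  case (Suc k)
  have nn: "0 \<le> total n" for n using total_ge_1[of n] by simp
  have "(\<integral>\<^sup>+n. ennreal (total n ^ Suc k) \<partial>D) = (\<integral>\<^sup>+n. ennreal (total n ^ k) + (\<Sum>j\<in>I. of_nat (n j) * ennreal (total n ^ k)) \<partial>D)"
  proof (rule nn_integral_cong)
    fix n
    have "ennreal (total n ^ Suc k) = ennreal (total n ^ k + (\<Sum>j\<in>I. real (n j) * total n ^ k))"
      by (simp add: total_def algebra_simps sum_distrib_left flip: sum_distrib_right)
    also have "\<dots> = ennreal (total n ^ k) + (\<Sum>j\<in>I. ennreal (real (n j) * total n ^ k))"
      using nn by (simp add: sum_nonneg ennreal_plus)
    finally show "ennreal (total n ^ Suc k) = ennreal (total n ^ k) + (\<Sum>j\<in>I. of_nat (n j) * ennreal (total n ^ k))"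
      using nn by (simp add: ennreal_mult ennreal_of_nat_eq_real_of_nat)
  qed
  also have "\<dots> = (\<integral>\<^sup>+n. ennreal (total n ^ k) \<partial>D) + (\<Sum>j\<in>I. \<integral>\<^sup>+n. of_nat (n j) * ennreal (total n ^ k) \<partial>D)"
    by (subst nn_integral_add) (auto simp: nn_integral_sum)
  also have "(\<Sum>j\<in>I. \<integral>\<^sup>+n. of_nat (n j) * ennreal (total n ^ k) \<partial>D) = (\<Sum>j\<in>I. ennreal (l j) * (\<integral>\<^sup>+n. ennreal ((total n + 1) ^ k) \<partial>D))"
    by (intro sum.cong refl) (simp add: mecke_nn total_Suc)
  also have "(\<integral>\<^sup>+n. ennreal ((total n + 1) ^ k) \<partial>D) \<le> (\<integral>\<^sup>+n. ennreal (2 ^ k) * ennreal (total n ^ k) \<partial>D)"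
  proof (rule nn_integral_mono)
    fix n
    have "(total n + 1) ^ k \<le> (2 * total n) ^ k" using total_ge_1[of n] by (intro power_mono) auto
    then show "ennreal ((total n + 1) ^ k) \<le> ennreal (2 ^ k) * ennreal (total n ^ k)"
      using nn by (simp add: power_mult_distrib flip: ennreal_mult)
  qed
  also have "\<dots> = ennreal (2 ^ k) * (\<integral>\<^sup>+n. ennreal (total n ^ k) \<partial>D)"
    by (rule nn_integral_cmult) simp
  finally have "(\<integral>\<^sup>+n. ennreal (total n ^ Suc k) \<partial>D) \<le> (\<integral>\<^sup>+n. ennreal (total n ^ k) \<partial>D)
     + (\<Sum>j\<in>I. ennreal (l j) * (ennreal (2 ^ k) * (\<integral>\<^sup>+n. ennreal (total n ^ k) \<partial>D)))"
    by (simp add: mult_left_mono sum_mono)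
  also have "\<dots> < \<infinity>" using Suc finite_I by (auto simp: ennreal_mult_less_top)
  finally show ?case .
qed

lemma tame_integrable [simp, intro]: "integrable D u" if u: "tame u"
proof -
  obtain C k where C: "0 \<le> C" "\<And>n k'. k \<le> k' \<Longrightarrow> \<bar>u n\<bar> \<le> C * total n ^ k'" using tameE[OF u] by blast
  have nn: "0 \<le> total n" for n using total_ge_1[of n] by simp
  have "integrable D (\<lambda>n. total n ^ k)"
    using nn_total_finite[of k] nn by (intro integrableI_bounded) auto
  then have "integrable D (\<lambda>n. C * total n ^ k)" by simp
  then show ?thesis
    by (rule Bochner_Integration.integrable_bound) (use C nn in auto)
qed

lemma mecke_pos:
  assumes "tame u" "j \<in> I" "\<And>n. 0 \<le> u n"
  shows "(\<integral>n. real (n j) * u n \<partial>D) = l j * (\<integral>n. u (n(j := Suc (n j))) \<partial>D)"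
proof -
  have "ennreal (\<integral>n. real (n j) * u n \<partial>D) = (\<integral>\<^sup>+n. ennreal (real (n j) * u n) \<partial>D)"
    using assms by (intro nn_integral_eq_integral[symmetric] tame_integrable) auto
  also have "\<dots> = (\<integral>\<^sup>+n. of_nat (n j) * ennreal (u n) \<partial>D)"
    using assms by (intro nn_integral_cong) (simp add: ennreal_mult ennreal_of_nat_eq_real_of_nat)
  also have "\<dots> = ennreal (l j) * (\<integral>\<^sup>+n. ennreal (u (n(j := Suc (n j)))) \<partial>D)"
    by (rule mecke_nn[OF assms(2)])
  also have "(\<integral>\<^sup>+n. ennreal (u (n(j := Suc (n j)))) \<partial>D) = ennreal (\<integral>n. u (n(j := Suc (n j))) \<partial>D)"
    using assms by (intro nn_integral_eq_integral tame_integrable) auto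
  also have "ennreal (l j) * \<dots> = ennreal (l j * (\<integral>n. u (n(j := Suc (n j))) \<partial>D))"
    using l_nonneg[OF assms(2)] assms by (simp add: ennreal_mult integral_nonneg)
  finally show ?thesis
    using l_nonneg[OF assms(2)] assms by (subst (asm) ennreal_inj) (auto intro!: integral_nonneg)
qed

text \<open>Reduced to nonnegative functions by writing u as the difference of |u| + u and |u|, both
  again of polynomial growth.\<close>

lemma mecke:
  assumes u: "tame u" and j: "j \<in> I"
  shows "(\<integral>n. real (n j) * u n \<partial>D) = l j * (\<integral>n. u (n(j := Suc (n j))) \<partial>D)"
proof -
  define p where "p n = \<bar>u n\<bar> + u n" for n
  have p: "tame p" "\<And>n. 0 \<le> p n" and a: "tame (\<lambda>n. \<bar>u n\<bar>)" using u by (auto simp: p_def[abs_def])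
  have "(\<integral>n. real (n j) * u n \<partial>D) = (\<integral>n. real (n j) * p n - real (n j) * \<bar>u n\<bar> \<partial>D)"
    by (simp add: p_def algebra_simps)
  also have "\<dots> = (\<integral>n. real (n j) * p n \<partial>D) - (\<integral>n. real (n j) * \<bar>u n\<bar> \<partial>D)"
    using p a j by (intro Bochner_Integration.integral_diff) auto
  also have "\<dots> = l j * ((\<integral>n. p (n(j := Suc (n j))) \<partial>D) - (\<integral>n. \<bar>u (n(j := Suc (n j)))\<bar> \<partial>D))"
    using mecke_pos[OF p(1) j p(2)] mecke_pos[OF a j] by (simp add: right_diff_distrib)
  also have "(\<integral>n. p (n(j := Suc (n j))) \<partial>D) - (\<integral>n. \<bar>u (n(j := Suc (n j)))\<bar> \<partial>D) =
      (\<integral>n. p (n(j := Suc (n j))) - \<bar>u (n(j := Suc (n j)))\<bar> \<partial>D)"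
    using p(1) a u j by (intro Bochner_Integration.integral_diff[symmetric] tame_integrable tame_up tame_abs) auto
  finally show ?thesis by (simp add: p_def)
qed

section \<open>The difference operator, its adjoint and the generator\<close>

definition diff :: "'i \<Rightarrow> (('i \<Rightarrow> nat) \<Rightarrow> real) \<Rightarrow> ('i \<Rightarrow> nat) \<Rightarrow> real" where
  "diff j v n = v (n(j := Suc (n j))) - v n"

text \<open>The Kabanov--Skorohod integral in one coordinate, the creation operator of the Fock
  space. Where n j = 0, the truncated \<open>n j - 1\<close> is multiplied by 0.\<close>

definition skor :: "'i \<Rightarrow> (('i \<Rightarrow> nat) \<Rightarrow> real) \<Rightarrow> ('i \<Rightarrow> nat) \<Rightarrow> real" where
  "skor j v n = real (n j) * v (n(j := n j - 1)) - l j * v n"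

lemma tame_diff_op [simp, intro]: "tame v \<Longrightarrow> j \<in> I \<Longrightarrow> tame (diff j v)"
  and tame_skor [simp, intro]: "tame v \<Longrightarrow> j \<in> I \<Longrightarrow> tame (skor j v)"
  by (auto simp: diff_def[abs_def] skor_def[abs_def] intro!: tame_diff tame_mult tame_up tame_down)

text \<open>The Mecke identity turns the point removed in v into a point added in u; the term with
  \<open>l j\<close> completes the difference.\<close>

lemma adjoint:
  assumes "tame u" "tame v" "j \<in> I"
  shows "(\<integral>n. u n * skor j v n \<partial>D) = l j * (\<integral>n. diff j u n * v n \<partial>D)"
proof -
  have "(\<integral>n. u n * skor j v n \<partial>D) = (\<integral>n. real (n j) * (u n * v (n(j := n j - 1))) - l j * (u n * v n) \<partial>D)"
    by (simp add: skor_def algebra_simps)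
  also have "\<dots> = (\<integral>n. real (n j) * (u n * v (n(j := n j - 1))) \<partial>D) - l j * (\<integral>n. u n * v n \<partial>D)"
    using assms by (subst Bochner_Integration.integral_diff) (auto intro!: tame_integrable)
  also have "(\<integral>n. real (n j) * (u n * v (n(j := n j - 1))) \<partial>D) = l j * (\<integral>n. u (n(j := Suc (n j))) * v n \<partial>D)"
    using mecke[of "\<lambda>n. u n * v (n(j := n j - 1))" j] assms by auto
  also have "\<dots> - l j * (\<integral>n. u n * v n \<partial>D) = l j * (\<integral>n. u (n(j := Suc (n j))) * v n - u n * v n \<partial>D)"
    using assms by (subst Bochner_Integration.integral_diff) (auto intro!: tame_integrable simp: right_diff_distrib)
  finally show ?thesis by (simp add: diff_def algebra_simps)
qed

definition gen :: "(('i \<Rightarrow> nat) \<Rightarrow> real) \<Rightarrow> ('i \<Rightarrow> nat) \<Rightarrow> real" where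
  "gen v n = - (\<Sum>j\<in>I. skor j (diff j v) n)"

text \<open>Exhibits the generator of independent immigration-death chains: a point enters cell j at
  rate \<open>l j\<close>, and each of the n j points leaves at rate 1. This form admits a Taylor
  expansion along the jumps.\<close>

lemma gen_eq: "gen v n = (\<Sum>j\<in>I. l j * (v (n(j := Suc (n j))) - v n) + real (n j) * (v (n(j := n j - 1)) - v n))"
proof -
  have "- skor j (diff j v) n = l j * (v (n(j := Suc (n j))) - v n) + real (n j) * (v (n(j := n j - 1)) - v n)" for j
    by (cases "n j") (auto simp: skor_def diff_def fun_upd_idem algebra_simps)
  then show ?thesis by (simp add: gen_def flip: sum_negf)
qed

lemma tame_gen [simp, intro]: "tame v \<Longrightarrow> tame (gen v)"
  unfolding gen_def[abs_def] by (intro tame_uminus tame_sum tame_skor tame_diff_op)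

text \<open>Integration by parts into the Dirichlet form; for constant v it says that the law is
  invariant.\<close>

lemma integral_gen:
  assumes "tame u" "tame v"
  shows "(\<integral>n. v n * gen u n \<partial>D) = - (\<Sum>j\<in>I. l j * (\<integral>n. diff j v n * diff j u n \<partial>D))"
proof -
  have "(\<integral>n. v n * gen u n \<partial>D) = (\<integral>n. - (\<Sum>j\<in>I. v n * skor j (diff j u) n) \<partial>D)"
    by (simp add: gen_def sum_distrib_left)
  also have "\<dots> = - (\<Sum>j\<in>I. \<integral>n. v n * skor j (diff j u) n \<partial>D)"
    using assms by (subst Bochner_Integration.integral_minus, subst Bochner_Integration.integral_sum)
      (auto intro!: tame_integrable tame_mult tame_skor tame_diff_op)
  also have "\<dots> = - (\<Sum>j\<in>I. l j * (\<integral>n. diff j v n * diff j u n \<partial>D))"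
    using assms by (intro arg_cong[where f=uminus] sum.cong refl adjoint) auto
  finally show ?thesis .
qed

section \<open>Orthogonality and products of Charlier polynomials in several variables\<close>

definition chr :: "('i \<Rightarrow> nat) \<Rightarrow> ('i \<Rightarrow> nat) \<Rightarrow> real" where
  "chr \<alpha> n = (\<Prod>i\<in>I. charlier (l i) (\<alpha> i) (n i))"

lemma chr_remove: "j \<in> I \<Longrightarrow> chr \<alpha> n = charlier (l j) (\<alpha> j) (n j) * (\<Prod>i\<in>I - {j}. charlier (l i) (\<alpha> i) (n i))"
  unfolding chr_def using finite_I by (rule prod.remove)

lemma skor_chr: "skor j (chr \<alpha>) = chr (\<alpha>(j := Suc (\<alpha> j)))" if "j \<in> I"
  by (rule ext) (simp add: skor_def chr_remove[OF that] algebra_simps)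

lemma diff_chr: "diff j (chr \<alpha>) n = real (\<alpha> j) * chr (\<alpha>(j := \<alpha> j - 1)) n" if "j \<in> I"
  using charlier_diff[of "l j" "\<alpha> j" "n j"] by (simp add: diff_def chr_remove[OF that] flip: left_diff_distrib)

lemma tame_charlier: "i \<in> I \<Longrightarrow> tame (\<lambda>n. charlier c a (n i))"
proof (induction a)
  case (Suc a)
  have "tame (\<lambda>n. charlier c a ((n(i := n i - 1)) i))" by (rule tame_down) (rule Suc.IH[OF Suc.prems])
  then show ?case using Suc by (auto intro!: tame_diff tame_mult)
qed simp

lemma tame_chr [simp, intro]: "tame (chr \<alpha>)"
  unfolding chr_def[abs_def] by (intro tame_prod tame_charlier)

lemma skor_cmult: "skor j (\<lambda>n. c * v n) n = c * skor j v n"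
  and skor_sum: "skor j (\<lambda>n. \<Sum>i\<in>A. w i n) n = (\<Sum>i\<in>A. skor j (w i) n)"
  and diff_sum: "diff j (\<lambda>n. \<Sum>i\<in>A. w i n) n = (\<Sum>i\<in>A. diff j (w i) n)"
  by (simp_all add: skor_def diff_def algebra_simps sum_distrib_left sum_subtractf)

abbreviation "mi \<equiv> multi_indices I"
abbreviation "nrm \<equiv> index_norm I l"

definition low :: "nat \<Rightarrow> ('i \<Rightarrow> nat) set" where "low r = (\<Union>p<r. mi p)"

lemma finite_mi [simp]: "finite (mi p)" by (rule finite_multi_indices[OF finite_I])
lemma finite_low [simp]: "finite (low r)" by (simp add: low_def)
lemma low_iff: "\<gamma> \<in> low r \<longleftrightarrow> (\<forall>i. i \<notin> I \<longrightarrow> \<gamma> i = 0) \<and> sum \<gamma> I < r"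
  by (auto simp: low_def multi_indices_def)

lemma mi_0: "\<alpha> \<in> mi 0 \<longleftrightarrow> \<alpha> = (\<lambda>_. 0)"
  using finite_I by (auto simp: multi_indices_def fun_eq_iff)

lemma chr_0 [simp]: "chr (\<lambda>_. 0) n = 1" by (simp add: chr_def)
lemma nrm_0 [simp]: "nrm (\<lambda>_. 0) = 1" by (simp add: index_norm_def)
lemma nrm_nonneg: "0 \<le> nrm \<alpha>" using l_nonneg by (auto simp: index_norm_def intro!: prod_nonneg)

lemma mi_Suc_upd: "\<alpha> \<in> mi p \<Longrightarrow> j \<in> I \<Longrightarrow> \<alpha>(j := Suc (\<alpha> j)) \<in> mi (Suc p)"
  using finite_I by (auto simp: multi_indices_def sum.remove[of I j])

lemma mi_dec: "\<alpha> \<in> mi (Suc p) \<Longrightarrow> j \<in> I \<Longrightarrow> 0 < \<alpha> j \<Longrightarrow> \<alpha>(j := \<alpha> j - 1) \<in> mi p"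
  using finite_I by (auto simp: multi_indices_def sum.remove[of I j])

lemma mi_SucE:
  assumes "\<alpha> \<in> mi (Suc p)"
  obtains j \<alpha>' where "j \<in> I" "\<alpha>' \<in> mi p" "\<alpha> = \<alpha>'(j := Suc (\<alpha>' j))"
proof -
  from assms have "sum \<alpha> I \<noteq> 0" by (simp add: multi_indices_def)
  then obtain j where j: "j \<in> I" "0 < \<alpha> j" using finite_I by auto
  show ?thesis
    by (rule that[OF j(1) mi_dec[OF assms j]]) (use j in \<open>auto simp: fun_eq_iff\<close>)
qed

lemma nrm_Suc: "j \<in> I \<Longrightarrow> nrm (\<alpha>(j := Suc (\<alpha> j))) = l j * real (Suc (\<alpha> j)) * nrm \<alpha>"
  unfolding index_norm_def using finite_I by (simp add: prod.remove[of I j] algebra_simps)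

text \<open>Induction on the degree of \<alpha>: one creation operator is taken off
  \<open>chr \<alpha>\<close> and acts as a difference on \<open>chr \<beta>\<close>, which lowers
  both degrees by one. At degree 0 a constant meets a creation operator, whose integral
  vanishes.\<close>

lemma chr_orth:
  assumes "\<alpha> \<in> mi p" "\<beta> \<in> mi r"
  shows "(\<integral>n. chr \<alpha> n * chr \<beta> n \<partial>D) = (if \<alpha> = \<beta> then nrm \<alpha> else 0)"
  using assms
proof (induction p arbitrary: \<alpha> \<beta> r)
  case 0
  then have a: "\<alpha> = (\<lambda>_. 0)" by (simp add: mi_0)
  show ?case
  proof (cases r)
    case 0
    with \<open>\<beta> \<in> mi r\<close> have "\<beta> = (\<lambda>_. 0)" by (simp add: mi_0)
    then show ?thesis by (simp add: a prob_space)
  next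
    case (Suc r')
    then obtain j \<beta>' where j: "j \<in> I" "\<beta>' \<in> mi r'" "\<beta> = \<beta>'(j := Suc (\<beta>' j))"
      using \<open>\<beta> \<in> mi r\<close> mi_SucE by blast
    have "(\<integral>n. chr \<alpha> n * chr \<beta> n \<partial>D) = (\<integral>n. 1 * skor j (chr \<beta>') n \<partial>D)"
      by (simp add: a j skor_chr)
    also have "\<dots> = l j * (\<integral>n. diff j (\<lambda>_. 1) n * chr \<beta>' n \<partial>D)"
      by (rule adjoint) (use j in auto)
    also have "\<dots> = 0" by (simp add: diff_def)
    moreover have "\<alpha> \<noteq> \<beta>" using j by (auto simp: a fun_eq_iff)
    ultimately show ?thesis by simp
  qed
next
  case (Suc p)
  then obtain j \<alpha>' where j: "j \<in> I" "\<alpha>' \<in> mi p" "\<alpha> = \<alpha>'(j := Suc (\<alpha>' j))"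
    using mi_SucE by blast
  let ?b = "\<beta>(j := \<beta> j - 1)"
  have "(\<integral>n. chr \<alpha> n * chr \<beta> n \<partial>D) = (\<integral>n. chr \<beta> n * skor j (chr \<alpha>') n \<partial>D)"
    by (simp add: j skor_chr mult.commute)
  also have "\<dots> = l j * (\<integral>n. diff j (chr \<beta>) n * chr \<alpha>' n \<partial>D)"
    by (rule adjoint) (use j in auto)
  also have "\<dots> = l j * real (\<beta> j) * (\<integral>n. chr \<alpha>' n * chr ?b n \<partial>D)"
    by (simp add: diff_chr[OF j(1)] mult_ac)
  finally have e: "(\<integral>n. chr \<alpha> n * chr \<beta> n \<partial>D) = l j * real (\<beta> j) * (\<integral>n. chr \<alpha>' n * chr ?b n \<partial>D)" .
  show ?case
  proof (cases "\<beta> j = 0")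
    case True
    then have "\<alpha> \<noteq> \<beta>" using j by (auto simp: fun_eq_iff)
    then show ?thesis using e True by simp
  next
    case False
    then have "sum \<beta> I \<noteq> 0" using j finite_I by auto
    then obtain r' where r': "r = Suc r'" using Suc.prems(2) by (cases r) (auto simp: multi_indices_def)
    have "?b \<in> mi r'" using mi_dec[of \<beta> r' j] Suc.prems(2) r' j False by auto
    from Suc.IH[OF j(2) this] have "(\<integral>n. chr \<alpha>' n * chr ?b n \<partial>D) = (if \<alpha>' = ?b then nrm \<alpha>' else 0)" .
    moreover have "\<alpha>' = ?b \<longleftrightarrow> \<alpha> = \<beta>" using False j(3) by (auto simp: fun_eq_iff split: if_splits)
    moreover have "\<alpha> = \<beta> \<Longrightarrow> l j * real (\<beta> j) * nrm \<alpha>' = nrm \<alpha>"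
      using nrm_Suc[OF j(1), of \<alpha>'] j(3) by auto
    ultimately show ?thesis using e by auto
  qed
qed

lemma span_inner:
  assumes "B \<subseteq> low r"
  shows "(\<integral>n. (\<Sum>\<gamma>\<in>B. x \<gamma> * chr \<gamma> n) * (\<Sum>\<gamma>\<in>B. y \<gamma> * chr \<gamma> n) \<partial>D) = (\<Sum>\<gamma>\<in>B. x \<gamma> * y \<gamma> * nrm \<gamma>)"
proof -
  have fB: "finite B" using assms finite_low by (rule finite_subset)
  have "(\<integral>n. (\<Sum>\<gamma>\<in>B. x \<gamma> * chr \<gamma> n) * (\<Sum>\<gamma>\<in>B. y \<gamma> * chr \<gamma> n) \<partial>D) =
     (\<integral>n. (\<Sum>\<gamma>\<in>B. \<Sum>\<delta>\<in>B. x \<gamma> * y \<delta> * (chr \<gamma> n * chr \<delta> n)) \<partial>D)"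
    by (simp add: sum_product mult_ac)
  also have "\<dots> = (\<Sum>\<gamma>\<in>B. \<integral>n. (\<Sum>\<delta>\<in>B. x \<gamma> * y \<delta> * (chr \<gamma> n * chr \<delta> n)) \<partial>D)"
    by (rule Bochner_Integration.integral_sum) (intro tame_integrable tame_sum tame_mult tame_const tame_chr)
  also have "\<dots> = (\<Sum>\<gamma>\<in>B. \<Sum>\<delta>\<in>B. \<integral>n. x \<gamma> * y \<delta> * (chr \<gamma> n * chr \<delta> n) \<partial>D)"
    by (intro sum.cong refl Bochner_Integration.integral_sum tame_integrable tame_mult tame_const tame_chr)
  also have "\<dots> = (\<Sum>\<gamma>\<in>B. \<Sum>\<delta>\<in>B. if \<gamma> = \<delta> then x \<gamma> * y \<delta> * nrm \<gamma> else 0)"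
  proof (intro sum.cong refl)
    fix \<gamma> \<delta> assume "\<gamma> \<in> B" "\<delta> \<in> B"
    then obtain p r where "\<gamma> \<in> mi p" "\<delta> \<in> mi r" using assms by (auto simp: low_def) blast
    from chr_orth[OF this] show "(\<integral>n. x \<gamma> * y \<delta> * (chr \<gamma> n * chr \<delta> n) \<partial>D) = (if \<gamma> = \<delta> then x \<gamma> * y \<delta> * nrm \<gamma> else 0)"
      by simp
  qed
  also have "\<dots> = (\<Sum>\<gamma>\<in>B. x \<gamma> * y \<gamma> * nrm \<gamma>)" using fB by (simp add: sum.delta')
  finally show ?thesis .
qed

definition in_span :: "('i \<Rightarrow> nat) set \<Rightarrow> (('i \<Rightarrow> nat) \<Rightarrow> real) \<Rightarrow> bool" where
  "in_span B v \<longleftrightarrow> (\<exists>c. v = (\<lambda>n. \<Sum>\<gamma>\<in>B. c \<gamma> * chr \<gamma> n))"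

lemma in_span_zero: "in_span B (\<lambda>n. 0)" unfolding in_span_def by (rule exI[of _ "\<lambda>_. 0"]) simp

lemma in_span_add: "in_span B v \<Longrightarrow> in_span B w \<Longrightarrow> in_span B (\<lambda>n. v n + w n)"
  unfolding in_span_def by clarify (rule_tac x="\<lambda>\<gamma>. c \<gamma> + ca \<gamma>" in exI, simp add: algebra_simps sum.distrib)

lemma in_span_cmult: "in_span B v \<Longrightarrow> in_span B (\<lambda>n. k * v n)"
  unfolding in_span_def by clarify (rule_tac x="\<lambda>\<gamma>. k * c \<gamma>" in exI, simp add: sum_distrib_left mult_ac)

lemma in_span_sum: "(\<And>i. i \<in> A \<Longrightarrow> in_span B (w i)) \<Longrightarrow> in_span B (\<lambda>n. \<Sum>i\<in>A. w i n)"
  by (induction A rule: infinite_finite_induct) (auto intro: in_span_zero in_span_add)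

lemma in_span_chr: "finite B \<Longrightarrow> \<gamma> \<in> B \<Longrightarrow> in_span B (chr \<gamma>)"
  unfolding in_span_def by (rule exI[of _ "\<lambda>\<delta>. if \<delta> = \<gamma> then 1 else 0"]) (simp add: if_distrib[of "\<lambda>x. x * _"] sum.delta cong: if_cong)

lemma in_span_mono: "in_span B v" if "in_span A v" "A \<subseteq> B" "finite B"
proof -
  from that(1) obtain c where "v = (\<lambda>n. \<Sum>\<gamma>\<in>A. c \<gamma> * chr \<gamma> n)" by (auto simp: in_span_def)
  then show ?thesis using that by (auto intro!: in_span_sum in_span_cmult in_span_chr)
qed

lemma in_span_skor: "in_span (low (Suc r)) (skor j v)" if "in_span (low r) v" "j \<in> I"
proof -
  from that(1) obtain c where c: "v = (\<lambda>n. \<Sum>\<gamma>\<in>low r. c \<gamma> * chr \<gamma> n)" by (auto simp: in_span_def)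
  have "skor j v = (\<lambda>n. \<Sum>\<gamma>\<in>low r. c \<gamma> * chr (\<gamma>(j := Suc (\<gamma> j))) n)"
    by (rule ext) (simp add: c skor_sum skor_cmult skor_chr[OF that(2)])
  moreover have "\<gamma>(j := Suc (\<gamma> j)) \<in> low (Suc r)" if "\<gamma> \<in> low r" for \<gamma>
    using that mi_Suc_upd[OF _ \<open>j \<in> I\<close>] by (auto simp: low_def)
  ultimately show ?thesis by (auto intro!: in_span_sum in_span_cmult in_span_chr)
qed

text \<open>In the induction one creation operator is taken off the first factor and moved in front
  of the product by its product rule. Every correction in that rule contains \<open>diff j\<close>
  of the second factor and so stays below the full degree.\<close>

lemma chr_mult:
  assumes "\<alpha> \<in> mi a" "\<beta> \<in> mi b"
  shows "in_span (low (a + b)) (\<lambda>n. chr \<alpha> n * chr \<beta> n - chr (\<lambda>i. \<alpha> i + \<beta> i) n)"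
  using assms
proof (induction a arbitrary: \<alpha> \<beta> b)
  case 0
  then show ?case by (simp add: mi_0 in_span_zero)
next
  case (Suc a)
  then obtain j \<alpha>' where j: "j \<in> I" "\<alpha>' \<in> mi a" "\<alpha> = \<alpha>'(j := Suc (\<alpha>' j))"
    using mi_SucE by blast
  let ?v = "chr \<alpha>'" and ?w = "chr \<beta>"
  define \<rho> where "\<rho> n = ?v n * ?w n - chr (\<lambda>i. \<alpha>' i + \<beta> i) n" for n
  have \<rho>: "in_span (low (a + b)) \<rho>" unfolding \<rho>_def using Suc.IH[OF j(2) Suc.prems(2)] .
  have \<tau>: "in_span (low (a + b)) (\<lambda>n. ?v n * diff j ?w n)"
  proof (cases "\<beta> j = 0")
    case True
    then show ?thesis by (simp add: diff_chr[OF j(1)] in_span_zero)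
  next
    case False
    then have "sum \<beta> I \<noteq> 0" using j finite_I by auto
    then obtain b' where b': "b = Suc b'" using Suc.prems(2) by (cases b) (auto simp: multi_indices_def)
    let ?b = "\<beta>(j := \<beta> j - 1)"
    have b: "?b \<in> mi b'" using mi_dec[of \<beta> b' j] Suc.prems(2) b' j False by auto
    have "in_span (low (a + b)) (\<lambda>n. ?v n * chr ?b n - chr (\<lambda>i. \<alpha>' i + ?b i) n)"
      by (rule in_span_mono[OF Suc.IH[OF j(2) b]]) (auto simp: low_iff b')
    moreover have "in_span (low (a + b)) (chr (\<lambda>i. \<alpha>' i + ?b i))"
    proof (rule in_span_chr)
      have "sum (\<lambda>i. \<alpha>' i + ?b i) I = a + b'"
        using j(2) b unfolding sum.distrib by (simp only: multi_indices_def mem_Collect_eq)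
      then show "(\<lambda>i. \<alpha>' i + ?b i) \<in> low (a + b)"
        using j b by (auto simp: low_iff multi_indices_def b')
    qed simp
    ultimately have "in_span (low (a + b)) (\<lambda>n. real (\<beta> j) * ((?v n * chr ?b n - chr (\<lambda>i. \<alpha>' i + ?b i) n) + chr (\<lambda>i. \<alpha>' i + ?b i) n))"
      by (intro in_span_cmult in_span_add)
    then show ?thesis by (simp add: diff_chr[OF j(1)] mult_ac)
  qed
  have "chr \<alpha> n * ?w n - chr (\<lambda>i. \<alpha> i + \<beta> i) n =
     skor j \<rho> n + (skor j (\<lambda>n. ?v n * diff j ?w n) n + l j * (?v n * diff j ?w n))" for n
  proof -
    have "chr \<alpha> n * ?w n = skor j ?v n * ?w n" by (simp add: j skor_chr)
    also have "\<dots> = skor j (\<lambda>n. ?v n * ?w n) n + skor j (\<lambda>n. ?v n * diff j ?w n) n + l j * (?v n * diff j ?w n)"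
      by (cases "n j") (auto simp: skor_def diff_def fun_upd_idem algebra_simps)
    also have "skor j (\<lambda>n. ?v n * ?w n) n = skor j \<rho> n + skor j (chr (\<lambda>i. \<alpha>' i + \<beta> i)) n"
      by (simp add: skor_def \<rho>_def algebra_simps)
    also have "skor j (chr (\<lambda>i. \<alpha>' i + \<beta> i)) n = chr ((\<lambda>i. \<alpha>' i + \<beta> i)(j := Suc (\<alpha>' j + \<beta> j))) n"
      by (simp add: skor_chr[OF j(1)])
    also have "(\<lambda>i. \<alpha>' i + \<beta> i)(j := Suc (\<alpha>' j + \<beta> j)) = (\<lambda>i. \<alpha> i + \<beta> i)"
      by (auto simp: j(3) fun_eq_iff)
    finally show ?thesis by simp
  qed
  moreover have "in_span (low (Suc (a + b))) (\<lambda>n. skor j \<rho> n + (skor j (\<lambda>n. ?v n * diff j ?w n) n + l j * (?v n * diff j ?w n)))"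
    by (intro in_span_add in_span_skor in_span_cmult \<rho> \<tau> j in_span_mono[OF \<tau>]) (auto simp: low_iff)
  ultimately show ?case by simp
qed

end

section \<open>Moments and the Stein bound for discrete chaoses\<close>

context poisson_vector
begin

text \<open>Half the expected squared jump of u per unit of time along the chain, that is, the carre
  du champ, half of gen(u^2) - 2 u gen(u).\<close>

definition gamma :: "(('i \<Rightarrow> nat) \<Rightarrow> real) \<Rightarrow> ('i \<Rightarrow> nat) \<Rightarrow> real" where
  "gamma u n = (\<Sum>j\<in>I. l j * (u (n(j := Suc (n j))) - u n)\<^sup>2 + real (n j) * (u (n(j := n j - 1)) - u n)\<^sup>2) / 2"

lemma tame_gamma [simp, intro]: "tame u \<Longrightarrow> tame (gamma u)"
  unfolding gamma_def[abs_def]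
  by (intro tame_divide tame_sum tame_add tame_mult tame_power tame_diff tame_const tame_coord tame_up tame_down)

lemma gen_square: "gen (\<lambda>n. (u n)\<^sup>2) n = 2 * u n * gen u n + 2 * gamma u n"
proof -
  have g: "2 * gamma u n = (\<Sum>j\<in>I. l j * (u (n(j := Suc (n j))) - u n)\<^sup>2 + real (n j) * (u (n(j := n j - 1)) - u n)\<^sup>2)"
    by (simp add: gamma_def)
  show ?thesis
    unfolding gen_eq g sum_distrib_left sum.distrib[symmetric]
    by (intro sum.cong refl) (simp add: algebra_simps power2_eq_square)
qed

text \<open>The generator of G(u) is expanded to second order along each jump: the first order gives
  f(u) times \<open>gen u\<close>, the second f'(u) times \<open>gamma u\<close>, and the integral
  of a generator is 0. The remainder is cubic in the jumps; by the Mecke identity downward jumps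
  contribute as much as upward ones, hence the factor 2.\<close>

lemma generator_taylor:
  assumes u: "tame u" and t: "tame (\<lambda>n. G (u n))" "tame (\<lambda>n. f (u n))" "tame (\<lambda>n. f' (u n))"
    and G: "\<And>x v. \<bar>G v - G x - f x * (v - x) - f' x * (v - x)\<^sup>2 / 2\<bar> \<le> \<kappa> * \<bar>v - x\<bar> ^ 3"
  shows "\<bar>(\<integral>n. f (u n) * gen u n \<partial>D) + (\<integral>n. f' (u n) * gamma u n \<partial>D)\<bar> \<le> 2 * \<kappa> * (\<Sum>j\<in>I. l j * (\<integral>n. \<bar>diff j u n\<bar> ^ 3 \<partial>D))"
proof -
  define R where "R n = gen (\<lambda>n. G (u n)) n - (f (u n) * gen u n + f' (u n) * gamma u n)" for n
  define S where "S n = (\<Sum>j\<in>I. l j * \<bar>diff j u n\<bar> ^ 3 + real (n j) * \<bar>u (n(j := n j - 1)) - u n\<bar> ^ 3)" for n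
  have tS: "tame (\<lambda>n. l j * \<bar>diff j u n\<bar> ^ 3)" "tame (\<lambda>n. real (n j) * \<bar>u (n(j := n j - 1)) - u n\<bar> ^ 3)" if "j \<in> I" for j
    using u that by (intro tame_mult tame_power tame_abs tame_diff tame_diff_op tame_const tame_coord tame_down; simp)+
  have tR: "tame R" unfolding R_def[abs_def] using u t by (intro tame_diff tame_add tame_mult tame_gen tame_gamma)
  have RS: "\<bar>R n\<bar> \<le> \<kappa> * S n" for n
  proof -
    define e where "e v = G v - G (u n) - f (u n) * (v - u n) - f' (u n) * (v - u n)\<^sup>2 / 2" for v
    have "R n = (\<Sum>j\<in>I. l j * e (u (n(j := Suc (n j)))) + real (n j) * e (u (n(j := n j - 1))))"
      unfolding R_def gen_eq gamma_def e_def
      by (simp add: sum_distrib_left sum_divide_distrib flip: sum.distrib sum_subtractf)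
         (rule sum.cong; simp add: algebra_simps diff_divide_distrib add_divide_distrib)
    also have "\<bar>\<dots>\<bar> \<le> (\<Sum>j\<in>I. \<bar>l j * e (u (n(j := Suc (n j)))) + real (n j) * e (u (n(j := n j - 1)))\<bar>)"
      by (rule sum_abs)
    also have "\<dots> \<le> (\<Sum>j\<in>I. \<kappa> * (l j * \<bar>diff j u n\<bar> ^ 3 + real (n j) * \<bar>u (n(j := n j - 1)) - u n\<bar> ^ 3))"
    proof (rule sum_mono)
      fix j assume j: "j \<in> I"
      have e: "\<bar>e v\<bar> \<le> \<kappa> * \<bar>v - u n\<bar> ^ 3" for v unfolding e_def by (rule G)
      have "\<bar>l j * e (u (n(j := Suc (n j)))) + real (n j) * e (u (n(j := n j - 1)))\<bar>
        \<le> l j * \<bar>e (u (n(j := Suc (n j))))\<bar> + real (n j) * \<bar>e (u (n(j := n j - 1)))\<bar>"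
        using l_nonneg[OF j] by (intro order_trans[OF abs_triangle_ineq]) (simp add: abs_mult)
      also have "\<dots> \<le> l j * (\<kappa> * \<bar>u (n(j := Suc (n j))) - u n\<bar> ^ 3) + real (n j) * (\<kappa> * \<bar>u (n(j := n j - 1)) - u n\<bar> ^ 3)"
        using l_nonneg[OF j] by (intro add_mono mult_left_mono e) auto
      finally show "\<bar>l j * e (u (n(j := Suc (n j)))) + real (n j) * e (u (n(j := n j - 1)))\<bar> \<le>
        \<kappa> * (l j * \<bar>diff j u n\<bar> ^ 3 + real (n j) * \<bar>u (n(j := n j - 1)) - u n\<bar> ^ 3)"
        by (simp add: diff_def algebra_simps)
    qed
    finally show ?thesis by (simp add: S_def sum_distrib_left)
  qed
  have IS: "(\<integral>n. S n \<partial>D) = 2 * (\<Sum>j\<in>I. l j * (\<integral>n. \<bar>diff j u n\<bar> ^ 3 \<partial>D))"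
  proof -
    have "(\<integral>n. S n \<partial>D) = (\<Sum>j\<in>I. \<integral>n. l j * \<bar>diff j u n\<bar> ^ 3 + real (n j) * \<bar>u (n(j := n j - 1)) - u n\<bar> ^ 3 \<partial>D)"
      unfolding S_def by (rule Bochner_Integration.integral_sum) (intro tame_integrable tame_add tS)
    also have "\<dots> = (\<Sum>j\<in>I. 2 * (l j * (\<integral>n. \<bar>diff j u n\<bar> ^ 3 \<partial>D)))"
    proof (rule sum.cong)
      fix j assume j: "j \<in> I"
      have "(\<integral>n. real (n j) * \<bar>u (n(j := n j - 1)) - u n\<bar> ^ 3 \<partial>D) = l j * (\<integral>n. \<bar>diff j u n\<bar> ^ 3 \<partial>D)"
        using mecke[of "\<lambda>n. \<bar>u (n(j := n j - 1)) - u n\<bar> ^ 3" j] u j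
        by (simp add: diff_def abs_minus_commute tame_power tame_abs tame_diff)
      then show "(\<integral>n. l j * \<bar>diff j u n\<bar> ^ 3 + real (n j) * \<bar>u (n(j := n j - 1)) - u n\<bar> ^ 3 \<partial>D) = 2 * (l j * (\<integral>n. \<bar>diff j u n\<bar> ^ 3 \<partial>D))"
        using tame_integrable[OF tS(1)[OF j]] tame_integrable[OF tS(2)[OF j]]
        by (subst Bochner_Integration.integral_add) (simp_all only: integral_mult_right_zero mult_2)
    qed simp
    finally show ?thesis by (simp add: sum_distrib_left)
  qed
  have tSS: "tame S" unfolding S_def[abs_def] by (intro tame_sum tame_add tS)
  have "(\<integral>n. R n \<partial>D) = (\<integral>n. 1 * gen (\<lambda>n. G (u n)) n \<partial>D) - ((\<integral>n. f (u n) * gen u n \<partial>D) + (\<integral>n. f' (u n) * gamma u n \<partial>D))"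
    unfolding R_def
    using tame_integrable[OF tame_gen[OF t(1)]] tame_integrable[OF tame_mult[OF t(2) tame_gen[OF u]]]
      tame_integrable[OF tame_mult[OF t(3) tame_gamma[OF u]]] by simp
  also have "(\<integral>n. 1 * gen (\<lambda>n. G (u n)) n \<partial>D) = 0"
    by (subst integral_gen[OF t(1) tame_const]) (simp add: diff_def)
  finally have "\<bar>(\<integral>n. f (u n) * gen u n \<partial>D) + (\<integral>n. f' (u n) * gamma u n \<partial>D)\<bar> = \<bar>\<integral>n. R n \<partial>D\<bar>" by simp
  also have "\<dots> \<le> (\<integral>n. \<bar>R n\<bar> \<partial>D)" by (rule integral_abs_bound)
  also have "\<dots> \<le> (\<integral>n. \<kappa> * S n \<partial>D)"
    using tR tSS by (intro integral_mono tame_integrable RS tame_abs tame_mult tame_const)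
  also have "\<dots> = \<kappa> * (\<integral>n. S n \<partial>D)" by simp
  finally show ?thesis unfolding IS by (simp add: mult_ac)
qed

text \<open>Cauchy--Schwarz for the absolute value and the square of the difference, on the product
  of the index set weighted by l and the law.\<close>

lemma third_moment_bound:
  assumes u: "tame u"
  shows "(\<Sum>j\<in>I. l j * (\<integral>n. \<bar>diff j u n\<bar> ^ 3 \<partial>D)) \<le>
    sqrt ((\<Sum>j\<in>I. l j * (\<integral>n. (diff j u n)\<^sup>2 \<partial>D)) * (\<Sum>j\<in>I. l j * (\<integral>n. (diff j u n) ^ 4 \<partial>D)))"
    (is "?z \<le> sqrt (?x * ?y)")
proof (rule quadratic_nonneg_imp)
  show "0 \<le> ?y" using l_nonneg by (intro sum_nonneg mult_nonneg_nonneg Bochner_Integration.integral_nonneg) auto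
  fix t
  have "(\<integral>n. (\<bar>diff j u n\<bar> - t * (diff j u n)\<^sup>2)\<^sup>2 \<partial>D) =
    (\<integral>n. (diff j u n)\<^sup>2 \<partial>D) - 2 * t * (\<integral>n. \<bar>diff j u n\<bar> ^ 3 \<partial>D) + t\<^sup>2 * (\<integral>n. (diff j u n) ^ 4 \<partial>D)"
    if j: "j \<in> I" for j
  proof -
    have "(\<integral>n. (\<bar>diff j u n\<bar> - t * (diff j u n)\<^sup>2)\<^sup>2 \<partial>D) =
      (\<integral>n. (diff j u n)\<^sup>2 - 2 * t * \<bar>diff j u n\<bar> ^ 3 + t\<^sup>2 * (diff j u n) ^ 4 \<partial>D)"
    proof (rule Bochner_Integration.integral_cong[OF refl])
      fix n
      have "(\<bar>a\<bar> - t * a\<^sup>2)\<^sup>2 = a\<^sup>2 - 2 * t * \<bar>a\<bar> ^ 3 + t\<^sup>2 * a ^ 4" for a :: real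
        by (cases "0 \<le> a") (simp_all add: power2_eq_square power3_eq_cube power4_eq_xxxx algebra_simps)
      then show "(\<bar>diff j u n\<bar> - t * (diff j u n)\<^sup>2)\<^sup>2 = (diff j u n)\<^sup>2 - 2 * t * \<bar>diff j u n\<bar> ^ 3 + t\<^sup>2 * (diff j u n) ^ 4" .
    qed
    then show ?thesis
      using u j by (simp add: tame_integrable tame_power tame_abs tame_diff_op tame_mult)
  qed
  then have "(\<Sum>j\<in>I. l j * (\<integral>n. (\<bar>diff j u n\<bar> - t * (diff j u n)\<^sup>2)\<^sup>2 \<partial>D)) =
    (\<Sum>j\<in>I. l j * (\<integral>n. (diff j u n)\<^sup>2 \<partial>D) - 2 * t * (l j * (\<integral>n. \<bar>diff j u n\<bar> ^ 3 \<partial>D)) + t\<^sup>2 * (l j * (\<integral>n. (diff j u n) ^ 4 \<partial>D)))"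
    by (intro sum.cong refl) (simp only: right_diff_distrib distrib_left mult_ac)
  also have "\<dots> = ?x - 2 * t * ?z + t\<^sup>2 * ?y"
    unfolding sum_subtractf sum.distrib sum_distrib_left ..
  finally have "?x - 2 * ?z * t + ?y * t\<^sup>2 = (\<Sum>j\<in>I. l j * (\<integral>n. (\<bar>diff j u n\<bar> - t * (diff j u n)\<^sup>2)\<^sup>2 \<partial>D))"
    by (simp only: mult_ac)
  also have "\<dots> \<ge> 0" using l_nonneg by (intro sum_nonneg mult_nonneg_nonneg Bochner_Integration.integral_nonneg) auto
  finally show "0 \<le> ?x - 2 * ?z * t + ?y * t\<^sup>2" .
qed

text \<open>Rests on (y - x)^4 = 4 (y^3 - x^3)(y - x) - 3 (y^2 - x^2)^2, which expresses fourth
  powers of differences by Dirichlet forms and thus by \<open>gen\<close>.\<close>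

lemma fourth_moment_eq:
  assumes u: "tame u"
  shows "(\<Sum>j\<in>I. l j * (\<integral>n. (diff j u n) ^ 4 \<partial>D)) =
     - 4 * (\<integral>n. u n ^ 3 * gen u n \<partial>D) + 3 * (\<integral>n. (u n)\<^sup>2 * gen (\<lambda>n. (u n)\<^sup>2) n \<partial>D)"
proof -
  have "(\<integral>n. (diff j u n) ^ 4 \<partial>D) =
    4 * (\<integral>n. diff j (\<lambda>n. u n ^ 3) n * diff j u n \<partial>D) - 3 * (\<integral>n. diff j (\<lambda>n. (u n)\<^sup>2) n * diff j (\<lambda>n. (u n)\<^sup>2) n \<partial>D)"
    if j: "j \<in> I" for j
  proof -
    have "(\<integral>n. (diff j u n) ^ 4 \<partial>D) =
      (\<integral>n. 4 * (diff j (\<lambda>n. u n ^ 3) n * diff j u n) - 3 * (diff j (\<lambda>n. (u n)\<^sup>2) n * diff j (\<lambda>n. (u n)\<^sup>2) n) \<partial>D)"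
      by (rule Bochner_Integration.integral_cong[OF refl])
         (simp add: diff_def power2_eq_square power3_eq_cube power4_eq_xxxx algebra_simps)
    also have "\<dots> = 4 * (\<integral>n. diff j (\<lambda>n. u n ^ 3) n * diff j u n \<partial>D) - 3 * (\<integral>n. diff j (\<lambda>n. (u n)\<^sup>2) n * diff j (\<lambda>n. (u n)\<^sup>2) n \<partial>D)"
      using u j by (simp add: tame_integrable tame_power tame_diff_op tame_mult)
    finally show ?thesis .
  qed
  then have "(\<Sum>j\<in>I. l j * (\<integral>n. (diff j u n) ^ 4 \<partial>D)) =
    (\<Sum>j\<in>I. 4 * (l j * (\<integral>n. diff j (\<lambda>n. u n ^ 3) n * diff j u n \<partial>D))
       - 3 * (l j * (\<integral>n. diff j (\<lambda>n. (u n)\<^sup>2) n * diff j (\<lambda>n. (u n)\<^sup>2) n \<partial>D)))"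
    by (intro sum.cong refl) (simp only: right_diff_distrib mult_ac)
  also have "\<dots> = 4 * (\<Sum>j\<in>I. l j * (\<integral>n. diff j (\<lambda>n. u n ^ 3) n * diff j u n \<partial>D))
       - 3 * (\<Sum>j\<in>I. l j * (\<integral>n. diff j (\<lambda>n. (u n)\<^sup>2) n * diff j (\<lambda>n. (u n)\<^sup>2) n \<partial>D))"
    unfolding sum_subtractf sum_distrib_left ..
  finally show ?thesis
    using integral_gen[OF u tame_power[OF u, of 3]] integral_gen[OF tame_power[OF u, of 2] tame_power[OF u, of 2]] by simp
qed

section \<open>Chaos decomposition of the square and the resulting moment bounds\<close>

lemma gen_chr:
  assumes "\<gamma> \<in> mi p"
  shows "gen (chr \<gamma>) n = - real p * chr \<gamma> n"
proof -
  have "skor j (diff j (chr \<gamma>)) n = real (\<gamma> j) * chr \<gamma> n" if j: "j \<in> I" for j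
  proof -
    have "diff j (chr \<gamma>) = (\<lambda>n. real (\<gamma> j) * chr (\<gamma>(j := \<gamma> j - 1)) n)"
      by (rule ext) (rule diff_chr[OF j])
    then have "skor j (diff j (chr \<gamma>)) n = real (\<gamma> j) * chr ((\<gamma>(j := \<gamma> j - 1))(j := Suc (\<gamma> j - 1))) n"
      by (simp add: skor_cmult skor_chr[OF j])
    then show ?thesis by (cases "\<gamma> j") (auto simp: fun_upd_idem)
  qed
  then have "gen (chr \<gamma>) n = - (\<Sum>j\<in>I. real (\<gamma> j)) * chr \<gamma> n"
    by (simp add: gen_def sum_distrib_right)
  also have "(\<Sum>j\<in>I. real (\<gamma> j)) = real p" using assms by (simp add: multi_indices_def flip: of_nat_sum)
  finally show ?thesis .
qed

lemma gen_cmult: "gen (\<lambda>n. c * v n) n = c * gen v n"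
  by (simp add: gen_eq sum_distrib_left algebra_simps)

lemma gen_sum: "gen (\<lambda>n. \<Sum>i\<in>A. w i n) n = (\<Sum>i\<in>A. gen (w i) n)"
proof -
  have "diff j (\<lambda>n. \<Sum>i\<in>A. w i n) = (\<lambda>n. \<Sum>i\<in>A. diff j (w i) n)" for j
    by (rule ext) (rule diff_sum)
  then have "gen (\<lambda>n. \<Sum>i\<in>A. w i n) n = - (\<Sum>j\<in>I. \<Sum>i\<in>A. skor j (diff j (w i)) n)"
    by (simp add: gen_def skor_sum)
  also have "\<dots> = (\<Sum>i\<in>A. gen (w i) n)"
    by (subst sum.swap) (simp add: gen_def sum_negf)
  finally show ?thesis .
qed

lemma gen_in_span:
  assumes "B \<subseteq> low r"
  shows "gen (\<lambda>n. \<Sum>\<gamma>\<in>B. d \<gamma> * chr \<gamma> n) n = (\<Sum>\<gamma>\<in>B. (- real (sum \<gamma> I) * d \<gamma>) * chr \<gamma> n)"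
proof -
  have "gen (chr \<gamma>) n = - real (sum \<gamma> I) * chr \<gamma> n" if "\<gamma> \<in> B" for \<gamma>
    by (rule gen_chr) (use that assms in \<open>auto simp: low_def multi_indices_def\<close>)
  then show ?thesis by (simp add: gen_sum gen_cmult mult_ac)
qed

lemma low_Suc: "low (Suc r) = low r \<union> mi r" and low_disj: "low r \<inter> mi r = {}"
  by (auto simp: low_def less_Suc_eq multi_indices_def)

text \<open>The product formula makes the coefficients of top degree 2q explicit, as a convolution
  of those of u; the lower degrees enter later through the sizes of their components.\<close>

lemma chaos_square:
  fixes c :: "('i \<Rightarrow> nat) \<Rightarrow> real" and q :: nat
  defines "u \<equiv> \<lambda>n. \<Sum>\<alpha>\<in>mi q. c \<alpha> * chr \<alpha> n"
  defines "dd \<equiv> \<lambda>\<gamma>. \<Sum>\<alpha>\<in>mi q. \<Sum>\<beta>\<in>mi q. if (\<lambda>i. \<alpha> i + \<beta> i) = \<gamma> then c \<alpha> * c \<beta> else 0"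
  obtains d where "\<And>n. (u n)\<^sup>2 = (\<Sum>\<gamma>\<in>low (Suc (2 * q)). d \<gamma> * chr \<gamma> n)" "\<And>\<gamma>. \<gamma> \<in> mi (2 * q) \<Longrightarrow> d \<gamma> = dd \<gamma>"
proof -
  define \<rho> where "\<rho> = (\<lambda>n. \<Sum>\<alpha>\<in>mi q. \<Sum>\<beta>\<in>mi q. (c \<alpha> * c \<beta>) * (chr \<alpha> n * chr \<beta> n - chr (\<lambda>i. \<alpha> i + \<beta> i) n))"
  have "in_span (low (q + q)) \<rho>" unfolding \<rho>_def by (intro in_span_sum in_span_cmult chr_mult)
  then obtain e where e: "\<rho> = (\<lambda>n. \<Sum>\<gamma>\<in>low (q + q). e \<gamma> * chr \<gamma> n)" by (auto simp: in_span_def)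
  define d where "d \<gamma> = (if \<gamma> \<in> mi (2 * q) then dd \<gamma> else e \<gamma>)" for \<gamma>
  have "(u n)\<^sup>2 = (\<Sum>\<gamma>\<in>low (Suc (2 * q)). d \<gamma> * chr \<gamma> n)" for n
  proof -
    have "(u n)\<^sup>2 = (\<Sum>\<alpha>\<in>mi q. \<Sum>\<beta>\<in>mi q. (c \<alpha> * c \<beta>) * (chr \<alpha> n * chr \<beta> n))"
      by (simp add: u_def power2_eq_square sum_product mult_ac)
    also have "\<dots> = \<rho> n + (\<Sum>\<alpha>\<in>mi q. \<Sum>\<beta>\<in>mi q. (c \<alpha> * c \<beta>) * chr (\<lambda>i. \<alpha> i + \<beta> i) n)"
      by (simp add: \<rho>_def algebra_simps flip: sum.distrib)
    also have "(\<Sum>\<alpha>\<in>mi q. \<Sum>\<beta>\<in>mi q. (c \<alpha> * c \<beta>) * chr (\<lambda>i. \<alpha> i + \<beta> i) n) =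
       (\<Sum>\<alpha>\<in>mi q. \<Sum>\<beta>\<in>mi q. \<Sum>\<gamma>\<in>mi (2 * q). (if (\<lambda>i. \<alpha> i + \<beta> i) = \<gamma> then c \<alpha> * c \<beta> else 0) * chr \<gamma> n)"
    proof (intro sum.cong refl)
      fix \<alpha> \<beta> assume "\<alpha> \<in> mi q" "\<beta> \<in> mi q"
      then have "(\<lambda>i. \<alpha> i + \<beta> i) \<in> mi (2 * q)" by (auto simp: multi_indices_def sum.distrib)
      moreover have "(if (\<lambda>i. \<alpha> i + \<beta> i) = \<gamma> then c \<alpha> * c \<beta> else 0) * chr \<gamma> n = (if (\<lambda>i. \<alpha> i + \<beta> i) = \<gamma> then c \<alpha> * c \<beta> * chr \<gamma> n else 0)" for \<gamma>
        by simp
      ultimately show "c \<alpha> * c \<beta> * chr (\<lambda>i. \<alpha> i + \<beta> i) n = (\<Sum>\<gamma>\<in>mi (2 * q). (if (\<lambda>i. \<alpha> i + \<beta> i) = \<gamma> then c \<alpha> * c \<beta> else 0) * chr \<gamma> n)"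
        by (simp only: sum.delta'[OF finite_mi] if_True)
    qed
    also have "\<dots> = (\<Sum>\<gamma>\<in>mi (2 * q). dd \<gamma> * chr \<gamma> n)"
      unfolding dd_def sum_distrib_right sum.swap[of _ "mi (2 * q)" "mi q"] ..
    also have "\<rho> n = (\<Sum>\<gamma>\<in>low (2 * q). d \<gamma> * chr \<gamma> n)"
      unfolding e mult_2 by (intro sum.cong refl) (use low_disj[of "q + q"] in \<open>auto simp: d_def mult_2\<close>)
    also have "(\<Sum>\<gamma>\<in>mi (2 * q). dd \<gamma> * chr \<gamma> n) = (\<Sum>\<gamma>\<in>mi (2 * q). d \<gamma> * chr \<gamma> n)"
      by (intro sum.cong refl) (simp add: d_def)
    finally show ?thesis
      unfolding low_Suc using low_disj by (subst sum.union_disjoint) auto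
  qed
  then show ?thesis by (rule that) (simp add: d_def)
qed

text \<open>Let A be the squared norm of the components of the square in degrees strictly between 0
  and 2q, and T that of the top degree. Then \<Delta> = A + (T - 2 s2^2), so that A \<le> \<Delta>.
  Since gen u = -q u, passing to \<open>gamma u\<close> multiplies degree p by (2q - p)/2, which
  removes the top degree and is at most (2q - 1)/2 in between. The fourth moments of the differences
  weight degree p by 4q - 3p, at most 4q - 3 in between, while the degrees 0 and 2q together
  contribute -2q (T - 2 s2^2) \<le> 0.\<close>

lemma chaos_moments:
  fixes c :: "('i \<Rightarrow> nat) \<Rightarrow> real" and q :: nat
  assumes q: "1 \<le> q"
  defines "u \<equiv> \<lambda>n. \<Sum>\<alpha>\<in>mi q. c \<alpha> * chr \<alpha> n"
  defines "s2 \<equiv> \<integral>n. (u n)\<^sup>2 \<partial>D"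
  defines "\<Delta> \<equiv> (\<integral>n. u n ^ 4 \<partial>D) - 3 * s2\<^sup>2"
  shows "0 \<le> \<Delta>" (is ?A)
    and "(\<integral>n. (gamma u n - real q * s2)\<^sup>2 \<partial>D) \<le> ((2 * real q - 1) / 2)\<^sup>2 * \<Delta>" (is ?B)
    and "(\<Sum>j\<in>I. l j * (\<integral>n. (diff j u n) ^ 4 \<partial>D)) \<le> (4 * real q - 3) * \<Delta>" (is ?C)
    and "(\<Sum>j\<in>I. l j * (\<integral>n. (diff j u n)\<^sup>2 \<partial>D)) = real q * s2" (is ?D)
    and "gen u n = - real q * u n" (is ?E)
proof -
  have tu: "tame u" unfolding u_def by (intro tame_sum tame_mult tame_const tame_chr)
  have gu: "gen u n = - real q * u n" for n
    unfolding u_def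
    by (subst gen_in_span[of _ "Suc q"]) (auto simp: low_iff multi_indices_def sum_distrib_left mult_ac intro!: sum.cong)
  show ?E by (rule gu)
  show ?D
  proof -
    have "(\<integral>n. u n * gen u n \<partial>D) = (\<integral>n. - real q * (u n)\<^sup>2 \<partial>D)"
      by (simp add: gu power2_eq_square mult_ac)
    then show ?thesis using integral_gen[OF tu tu] by (simp add: s2_def power2_eq_square)
  qed
  define B where "B = low (Suc (2 * q))"
  define dd where "dd \<gamma> = (\<Sum>\<alpha>\<in>mi q. \<Sum>\<beta>\<in>mi q. if (\<lambda>i. \<alpha> i + \<beta> i) = \<gamma> then c \<alpha> * c \<beta> else 0)" for \<gamma>
  obtain d where d: "\<And>n. (u n)\<^sup>2 = (\<Sum>\<gamma>\<in>B. d \<gamma> * chr \<gamma> n)" "\<And>\<gamma>. \<gamma> \<in> mi (2 * q) \<Longrightarrow> d \<gamma> = dd \<gamma>"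
    using chaos_square[of c q] unfolding B_def dd_def u_def by blast
  define a where "a \<gamma> = (d \<gamma>)\<^sup>2 * nrm \<gamma>" for \<gamma>
  have a_nn: "0 \<le> a \<gamma>" for \<gamma> using nrm_nonneg by (simp add: a_def)
  let ?z = "\<lambda>_::'i. 0::nat"
  define R where "R = B - {?z} - mi (2 * q)"
  have Bl: "B \<subseteq> low (Suc (2 * q))" and finB: "finite B" by (simp_all add: B_def)
  have zB: "?z \<in> B" by (simp add: B_def low_iff)
  have zmi: "?z \<notin> mi (2 * q)" using q by (simp add: multi_indices_def)
  have miB: "mi (2 * q) \<subseteq> B" by (simp add: B_def low_Suc)
  have split: "sum g B = g ?z + sum g R + sum g (mi (2 * q))" for g :: "_ \<Rightarrow> real"
  proof -
    have "sum g B = g ?z + sum g (B - {?z})" using zB finB by (simp add: sum.remove)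
    also have "sum g (B - {?z}) = sum g R + sum g (mi (2 * q))"
      unfolding R_def using zmi miB finB by (subst sum.subset_diff[of "mi (2 * q)"]) auto
    finally show ?thesis by simp
  qed
  have Rdeg: "1 \<le> sum \<gamma> I \<and> sum \<gamma> I < 2 * q" if "\<gamma> \<in> R" for \<gamma>
  proof -
    from that have "\<gamma> \<noteq> ?z" "\<gamma> \<notin> mi (2 * q)" "\<gamma> \<in> B" by (auto simp: R_def)
    then show ?thesis using mi_0[of \<gamma>] by (auto simp: B_def low_iff multi_indices_def)
  qed
  have s2c: "s2 = (\<Sum>\<alpha>\<in>mi q. (c \<alpha>)\<^sup>2 * nrm \<alpha>)"
    unfolding s2_def u_def power2_eq_square
    by (subst span_inner[of _ "Suc q"]) (auto simp: low_Suc)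
  \<comment> \<open>Testing the square against the constant function identifies its constant
    component with the second moment.\<close>
  have d0: "d ?z = s2"
  proof -
    have "s2 = (\<integral>n. (\<Sum>\<gamma>\<in>B. d \<gamma> * chr \<gamma> n) * (\<Sum>\<gamma>\<in>B. (if \<gamma> = ?z then 1 else 0) * chr \<gamma> n) \<partial>D)"
      unfolding s2_def d(1) using finB zB by (simp add: if_distrib[of "\<lambda>x. x * _"] cong: if_cong)
    also have "\<dots> = (\<Sum>\<gamma>\<in>B. d \<gamma> * (if \<gamma> = ?z then 1 else 0) * nrm \<gamma>)" by (rule span_inner[OF Bl])
    also have "\<dots> = (\<Sum>\<gamma>\<in>B. if \<gamma> = ?z then d \<gamma> * nrm \<gamma> else 0)" by (intro sum.cong) auto
    also have "\<dots> = d ?z" using finB zB by simp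
    finally show ?thesis by simp
  qed
  then have a0: "a ?z = s2\<^sup>2" by (simp add: a_def)
  have u4: "(\<integral>n. u n ^ 4 \<partial>D) = sum a B"
  proof -
    have "u n ^ 4 = (\<Sum>\<gamma>\<in>B. d \<gamma> * chr \<gamma> n) * (\<Sum>\<gamma>\<in>B. d \<gamma> * chr \<gamma> n)" for n
      unfolding d(1)[symmetric] by (simp add: power4_eq_xxxx power2_eq_square)
    then show ?thesis by (simp add: span_inner[OF Bl] a_def power2_eq_square)
  qed
  have sqB: "(\<lambda>n. (u n)\<^sup>2) = (\<lambda>n. \<Sum>\<gamma>\<in>B. d \<gamma> * chr \<gamma> n)" using d(1) by blast
  have gsq: "gen (\<lambda>n. (u n)\<^sup>2) n = (\<Sum>\<gamma>\<in>B. (- real (sum \<gamma> I) * d \<gamma>) * chr \<gamma> n)" for n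
    unfolding sqB by (rule gen_in_span[OF Bl])
  have u2g: "(\<integral>n. (u n)\<^sup>2 * gen (\<lambda>n. (u n)\<^sup>2) n \<partial>D) = - (\<Sum>\<gamma>\<in>B. real (sum \<gamma> I) * a \<gamma>)"
    unfolding gsq unfolding d(1) span_inner[OF Bl] by (simp add: a_def power2_eq_square mult_ac sum_negf)
  define A where "A = sum a R"
  define T where "T = sum a (mi (2 * q))"
  have T: "2 * s2\<^sup>2 \<le> T"
  proof -
    have "2 * s2\<^sup>2 \<le> (\<Sum>\<gamma>\<in>mi (2 * q). (dd \<gamma>)\<^sup>2 * nrm \<gamma>)"
      unfolding s2c dd_def by (rule homogeneous_square_norm) (use finite_I l_nonneg q in auto)
    also have "\<dots> = T" by (simp add: T_def a_def d(2))
    finally show ?thesis .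
  qed
  have A_nn: "0 \<le> A" by (simp add: A_def sum_nonneg a_nn)
  have u4': "(\<integral>n. u n ^ 4 \<partial>D) = s2\<^sup>2 + A + T" using u4 split[of a] a0 by (simp add: A_def T_def)
  have A\<Delta>: "A \<le> \<Delta>" using T by (simp add: \<Delta>_def u4')
  show ?A using A_nn A\<Delta> by simp
  have gam: "gamma u n - real q * s2 = (\<Sum>\<gamma>\<in>B. (if \<gamma> = ?z then 0 else (2 * real q - real (sum \<gamma> I)) / 2 * d \<gamma>) * chr \<gamma> n)" for n
  proof -
    have "gamma u n = gen (\<lambda>n. (u n)\<^sup>2) n / 2 + real q * (u n)\<^sup>2"
      unfolding gen_square by (simp add: gu power2_eq_square diff_divide_distrib)
    also have "\<dots> = (\<Sum>\<gamma>\<in>B. (2 * real q - real (sum \<gamma> I)) / 2 * d \<gamma> * chr \<gamma> n)"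
      unfolding gsq unfolding d(1) sum_divide_distrib sum_distrib_left sum.distrib[symmetric]
      by (intro sum.cong refl) (simp add: field_simps del: of_nat_sum)
    also have "\<dots> = real q * s2 + (\<Sum>\<gamma>\<in>B - {?z}. (2 * real q - real (sum \<gamma> I)) / 2 * d \<gamma> * chr \<gamma> n)"
      using zB finB by (simp add: sum.remove[of B ?z] d0)
    also have "(\<Sum>\<gamma>\<in>B - {?z}. (2 * real q - real (sum \<gamma> I)) / 2 * d \<gamma> * chr \<gamma> n) =
      (\<Sum>\<gamma>\<in>B. (if \<gamma> = ?z then 0 else (2 * real q - real (sum \<gamma> I)) / 2 * d \<gamma>) * chr \<gamma> n)"
      using zB finB by (simp add: sum.remove[of B ?z "\<lambda>\<gamma>. (if \<gamma> = ?z then 0 else _ \<gamma>) * _ \<gamma>"])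
    finally show ?thesis by simp
  qed
  have "(\<integral>n. (gamma u n - real q * s2)\<^sup>2 \<partial>D) =
     (\<Sum>\<gamma>\<in>B. (if \<gamma> = ?z then 0 else (2 * real q - real (sum \<gamma> I)) / 2 * d \<gamma>) * (if \<gamma> = ?z then 0 else (2 * real q - real (sum \<gamma> I)) / 2 * d \<gamma>) * nrm \<gamma>)"
    unfolding gam power2_eq_square by (rule span_inner[OF Bl])
  also have "\<dots> = (\<Sum>\<gamma>\<in>B. if \<gamma> = ?z then 0 else ((2 * real q - real (sum \<gamma> I)) / 2)\<^sup>2 * a \<gamma>)"
    by (intro sum.cong refl) (simp add: a_def power2_eq_square)
  also have "\<dots> = (\<Sum>\<gamma>\<in>R. ((2 * real q - real (sum \<gamma> I)) / 2)\<^sup>2 * a \<gamma>)"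
  proof -
    have "(\<Sum>\<gamma>\<in>mi (2 * q). if \<gamma> = ?z then 0 else ((2 * real q - real (sum \<gamma> I)) / 2)\<^sup>2 * a \<gamma>) = 0"
      by (rule sum.neutral) (auto simp: multi_indices_def)
    moreover have "(\<Sum>\<gamma>\<in>R. if \<gamma> = ?z then 0 else ((2 * real q - real (sum \<gamma> I)) / 2)\<^sup>2 * a \<gamma>) = (\<Sum>\<gamma>\<in>R. ((2 * real q - real (sum \<gamma> I)) / 2)\<^sup>2 * a \<gamma>)"
      by (intro sum.cong) (auto simp: R_def)
    ultimately show ?thesis unfolding split by simp
  qed
  also have "\<dots> \<le> (\<Sum>\<gamma>\<in>R. ((2 * real q - 1) / 2)\<^sup>2 * a \<gamma>)"
  proof (intro sum_mono mult_right_mono a_nn power_mono divide_right_mono)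
    fix \<gamma> assume "\<gamma> \<in> R"
    then have "1 \<le> real (sum \<gamma> I)" "real (sum \<gamma> I) \<le> 2 * real q" using Rdeg[of \<gamma>] by (auto simp del: of_nat_sum)
    then show "2 * real q - real (sum \<gamma> I) \<le> 2 * real q - 1" "0 \<le> (2 * real q - real (sum \<gamma> I)) / 2" by auto
  qed simp
  also have "\<dots> = ((2 * real q - 1) / 2)\<^sup>2 * A" by (simp add: A_def sum_distrib_left)
  also have "\<dots> \<le> ((2 * real q - 1) / 2)\<^sup>2 * \<Delta>" by (intro mult_left_mono A\<Delta>) simp
  finally show ?B .
  have "(\<Sum>j\<in>I. l j * (\<integral>n. (diff j u n) ^ 4 \<partial>D)) = 4 * real q * (\<integral>n. u n ^ 4 \<partial>D) - 3 * (\<Sum>\<gamma>\<in>B. real (sum \<gamma> I) * a \<gamma>)"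
    unfolding fourth_moment_eq[OF tu] u2g by (simp add: gu power4_eq_xxxx power3_eq_cube mult_ac)
  also have "(\<Sum>\<gamma>\<in>B. real (sum \<gamma> I) * a \<gamma>) = (\<Sum>\<gamma>\<in>R. real (sum \<gamma> I) * a \<gamma>) + 2 * real q * T"
    unfolding split T_def by (simp add: sum_distrib_left multi_indices_def)
  also have "4 * real q * (\<integral>n. u n ^ 4 \<partial>D) - 3 * ((\<Sum>\<gamma>\<in>R. real (sum \<gamma> I) * a \<gamma>) + 2 * real q * T)
      \<le> 4 * real q * (\<integral>n. u n ^ 4 \<partial>D) - 3 * (A + 2 * real q * T)"
  proof -
    have "(\<Sum>\<gamma>\<in>R. 1 * a \<gamma>) \<le> (\<Sum>\<gamma>\<in>R. real (sum \<gamma> I) * a \<gamma>)"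
      by (intro sum_mono mult_right_mono a_nn) (use Rdeg in \<open>force simp del: of_nat_sum\<close>)
    then show ?thesis by (simp add: A_def)
  qed
  also have "\<dots> = (4 * real q - 3) * A - 2 * real q * (T - 2 * s2\<^sup>2)"
    by (simp add: u4' algebra_simps)
  also have "\<dots> \<le> (4 * real q - 3) * \<Delta>"
  proof -
    have "(4 * real q - 3) * A \<le> (4 * real q - 3) * \<Delta>" using q by (intro mult_left_mono A\<Delta>) auto
    moreover have "0 \<le> 2 * real q * (T - 2 * s2\<^sup>2)" using T by simp
    ultimately show ?thesis by simp
  qed
  finally show ?C .
qed

lemma abs_integral_le_sqrt:
  assumes "tame u" shows "(\<integral>n. \<bar>u n\<bar> \<partial>D) \<le> sqrt (\<integral>n. (u n)\<^sup>2 \<partial>D)"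
proof -
  have "(\<integral>n. \<bar>u n\<bar> \<partial>D) \<le> sqrt ((\<integral>n. (u n)\<^sup>2 \<partial>D) * 1)"
  proof (rule quadratic_nonneg_imp)
    fix t
    have "0 \<le> (\<integral>n. (\<bar>u n\<bar> - t)\<^sup>2 \<partial>D)" by (rule Bochner_Integration.integral_nonneg) simp
    also have "\<dots> = (\<integral>n. (u n)\<^sup>2 - 2 * t * \<bar>u n\<bar> + t\<^sup>2 \<partial>D)"
      by (simp add: power2_diff algebra_simps)
    also have "\<dots> = (\<integral>n. (u n)\<^sup>2 \<partial>D) - 2 * t * (\<integral>n. \<bar>u n\<bar> \<partial>D) + t\<^sup>2"
      using assms by (simp add: tame_integrable tame_power tame_abs prob_space)
    finally show "0 \<le> (\<integral>n. (u n)\<^sup>2 \<partial>D) - 2 * (\<integral>n. \<bar>u n\<bar> \<partial>D) * t + 1 * t\<^sup>2" by (simp add: mult_ac)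
  qed simp
  then show ?thesis by simp
qed

text \<open>Stein's equation is multiplied by q so that q u can be replaced by -gen u. Then q (E
  h(u) - m) splits into V, the deviation of \<open>gamma u\<close> from q \<sigma>^2 weighted by f',
  and E, the Taylor error of the generator. The Gaussian variance \<sigma>^2 is kept apart from the
  second moment s2 of u, because a projection need not preserve second moments.\<close>

theorem chaos_stein_bound:
  fixes c :: "('i \<Rightarrow> nat) \<Rightarrow> real" and q :: nat and h :: "real \<Rightarrow> real"
  assumes q: "1 \<le> q" and lip: "1-lipschitz_on UNIV h" and \<sigma>: "0 < \<sigma>"
  defines "u \<equiv> \<lambda>n. \<Sum>\<alpha>\<in>mi q. c \<alpha> * chr \<alpha> n"
  defines "s2 \<equiv> \<integral>n. (u n)\<^sup>2 \<partial>D"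
  defines "\<Delta> \<equiv> (\<integral>n. u n ^ 4 \<partial>D) - 3 * s2\<^sup>2"
  shows "\<bar>(\<integral>n. h (u n) \<partial>D) - (\<integral>z. h (\<sigma> * z) * std_normal_density z \<partial>lborel)\<bar> \<le>
    sqrt (2 / pi) / \<sigma> * (\<bar>\<sigma>\<^sup>2 - s2\<bar> + (2 * real q - 1) / (2 * real q) * sqrt \<Delta>)
    + 2 / (3 * \<sigma>\<^sup>2) * sqrt s2 * sqrt ((4 * real q - 3) / real q) * sqrt \<Delta>"
proof -
  define m where "m = (\<integral>z. h (\<sigma> * z) * std_normal_density z \<partial>lborel)"
  obtain G f f' where G: "\<And>x. (G has_real_derivative f x) (at x)" and f: "\<And>x. (f has_real_derivative f' x) (at x)"
    and st: "\<And>x. \<sigma>\<^sup>2 * f' x - x * f x = h x - m" and fb: "\<And>x. \<bar>f' x\<bar> \<le> sqrt (2 / pi) / \<sigma>"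
    and ta: "\<And>x v. \<bar>G v - G x - f x * (v - x) - f' x * (v - x)\<^sup>2 / 2\<bar> \<le> 1 / (3 * \<sigma>\<^sup>2) * \<bar>v - x\<bar> ^ 3"
    using stein_solution[OF lip \<sigma>, folded m_def] by blast
  define b where "b = sqrt (2 / pi) / \<sigma>"
  define \<kappa> where "\<kappa> = 1 / (3 * \<sigma>\<^sup>2)"
  have b0: "0 \<le> b" and k0: "0 \<le> \<kappa>" using \<sigma> by (auto simp: b_def \<kappa>_def)
  have tu: "tame u" unfolding u_def by (intro tame_sum tame_mult tame_const tame_chr)
  have th: "tame (\<lambda>n. h (u n))"
  proof (rule tame_bound[where u="\<lambda>n. \<bar>h 0\<bar> + \<bar>u n\<bar>"])
    fix n show "\<bar>h (u n)\<bar> \<le> \<bar>\<bar>h 0\<bar> + \<bar>u n\<bar>\<bar>"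
      using lipschitz_onD[OF lip, of "u n" 0] by (simp add: dist_real_def)
  qed (use tu in auto)
  have tf': "tame (\<lambda>n. f' (u n))"
    by (rule tame_bound[where u="\<lambda>n. b"]) (use fb b0 in \<open>auto simp flip: b_def\<close>)
  have tf: "tame (\<lambda>n. f (u n))"
  proof (rule tame_bound[where u="\<lambda>n. \<bar>f 0\<bar> + b * \<bar>u n\<bar>"])
    fix n
    have "\<bar>f (u n) - f 0\<bar> \<le> b / (real 0 + 1) * \<bar>u n - 0\<bar> ^ Suc 0"
    proof (rule bound_from_deriv[where h=f'])
      show "((\<lambda>x. f x - f 0) has_real_derivative f' v) (at v)" for v
        by (rule derivative_eq_intros f refl)+ simp
    qed (use fb in \<open>auto simp: b_def\<close>)
    moreover have "0 \<le> b * \<bar>u n\<bar>" using b0 by simp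
    ultimately show "\<bar>f (u n)\<bar> \<le> \<bar>\<bar>f 0\<bar> + b * \<bar>u n\<bar>\<bar>" by simp
  qed (use tu in \<open>auto intro!: tame_add tame_mult\<close>)
  \<comment> \<open>The third-order Taylor bound at 0 gives G at most cubic growth.\<close>
  have tG: "tame (\<lambda>n. G (u n))"
  proof (rule tame_bound[where u="\<lambda>n. \<bar>G 0\<bar> + \<bar>f 0 * u n\<bar> + \<bar>f' 0 * (u n)\<^sup>2 / 2\<bar> + \<kappa> * \<bar>u n\<bar> ^ 3"])
    fix n
    have "\<bar>G (u n) - G 0 - f 0 * u n - f' 0 * (u n)\<^sup>2 / 2\<bar> \<le> \<kappa> * \<bar>u n\<bar> ^ 3"
      using ta[of "u n" 0] by (simp add: \<kappa>_def)
    then show "\<bar>G (u n)\<bar> \<le> \<bar>\<bar>G 0\<bar> + \<bar>f 0 * u n\<bar> + \<bar>f' 0 * (u n)\<^sup>2 / 2\<bar> + \<kappa> * \<bar>u n\<bar> ^ 3\<bar>" by arith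
  qed (use tu in \<open>intro tame_add tame_mult tame_abs tame_const tame_power tame_divide; assumption\<close>)
  have cm: "0 \<le> \<Delta>" "(\<integral>n. (gamma u n - real q * s2)\<^sup>2 \<partial>D) \<le> ((2 * real q - 1) / 2)\<^sup>2 * \<Delta>"
    "(\<Sum>j\<in>I. l j * (\<integral>n. (diff j u n) ^ 4 \<partial>D)) \<le> (4 * real q - 3) * \<Delta>"
    "(\<Sum>j\<in>I. l j * (\<integral>n. (diff j u n)\<^sup>2 \<partial>D)) = real q * s2"
    "\<And>n. gen u n = - real q * u n"
    unfolding \<Delta>_def s2_def u_def by (rule chaos_moments[OF q])+
  have s2: "0 \<le> s2" unfolding s2_def by (rule Bochner_Integration.integral_nonneg) simp
  have gu: "gen u n = - real q * u n" for n by (rule cm(5))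
  define E where "E = (\<integral>n. f (u n) * gen u n \<partial>D) + (\<integral>n. f' (u n) * gamma u n \<partial>D)"
  have E: "\<bar>E\<bar> \<le> 2 * \<kappa> * sqrt (real q * s2 * ((4 * real q - 3) * \<Delta>))"
  proof -
    have "\<bar>E\<bar> \<le> 2 * \<kappa> * (\<Sum>j\<in>I. l j * (\<integral>n. \<bar>diff j u n\<bar> ^ 3 \<partial>D))"
      unfolding E_def by (rule generator_taylor[OF tu tG tf tf']) (use ta in \<open>simp add: \<kappa>_def\<close>)
    also have "(\<Sum>j\<in>I. l j * (\<integral>n. \<bar>diff j u n\<bar> ^ 3 \<partial>D)) \<le> sqrt (real q * s2 * (\<Sum>j\<in>I. l j * (\<integral>n. (diff j u n) ^ 4 \<partial>D)))"
      using third_moment_bound[OF tu] by (simp add: cm(4))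
    also have "\<dots> \<le> sqrt (real q * s2 * ((4 * real q - 3) * \<Delta>))"
      using s2 by (intro real_sqrt_le_mono mult_left_mono cm(3)) auto
    finally show ?thesis using k0 by (simp add: mult_left_mono)
  qed
  define V where "V = (\<integral>n. f' (u n) * (real q * \<sigma>\<^sup>2 - gamma u n) \<partial>D)"
  have tg: "tame (\<lambda>n. real q * \<sigma>\<^sup>2 - gamma u n)" "tame (\<lambda>n. gamma u n - real q * s2)" using tu by auto
  have V: "\<bar>V\<bar> \<le> b * (real q * \<bar>\<sigma>\<^sup>2 - s2\<bar> + (2 * real q - 1) / 2 * sqrt \<Delta>)"
  proof -
    have "\<bar>V\<bar> \<le> (\<integral>n. \<bar>f' (u n) * (real q * \<sigma>\<^sup>2 - gamma u n)\<bar> \<partial>D)" unfolding V_def by (rule integral_abs_bound)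
    also have "\<dots> \<le> (\<integral>n. b * (real q * \<bar>\<sigma>\<^sup>2 - s2\<bar> + \<bar>gamma u n - real q * s2\<bar>) \<partial>D)"
    proof (rule integral_mono)
      fix n
      have "\<bar>real q * \<sigma>\<^sup>2 - gamma u n\<bar> \<le> \<bar>real q * (\<sigma>\<^sup>2 - s2)\<bar> + \<bar>gamma u n - real q * s2\<bar>"
        by (simp add: right_diff_distrib)
      then have "\<bar>real q * \<sigma>\<^sup>2 - gamma u n\<bar> \<le> real q * \<bar>\<sigma>\<^sup>2 - s2\<bar> + \<bar>gamma u n - real q * s2\<bar>"
        by (simp add: abs_mult)
      then show "\<bar>f' (u n) * (real q * \<sigma>\<^sup>2 - gamma u n)\<bar> \<le> b * (real q * \<bar>\<sigma>\<^sup>2 - s2\<bar> + \<bar>gamma u n - real q * s2\<bar>)"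
        using fb[of "u n"] b0 unfolding abs_mult b_def by (intro mult_mono) auto
    qed (intro tame_integrable tame_abs tame_mult tame_add tame_const tf' tg)+
    also have "\<dots> = b * (real q * \<bar>\<sigma>\<^sup>2 - s2\<bar> + (\<integral>n. \<bar>gamma u n - real q * s2\<bar> \<partial>D))"
      using tame_abs[OF tg(2)] by (simp add: prob_space)
    also have "(\<integral>n. \<bar>gamma u n - real q * s2\<bar> \<partial>D) \<le> sqrt (\<integral>n. (gamma u n - real q * s2)\<^sup>2 \<partial>D)"
      by (rule abs_integral_le_sqrt[OF tg(2)])
    also have "\<dots> \<le> sqrt (((2 * real q - 1) / 2)\<^sup>2 * \<Delta>)" by (intro real_sqrt_le_mono cm(2))
    also have "\<dots> = (2 * real q - 1) / 2 * sqrt \<Delta>" using q by (simp add: real_sqrt_mult)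
    finally show ?thesis using b0 by (simp add: mult_left_mono)
  qed
  have "real q * ((\<integral>n. h (u n) \<partial>D) - m) = (\<integral>n. real q * (\<sigma>\<^sup>2 * f' (u n) - u n * f (u n)) \<partial>D)"
    unfolding st using th by (simp add: prob_space)
  also have "\<dots> = (\<integral>n. f' (u n) * (real q * \<sigma>\<^sup>2 - gamma u n) + (f (u n) * gen u n + f' (u n) * gamma u n) \<partial>D)"
    by (simp add: gu algebra_simps)
  also have "\<dots> = V + E"
    unfolding V_def E_def
    using tame_integrable[OF tame_mult[OF tf' tg(1)]] tame_integrable[OF tame_mult[OF tf tame_gen[OF tu]]]
      tame_integrable[OF tame_mult[OF tf' tame_gamma[OF tu]]] by simp
  finally have VE: "real q * ((\<integral>n. h (u n) \<partial>D) - m) = V + E" .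
  have "real q * \<bar>(\<integral>n. h (u n) \<partial>D) - m\<bar> = \<bar>real q * ((\<integral>n. h (u n) \<partial>D) - m)\<bar>"
    by (simp add: abs_mult)
  also have "\<dots> \<le> \<bar>V\<bar> + \<bar>E\<bar>" unfolding VE by (rule abs_triangle_ineq)
  also have "\<dots> \<le> b * (real q * \<bar>\<sigma>\<^sup>2 - s2\<bar> + (2 * real q - 1) / 2 * sqrt \<Delta>) + 2 * \<kappa> * sqrt (real q * s2 * ((4 * real q - 3) * \<Delta>))"
    by (intro add_mono V E)
  also have "sqrt (real q * s2 * ((4 * real q - 3) * \<Delta>)) = real q * (sqrt s2 * sqrt ((4 * real q - 3) / real q) * sqrt \<Delta>)"
  proof -
    have "real q * s2 * ((4 * real q - 3) * \<Delta>) = (real q)\<^sup>2 * (s2 * ((4 * real q - 3) / real q) * \<Delta>)"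
      using q by (simp add: power2_eq_square field_simps)
    then have "sqrt (real q * s2 * ((4 * real q - 3) * \<Delta>)) = sqrt ((real q)\<^sup>2 * (s2 * ((4 * real q - 3) / real q) * \<Delta>))"
      by (rule arg_cong)
    also have "\<dots> = \<bar>real q\<bar> * (sqrt s2 * sqrt ((4 * real q - 3) / real q) * sqrt \<Delta>)"
      by (simp only: real_sqrt_mult real_sqrt_abs)
    finally show ?thesis by simp
  qed
  also have "b * (real q * \<bar>\<sigma>\<^sup>2 - s2\<bar> + (2 * real q - 1) / 2 * sqrt \<Delta>) + 2 * \<kappa> * (real q * (sqrt s2 * sqrt ((4 * real q - 3) / real q) * sqrt \<Delta>))
    = real q * (b * (\<bar>\<sigma>\<^sup>2 - s2\<bar> + (2 * real q - 1) / (2 * real q) * sqrt \<Delta>) + 2 * \<kappa> * (sqrt s2 * sqrt ((4 * real q - 3) / real q) * sqrt \<Delta>))"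
    using q by (simp add: field_simps)
  finally have "\<bar>(\<integral>n. h (u n) \<partial>D) - m\<bar> \<le> b * (\<bar>\<sigma>\<^sup>2 - s2\<bar> + (2 * real q - 1) / (2 * real q) * sqrt \<Delta>) + 2 * \<kappa> * (sqrt s2 * sqrt ((4 * real q - 3) / real q) * sqrt \<Delta>)"
    using q by (subst (asm) mult_le_cancel_left_pos) auto
  then show ?thesis by (simp add: b_def \<kappa>_def m_def mult_ac)
qed

end

section \<open>Atom decompositions and factorial measures\<close>

lemma unit_mass_cong: "sets M = sets N \<Longrightarrow> unit_mass M \<nu> = unit_mass N \<nu>"
  by (simp add: unit_mass_def)

text \<open>A set A of least positive mass k carries an atom: each of its measurable subsets has
  mass 0 or k, so the normalised restriction is a unit mass. It is taken k times, and the induction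
  continues with the mass n - k off A.\<close>

lemma finite_atom_decomposition:
  fixes N :: "'z measure"
  assumes "\<And>A. A \<in> sets N \<Longrightarrow> emeasure N A \<in> range of_nat" "emeasure N (space N) = of_nat n"
  shows "\<exists>\<nu>. (\<forall>i<n. unit_mass N (\<nu> i)) \<and> (\<forall>A\<in>sets N. emeasure N A = (\<Sum>i<n. emeasure (\<nu> i) A))"
  using assms
proof (induction n arbitrary: N rule: less_induct)
  case (less n)
  show ?case
  proof (cases "n = 0")
    case True
    then have "emeasure N A = 0" if "A \<in> sets N" for A
      using emeasure_mono[OF sets.sets_into_space[OF that] sets.top] less.prems(2) by simp
    then show ?thesis using True by auto
  next
    case False
    define Q where "Q k \<longleftrightarrow> 0 < k \<and> (\<exists>A\<in>sets N. emeasure N A = of_nat k)" for k :: nat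
    have "Q n" using False less.prems(2) by (auto simp: Q_def)
    define k where "k = (LEAST k. Q k)"
    have "Q k" unfolding k_def using \<open>Q n\<close> by (rule LeastI)
    then obtain A where A: "A \<in> sets N" "emeasure N A = of_nat k" and k: "0 < k" by (auto simp: Q_def)
    have kmin: "k \<le> j" if "Q j" for j unfolding k_def using that by (rule Least_le)
    have kn: "k \<le> n" using kmin[OF \<open>Q n\<close>] .
    define \<nu>0 where "\<nu>0 = scale_measure (1 / of_nat k) (density N (indicator A))"
    have e0: "emeasure \<nu>0 B = 1 / of_nat k * emeasure N (A \<inter> B)" if "B \<in> sets N" for B
      unfolding \<nu>0_def using that A by (simp add: emeasure_restricted)
    have kk: "1 / of_nat k * of_nat k = (1 :: ennreal)"
    proof -
      have "of_nat k / of_nat k = (1 :: ennreal)"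
        by (rule ennreal_divide_self) (use k in \<open>simp_all add: of_nat_less_top\<close>)
      then show ?thesis by (simp add: ennreal_divide_times)
    qed
    have cases0: "emeasure N (A \<inter> B) = 0 \<or> emeasure N (A \<inter> B) = of_nat k" if B: "B \<in> sets N" for B
    proof -
      obtain j where j: "emeasure N (A \<inter> B) = of_nat j" using less.prems(1)[of "A \<inter> B"] A B by auto
      have "of_nat j \<le> (of_nat k :: ennreal)"
        unfolding j[symmetric] A(2)[symmetric] using A by (intro emeasure_mono) auto
      then have "j \<le> k" by simp
      moreover have "j = 0 \<or> k \<le> j"
      proof (cases "j = 0")
        case False
        then have "Q j" using j A B by (auto simp: Q_def intro!: bexI[of _ "A \<inter> B"])
        then show ?thesis using kmin by blast
      qed simp
      ultimately show ?thesis using j by auto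
    qed
    have um0: "unit_mass N \<nu>0"
      unfolding unit_mass_def
    proof (intro conjI ballI)
      have "emeasure \<nu>0 (space \<nu>0) = 1"
        using e0[OF sets.top] A kk sets.sets_into_space[OF A(1)]
        by (simp add: \<nu>0_def Int_absorb2 space_scale_measure)
      then show "prob_space \<nu>0" by (rule prob_spaceI)
      show "sets \<nu>0 = sets N" by (simp add: \<nu>0_def)
      fix B assume B: "B \<in> sets N"
      show "emeasure \<nu>0 B \<in> {0, 1}" using e0[OF B] cases0[OF B] kk by auto
    qed
    define N' where "N' = density N (indicator (space N - A))"
    have sN': "sets N' = sets N" by (simp add: N'_def)
    have e': "emeasure N' B = emeasure N ((space N - A) \<inter> B)" if "B \<in> sets N" for B
      unfolding N'_def using that A by (intro emeasure_restricted) auto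
    have N'nat: "emeasure N' B \<in> range of_nat" if "B \<in> sets N'" for B
      using that A e'[of B] sN' less.prems(1)[of "(space N - A) \<inter> B"] by auto
    have spl: "emeasure N B = emeasure N (A \<inter> B) + emeasure N' B" if B: "B \<in> sets N" for B
    proof -
      have "B = (A \<inter> B) \<union> ((space N - A) \<inter> B)" using sets.sets_into_space[OF B] by auto
      then have "emeasure N B = emeasure N ((A \<inter> B) \<union> ((space N - A) \<inter> B))" by simp
      also have "\<dots> = emeasure N (A \<inter> B) + emeasure N ((space N - A) \<inter> B)"
        using A B by (intro plus_emeasure[symmetric]) auto
      finally show ?thesis using e'[OF B] by simp
    qed
    have N'sp: "emeasure N' (space N') = of_nat (n - k)"
    proof -
      obtain j where j: "emeasure N' (space N') = of_nat j" using N'nat[OF sets.top] by auto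
      have "space N' = space N" by (simp add: N'_def)
      then have "(of_nat n :: ennreal) = of_nat k + of_nat j"
        using spl[OF sets.top] j A less.prems(2) sets.sets_into_space[OF A(1)] by (simp add: Int_absorb2)
      then have "n = k + j" by (simp flip: of_nat_add)
      then show ?thesis using j by simp
    qed
    obtain \<nu>' where \<nu>': "\<And>i. i < n - k \<Longrightarrow> unit_mass N' (\<nu>' i)"
      "\<And>B. B \<in> sets N' \<Longrightarrow> emeasure N' B = (\<Sum>i<n - k. emeasure (\<nu>' i) B)"
      using less.IH[of "n - k" N'] N'nat N'sp k False by auto
    \<comment> \<open>The last k of the n indices all carry the same unit mass \<nu>0.\<close>
    define \<nu> where "\<nu> i = (if i < n - k then \<nu>' i else \<nu>0)" for i
    show ?thesis
    proof (intro exI[of _ \<nu>] conjI allI impI ballI)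
      fix i show "unit_mass N (\<nu> i)"
        using um0 \<nu>'(1)[of i] unit_mass_cong[OF sN'] by (simp add: \<nu>_def)
      fix B assume B: "B \<in> sets N"
      have "emeasure N (A \<inter> B) = of_nat k * emeasure \<nu>0 B"
        using cases0[OF B] e0[OF B] kk by (auto simp: mult.commute)
      then have "emeasure N B = of_nat k * emeasure \<nu>0 B + (\<Sum>i<n - k. emeasure (\<nu>' i) B)"
        using spl[OF B] \<nu>'(2)[of B] B sN' by simp
      also have "\<dots> = (\<Sum>i\<in>{..<n - k}. emeasure (\<nu> i) B) + (\<Sum>i\<in>{n - k..<n}. emeasure (\<nu> i) B)"
        using kn by (simp add: \<nu>_def add.commute)
      also have "\<dots> = (\<Sum>i\<in>{..<n - k} \<union> {n - k..<n}. emeasure (\<nu> i) B)"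
        by (rule sum.union_disjoint[symmetric]) auto
      also have "{..<n - k} \<union> {n - k..<n} = {..<n}" by auto
      finally show "emeasure N B = (\<Sum>i<n. emeasure (\<nu> i) B)" .
    qed
  qed
qed

text \<open>Each piece \<open>Z n\<close> has finite mass and is decomposed separately; a piece
  together with an index in it is encoded as one natural number.\<close>

lemma atom_decomposition_exists:
  fixes M N :: "'z measure" and Z :: "nat \<Rightarrow> 'z set"
  assumes sN: "sets N = sets M" and nat: "\<And>A. A \<in> sets M \<Longrightarrow> emeasure N A \<in> insert \<infinity> (range of_nat)"
    and Z: "\<And>n. Z n \<in> sets M" "disjoint_family Z" "(\<Union>n. Z n) = space M" and fin: "\<And>n. emeasure N (Z n) < \<infinity>"
  shows "\<exists>J \<nu>. atom_decomposition M N J \<nu>"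
proof -
  define NN where "NN n = density N (indicator (Z n))" for n
  have sNN: "sets (NN n) = sets M" for n by (simp add: NN_def sN)
  have eNN: "emeasure (NN n) A = emeasure N (Z n \<inter> A)" if "A \<in> sets M" for n A
    unfolding NN_def using that Z sN by (intro emeasure_restricted) auto
  have natNN: "emeasure (NN n) A \<in> range of_nat" if A: "A \<in> sets (NN n)" for n A
  proof -
    have "A \<in> sets M" using A sNN by simp
    then have "emeasure N (Z n \<inter> A) \<le> emeasure N (Z n)" using Z sN by (intro emeasure_mono) auto
    then have "emeasure N (Z n \<inter> A) \<noteq> \<infinity>" using fin[of n] by (auto simp: top_unique)
    then show ?thesis using nat[of "Z n \<inter> A"] Z \<open>A \<in> sets M\<close> eNN by auto
  qed
  have "\<exists>k. emeasure (NN n) (space (NN n)) = of_nat k" for n using natNN[OF sets.top] by auto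
  then obtain k where k: "\<And>n. emeasure (NN n) (space (NN n)) = of_nat (k n)" by metis
  have "\<exists>\<nu>. (\<forall>i<k n. unit_mass (NN n) (\<nu> i)) \<and> (\<forall>A\<in>sets (NN n). emeasure (NN n) A = (\<Sum>i<k n. emeasure (\<nu> i) A))" for n
    by (rule finite_atom_decomposition[OF natNN k])
  then obtain \<nu>\<nu> where \<nu>\<nu>: "\<And>n i. i < k n \<Longrightarrow> unit_mass (NN n) (\<nu>\<nu> n i)"
     "\<And>n A. A \<in> sets (NN n) \<Longrightarrow> emeasure (NN n) A = (\<Sum>i<k n. emeasure (\<nu>\<nu> n i) A)" by metis
  define J where "J = {j. case prod_decode j of (n, i) \<Rightarrow> i < k n}"
  define \<nu> where "\<nu> j = (case prod_decode j of (n, i) \<Rightarrow> \<nu>\<nu> n i)" for j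
  have "atom_decomposition M N J \<nu>"
    unfolding atom_decomposition_def
  proof (intro conjI ballI)
    fix j assume "j \<in> J"
    then show "unit_mass M (\<nu> j)"
      using \<nu>\<nu>(1) unit_mass_cong[OF sNN] by (auto simp: J_def \<nu>_def split: prod.splits)
  next
    fix A assume A: "A \<in> sets M"
    have "(\<integral>\<^sup>+j. emeasure (\<nu> j) A \<partial>count_space J) = (\<integral>\<^sup>+j. emeasure (\<nu> j) A * indicator J j \<partial>count_space UNIV)"
      by (simp add: nn_integral_count_space_indicator)
    also have "\<dots> = (\<integral>\<^sup>+p. emeasure (\<nu> (prod_encode p)) A * indicator J (prod_encode p) \<partial>count_space UNIV)"
      by (rule nn_integral_bij_count_space[symmetric]) (rule bij_prod_encode)
    also have "\<dots> = (\<integral>\<^sup>+n. (\<integral>\<^sup>+i. emeasure (\<nu>\<nu> n i) A * indicator {..<k n} i \<partial>count_space UNIV) \<partial>count_space UNIV)"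
      by (subst nn_integral_fst_count_space[symmetric]) (simp add: \<nu>_def J_def indicator_def)
    also have "\<dots> = (\<integral>\<^sup>+n. emeasure N (Z n \<inter> A) \<partial>count_space UNIV)"
    proof (rule nn_integral_cong)
      fix n
      have "(\<integral>\<^sup>+i. emeasure (\<nu>\<nu> n i) A * indicator {..<k n} i \<partial>count_space UNIV) = (\<integral>\<^sup>+i. emeasure (\<nu>\<nu> n i) A \<partial>count_space {..<k n})"
        by (simp add: nn_integral_count_space_indicator)
      also have "\<dots> = (\<Sum>i<k n. emeasure (\<nu>\<nu> n i) A)" by (rule nn_integral_count_space_finite) simp
      finally show "(\<integral>\<^sup>+i. emeasure (\<nu>\<nu> n i) A * indicator {..<k n} i \<partial>count_space UNIV) = emeasure N (Z n \<inter> A)"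
        using \<nu>\<nu>(2)[of A n] A sNN eNN by simp
    qed
    also have "\<dots> = (\<Sum>n. emeasure N (Z n \<inter> A))" by (rule nn_integral_count_space_nat)
    also have "\<dots> = emeasure N (\<Union>n. Z n \<inter> A)"
      using Z A sN by (intro suminf_emeasure) (auto simp: disjoint_family_on_def)
    also have "(\<Union>n. Z n \<inter> A) = A" using Z(3) sets.sets_into_space[OF A] by auto
    finally show "emeasure N A = (\<integral>\<^sup>+j. emeasure (\<nu> j) A \<partial>count_space J)" by simp
  qed
  then show ?thesis by blast
qed

text \<open>The number of ways to choose distinct atoms along the word s when cell c holds y c of
  them, a product of falling factorials. Truncated subtraction is exact, since a factor 0 occurs
  before a difference could become negative.\<close>

definition falling_product :: "('c \<Rightarrow> nat) \<Rightarrow> (nat \<Rightarrow> 'c) \<Rightarrow> nat \<Rightarrow> nat" where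
  "falling_product y s k = (\<Prod>j<k. y (s j) - card {i. i < j \<and> s i = s j})"

text \<open>The positions are filled one after the other. As distinct cells are disjoint, position k
  loses exactly the atoms used at earlier positions with the same letter.\<close>

lemma card_inj_PiE_disjoint:
  fixes S :: "'c \<Rightarrow> 'a set"
  assumes "\<And>j. j < k \<Longrightarrow> finite (S (s j))" "\<And>i j. i < k \<Longrightarrow> j < k \<Longrightarrow> s i \<noteq> s j \<Longrightarrow> S (s i) \<inter> S (s j) = {}"
  shows "finite {t \<in> Pi\<^sub>E {..<k} (\<lambda>j. S (s j)). inj_on t {..<k}} \<and>
    card {t \<in> Pi\<^sub>E {..<k} (\<lambda>j. S (s j)). inj_on t {..<k}} = falling_product (\<lambda>c. card (S c)) s k"
  using assms
proof (induction k)
  case 0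
  have "{t \<in> Pi\<^sub>E {..<0} (\<lambda>j. S (s j)). inj_on t {..<0}} = {\<lambda>_. undefined}" by auto
  then show ?case by (simp add: falling_product_def)
next
  case (Suc k)
  let ?C = "\<lambda>k. {t \<in> Pi\<^sub>E {..<k} (\<lambda>j. S (s j)). inj_on t {..<k}}"
  have IH: "finite (?C k)" "card (?C k) = falling_product (\<lambda>c. card (S c)) s k" using Suc by auto
  let ?m = "card {i. i < k \<and> s i = s k}"
  have step: "?C (Suc k) = (\<lambda>(t, a). t(k := a)) ` (SIGMA t:?C k. S (s k) - t ` {..<k})"
  proof (intro equalityI subsetI)
    fix t assume t: "t \<in> ?C (Suc k)"
    have inj: "inj_on t {..<Suc k}" and tS: "\<And>j. j < Suc k \<Longrightarrow> t j \<in> S (s j)" and te: "\<And>j. \<not> j < Suc k \<Longrightarrow> t j = undefined"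
      using t by (auto simp: PiE_iff extensional_def)
    define t' where "t' = restrict t {..<k}"
    have "t' \<in> ?C k" using inj tS by (auto simp: t'_def inj_on_def)
    moreover have "t k \<in> S (s k) - t' ` {..<k}"
      using tS[of k] inj_onD[OF inj, of k] by (force simp: t'_def)
    moreover have "t = t'(k := t k)" using te by (auto simp: t'_def fun_eq_iff less_Suc_eq)
    ultimately show "t \<in> (\<lambda>(t, a). t(k := a)) ` (SIGMA t:?C k. S (s k) - t ` {..<k})"
      by (intro image_eqI[of _ _ "(t', t k)"]) auto
  next
    fix t assume "t \<in> (\<lambda>(t, a). t(k := a)) ` (SIGMA t:?C k. S (s k) - t ` {..<k})"
    then obtain t' a where t': "t = t'(k := a)" "t' \<in> ?C k" "a \<in> S (s k)" "a \<notin> t' ` {..<k}" by auto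
    then show "t \<in> ?C (Suc k)"
      by (auto simp: PiE_iff extensional_def inj_on_def less_Suc_eq)
  qed
  have injc: "inj_on (\<lambda>(t, a). t(k := a)) (SIGMA t:?C k. S (s k) - t ` {..<k})"
  proof (rule inj_onI, clarify)
    fix t a t' a' assume *: "t \<in> Pi\<^sub>E {..<k} (\<lambda>j. S (s j))" "t' \<in> Pi\<^sub>E {..<k} (\<lambda>j. S (s j))" "t(k := a) = t'(k := a')"
    have "t j = t' j" for j
    proof (cases "j = k")
      case True
      then show ?thesis using *(1,2) by (auto simp: PiE_iff extensional_def)
    next
      case False
      then show ?thesis using fun_cong[OF *(3), of j] by simp
    qed
    then show "t = t' \<and> a = a'" using fun_cong[OF *(3), of k] by auto
  qed
  have cnt: "card (S (s k) - t ` {..<k}) = card (S (s k)) - ?m" if t: "t \<in> ?C k" for t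
  proof -
    have tP: "t \<in> Pi\<^sub>E {..<k} (\<lambda>j. S (s j))" and tinj: "inj_on t {..<k}" using t by blast+
    have eq: "S (s k) \<inter> t ` {..<k} = t ` {i. i < k \<and> s i = s k}"
    proof (intro equalityI subsetI)
      fix a assume "a \<in> S (s k) \<inter> t ` {..<k}"
      then obtain i where i: "i < k" "a = t i" "t i \<in> S (s k)" by auto
      have "t i \<in> S (s i)" using PiE_mem[OF tP, of i] i(1) by simp
      then have "s i = s k" using Suc.prems(2)[of i k] i by auto
      then show "a \<in> t ` {i. i < k \<and> s i = s k}" using i by auto
    next
      fix a assume "a \<in> t ` {i. i < k \<and> s i = s k}"
      then obtain i where i: "i < k" "s i = s k" "a = t i" by auto
      have "t i \<in> S (s i)" using PiE_mem[OF tP, of i] i(1) by simp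
      then show "a \<in> S (s k) \<inter> t ` {..<k}"
        unfolding i(2,3) using i(1) by simp
    qed
    have "card (S (s k) - t ` {..<k}) = card (S (s k)) - card (S (s k) \<inter> t ` {..<k})"
      using Suc.prems(1)[of k] by (simp add: card_Diff_subset_Int)
    also have "card (S (s k) \<inter> t ` {..<k}) = ?m"
      unfolding eq by (rule card_image[OF inj_on_subset[OF tinj]]) auto
    finally show ?thesis .
  qed
  have fin: "finite (SIGMA t:?C k. S (s k) - t ` {..<k})" using IH(1) Suc.prems(1)[of k] by auto
  have "card (?C (Suc k)) = card (SIGMA t:?C k. S (s k) - t ` {..<k})"
    unfolding step by (rule card_image[OF injc])
  also have "\<dots> = (\<Sum>t\<in>?C k. card (S (s k) - t ` {..<k}))"
    using IH(1) Suc.prems(1)[of k] by (intro card_SigmaI) auto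
  also have "\<dots> = card (?C k) * (card (S (s k)) - ?m)" using cnt by simp
  also have "\<dots> = falling_product (\<lambda>c. card (S c)) s (Suc k)"
    using IH(2) by (simp add: falling_product_def)
  finally show ?case using fin unfolding step by blast
qed

lemma emeasure_PiM_unit_mass:
  fixes k :: nat
  assumes "\<And>j. j < k \<Longrightarrow> unit_mass M (\<nu> j)" "\<And>j. j < k \<Longrightarrow> B j \<in> sets M"
  shows "emeasure (PiM {..<k} \<nu>) (Pi\<^sub>E {..<k} B) = (\<Prod>j<k. emeasure (\<nu> j) (B j))"
proof -
  \<comment> \<open>A dummy probability measure fills the indices outside \<open>{..<k}\<close>, so
    that every factor is a probability measure.\<close>
  define z where "z j = (if j < k then \<nu> j else return (count_space UNIV) undefined)" for j
  have "prob_space (z j)" for j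
    using assms(1) by (auto simp: z_def unit_mass_def intro!: prob_space_return)
  then interpret product_prob_space z "{..<k}"
    by (simp add: product_prob_space_def product_prob_space_axioms_def product_sigma_finite_def
        prob_space_imp_sigma_finite)
  have "PiM {..<k} \<nu> = PiM {..<k} z" by (rule PiM_cong) (auto simp: z_def)
  moreover have "emeasure (PiM {..<k} z) (Pi\<^sub>E {..<k} B) = (\<Prod>j<k. emeasure (z j) (B j))"
    using assms by (intro emeasure_PiM) (auto simp: z_def unit_mass_def)
  ultimately show ?thesis by (simp add: z_def)
qed

lemma sets_distinct_tuples_measure [simp]:
  "sets (distinct_tuples_measure k M J \<nu>) = sets (PiM {..<k} (\<lambda>_. M))"
  "space (distinct_tuples_measure k M J \<nu>) = space (PiM {..<k} (\<lambda>_. M))"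
  unfolding distinct_tuples_measure_def
  by (simp_all add: sets.space_closed sets.sigma_sets_eq)

lemma emeasure_distinct_tuples_measure:
  assumes "\<And>i. i \<in> J \<Longrightarrow> unit_mass M (\<nu> i)" and A: "A \<in> sets (PiM {..<k} (\<lambda>_. M))"
  shows "emeasure (distinct_tuples_measure k M J \<nu>) A =
    (\<integral>\<^sup>+i. emeasure (PiM {..<k} (\<lambda>j. \<nu> (i j))) A \<partial>count_space {i \<in> {..<k} \<rightarrow>\<^sub>E J. inj_on i {..<k}})"
proof (rule emeasure_measure_of[OF distinct_tuples_measure_def])
  let ?T = "{i \<in> {..<k} \<rightarrow>\<^sub>E J. inj_on i {..<k}}"
  have s: "sets (PiM {..<k} (\<lambda>j. \<nu> (i j))) = sets (PiM {..<k} (\<lambda>_. M))" if "i \<in> ?T" for i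
    by (rule sets_PiM_cong) (use that assms in \<open>auto simp: unit_mass_def\<close>)
  show "countably_additive (sets (distinct_tuples_measure k M J \<nu>))
     (\<lambda>A. \<integral>\<^sup>+i. emeasure (PiM {..<k} (\<lambda>j. \<nu> (i j))) A \<partial>count_space ?T)"
  proof (rule countably_additiveI)
    fix B :: "nat \<Rightarrow> _" assume B: "range B \<subseteq> sets (distinct_tuples_measure k M J \<nu>)" "disjoint_family B"
    have "(\<Sum>n. \<integral>\<^sup>+i. emeasure (PiM {..<k} (\<lambda>j. \<nu> (i j))) (B n) \<partial>count_space ?T) =
       (\<integral>\<^sup>+i. (\<Sum>n. emeasure (PiM {..<k} (\<lambda>j. \<nu> (i j))) (B n)) \<partial>count_space ?T)"
      by (rule nn_integral_suminf[symmetric]) simp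
    also have "\<dots> = (\<integral>\<^sup>+i. emeasure (PiM {..<k} (\<lambda>j. \<nu> (i j))) (\<Union>n. B n) \<partial>count_space ?T)"
      by (intro nn_integral_cong suminf_emeasure) (use B s in auto)
    finally show "(\<Sum>n. \<integral>\<^sup>+i. emeasure (PiM {..<k} (\<lambda>j. \<nu> (i j))) (B n) \<partial>count_space ?T) = \<dots>" .
  qed
qed (use A in \<open>auto simp: positive_def sets.space_closed\<close>)

text \<open>A unit mass gives each cell mass 0 or 1, so the tuples of atoms that contribute are the
  injective ones whose entries sit in the prescribed cells. The value depends on the counts of N
  alone and hence not on the chosen decomposition.\<close>

lemma distinct_tuples_measure_cells:
  assumes ad: "atom_decomposition M N J \<nu>"
    and D: "\<And>j. j < k \<Longrightarrow> D (s j) \<in> sets M" "\<And>i j. i < k \<Longrightarrow> j < k \<Longrightarrow> s i \<noteq> s j \<Longrightarrow> D (s i) \<inter> D (s j) = {}"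
    and y: "\<And>j. j < k \<Longrightarrow> emeasure N (D (s j)) = of_nat (y (s j))"
  shows "emeasure (distinct_tuples_measure k M J \<nu>) (Pi\<^sub>E {..<k} (\<lambda>j. D (s j))) = of_nat (falling_product y s k)"
proof -
  let ?T = "{i \<in> {..<k} \<rightarrow>\<^sub>E J. inj_on i {..<k}}"
  have um: "\<And>i. i \<in> J \<Longrightarrow> unit_mass M (\<nu> i)" using ad by (auto simp: atom_decomposition_def)
  define S where "S c = {i \<in> J. emeasure (\<nu> i) (D c) = 1}" for c
  have Sy: "finite (S (s j)) \<and> card (S (s j)) = y (s j)" if j: "j < k" for j
  proof -
    have "emeasure N (D (s j)) = (\<integral>\<^sup>+i. emeasure (\<nu> i) (D (s j)) \<partial>count_space J)"
      using ad D j by (auto simp: atom_decomposition_def)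
    also have "\<dots> = (\<integral>\<^sup>+i. indicator (S (s j)) i \<partial>count_space J)"
      by (rule nn_integral_cong) (use um D(1)[OF j] in \<open>auto simp: S_def indicator_def unit_mass_def\<close>)
    also have "\<dots> = emeasure (count_space J) (S (s j))" by (rule nn_integral_indicator) (auto simp: S_def)
    finally have "emeasure (count_space J) (S (s j)) = of_nat (y (s j))" using y[OF j] by simp
    moreover have "S (s j) \<subseteq> J" by (auto simp: S_def)
    ultimately show ?thesis by (auto simp: emeasure_count_space split: if_splits)
  qed
  have Sdisj: "S (s i) \<inter> S (s j) = {}" if "i < k" "j < k" "s i \<noteq> s j" for i j
  proof (rule ccontr)
    assume "S (s i) \<inter> S (s j) \<noteq> {}"
    then obtain a where a: "a \<in> J" "emeasure (\<nu> a) (D (s i)) = 1" "emeasure (\<nu> a) (D (s j)) = 1" by (auto simp: S_def)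
    have sets: "D (s i) \<in> sets (\<nu> a)" "D (s j) \<in> sets (\<nu> a)" using um[OF a(1)] D(1) that by (auto simp: unit_mass_def)
    have "emeasure (\<nu> a) (D (s i) \<union> D (s j)) = 2"
      using plus_emeasure[OF sets D(2)[OF that]] a by simp
    moreover have "emeasure (\<nu> a) (D (s i) \<union> D (s j)) \<in> {0, 1}"
      using um[OF a(1)] sets by (auto simp: unit_mass_def)
    ultimately show False by auto
  qed
  have "emeasure (distinct_tuples_measure k M J \<nu>) (Pi\<^sub>E {..<k} (\<lambda>j. D (s j))) =
     (\<integral>\<^sup>+i. emeasure (PiM {..<k} (\<lambda>j. \<nu> (i j))) (Pi\<^sub>E {..<k} (\<lambda>j. D (s j))) \<partial>count_space ?T)"
    by (rule emeasure_distinct_tuples_measure[OF um]) (use D in \<open>auto intro!: sets_PiM_I_finite\<close>)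
  also have "\<dots> = (\<integral>\<^sup>+i. indicator {t \<in> Pi\<^sub>E {..<k} (\<lambda>j. S (s j)). inj_on t {..<k}} i \<partial>count_space ?T)"
  proof (rule nn_integral_cong)
    fix i assume i: "i \<in> space (count_space ?T)"
    have "emeasure (PiM {..<k} (\<lambda>j. \<nu> (i j))) (Pi\<^sub>E {..<k} (\<lambda>j. D (s j))) = (\<Prod>j<k. emeasure (\<nu> (i j)) (D (s j)))"
      by (rule emeasure_PiM_unit_mass[where M=M]) (use um i D in \<open>auto simp: PiE_iff\<close>)
    also have "\<dots> = (\<Prod>j<k. indicator (S (s j)) (i j))"
    proof (rule prod.cong)
      fix j assume "j \<in> {..<k}"
      then have j: "j < k" "i j \<in> J" using i by auto
      then have "emeasure (\<nu> (i j)) (D (s j)) \<in> {0, 1}" using um[of "i j"] D(1)[of j] by (auto simp: unit_mass_def)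
      then show "emeasure (\<nu> (i j)) (D (s j)) = indicator (S (s j)) (i j)" using j by (auto simp: S_def indicator_def)
    qed simp
    also have "\<dots> = indicator {t \<in> Pi\<^sub>E {..<k} (\<lambda>j. S (s j)). inj_on t {..<k}} i"
      using i by (auto simp: indicator_def PiE_iff)
    finally show "emeasure (PiM {..<k} (\<lambda>j. \<nu> (i j))) (Pi\<^sub>E {..<k} (\<lambda>j. D (s j))) = indicator {t \<in> Pi\<^sub>E {..<k} (\<lambda>j. S (s j)). inj_on t {..<k}} i" .
  qed
  also have "\<dots> = emeasure (count_space ?T) {t \<in> Pi\<^sub>E {..<k} (\<lambda>j. S (s j)). inj_on t {..<k}}"
    by (rule nn_integral_indicator) (auto simp: S_def PiE_iff)
  also have "\<dots> = of_nat (card {t \<in> Pi\<^sub>E {..<k} (\<lambda>j. S (s j)). inj_on t {..<k}})"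
    using card_inj_PiE_disjoint[of k S s] Sy Sdisj by (subst emeasure_count_space_finite) (auto simp: S_def PiE_iff)
  also have "card {t \<in> Pi\<^sub>E {..<k} (\<lambda>j. S (s j)). inj_on t {..<k}} = falling_product (\<lambda>c. card (S c)) s k"
    using card_inj_PiE_disjoint[of k S s] Sy Sdisj by auto
  also have "\<dots> = falling_product y s k"
    unfolding falling_product_def using Sy by (intro prod.cong) auto
  finally show ?thesis .
qed

definition add_points :: "('c \<Rightarrow> nat) \<Rightarrow> (nat \<Rightarrow> 'c) \<Rightarrow> nat \<Rightarrow> 'c \<Rightarrow> nat" where
  "add_points n s k c = n c + card {j. j < k \<and> s j = c}"

text \<open>The Mecke identity of order k, by peeling off the last letter: the points inserted
  before raise the count of cell \<open>s k\<close> by exactly the number subtracted in the last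
  factor, which leaves one application of \<open>mecke_nn\<close>.\<close>

lemma (in poisson_vector) mecke_falling_product:
  assumes "\<And>j. j < k \<Longrightarrow> s j \<in> I"
  shows "(\<integral>\<^sup>+n. of_nat (falling_product n s k) * \<psi> n \<partial>D) = (\<Prod>j<k. ennreal (l (s j))) * (\<integral>\<^sup>+n. \<psi> (add_points n s k) \<partial>D)"
  using assms
proof (induction k arbitrary: \<psi>)
  case 0
  have "add_points n s 0 = n" for n :: "'i \<Rightarrow> nat" by (simp add: add_points_def fun_eq_iff)
  then show ?case by (simp add: falling_product_def)
next
  case (Suc k)
  let ?m = "card {i. i < k \<and> s i = s k}"
  have Sk: "{j. j < Suc k \<and> s j = c} = (if s k = c then insert k {j. j < k \<and> s j = c} else {j. j < k \<and> s j = c})" for c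
    by (auto simp: less_Suc_eq)
  have ap: "add_points (n(s k := Suc (n (s k)))) s k = add_points n s (Suc k)" for n :: "'i \<Rightarrow> nat"
    unfolding add_points_def Sk by (auto simp: fun_eq_iff)
  have "(\<integral>\<^sup>+n. of_nat (falling_product n s (Suc k)) * \<psi> n \<partial>D) =
    (\<integral>\<^sup>+n. of_nat (falling_product n s k) * (of_nat (n (s k) - ?m) * \<psi> n) \<partial>D)"
    by (simp add: falling_product_def mult.assoc)
  also have "\<dots> = (\<Prod>j<k. ennreal (l (s j))) * (\<integral>\<^sup>+n. of_nat (add_points n s k (s k) - ?m) * \<psi> (add_points n s k) \<partial>D)"
    by (rule Suc.IH) (use Suc.prems in auto)
  also have "\<dots> = (\<Prod>j<k. ennreal (l (s j))) * (\<integral>\<^sup>+n. of_nat (n (s k)) * \<psi> (add_points n s k) \<partial>D)"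
    by (simp add: add_points_def)
  also have "\<dots> = (\<Prod>j<k. ennreal (l (s j))) * (ennreal (l (s k)) * (\<integral>\<^sup>+n. \<psi> (add_points n s (Suc k)) \<partial>D))"
    by (subst mecke_nn) (use Suc.prems ap in auto)
  finally show ?case by (simp add: mult.assoc)
qed

section \<open>Counts of a Poisson random measure\<close>

lemma countable_finite_support:
  assumes "finite L" shows "countable {n :: 'c \<Rightarrow> nat. \<forall>c. c \<notin> L \<longrightarrow> n c = 0}"
proof (rule countable_subset)
  show "countable ((\<lambda>f c. if c \<in> L then f c else 0) ` Pi\<^sub>E L (\<lambda>_. UNIV :: nat set))"
    using assms by (intro countable_image countable_PiE) auto
  show "{n :: 'c \<Rightarrow> nat. \<forall>c. c \<notin> L \<longrightarrow> n c = 0} \<subseteq> (\<lambda>f c. if c \<in> L then f c else 0) ` Pi\<^sub>E L (\<lambda>_. UNIV)"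
  proof
    fix n :: "'c \<Rightarrow> nat" assume "n \<in> {n. \<forall>c. c \<notin> L \<longrightarrow> n c = 0}"
    then have "n = (\<lambda>c. if c \<in> L then restrict n L c else 0)" by (auto simp: fun_eq_iff)
    then show "n \<in> (\<lambda>f c. if c \<in> L then f c else 0) ` Pi\<^sub>E L (\<lambda>_. UNIV)" by (rule image_eqI[where x="restrict n L"]) auto
  qed
qed

text \<open>The target carries the power set of a space that is uncountable in general, for which
  measurable coordinates would not suffice. The values lie, however, in the countable set of vectors
  supported in L.\<close>

lemma measurable_finite_support:
  fixes f :: "'a \<Rightarrow> 'c \<Rightarrow> nat"
  assumes L: "finite L" and f: "\<And>c. c \<in> L \<Longrightarrow> (\<lambda>x. f x c) \<in> measurable N (count_space UNIV)"
    and z: "\<And>x c. x \<in> space N \<Longrightarrow> c \<notin> L \<Longrightarrow> f x c = 0"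
  shows "f \<in> measurable N (count_space UNIV)"
proof (rule measurableI)
  fix S :: "('c \<Rightarrow> nat) set"
  let ?A = "{n :: 'c \<Rightarrow> nat. \<forall>c. c \<notin> L \<longrightarrow> n c = 0}"
  have cA: "countable ?A" by (rule countable_finite_support[OF L])
  have "f -` S \<inter> space N = (\<Union>n\<in>S \<inter> ?A. {x \<in> space N. \<forall>c\<in>L. f x c = n c})"
  proof (intro equalityI subsetI)
    fix x assume x: "x \<in> f -` S \<inter> space N"
    then have "f x \<in> S \<inter> ?A" using z by auto
    with x show "x \<in> (\<Union>n\<in>S \<inter> ?A. {x \<in> space N. \<forall>c\<in>L. f x c = n c})" by auto
  next
    fix x assume "x \<in> (\<Union>n\<in>S \<inter> ?A. {x \<in> space N. \<forall>c\<in>L. f x c = n c})"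
    then obtain n where n: "n \<in> S" "n \<in> ?A" "x \<in> space N" "\<forall>c\<in>L. f x c = n c" by auto
    have "f x = n"
    proof (rule ext)
      fix c show "f x c = n c" using n z[of x c] by (cases "c \<in> L") auto
    qed
    with n show "x \<in> f -` S \<inter> space N" by auto
  qed
  also have "\<dots> \<in> sets N"
  proof (rule sets.countable_UN'')
    show "countable (S \<inter> ?A)" using cA by auto
    fix n assume "n \<in> S \<inter> ?A"
    have "{x \<in> space N. f x c = n c} \<in> sets N" if "c \<in> L" for c
      using measurable_sets[OF f[OF that], of "{n c}"] by (simp add: vimage_def Int_def conj_commute)
    then show "{x \<in> space N. \<forall>c\<in>L. f x c = n c} \<in> sets N"
      using L by (intro sets.sets_Collect_finite_All) auto
  qed
  finally show "f -` S \<inter> space N \<in> sets N" .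
qed simp

section \<open>Counts of bounded sets and their joint law\<close>

locale poisson_process = prob_space P for P :: "'w measure" +
  fixes M :: "'z measure" and \<eta> :: "'w \<Rightarrow> 'z measure" and Z :: "nat \<Rightarrow> 'z set"
  assumes sf: "sigma_finite_measure M" and prm: "poisson_random_measure P M \<eta>"
    and Z_sets: "\<And>n. Z n \<in> sets M" and Z_inc: "incseq Z" and Z_un: "(\<Union>n. Z n) = space M"
    and Z_fin: "\<And>n. emeasure M (Z n) < \<infinity>"

sublocale poisson_process \<subseteq> M: sigma_finite_measure M by (rule sf)

context poisson_process
begin

text \<open>Containment in some \<open>Z n\<close> takes the place of finite measure: countably many
  conditions then make the counts of all bounded sets finite at once, outside a single null
  set.\<close>

definition bdd :: "'z set \<Rightarrow> bool" where "bdd B \<longleftrightarrow> B \<in> sets M \<and> (\<exists>n. B \<subseteq> Z n)"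

lemma bdd_sets: "bdd B \<Longrightarrow> B \<in> sets M" by (simp add: bdd_def)
lemma bdd_Z [simp]: "bdd (Z n)" using Z_sets by (auto simp: bdd_def)
lemma bdd_subset: "bdd B \<Longrightarrow> A \<in> sets M \<Longrightarrow> A \<subseteq> B \<Longrightarrow> bdd A" by (auto simp: bdd_def)
lemma bdd_fin: "bdd B \<Longrightarrow> emeasure M B < \<infinity>"
  using Z_fin emeasure_mono[of B _ M] Z_sets by (auto simp: bdd_def) (metis le_less_trans)

lemma eta_props: "\<omega> \<in> space P \<Longrightarrow> sets (\<eta> \<omega>) = sets M"
  "\<omega> \<in> space P \<Longrightarrow> B \<in> sets M \<Longrightarrow> emeasure (\<eta> \<omega>) B \<in> insert \<infinity> (range of_nat)"
  "B \<in> sets M \<Longrightarrow> (\<lambda>\<omega>. emeasure (\<eta> \<omega>) B) \<in> borel_measurable P"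
  "B \<in> sets M \<Longrightarrow> emeasure M B < \<infinity> \<Longrightarrow>
     measure P {\<omega>\<in>space P. emeasure (\<eta> \<omega>) B = of_nat k} = measure M B ^ k / fact k * exp (- measure M B)"
  using prm unfolding poisson_random_measure_def by blast+

lemma eta_indep:
  "(\<forall>i<m. B i \<in> sets M) \<Longrightarrow> disjoint_family_on B {..<m::nat} \<Longrightarrow>
    indep_vars (\<lambda>_. borel) (\<lambda>i \<omega>. emeasure (\<eta> \<omega>) (B i)) {..<m}"
  using prm unfolding poisson_random_measure_def by blast

definition good :: "'w set" where "good = {\<omega>\<in>space P. \<forall>n. emeasure (\<eta> \<omega>) (Z n) < \<infinity>}"

lemma eta_level_sets: "B \<in> sets M \<Longrightarrow> {\<omega>\<in>space P. emeasure (\<eta> \<omega>) B = c} \<in> sets P"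
  using measurable_sets[OF eta_props(3), of B "{c}"] by (simp add: vimage_def Int_def conj_commute)

lemma good_sets: "good \<in> sets P"
proof -
  have "{\<omega>\<in>space P. emeasure (\<eta> \<omega>) (Z n) < \<infinity>} \<in> sets P" for n
    using measurable_sets[OF eta_props(3)[OF Z_sets], of "{..<\<infinity>}" n] by (simp add: vimage_def Int_def conj_commute)
  then show ?thesis unfolding good_def by (intro sets.sets_Collect_countable_All)
qed

text \<open>The Poisson probabilities of the finite values add up to 1 by the exponential
  series.\<close>

lemma AE_finite:
  assumes B: "B \<in> sets M" "emeasure M B < \<infinity>"
  shows "AE \<omega> in P. emeasure (\<eta> \<omega>) B < \<infinity>"
proof -
  define A where "A k = {\<omega>\<in>space P. emeasure (\<eta> \<omega>) B = of_nat k}" for k :: nat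
  have A: "A k \<in> events" for k unfolding A_def by (rule eta_level_sets[OF B(1)])
  have "(\<lambda>k. prob (A k)) sums prob (\<Union>k. A k)"
    by (rule finite_measure_UNION) (use A in \<open>auto simp: disjoint_family_on_def A_def\<close>)
  moreover have "(\<lambda>k. prob (A k)) sums 1"
  proof -
    have "(\<lambda>k. measure M B ^ k /\<^sub>R fact k * exp (- measure M B)) sums (exp (measure M B) * exp (- measure M B))"
      by (intro sums_mult2 exp_converges)
    then show ?thesis unfolding A_def eta_props(4)[OF B]
      by (simp add: exp_minus field_simps)
  qed
  ultimately have "prob (\<Union>k. A k) = 1" by (rule sums_unique2)
  then have "AE \<omega> in P. \<omega> \<in> (\<Union>k. A k)" using A by (subst prob_eq_1[symmetric]) auto
  then show ?thesis by eventually_elim (auto simp: A_def of_nat_less_top)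
qed

lemma AE_good: "AE \<omega> in P. \<omega> \<in> good"
proof -
  have "AE \<omega> in P. \<forall>n. emeasure (\<eta> \<omega>) (Z n) < \<infinity>"
    unfolding AE_all_countable using AE_finite[OF Z_sets Z_fin] by blast
  then show ?thesis using AE_space by eventually_elim (auto simp: good_def)
qed

text \<open>Finiteness on bounded sets is guaranteed on \<open>good\<close>; the value 0 elsewhere
  keeps additivity valid for every \<omega>.\<close>

definition cnt :: "'w \<Rightarrow> 'z set \<Rightarrow> nat" where
  "cnt \<omega> B = (if \<omega> \<in> good then nat \<lfloor>enn2real (emeasure (\<eta> \<omega>) B)\<rfloor> else 0)"

lemma cnt_eq: "\<omega> \<in> good \<Longrightarrow> bdd B \<Longrightarrow> emeasure (\<eta> \<omega>) B = of_nat (cnt \<omega> B)"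
proof -
  assume w: "\<omega> \<in> good" and B: "bdd B"
  then obtain n where n: "B \<subseteq> Z n" "B \<in> sets M" by (auto simp: bdd_def)
  have "emeasure (\<eta> \<omega>) B \<le> emeasure (\<eta> \<omega>) (Z n)"
    using n eta_props(1)[of \<omega>] w Z_sets by (intro emeasure_mono) (auto simp: good_def)
  also have "\<dots> < \<infinity>" using w by (auto simp: good_def)
  finally obtain k where k: "emeasure (\<eta> \<omega>) B = of_nat k"
    using eta_props(2)[of \<omega> B] n w by (auto simp: good_def)
  then show "emeasure (\<eta> \<omega>) B = of_nat (cnt \<omega> B)"
    using w by (simp add: cnt_def ennreal_of_nat_eq_real_of_nat)
qed

lemma cnt_measurable [measurable]:
  assumes "B \<in> sets M" shows "(\<lambda>\<omega>. cnt \<omega> B) \<in> measurable P (count_space UNIV)"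
proof -
  note [measurable] = eta_props(3)[OF assms] good_sets
  show ?thesis unfolding cnt_def by measurable
qed

lemma cnt_UN:
  assumes L: "finite L" and D: "\<And>c. c \<in> L \<Longrightarrow> bdd (D c)" "disjoint_family_on D L" and B: "bdd B" "B = (\<Union>c\<in>L. D c)"
  shows "cnt \<omega> B = (\<Sum>c\<in>L. cnt \<omega> (D c))"
proof (cases "\<omega> \<in> good")
  case True
  then have s: "sets (\<eta> \<omega>) = sets M" by (auto simp: good_def eta_props)
  have "of_nat (cnt \<omega> B) = emeasure (\<eta> \<omega>) (\<Union>c\<in>L. D c)" using cnt_eq[OF True B(1)] B(2) by simp
  also have "\<dots> = (\<Sum>c\<in>L. emeasure (\<eta> \<omega>) (D c))"
    using L D s by (intro sum_emeasure[symmetric]) (auto simp: bdd_def)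
  also have "\<dots> = of_nat (\<Sum>c\<in>L. cnt \<omega> (D c))" using cnt_eq[OF True] D by simp
  finally show ?thesis by (simp del: of_nat_sum)
qed (simp add: cnt_def)

definition cells :: "'c set \<Rightarrow> ('c \<Rightarrow> 'z set) \<Rightarrow> bool" where
  "cells L D \<longleftrightarrow> finite L \<and> (\<forall>c\<in>L. bdd (D c)) \<and> disjoint_family_on D L"

definition counts :: "'c set \<Rightarrow> ('c \<Rightarrow> 'z set) \<Rightarrow> 'w \<Rightarrow> 'c \<Rightarrow> nat" where
  "counts L D \<omega> c = (if c \<in> L then cnt \<omega> (D c) else 0)"

lemma counts_measurable:
  assumes "cells L D" shows "counts L D \<in> measurable P (count_space UNIV)"
proof (rule measurable_finite_support[where L=L])
  show "finite L" using assms by (simp add: cells_def)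
  fix c assume "c \<in> L"
  then have "D c \<in> sets M" using assms by (auto simp: cells_def bdd_def)
  then show "(\<lambda>\<omega>. counts L D \<omega> c) \<in> measurable P (count_space UNIV)"
    using \<open>c \<in> L\<close> by (simp add: counts_def)
qed (simp add: counts_def)

text \<open>Independence is given for families indexed by initial segments of the naturals, hence
  the enumeration e. The empty family is separate, because an empty intersection of events is not
  the whole probability space.\<close>

lemma prob_counts:
  assumes c: "cells L D"
  shows "prob {\<omega>\<in>space P. \<forall>c\<in>L. cnt \<omega> (D c) = n c} = (\<Prod>c\<in>L. measure M (D c) ^ n c / fact (n c) * exp (- measure M (D c)))"
proof (cases "L = {}")
  case True
  then show ?thesis by (simp add: prob_space)
next
  case False
  have L: "finite L" and D: "\<And>c. c \<in> L \<Longrightarrow> bdd (D c)" and dj: "disjoint_family_on D L" using c by (auto simp: cells_def)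
  obtain e where e: "bij_betw e {..<card L} L" using ex_bij_betw_nat_finite[OF L] by (auto simp: atLeast0LessThan)
  let ?m = "card L"
  have eL: "e i \<in> L" if "i < ?m" for i using e that by (auto simp: bij_betw_def)
  have "indep_vars (\<lambda>_. borel) (\<lambda>i \<omega>. emeasure (\<eta> \<omega>) (D (e i))) {..<?m}"
  proof (rule eta_indep)
    show "\<forall>i<?m. D (e i) \<in> sets M" using D eL by (auto simp: bdd_def)
    show "disjoint_family_on (\<lambda>i. D (e i)) {..<?m}"
      unfolding disjoint_family_on_def
    proof (intro ballI impI)
      fix i j assume "i \<in> {..<?m}" "j \<in> {..<?m}" "i \<noteq> j"
      then have "e i \<noteq> e j" using e by (auto simp: bij_betw_def inj_on_def)
      then show "D (e i) \<inter> D (e j) = {}" using dj eL \<open>i \<in> _\<close> \<open>j \<in> _\<close> by (auto simp: disjoint_family_on_def)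
    qed
  qed
  from indep_varsD_finite[OF this, of "\<lambda>i. {of_nat (n (e i))}"]
  have "prob (\<Inter>i\<in>{..<?m}. (\<lambda>\<omega>. emeasure (\<eta> \<omega>) (D (e i))) -` {of_nat (n (e i))} \<inter> space P) =
    (\<Prod>i\<in>{..<?m}. prob ((\<lambda>\<omega>. emeasure (\<eta> \<omega>) (D (e i))) -` {of_nat (n (e i))} \<inter> space P))"
    using False L by (auto simp: lessThan_empty_iff)
  also have "\<dots> = (\<Prod>i\<in>{..<?m}. measure M (D (e i)) ^ n (e i) / fact (n (e i)) * exp (- measure M (D (e i))))"
  proof (intro prod.cong refl)
    fix i assume "i \<in> {..<?m}"
    then have "D (e i) \<in> sets M" "emeasure M (D (e i)) < \<infinity>" using D eL bdd_fin by (auto simp: bdd_def)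
    from eta_props(4)[OF this, of "n (e i)"]
    show "prob ((\<lambda>\<omega>. emeasure (\<eta> \<omega>) (D (e i))) -` {of_nat (n (e i))} \<inter> space P) =
       measure M (D (e i)) ^ n (e i) / fact (n (e i)) * exp (- measure M (D (e i)))"
      by (simp add: vimage_def Int_def conj_commute)
  qed
  also have "\<dots> = (\<Prod>c\<in>L. measure M (D c) ^ n c / fact (n c) * exp (- measure M (D c)))"
    by (rule prod.reindex_bij_betw[OF e])
  also have "(\<Inter>i\<in>{..<?m}. (\<lambda>\<omega>. emeasure (\<eta> \<omega>) (D (e i))) -` {of_nat (n (e i))} \<inter> space P) =
     {\<omega>\<in>space P. \<forall>c\<in>L. emeasure (\<eta> \<omega>) (D c) = of_nat (n c)}"
  proof -
    have "0 \<in> {..<?m}" using False L by auto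
    then show ?thesis unfolding bij_betw_ball[OF e] by blast
  qed
  also have "prob {\<omega>\<in>space P. \<forall>c\<in>L. emeasure (\<eta> \<omega>) (D c) = of_nat (n c)} = prob {\<omega>\<in>space P. \<forall>c\<in>L. cnt \<omega> (D c) = n c}"
  proof (rule finite_measure_eq_AE)
    show "AE \<omega> in P. (\<omega> \<in> {\<omega>\<in>space P. \<forall>c\<in>L. emeasure (\<eta> \<omega>) (D c) = of_nat (n c)}) = (\<omega> \<in> {\<omega>\<in>space P. \<forall>c\<in>L. cnt \<omega> (D c) = n c})"
      using AE_good by eventually_elim (auto simp: cnt_eq[OF _ D])
    show "{\<omega>\<in>space P. \<forall>c\<in>L. emeasure (\<eta> \<omega>) (D c) = of_nat (n c)} \<in> events"
      using L D by (intro sets.sets_Collect_finite_All eta_level_sets) (auto simp: bdd_def)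
    have "{\<omega>\<in>space P. cnt \<omega> (D c) = n c} \<in> events" if "c \<in> L" for c
      using measurable_sets[OF cnt_measurable[OF bdd_sets[OF D[OF that]]], of "{n c}"]
      by (simp add: vimage_def Int_def conj_commute)
    then show "{\<omega>\<in>space P. \<forall>c\<in>L. cnt \<omega> (D c) = n c} \<in> events"
      using L by (intro sets.sets_Collect_finite_All) auto
  qed
  finally show ?thesis .
qed

definition law :: "'c set \<Rightarrow> ('c \<Rightarrow> 'z set) \<Rightarrow> ('c \<Rightarrow> nat) measure" where
  "law L D = distr P (count_space UNIV) (counts L D)"

lemma nn_integral_law:
  assumes "cells L D" shows "(\<integral>\<^sup>+n. \<psi> n \<partial>law L D) = (\<integral>\<^sup>+\<omega>. \<psi> (counts L D \<omega>) \<partial>P)"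
  unfolding law_def by (rule nn_integral_distr[OF counts_measurable[OF assms]]) simp

text \<open>The counts take values in a countable set, so their law is a sum of point masses, and
  the weight of each point is the product of Poisson probabilities.\<close>

lemma nn_integral_law_sum:
  fixes L :: "'c set" and \<psi> :: "('c \<Rightarrow> nat) \<Rightarrow> ennreal"
  assumes c: "cells L D"
  shows "(\<integral>\<^sup>+n. \<psi> n \<partial>law L D) =
    (\<integral>\<^sup>+n. \<psi> n * ennreal (\<Prod>c\<in>L. measure M (D c) ^ n c / fact (n c) * exp (- measure M (D c))) \<partial>count_space {n. \<forall>c. c \<notin> L \<longrightarrow> n c = 0})"
proof -
  let ?C = "{n :: 'c \<Rightarrow> nat. \<forall>c. c \<notin> L \<longrightarrow> n c = 0}"
  have fL: "finite L" using c by (simp add: cells_def)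
  have ev: "{\<omega>\<in>space P. counts L D \<omega> = n} \<in> events" for n
    using measurable_sets[OF counts_measurable[OF c], of "{n}"] by (simp add: vimage_def Int_def conj_commute)
  have "(\<integral>\<^sup>+n. \<psi> n \<partial>law L D) = (\<integral>\<^sup>+\<omega>. \<psi> (counts L D \<omega>) \<partial>P)" by (rule nn_integral_law[OF c])
  also have "\<dots> = (\<integral>\<^sup>+\<omega>. (\<integral>\<^sup>+n. \<psi> n * indicator {\<omega>\<in>space P. counts L D \<omega> = n} \<omega> \<partial>count_space ?C) \<partial>P)"
  proof (rule nn_integral_cong)
    fix \<omega> assume w: "\<omega> \<in> space P"
    have "(\<integral>\<^sup>+n. \<psi> n * indicator {\<omega>\<in>space P. counts L D \<omega> = n} \<omega> \<partial>count_space ?C) =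
      (\<integral>\<^sup>+n. \<psi> (counts L D \<omega>) * indicator {counts L D \<omega>} n \<partial>count_space ?C)"
      by (rule nn_integral_cong) (use w in \<open>auto simp: indicator_def\<close>)
    also have "\<dots> = \<psi> (counts L D \<omega>)"
      by (subst nn_integral_cmult_indicator) (auto simp: counts_def)
    finally show "\<psi> (counts L D \<omega>) = (\<integral>\<^sup>+n. \<psi> n * indicator {\<omega>\<in>space P. counts L D \<omega> = n} \<omega> \<partial>count_space ?C)" ..
  qed
  also have "\<dots> = (\<integral>\<^sup>+n. (\<integral>\<^sup>+\<omega>. \<psi> n * indicator {\<omega>\<in>space P. counts L D \<omega> = n} \<omega> \<partial>P) \<partial>count_space ?C)"
    by (rule nn_integral_count_space_nn_integral[OF countable_finite_support[OF fL]])
       (use ev in \<open>auto intro!: borel_measurable_times_ennreal\<close>)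
  also have "\<dots> = (\<integral>\<^sup>+n. \<psi> n * ennreal (\<Prod>c\<in>L. measure M (D c) ^ n c / fact (n c) * exp (- measure M (D c))) \<partial>count_space ?C)"
  proof (rule nn_integral_cong)
    fix n assume n: "n \<in> space (count_space ?C)"
    have "{\<omega>\<in>space P. counts L D \<omega> = n} = {\<omega>\<in>space P. \<forall>c\<in>L. cnt \<omega> (D c) = n c}"
      using n by (auto simp: counts_def fun_eq_iff)
    then show "(\<integral>\<^sup>+\<omega>. \<psi> n * indicator {\<omega>\<in>space P. counts L D \<omega> = n} \<omega> \<partial>P) =
      \<psi> n * ennreal (\<Prod>c\<in>L. measure M (D c) ^ n c / fact (n c) * exp (- measure M (D c)))"
      using ev[of n] prob_counts[OF c, of n] by (simp add: nn_integral_cmult_indicator emeasure_eq_measure)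
  qed
  finally show ?thesis .
qed

text \<open>With e_j the unit vector, the Poisson weights satisfy (n j + 1) p(n + e_j) = \<mu>(D j)
  p(n). The Mecke identity is this relation summed along the bijection n to n + e_j onto the vectors
  with positive entry at j.\<close>

lemma poisson_vector_law:
  assumes c: "cells L D" shows "poisson_vector (law L D) L (\<lambda>c. measure M (D c))"
proof -
  interpret law: prob_space "law L D"
    unfolding law_def by (rule prob_space_distr[OF counts_measurable[OF c]])
  have fL: "finite L" using c by (simp add: cells_def)
  show ?thesis
  proof
    show "finite L" by (rule fL)
    show "sets (law L D) = UNIV" by (simp add: law_def)
    fix j and \<psi> :: "('a \<Rightarrow> nat) \<Rightarrow> ennreal" assume j: "j \<in> L"
    let ?C = "{n :: 'a \<Rightarrow> nat. \<forall>c. c \<notin> L \<longrightarrow> n c = 0}"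
    define p where "p n = (\<Prod>c\<in>L. measure M (D c) ^ n c / fact (n c) * exp (- measure M (D c)))" for n
    have p_Suc: "real (Suc (n j)) * p (n(j := Suc (n j))) = measure M (D j) * p n" for n
      unfolding p_def by (simp add: prod.remove[OF fL j] field_simps del: of_nat_Suc)
    have p_nn: "0 \<le> p n" for n unfolding p_def by (intro prod_nonneg) auto
    let ?C1 = "{n \<in> ?C. 0 < n j}"
    have "(\<integral>\<^sup>+n. of_nat (n j) * \<psi> n \<partial>law L D) = (\<integral>\<^sup>+n. of_nat (n j) * \<psi> n * ennreal (p n) \<partial>count_space ?C)"
      unfolding p_def by (rule nn_integral_law_sum[OF c])
    also have "\<dots> = (\<integral>\<^sup>+n. of_nat (n j) * \<psi> n * ennreal (p n) \<partial>count_space ?C1)"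
      by (subst (1 2) nn_integral_count_space_indicator) (auto intro!: nn_integral_cong simp: indicator_def)
    also have "\<dots> = (\<integral>\<^sup>+n. of_nat ((n(j := Suc (n j))) j) * \<psi> (n(j := Suc (n j))) * ennreal (p (n(j := Suc (n j)))) \<partial>count_space ?C)"
    proof (rule nn_integral_bij_count_space[symmetric])
      show "bij_betw (\<lambda>n. n(j := Suc (n j))) ?C ?C1"
        by (rule bij_betwI[where g="\<lambda>n. n(j := n j - 1)"]) (use j in \<open>auto simp: fun_eq_iff\<close>)
    qed
    also have "\<dots> = (\<integral>\<^sup>+n. ennreal (measure M (D j)) * (\<psi> (n(j := Suc (n j))) * ennreal (p n)) \<partial>count_space ?C)"
    proof (rule nn_integral_cong)
      fix n
      have "of_nat ((n(j := Suc (n j))) j) * ennreal (p (n(j := Suc (n j)))) = ennreal (measure M (D j)) * ennreal (p n)"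
        using p_Suc[of n] p_nn by (simp add: ennreal_of_nat_eq_real_of_nat flip: ennreal_mult del: of_nat_Suc)
      then show "of_nat ((n(j := Suc (n j))) j) * \<psi> (n(j := Suc (n j))) * ennreal (p (n(j := Suc (n j)))) =
        ennreal (measure M (D j)) * (\<psi> (n(j := Suc (n j))) * ennreal (p n))"
        by (simp only: mult_ac)
    qed
    also have "\<dots> = ennreal (measure M (D j)) * (\<integral>\<^sup>+n. \<psi> (n(j := Suc (n j))) * ennreal (p n) \<partial>count_space ?C)"
      by (rule nn_integral_cmult) simp
    also have "(\<integral>\<^sup>+n. \<psi> (n(j := Suc (n j))) * ennreal (p n) \<partial>count_space ?C) = (\<integral>\<^sup>+n. \<psi> (n(j := Suc (n j))) \<partial>law L D)"
      unfolding p_def by (rule nn_integral_law_sum[OF c, symmetric])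
    finally show "(\<integral>\<^sup>+n. of_nat (n j) * \<psi> n \<partial>law L D) = ennreal (measure M (D j)) * (\<integral>\<^sup>+n. \<psi> (n(j := Suc (n j))) \<partial>law L D)" .
  qed simp
qed

section \<open>Disjoint cells generated by overlapping bounded sets\<close>

definition cell :: "'z set set \<Rightarrow> 'z set set \<Rightarrow> 'z set" where
  "cell \<B> S = {x \<in> space M. \<forall>B\<in>\<B>. x \<in> B \<longleftrightarrow> B \<in> S}"

text \<open>The empty index would name the complement of the union of \<B>, which is unbounded in
  general, so it is left out.\<close>

definition cell_ids :: "'z set set \<Rightarrow> 'z set set set" where
  "cell_ids \<B> = Pow \<B> - {{}}"

lemma cell_sets:
  assumes "finite \<B>" "\<forall>B\<in>\<B>. bdd B" shows "cell \<B> S \<in> sets M"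
proof -
  have "{x \<in> space M. x \<in> B \<longleftrightarrow> B \<in> S} \<in> sets M" if "B \<in> \<B>" for B
  proof -
    have "B \<in> sets M" using assms(2)[rule_format, OF that] by (rule bdd_sets)
    then have "{x \<in> space M. x \<in> B \<longleftrightarrow> B \<in> S} = (if B \<in> S then B else space M - B)"
      using sets.sets_into_space by auto
    then show ?thesis using \<open>B \<in> sets M\<close> by simp
  qed
  then show ?thesis unfolding cell_def using assms(1) by (intro sets.sets_Collect_finite_All) auto
qed

lemma cells_cell:
  assumes "finite \<B>" "\<forall>B\<in>\<B>. bdd B" shows "cells (cell_ids \<B>) (cell \<B>)"
  unfolding cells_def
proof (intro conjI ballI)
  show "finite (cell_ids \<B>)" using assms by (simp add: cell_ids_def)
  fix S assume "S \<in> cell_ids \<B>"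
  then obtain B where B: "B \<in> S" "B \<in> \<B>" by (auto simp: cell_ids_def)
  have "cell \<B> S \<subseteq> B" using B by (auto simp: cell_def)
  then show "bdd (cell \<B> S)" using bdd_subset[OF _ cell_sets[OF assms]] assms(2) B(2) by blast
next
  show "disjoint_family_on (cell \<B>) (cell_ids \<B>)"
    unfolding disjoint_family_on_def
  proof (intro ballI impI)
    fix S S' assume S: "S \<in> cell_ids \<B>" "S' \<in> cell_ids \<B>" "S \<noteq> S'"
    then obtain B where "B \<in> \<B>" "(B \<in> S) \<noteq> (B \<in> S')" by (auto simp: cell_ids_def)
    then show "cell \<B> S \<inter> cell \<B> S' = {}" by (auto simp: cell_def)
  qed
qed

lemma UN_cell:
  assumes "B \<in> \<B>" "bdd B" shows "B = (\<Union>S\<in>{S \<in> cell_ids \<B>. B \<in> S}. cell \<B> S)"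
proof (intro equalityI subsetI)
  fix x assume x: "x \<in> B"
  then have "x \<in> space M" using bdd_sets[OF assms(2)] sets.sets_into_space by blast
  then have "x \<in> cell \<B> {C \<in> \<B>. x \<in> C}" by (auto simp: cell_def)
  moreover have "{C \<in> \<B>. x \<in> C} \<in> {S \<in> cell_ids \<B>. B \<in> S}" using x assms by (auto simp: cell_ids_def)
  ultimately show "x \<in> (\<Union>S\<in>{S \<in> cell_ids \<B>. B \<in> S}. cell \<B> S)" by blast
next
  fix x assume "x \<in> (\<Union>S\<in>{S \<in> cell_ids \<B>. B \<in> S}. cell \<B> S)"
  then show "x \<in> B" using assms by (auto simp: cell_def)
qed

lemma mem_cell_iff: "x \<in> cell \<B> S \<Longrightarrow> B \<in> \<B> \<Longrightarrow> x \<in> B \<longleftrightarrow> B \<in> S"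
  by (auto simp: cell_def)

text \<open>Counts of overlapping sets become sums of counts of disjoint cells, whose joint law is
  known.\<close>

lemma cnt_refine:
  assumes "finite \<B>" "\<forall>B\<in>\<B>. bdd B" "B \<in> \<B>"
  shows "cnt \<omega> B = (\<Sum>S\<in>{S \<in> cell_ids \<B>. B \<in> S}. counts (cell_ids \<B>) (cell \<B>) \<omega> S)"
proof -
  have c: "cells (cell_ids \<B>) (cell \<B>)" by (rule cells_cell[OF assms(1,2)])
  have "cnt \<omega> B = (\<Sum>S\<in>{S \<in> cell_ids \<B>. B \<in> S}. cnt \<omega> (cell \<B> S))"
  proof (rule cnt_UN)
    show "disjoint_family_on (cell \<B>) {S \<in> cell_ids \<B>. B \<in> S}"
      using c by (auto simp: cells_def disjoint_family_on_def)
    show "B = (\<Union>S\<in>{S \<in> cell_ids \<B>. B \<in> S}. cell \<B> S)" using UN_cell assms by blast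
  qed (use c assms in \<open>auto simp: cells_def\<close>)
  then show ?thesis by (simp add: counts_def)
qed

section \<open>Factorial measures of rectangles as functions of counts\<close>

abbreviation "Mk k \<equiv> PiM {..<k::nat} (\<lambda>_. M)"

definition rect :: "nat \<Rightarrow> (nat \<Rightarrow> 'z set) \<Rightarrow> (nat \<Rightarrow> 'z) set" where
  "rect k B = Pi\<^sub>E {..<k} B"

definition cell_maps :: "nat \<Rightarrow> 'z set set \<Rightarrow> (nat \<Rightarrow> 'z set) \<Rightarrow> (nat \<Rightarrow> 'z set set) set" where
  "cell_maps k \<B> B = Pi\<^sub>E {..<k} (\<lambda>j. {S \<in> cell_ids \<B>. B j \<in> S})"

lemma rect_sets: "(\<And>j. j < k \<Longrightarrow> B j \<in> sets M) \<Longrightarrow> rect k B \<in> sets (Mk k)"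
  unfolding rect_def by (intro sets_PiM_I_finite) auto

lemma rect_cells:
  assumes "finite \<B>" "\<forall>B\<in>\<B>. bdd B" and B: "\<forall>j<k. B j \<in> \<B>"
  shows "rect k B = (\<Union>s\<in>cell_maps k \<B> B. rect k (\<lambda>j. cell \<B> (s j)))"
    "disjoint_family_on (\<lambda>s. rect k (\<lambda>j. cell \<B> (s j))) (cell_maps k \<B> B)" "finite (cell_maps k \<B> B)"
proof -
  have c: "cells (cell_ids \<B>) (cell \<B>)" by (rule cells_cell[OF assms(1,2)])
  show "finite (cell_maps k \<B> B)"
    unfolding cell_maps_def using c by (intro finite_PiE) (auto simp: cells_def)
  show "rect k B = (\<Union>s\<in>cell_maps k \<B> B. rect k (\<lambda>j. cell \<B> (s j)))"
  proof (intro equalityI subsetI)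
    fix x assume x: "x \<in> rect k B"
    have "\<exists>S\<in>{S \<in> cell_ids \<B>. B j \<in> S}. x j \<in> cell \<B> S" if j: "j < k" for j
    proof -
      have "x j \<in> B j" using x j by (auto simp: rect_def)
      then show ?thesis using UN_cell[of "B j" \<B>] B assms(2) j by blast
    qed
    then obtain s where s: "\<And>j. j < k \<Longrightarrow> s j \<in> {S \<in> cell_ids \<B>. B j \<in> S} \<and> x j \<in> cell \<B> (s j)" by metis
    have "restrict s {..<k} \<in> cell_maps k \<B> B" using s by (auto simp: cell_maps_def)
    moreover have "x \<in> rect k (\<lambda>j. cell \<B> (restrict s {..<k} j))"
      using s x by (auto simp: rect_def PiE_iff)
    ultimately show "x \<in> (\<Union>s\<in>cell_maps k \<B> B. rect k (\<lambda>j. cell \<B> (s j)))" by blast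
  next
    fix x assume "x \<in> (\<Union>s\<in>cell_maps k \<B> B. rect k (\<lambda>j. cell \<B> (s j)))"
    then obtain s where s: "s \<in> cell_maps k \<B> B" "x \<in> rect k (\<lambda>j. cell \<B> (s j))" by blast
    have "x j \<in> B j" if j: "j < k" for j
      using s j B mem_cell_iff[of "x j" \<B> "s j" "B j"] by (auto simp: cell_maps_def rect_def PiE_iff)
    then show "x \<in> rect k B" using s(2) by (auto simp: rect_def PiE_iff)
  qed
  show "disjoint_family_on (\<lambda>s. rect k (\<lambda>j. cell \<B> (s j))) (cell_maps k \<B> B)"
    unfolding disjoint_family_on_def
  proof (intro ballI impI)
    fix s s' assume s: "s \<in> cell_maps k \<B> B" "s' \<in> cell_maps k \<B> B" "s \<noteq> s'"
    have "\<exists>j<k. s j \<noteq> s' j"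
    proof (rule ccontr)
      assume "\<not> (\<exists>j<k. s j \<noteq> s' j)"
      then have "s = s'" using s(1,2) unfolding cell_maps_def by (intro PiE_ext[of s _ _ s']) auto
      with s(3) show False by simp
    qed
    then obtain j where j: "j < k" "s j \<noteq> s' j" by blast
    then have "s j \<in> cell_ids \<B>" "s' j \<in> cell_ids \<B>" using s by (auto simp: cell_maps_def PiE_iff)
    then have d: "cell \<B> (s j) \<inter> cell \<B> (s' j) = {}" using c j by (auto simp: cells_def disjoint_family_on_def)
    show "rect k (\<lambda>j. cell \<B> (s j)) \<inter> rect k (\<lambda>j. cell \<B> (s' j)) = {}"
    proof (rule ccontr)
      assume "rect k (\<lambda>j. cell \<B> (s j)) \<inter> rect k (\<lambda>j. cell \<B> (s' j)) \<noteq> {}"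
      then obtain x where "x \<in> rect k (\<lambda>j. cell \<B> (s j))" "x \<in> rect k (\<lambda>j. cell \<B> (s' j))" by blast
      then have "x j \<in> cell \<B> (s j) \<inter> cell \<B> (s' j)" using j by (auto simp: rect_def PiE_iff)
      with d show False by blast
    qed
  qed
qed

lemma emeasure_rect_cells:
  assumes "finite \<B>" "\<forall>B\<in>\<B>. bdd B" and B: "\<forall>j<k. B j \<in> \<B>" and K: "sets K = sets (Mk k)"
  shows "emeasure K (rect k B) = (\<Sum>s\<in>cell_maps k \<B> B. emeasure K (rect k (\<lambda>j. cell \<B> (s j))))"
  unfolding rect_cells(1)[OF assms(1-3)]
  using rect_cells(2,3)[OF assms(1-3)] K rect_sets cell_sets[OF assms(1,2)]
  by (intro sum_emeasure[symmetric]) auto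

text \<open>Outside the event \<open>good\<close> the factorial measures are those of the empty configuration, so that
  the formula in terms of \<open>cnt\<close> holds everywhere.\<close>

definition factorial_at :: "nat \<Rightarrow> 'w \<Rightarrow> (nat \<Rightarrow> 'z) measure" where
  "factorial_at k \<omega> = (if \<omega> \<in> good then factorial_measure k M (\<eta> \<omega>) else distinct_tuples_measure k M {} (\<lambda>_. M))"

text \<open>Puts both cases of \<open>factorial_at\<close> into one form, which spares later proofs
  the case distinction: on \<open>good\<close> the choice operator picks a decomposition because one
  exists; elsewhere the empty decomposition of the null measure matches counts equal to 0.\<close>

lemma factorial_at_decomposition:
  assumes w: "\<omega> \<in> space P"
  shows "\<exists>N J \<nu>. atom_decomposition M N J \<nu> \<and> (\<forall>k. factorial_at k \<omega> = distinct_tuples_measure k M J \<nu>) \<and>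
    (\<forall>B. bdd B \<longrightarrow> emeasure N B = of_nat (cnt \<omega> B))"
proof (cases "\<omega> \<in> good")
  case True
  have "\<exists>J \<nu>. atom_decomposition M (\<eta> \<omega>) J \<nu>"
  proof (rule atom_decomposition_exists[where Z="disjointed Z"])
    show "sets (\<eta> \<omega>) = sets M" "\<And>A. A \<in> sets M \<Longrightarrow> emeasure (\<eta> \<omega>) A \<in> insert \<infinity> (range of_nat)"
      using eta_props w by auto
    show "\<And>n. disjointed Z n \<in> sets M" using Z_sets sets.range_disjointed_sets[of Z M] by auto
    show "disjoint_family (disjointed Z)" by (rule disjoint_family_disjointed)
    show "(\<Union>n. disjointed Z n) = space M" by (simp add: UN_disjointed_eq Z_un)
    fix n
    have "emeasure (\<eta> \<omega>) (disjointed Z n) \<le> emeasure (\<eta> \<omega>) (Z n)"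
      using eta_props(1)[OF w] Z_sets disjointed_subset[of Z n] by (intro emeasure_mono) auto
    also have "\<dots> < \<infinity>" using True by (auto simp: good_def)
    finally show "emeasure (\<eta> \<omega>) (disjointed Z n) < \<infinity>" .
  qed
  then have ex: "\<exists>p. (case p of (J, \<nu>) \<Rightarrow> atom_decomposition M (\<eta> \<omega>) J \<nu>)" by auto
  obtain J \<nu> where p: "(SOME (J, \<nu>). atom_decomposition M (\<eta> \<omega>) J \<nu>) = (J, \<nu>)" by (cases "SOME (J, \<nu>). atom_decomposition M (\<eta> \<omega>) J \<nu>") auto
  have ad: "atom_decomposition M (\<eta> \<omega>) J \<nu>" using someI_ex[OF ex] unfolding p by simp
  show ?thesis
  proof (intro exI conjI allI impI)
    show "atom_decomposition M (\<eta> \<omega>) J \<nu>" by (rule ad)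
    show "factorial_at k \<omega> = distinct_tuples_measure k M J \<nu>" for k
      using True p by (simp add: factorial_at_def factorial_measure_def)
  qed (use cnt_eq True in auto)
next
  case False
  show ?thesis
  proof (intro exI conjI allI impI)
    show "atom_decomposition M (null_measure M) {} (\<lambda>_. M)"
      by (auto simp: atom_decomposition_def nn_integral_count_space_finite)
    show "factorial_at k \<omega> = distinct_tuples_measure k M {} (\<lambda>_. M)" for k using False by (simp add: factorial_at_def)
  qed (use False in \<open>simp add: cnt_def\<close>)
qed

lemma sets_factorial_at: assumes "\<omega> \<in> space P" shows "sets (factorial_at k \<omega>) = sets (Mk k)"
proof -
  obtain N J \<nu> where "atom_decomposition M N J \<nu>" and factorial_at: "\<And>k. factorial_at k \<omega> = distinct_tuples_measure k M J \<nu>"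
    and "\<And>B. bdd B \<Longrightarrow> emeasure N B = of_nat (cnt \<omega> B)" using factorial_at_decomposition[OF assms] by auto
  show ?thesis by (simp add: factorial_at)
qed

lemma space_factorial_at: "\<omega> \<in> space P \<Longrightarrow> space (factorial_at k \<omega>) = space (Mk k)"
  by (rule sets_eq_imp_space_eq[OF sets_factorial_at])

lemma factorial_at_cells:
  assumes c: "cells L D" and s: "\<And>j. j < k \<Longrightarrow> s j \<in> L" and w: "\<omega> \<in> space P"
  shows "emeasure (factorial_at k \<omega>) (rect k (\<lambda>j. D (s j))) = of_nat (falling_product (counts L D \<omega>) s k)"
proof -
  obtain N J \<nu> where ad: "atom_decomposition M N J \<nu>" and factorial_at: "\<And>k. factorial_at k \<omega> = distinct_tuples_measure k M J \<nu>"
    and cnt: "\<And>B. bdd B \<Longrightarrow> emeasure N B = of_nat (cnt \<omega> B)" using factorial_at_decomposition[OF w] by auto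
  show ?thesis
    unfolding factorial_at rect_def
  proof (rule distinct_tuples_measure_cells[OF ad])
    fix j assume j: "j < k"
    have b: "bdd (D (s j))" using c s[OF j] by (auto simp: cells_def)
    show "D (s j) \<in> sets M" using b by (rule bdd_sets)
    show "emeasure N (D (s j)) = of_nat (counts L D \<omega> (s j))" using cnt[OF b] s[OF j] by (simp add: counts_def)
    fix i assume "i < k" "s i \<noteq> s j"
    then show "D (s i) \<inter> D (s j) = {}" using c s s[OF j] by (auto simp: cells_def disjoint_family_on_def)
  qed
qed

text \<open>Overlapping sides are cut into cells, and each word of cells contributes a falling
  product. Hence the value on a rectangle is a function of finitely many counts.\<close>

lemma factorial_at_rect:
  assumes "finite \<B>" "\<forall>B\<in>\<B>. bdd B" and B: "\<forall>j<k. B j \<in> \<B>" and w: "\<omega> \<in> space P"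
  shows "emeasure (factorial_at k \<omega>) (rect k B) = (\<Sum>s\<in>cell_maps k \<B> B. of_nat (falling_product (counts (cell_ids \<B>) (cell \<B>) \<omega>) s k))"
  unfolding emeasure_rect_cells[OF assms(1-3) sets_factorial_at[OF w]]
  by (intro sum.cong refl factorial_at_cells cells_cell assms) (auto simp: cell_maps_def)

section \<open>The sigma-algebra of bounded counts\<close>

text \<open>Through \<open>id\<close> each set serves as its own index, so that conditions on
  different families of sets, overlapping or not, can be combined on the union of the
  families.\<close>

definition cylinder :: "'w set set" where
  "cylinder = {{\<omega>\<in>space P. \<psi> (counts J id \<omega>)} | J \<psi>. finite J \<and> (\<forall>B\<in>J. bdd B)}"

text \<open>Measurability of the pathwise integrals with respect to this algebra, and not merely
  with respect to P, is what later makes them limits of functions of finitely many counts.\<close>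

definition cylinder_algebra :: "'w measure" where "cylinder_algebra = sigma (space P) cylinder"

lemma counts_id_measurable:
  assumes J: "finite J" "\<forall>B\<in>J. bdd B" shows "counts J id \<in> measurable P (count_space UNIV)"
proof (rule measurable_finite_support[OF J(1)])
  fix B assume "B \<in> J"
  then show "(\<lambda>\<omega>. counts J id \<omega> B) \<in> measurable P (count_space UNIV)"
    using J cnt_measurable[OF bdd_sets] by (auto simp: counts_def)
qed (simp add: counts_def)

lemma cylinder_events: "cylinder \<subseteq> events"
proof
  fix E assume "E \<in> cylinder"
  then obtain J \<psi> where J: "finite J" "\<forall>B\<in>J. bdd B" and E: "E = {\<omega>\<in>space P. \<psi> (counts J id \<omega>)}" by (auto simp: cylinder_def)
  have "E = counts J id -` {n. \<psi> n} \<inter> space P" by (auto simp: E)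
  then show "E \<in> events" using measurable_sets[OF counts_id_measurable[OF J], of "{n. \<psi> n}"] by simp
qed

lemma cylinder_Pow: "cylinder \<subseteq> Pow (space P)" using cylinder_events sets.space_closed by blast

lemma space_cylinder_algebra [simp]: "space cylinder_algebra = space P" and sets_cylinder_algebra: "sets cylinder_algebra = sigma_sets (space P) cylinder"
  using cylinder_Pow by (simp_all add: cylinder_algebra_def)

lemma cylinder_algebra_subalgebra: "subalgebra P cylinder_algebra"
  unfolding subalgebra_def using cylinder_events by (simp add: sets_cylinder_algebra sets.sigma_sets_subset)

lemma cylinder_algebra_measurableD: "f \<in> measurable cylinder_algebra K \<Longrightarrow> f \<in> measurable P K"
  by (rule measurable_from_subalg[OF cylinder_algebra_subalgebra])

lemma cnt_cylinder_algebra: assumes "bdd B" shows "(\<lambda>\<omega>. cnt \<omega> B) \<in> measurable cylinder_algebra (count_space UNIV)"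
proof (rule measurableI)
  fix A :: "nat set"
  have "(\<lambda>\<omega>. cnt \<omega> B) -` A \<inter> space cylinder_algebra = {\<omega>\<in>space P. counts {B} id \<omega> B \<in> A}" by (auto simp: counts_def)
  also have "\<dots> \<in> cylinder" unfolding cylinder_def using assms by (intro CollectI exI[of _ "{B}"] exI[of _ "\<lambda>n. n B \<in> A"]) auto
  finally show "(\<lambda>\<omega>. cnt \<omega> B) -` A \<inter> space cylinder_algebra \<in> sets cylinder_algebra" by (auto simp: sets_cylinder_algebra)
qed simp

lemma counts_cylinder_algebra: assumes c: "cells L D" shows "counts L D \<in> measurable cylinder_algebra (count_space UNIV)"
proof (rule measurable_finite_support[where L=L])
  show "finite L" using c by (simp add: cells_def)
  fix c' assume "c' \<in> L"
  then show "(\<lambda>\<omega>. counts L D \<omega> c') \<in> measurable cylinder_algebra (count_space UNIV)"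
    using c cnt_cylinder_algebra by (auto simp: counts_def cells_def)
qed (simp add: counts_def)

section \<open>The Campbell formula\<close>

definition point_counts :: "'c set \<Rightarrow> ('c \<Rightarrow> 'z set) \<Rightarrow> nat set \<Rightarrow> (nat \<Rightarrow> 'z) \<Rightarrow> 'c \<Rightarrow> nat" where
  "point_counts L D K x c = (if c \<in> L then card {j \<in> K. x j \<in> D c} else 0)"

text \<open>The mean of \<phi> after the points x j with j in K have been added to the
  configuration, the integrand on the right-hand side of the Mecke formula.\<close>

definition shifted :: "'c set \<Rightarrow> ('c \<Rightarrow> 'z set) \<Rightarrow> (('c \<Rightarrow> nat) \<Rightarrow> ennreal) \<Rightarrow> nat set \<Rightarrow> (nat \<Rightarrow> 'z) \<Rightarrow> ennreal" where
  "shifted L D \<phi> K x = (\<integral>\<^sup>+\<omega>. \<phi> (\<lambda>c. counts L D \<omega> c + point_counts L D K x c) \<partial>P)"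

lemma point_counts_measurable:
  assumes c: "cells L D" and K: "finite K" "K \<subseteq> I" shows "point_counts L D K \<in> measurable (PiM I (\<lambda>_. M)) (count_space UNIV)"
proof (rule measurable_finite_support[where L=L])
  show "finite L" using c by (simp add: cells_def)
  fix c' assume c': "c' \<in> L"
  have [measurable]: "D c' \<in> sets M" using c c' by (auto simp: cells_def bdd_def)
  have [measurable]: "(\<lambda>x. x j) \<in> measurable (PiM I (\<lambda>_. M)) M" if "j \<in> K" for j
    using that K by (intro measurable_component_singleton) auto
  have "point_counts L D K x c' = (\<Sum>j\<in>K. if x j \<in> D c' then 1 else 0)" for x
    using c' K by (simp add: point_counts_def sum.If_cases Int_def)
  moreover have "(\<lambda>x. \<Sum>j\<in>K. if x j \<in> D c' then 1 else 0 :: nat) \<in> measurable (PiM I (\<lambda>_. M)) (count_space UNIV)"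
    by measurable
  ultimately show "(\<lambda>x. point_counts L D K x c') \<in> measurable (PiM I (\<lambda>_. M)) (count_space UNIV)" by simp
qed (simp add: point_counts_def)

lemma shifted_measurable:
  assumes c: "cells L D" and K: "finite K" "K \<subseteq> I" shows "shifted L D \<phi> K \<in> borel_measurable (PiM I (\<lambda>_. M))"
  unfolding shifted_def
  by (rule measurable_compose[OF point_counts_measurable[OF assms], where g="\<lambda>m. \<integral>\<^sup>+\<omega>. \<phi> (\<lambda>c. counts L D \<omega> c + m c) \<partial>P"]) simp

lemma fun_counts_measurable: "cells L D \<Longrightarrow> (\<lambda>\<omega>. g (counts L D \<omega>)) \<in> measurable P N" if "\<And>n. g n \<in> space N"
  by (rule measurable_compose[OF counts_measurable]) (use that in auto)

lemma fun_counts_cylinder_algebra: "cells L D \<Longrightarrow> (\<lambda>\<omega>. g (counts L D \<omega>)) \<in> measurable cylinder_algebra N" if "\<And>n. g n \<in> space N"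
  by (rule measurable_compose[OF counts_cylinder_algebra]) (use that in auto)

lemma factorial_at_rect_cylinder_algebra:
  assumes B: "\<forall>j<k. bdd (B j)"
  shows "(\<lambda>\<omega>. emeasure (factorial_at k \<omega>) (rect k B)) \<in> borel_measurable cylinder_algebra"
proof -
  let ?\<B> = "B ` {..<k}"
  have b: "finite ?\<B>" "\<forall>C\<in>?\<B>. bdd C" "\<forall>j<k. B j \<in> ?\<B>" using B by auto
  have "(\<lambda>\<omega>. \<Sum>s\<in>cell_maps k ?\<B> B. of_nat (falling_product (counts (cell_ids ?\<B>) (cell ?\<B>) \<omega>) s k)) \<in> borel_measurable cylinder_algebra"
    by (rule fun_counts_cylinder_algebra[OF _ cells_cell[OF b(1,2)]]) auto
  then show ?thesis
    by (subst measurable_cong[OF factorial_at_rect[OF b]]) auto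
qed

lemma emeasure_Mk_rect:
  assumes "\<And>j. j < k \<Longrightarrow> B j \<in> sets M" shows "emeasure (Mk k) (rect k B) = (\<Prod>j<k. emeasure M (B j))"
proof -
  interpret product_sigma_finite "\<lambda>_::nat. M" by (simp add: product_sigma_finite_def sf)
  show ?thesis unfolding rect_def using assms by (intro emeasure_PiM) auto
qed

text \<open>The cells are refined together with the sides of the rectangle, so that \<phi> and the
  factorial measure become functions of the counts of one disjoint family. On each word of fine
  cells \<open>shifted\<close> is constant and the identity is
  \<open>mecke_falling_product\<close>.\<close>

lemma campbell_rect:
  fixes L :: "'c set"
  assumes c: "cells L D" and B: "\<forall>j<k. bdd (B j)"
  shows "(\<integral>\<^sup>+\<omega>. \<phi> (counts L D \<omega>) * emeasure (factorial_at k \<omega>) (rect k B) \<partial>P) =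
    (\<integral>\<^sup>+x. shifted L D \<phi> {..<k} x * indicator (rect k B) x \<partial>Mk k)"
proof -
  define \<B> where "\<B> = D ` L \<union> B ` {..<k}"
  have fL: "finite L" and Db: "\<And>c. c \<in> L \<Longrightarrow> bdd (D c)" using c by (auto simp: cells_def)
  have b: "finite \<B>" "\<forall>C\<in>\<B>. bdd C" "\<forall>j<k. B j \<in> \<B>" using B fL Db by (auto simp: \<B>_def)
  let ?R = "cell_ids \<B>" and ?E = "cell \<B>" and ?T = "cell_maps k \<B> B"
  have cR: "cells ?R ?E" by (rule cells_cell[OF b(1,2)])
  interpret law: poisson_vector "law ?R ?E" ?R "\<lambda>c. measure M (?E c)" by (rule poisson_vector_law[OF cR])
  have fR: "finite ?R" using cR by (simp add: cells_def)
  have finT: "finite ?T" using rect_cells(3)[OF b] .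
  have sT: "s j \<in> ?R" "B j \<in> s j" if "s \<in> ?T" "j < k" for s j using that by (auto simp: cell_maps_def)
  \<comment> \<open>Recovers the counts of the original cells from those of the refinement.\<close>
  define agg where "agg n c = (if c \<in> L then \<Sum>S\<in>{S \<in> ?R. D c \<in> S}. n S else 0)" for n :: "'z set set \<Rightarrow> nat" and c
  have agg: "counts L D \<omega> = agg (counts ?R ?E \<omega>)" for \<omega>
    using cnt_refine[OF b(1,2)] by (auto simp: agg_def counts_def fun_eq_iff \<B>_def)
  have agg_add: "agg (add_points n s k) c = agg n c + (if c \<in> L then card {j \<in> {..<k}. D c \<in> s j} else 0)" if s: "s \<in> ?T" for n s c
  proof (cases "c \<in> L")
    case True
    let ?F = "{S \<in> ?R. D c \<in> S}"
    have "card {j \<in> {..<k}. D c \<in> s j} = (\<Sum>S\<in>?F. card {j. j < k \<and> s j = S})"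
    proof -
      have "(\<Sum>S\<in>?F. \<Sum>j\<in>{j \<in> {j \<in> {..<k}. D c \<in> s j}. s j = S}. 1::nat) = (\<Sum>j\<in>{j \<in> {..<k}. D c \<in> s j}. 1)"
        using fR sT(1)[OF s] by (intro sum.group) auto
      moreover have "{j \<in> {j \<in> {..<k}. D c \<in> s j}. s j = S} = {j. j < k \<and> s j = S}" if "S \<in> ?F" for S using that by auto
      ultimately show ?thesis by simp
    qed
    then show ?thesis using True by (simp add: agg_def add_points_def sum.distrib)
  qed (simp add: agg_def)
  have shift: "shifted L D \<phi> {..<k} x = (\<integral>\<^sup>+n. \<phi> (agg (add_points n s k)) \<partial>law ?R ?E)"
    if s: "s \<in> ?T" and x: "x \<in> rect k (\<lambda>j. ?E (s j))" for s x
  proof -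
    have "point_counts L D {..<k} x c = (if c \<in> L then card {j \<in> {..<k}. D c \<in> s j} else 0)" for c
    proof (cases "c \<in> L")
      case True
      have "x j \<in> D c \<longleftrightarrow> D c \<in> s j" if "j < k" for j
        using x that True mem_cell_iff[of "x j" \<B> "s j" "D c"] by (auto simp: rect_def \<B>_def PiE_iff)
      then have "{j \<in> {..<k}. x j \<in> D c} = {j \<in> {..<k}. D c \<in> s j}" by auto
      then show ?thesis using True by (simp add: point_counts_def)
    qed (simp add: point_counts_def)
    then have "(\<lambda>c. counts L D \<omega> c + point_counts L D {..<k} x c) = agg (add_points (counts ?R ?E \<omega>) s k)" for \<omega>
      unfolding agg[of \<omega>] by (rule_tac ext) (simp add: agg_add[OF s])
    then show ?thesis unfolding shifted_def by (simp add: nn_integral_law[OF cR])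
  qed
  have "(\<integral>\<^sup>+\<omega>. \<phi> (counts L D \<omega>) * emeasure (factorial_at k \<omega>) (rect k B) \<partial>P) =
    (\<integral>\<^sup>+\<omega>. (\<lambda>n. \<Sum>s\<in>?T. of_nat (falling_product n s k) * \<phi> (agg n)) (counts ?R ?E \<omega>) \<partial>P)"
    by (rule nn_integral_cong) (simp add: factorial_at_rect[OF b] agg sum_distrib_left mult.commute)
  also have "\<dots> = (\<integral>\<^sup>+n. (\<Sum>s\<in>?T. of_nat (falling_product n s k) * \<phi> (agg n)) \<partial>law ?R ?E)"
    by (rule nn_integral_law[OF cR, symmetric])
  also have "\<dots> = (\<Sum>s\<in>?T. \<integral>\<^sup>+n. of_nat (falling_product n s k) * \<phi> (agg n) \<partial>law ?R ?E)"
    by (rule nn_integral_sum) simp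
  also have "\<dots> = (\<Sum>s\<in>?T. \<integral>\<^sup>+x. shifted L D \<phi> {..<k} x * indicator (rect k (\<lambda>j. ?E (s j))) x \<partial>Mk k)"
  proof (rule sum.cong[OF refl])
    fix s assume s: "s \<in> ?T"
    have Es: "?E (s j) \<in> sets M" for j by (rule cell_sets[OF b(1,2)])
    have "(\<integral>\<^sup>+x. shifted L D \<phi> {..<k} x * indicator (rect k (\<lambda>j. ?E (s j))) x \<partial>Mk k) =
      (\<integral>\<^sup>+x. (\<integral>\<^sup>+n. \<phi> (agg (add_points n s k)) \<partial>law ?R ?E) * indicator (rect k (\<lambda>j. ?E (s j))) x \<partial>Mk k)"
      by (rule nn_integral_cong) (use shift[OF s] in \<open>auto simp: indicator_def\<close>)
    also have "\<dots> = (\<integral>\<^sup>+n. \<phi> (agg (add_points n s k)) \<partial>law ?R ?E) * (\<Prod>j<k. emeasure M (?E (s j)))"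
      using rect_sets[of k "\<lambda>j. ?E (s j)"] Es by (subst nn_integral_cmult_indicator) (auto simp: emeasure_Mk_rect)
    also have "(\<Prod>j<k. emeasure M (?E (s j))) = (\<Prod>j<k. ennreal (measure M (?E (s j))))"
    proof (intro prod.cong refl)
      fix j assume "j \<in> {..<k}"
      then have "bdd (?E (s j))" using cR sT(1)[OF s, of j] by (auto simp: cells_def)
      then show "emeasure M (?E (s j)) = ennreal (measure M (?E (s j)))"
        using bdd_fin[of "?E (s j)"] by (intro emeasure_eq_ennreal_measure) auto
    qed
    finally show "(\<integral>\<^sup>+n. of_nat (falling_product n s k) * \<phi> (agg n) \<partial>law ?R ?E) =
      (\<integral>\<^sup>+x. shifted L D \<phi> {..<k} x * indicator (rect k (\<lambda>j. ?E (s j))) x \<partial>Mk k)"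
      using law.mecke_falling_product[of k s "\<lambda>n. \<phi> (agg n)"] sT(1)[OF s] by (simp add: mult.commute)
  qed
  also have "\<dots> = (\<integral>\<^sup>+x. (\<Sum>s\<in>?T. shifted L D \<phi> {..<k} x * indicator (rect k (\<lambda>j. ?E (s j))) x) \<partial>Mk k)"
    using shifted_measurable[OF c, of "{..<k}" "{..<k}" \<phi>] rect_sets[of k "\<lambda>j. ?E (_ j)"] cell_sets[OF b(1,2)]
    by (intro nn_integral_sum[symmetric] borel_measurable_times_ennreal borel_measurable_indicator) auto
  also have "\<dots> = (\<integral>\<^sup>+x. shifted L D \<phi> {..<k} x * indicator (rect k B) x \<partial>Mk k)"
  proof (rule nn_integral_cong)
    fix x
    have "indicator (rect k B) x = (\<Sum>s\<in>?T. indicator (rect k (\<lambda>j. ?E (s j))) x :: ennreal)"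
      unfolding rect_cells(1)[OF b] using finT rect_cells(2)[OF b] by (rule indicator_UN_disjoint)
    then show "(\<Sum>s\<in>?T. shifted L D \<phi> {..<k} x * indicator (rect k (\<lambda>j. ?E (s j))) x) = shifted L D \<phi> {..<k} x * indicator (rect k B) x"
      by (simp add: sum_distrib_left)
  qed
  finally show ?thesis .
qed

definition box :: "nat \<Rightarrow> nat \<Rightarrow> (nat \<Rightarrow> 'z) set" where "box k n = rect k (\<lambda>_. Z n)"

lemma box_sets: "box k n \<in> sets (Mk k)" unfolding box_def using Z_sets by (intro rect_sets)

lemma box_inc: "incseq (box k)"
  using Z_inc by (auto simp: incseq_def box_def rect_def PiE_iff le_fun_def)

lemma box_UN: "(\<Union>n. box k n) = space (Mk k)"
proof
  show "(\<Union>n. box k n) \<subseteq> space (Mk k)" using box_sets sets.sets_into_space by blast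
  show "space (Mk k) \<subseteq> (\<Union>n. box k n)"
  proof
    fix x assume x: "x \<in> space (Mk k)"
    then have "\<exists>n. x j \<in> Z n" if "j < k" for j using that Z_un by (auto simp: space_PiM PiE_iff)
    then obtain n where n: "\<And>j. j < k \<Longrightarrow> x j \<in> Z (n j)" by metis
    define m where "m = Max (insert 0 (n ` {..<k}))"
    have "x j \<in> Z m" if "j < k" for j
    proof -
      have "n j \<le> m" using that by (auto simp: m_def)
      then show ?thesis using n[OF that] Z_inc by (auto simp: incseq_def)
    qed
    then show "x \<in> (\<Union>n. box k n)" using x by (auto simp: box_def rect_def space_PiM PiE_iff)
  qed
qed

lemma emeasure_box: "emeasure (Mk k) (box k n) < \<infinity>"
  unfolding box_def using Z_sets Z_fin[of n] by (subst emeasure_Mk_rect) (auto simp: less_top[symmetric] power_eq_top_ennreal)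

lemma factorial_at_box_fin: "\<omega> \<in> space P \<Longrightarrow> emeasure (factorial_at k \<omega>) (box k n) < \<infinity>"
  unfolding box_def by (subst factorial_at_rect[of "{Z n}"]) (auto simp: of_nat_less_top simp flip: of_nat_sum)

text \<open>Extends the formula from rectangles to all measurable sets by a Dynkin argument.
  Complements call for subtraction, hence the intersection with a box of finite measure and the
  bound C on \<open>shifted\<close>. Measurability is carried along because each step of the
  identity uses it.\<close>

lemma campbell_box:
  assumes c: "cells L D" and C: "C < \<infinity>" "\<And>x. shifted L D \<phi> {..<k} x \<le> C" and E: "E \<in> sets (Mk k)"
  shows "(\<lambda>\<omega>. emeasure (factorial_at k \<omega>) (E \<inter> box k n)) \<in> borel_measurable cylinder_algebra \<and>
    (\<integral>\<^sup>+\<omega>. \<phi> (counts L D \<omega>) * emeasure (factorial_at k \<omega>) (E \<inter> box k n) \<partial>P) =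
    (\<integral>\<^sup>+x. shifted L D \<phi> {..<k} x * indicator (E \<inter> box k n) x \<partial>Mk k)"
proof -
  have sh: "shifted L D \<phi> {..<k} \<in> borel_measurable (Mk k)" using shifted_measurable[OF c, of "{..<k}" "{..<k}"] by simp
  have \<phi>m: "(\<lambda>\<omega>. \<phi> (counts L D \<omega>)) \<in> borel_measurable P" by (rule fun_counts_measurable[OF _ c]) simp
  have boxm: "(\<lambda>\<omega>. emeasure (factorial_at k \<omega>) (box k n)) \<in> borel_measurable cylinder_algebra"
    unfolding box_def by (rule factorial_at_rect_cylinder_algebra) simp
  have boxi: "(\<integral>\<^sup>+\<omega>. \<phi> (counts L D \<omega>) * emeasure (factorial_at k \<omega>) (box k n) \<partial>P) =
     (\<integral>\<^sup>+x. shifted L D \<phi> {..<k} x * indicator (box k n) x \<partial>Mk k)"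
    unfolding box_def by (rule campbell_rect[OF c]) simp
  have fin: "(\<integral>\<^sup>+x. shifted L D \<phi> {..<k} x * indicator (box k n) x \<partial>Mk k) < \<infinity>"
  proof -
    have "(\<integral>\<^sup>+x. shifted L D \<phi> {..<k} x * indicator (box k n) x \<partial>Mk k) \<le> (\<integral>\<^sup>+x. C * indicator (box k n) x \<partial>Mk k)"
      by (intro nn_integral_mono mult_right_mono C) auto
    also have "\<dots> = C * emeasure (Mk k) (box k n)" by (rule nn_integral_cmult_indicator[OF box_sets])
    also have "\<dots> < \<infinity>" using C(1) emeasure_box[of k n] by (auto simp: ennreal_mult_less_top)
    finally show ?thesis .
  qed
  have "E \<in> sigma_sets (\<Pi>\<^sub>E i\<in>{..<k}. space M) (prod_algebra {..<k} (\<lambda>_. M))" using E by (simp add: sets_PiM)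
  with Int_stable_prod_algebra prod_algebra_sets_into_space show ?thesis
  proof (induction rule: sigma_sets_induct_disjoint)
    case (basic A)
    then obtain X where X: "A = rect k X" "\<And>j. j < k \<Longrightarrow> X j \<in> sets M"
      by (auto simp: prod_algebra_eq_finite rect_def)
    have eq: "A \<inter> box k n = rect k (\<lambda>j. X j \<inter> Z n)" by (auto simp: X box_def rect_def PiE_iff)
    have b: "\<forall>j<k. bdd (X j \<inter> Z n)"
      by (intro allI impI, rule bdd_subset[OF bdd_Z[of n]]) (use X Z_sets in auto)
    show ?case unfolding eq using factorial_at_rect_cylinder_algebra[OF b] campbell_rect[OF c b] by simp
  next
    case empty
    then show ?case by simp
  next
    case (compl A)
    then have A: "A \<in> sets (Mk k)" by (simp add: sets_PiM)
    let ?A = "A \<inter> box k n"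
    have eq: "((\<Pi>\<^sub>E i\<in>{..<k}. space M) - A) \<inter> box k n = box k n - ?A"
      using sets.sets_into_space[OF box_sets[of k n]] by (auto simp: space_PiM)
    have N: "emeasure (factorial_at k \<omega>) (box k n - ?A) = emeasure (factorial_at k \<omega>) (box k n) - emeasure (factorial_at k \<omega>) ?A" if w: "\<omega> \<in> space P" for \<omega>
    proof (rule emeasure_Diff)
      have "emeasure (factorial_at k \<omega>) ?A \<le> emeasure (factorial_at k \<omega>) (box k n)"
        using sets_factorial_at[OF w] A box_sets by (intro emeasure_mono) auto
      then show "emeasure (factorial_at k \<omega>) ?A \<noteq> \<infinity>" using factorial_at_box_fin[OF w, of k n] by (auto simp: top_unique)
    qed (use sets_factorial_at[OF w] A box_sets in auto)
    have le: "emeasure (factorial_at k \<omega>) ?A \<le> emeasure (factorial_at k \<omega>) (box k n)" if w: "\<omega> \<in> space P" for \<omega>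
      using sets_factorial_at[OF w] A box_sets by (intro emeasure_mono) auto
    have Am: "(\<lambda>\<omega>. emeasure (factorial_at k \<omega>) ?A) \<in> borel_measurable cylinder_algebra"
      and Ai: "(\<integral>\<^sup>+\<omega>. \<phi> (counts L D \<omega>) * emeasure (factorial_at k \<omega>) ?A \<partial>P) = (\<integral>\<^sup>+x. shifted L D \<phi> {..<k} x * indicator ?A x \<partial>Mk k)"
      using compl by auto
    have leA: "(\<integral>\<^sup>+x. shifted L D \<phi> {..<k} x * indicator ?A x \<partial>Mk k) \<le> (\<integral>\<^sup>+x. shifted L D \<phi> {..<k} x * indicator (box k n) x \<partial>Mk k)"
      by (intro nn_integral_mono) (auto simp: indicator_def)
    have "(\<lambda>\<omega>. emeasure (factorial_at k \<omega>) (box k n) - emeasure (factorial_at k \<omega>) ?A) \<in> borel_measurable cylinder_algebra"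
      using boxm Am by simp
    then have 1: "(\<lambda>\<omega>. emeasure (factorial_at k \<omega>) (box k n - ?A)) \<in> borel_measurable cylinder_algebra"
      by (subst measurable_cong[OF N]) auto
    have "(\<integral>\<^sup>+\<omega>. \<phi> (counts L D \<omega>) * emeasure (factorial_at k \<omega>) (box k n - ?A) \<partial>P) =
      (\<integral>\<^sup>+\<omega>. \<phi> (counts L D \<omega>) * emeasure (factorial_at k \<omega>) (box k n) - \<phi> (counts L D \<omega>) * emeasure (factorial_at k \<omega>) ?A \<partial>P)"
    proof (rule nn_integral_cong_AE)
      have "(\<integral>\<^sup>+\<omega>. \<phi> (counts L D \<omega>) * emeasure (factorial_at k \<omega>) ?A \<partial>P) \<noteq> \<infinity>" using Ai leA fin by (auto simp: top_unique)
      then have "AE \<omega> in P. \<phi> (counts L D \<omega>) * emeasure (factorial_at k \<omega>) ?A \<noteq> \<infinity>"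
        using \<phi>m cylinder_algebra_measurableD[OF Am] by (intro nn_integral_noteq_infinite) auto
      then show "AE \<omega> in P. \<phi> (counts L D \<omega>) * emeasure (factorial_at k \<omega>) (box k n - ?A) =
         \<phi> (counts L D \<omega>) * emeasure (factorial_at k \<omega>) (box k n) - \<phi> (counts L D \<omega>) * emeasure (factorial_at k \<omega>) ?A"
        using AE_space
      proof eventually_elim
        case (elim \<omega>)
        \<comment> \<open>In the extended reals distributivity may fail where the subtracted product
          is infinite; this happens on a null set at most.\<close>
        have "a * (b - a') = a * b - a * a'" if "a' \<le> b" "a * a' \<noteq> top" for a b a' :: ennreal
          using that by (metis (no_types, lifting) add_diff_inverse_ennreal ennreal_add_diff_cancel_left distrib_left)
        then show ?case unfolding N[OF elim(2)] using le[OF elim(2)] elim(1) by auto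
      qed
    qed
    also have "\<dots> = (\<integral>\<^sup>+x. shifted L D \<phi> {..<k} x * indicator (box k n) x \<partial>Mk k) - (\<integral>\<^sup>+x. shifted L D \<phi> {..<k} x * indicator ?A x \<partial>Mk k)"
      unfolding boxi[symmetric] Ai[symmetric]
    proof (rule nn_integral_diff)
      show "(\<lambda>\<omega>. \<phi> (counts L D \<omega>) * emeasure (factorial_at k \<omega>) (box k n)) \<in> borel_measurable P"
        "(\<lambda>\<omega>. \<phi> (counts L D \<omega>) * emeasure (factorial_at k \<omega>) ?A) \<in> borel_measurable P"
        using \<phi>m cylinder_algebra_measurableD[OF Am] cylinder_algebra_measurableD[OF boxm] by auto
      show "(\<integral>\<^sup>+\<omega>. \<phi> (counts L D \<omega>) * emeasure (factorial_at k \<omega>) ?A \<partial>P) \<noteq> \<infinity>" using Ai leA fin by (auto simp: top_unique)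
      show "AE \<omega> in P. \<phi> (counts L D \<omega>) * emeasure (factorial_at k \<omega>) ?A \<le> \<phi> (counts L D \<omega>) * emeasure (factorial_at k \<omega>) (box k n)"
        by (rule AE_I2) (intro mult_left_mono le, auto)
    qed
    also have "\<dots> = (\<integral>\<^sup>+x. shifted L D \<phi> {..<k} x * indicator (box k n) x - shifted L D \<phi> {..<k} x * indicator ?A x \<partial>Mk k)"
    proof (rule nn_integral_diff[symmetric])
      show "(\<lambda>x. shifted L D \<phi> {..<k} x * indicator (box k n) x) \<in> borel_measurable (Mk k)"
        "(\<lambda>x. shifted L D \<phi> {..<k} x * indicator ?A x) \<in> borel_measurable (Mk k)"
        using sh A box_sets by auto
      show "(\<integral>\<^sup>+x. shifted L D \<phi> {..<k} x * indicator ?A x \<partial>Mk k) \<noteq> \<infinity>" using leA fin by (auto simp: top_unique)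
    qed (auto simp: indicator_def)
    also have "\<dots> = (\<integral>\<^sup>+x. shifted L D \<phi> {..<k} x * indicator (box k n - ?A) x \<partial>Mk k)"
    proof (rule nn_integral_cong)
      fix x
      have "shifted L D \<phi> {..<k} x \<noteq> top" using C(2)[of x] C(1) by (auto simp: top_unique)
      then show "shifted L D \<phi> {..<k} x * indicator (box k n) x - shifted L D \<phi> {..<k} x * indicator ?A x =
        shifted L D \<phi> {..<k} x * indicator (box k n - ?A) x"
        by (auto simp: indicator_def)
    qed
    finally show ?case unfolding eq using 1 by simp
  next
    case (union A)
    have A: "A i \<in> sets (Mk k)" for i using union(2) by (auto simp: sets_PiM)
    have N: "emeasure (factorial_at k \<omega>) ((\<Union>i. A i) \<inter> box k n) = (\<Sum>i. emeasure (factorial_at k \<omega>) (A i \<inter> box k n))" if w: "\<omega> \<in> space P" for \<omega>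
    proof -
      have "(\<Union>i. A i) \<inter> box k n = (\<Union>i. A i \<inter> box k n)" by auto
      then show ?thesis
        using sets_factorial_at[OF w] A box_sets union(1) by (simp add: suminf_emeasure disjoint_family_on_def image_subset_iff Int_assoc disjoint_iff)
    qed
    have Am: "(\<lambda>\<omega>. emeasure (factorial_at k \<omega>) (A i \<inter> box k n)) \<in> borel_measurable cylinder_algebra" for i using union(3) by blast
    have "(\<lambda>\<omega>. \<Sum>i. emeasure (factorial_at k \<omega>) (A i \<inter> box k n)) \<in> borel_measurable cylinder_algebra" using Am by simp
    then have 1: "(\<lambda>\<omega>. emeasure (factorial_at k \<omega>) ((\<Union>i. A i) \<inter> box k n)) \<in> borel_measurable cylinder_algebra"
      by (subst measurable_cong[OF N]) auto
    have "(\<integral>\<^sup>+\<omega>. \<phi> (counts L D \<omega>) * emeasure (factorial_at k \<omega>) ((\<Union>i. A i) \<inter> box k n) \<partial>P) =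
      (\<integral>\<^sup>+\<omega>. (\<Sum>i. \<phi> (counts L D \<omega>) * emeasure (factorial_at k \<omega>) (A i \<inter> box k n)) \<partial>P)"
      by (rule nn_integral_cong) (simp add: N)
    also have "\<dots> = (\<Sum>i. \<integral>\<^sup>+\<omega>. \<phi> (counts L D \<omega>) * emeasure (factorial_at k \<omega>) (A i \<inter> box k n) \<partial>P)"
      using \<phi>m cylinder_algebra_measurableD[OF Am] by (intro nn_integral_suminf) auto
    also have "\<dots> = (\<Sum>i. \<integral>\<^sup>+x. shifted L D \<phi> {..<k} x * indicator (A i \<inter> box k n) x \<partial>Mk k)"
      using union(3) by simp
    also have "\<dots> = (\<integral>\<^sup>+x. (\<Sum>i. shifted L D \<phi> {..<k} x * indicator (A i \<inter> box k n) x) \<partial>Mk k)"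
      using sh A box_sets by (intro nn_integral_suminf[symmetric]) auto
    also have "\<dots> = (\<integral>\<^sup>+x. shifted L D \<phi> {..<k} x * indicator ((\<Union>i. A i) \<inter> box k n) x \<partial>Mk k)"
    proof (rule nn_integral_cong)
      fix x
      have "(\<Sum>i. indicator (A i \<inter> box k n) x :: ennreal) = indicator (\<Union>i. A i \<inter> box k n) x"
        using union(1) by (intro suminf_indicator) (auto simp: disjoint_family_on_def)
      then show "(\<Sum>i. shifted L D \<phi> {..<k} x * indicator (A i \<inter> box k n) x) = shifted L D \<phi> {..<k} x * indicator ((\<Union>i. A i) \<inter> box k n) x"
        by (simp add: Int_UN_distrib2)
    qed
    finally show ?case using 1 by simp
  qed
qed

end

section \<open>Charlier products as alternating sums of shifts\<close>

context poisson_vector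
begin

definition counts_of :: "(nat \<Rightarrow> 'i) \<Rightarrow> nat set \<Rightarrow> 'i \<Rightarrow> nat" where
  "counts_of s K c = card {j \<in> K. s j = c}"

definition plus :: "('i \<Rightarrow> nat) \<Rightarrow> ('i \<Rightarrow> nat) \<Rightarrow> 'i \<Rightarrow> nat" where
  "plus n m c = n c + m c"

lemma total_plus: "total (plus n m) = total n + (\<Sum>i\<in>I. real (m i))"
  by (simp add: total_def plus_def sum.distrib)

text \<open>The bound is uniform over all shifts with entries at most b. Through it the mean of a
  shifted function is bounded in the positions of the added points, since each entry of the shift is
  at most their number.\<close>

lemma tame_plus_bound:
  assumes "tame u"
  obtains C k where "0 \<le> C" "\<And>n m b. (\<And>i. i \<in> I \<Longrightarrow> m i \<le> b) \<Longrightarrow> \<bar>u (plus n m)\<bar> \<le> C * (1 + real b * card I) ^ k * total n ^ k"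
proof -
  obtain C k where C: "0 \<le> C" "\<And>n k'. k \<le> k' \<Longrightarrow> \<bar>u n\<bar> \<le> C * total n ^ k'" using tameE[OF assms] by blast
  have "\<bar>u (plus n m)\<bar> \<le> C * (1 + real b * card I) ^ k * total n ^ k" if m: "\<And>i. i \<in> I \<Longrightarrow> m i \<le> b" for n m b
  proof -
    have t1: "1 \<le> total n" by (rule total_ge_1)
    have "(\<Sum>i\<in>I. real (m i)) \<le> (\<Sum>i\<in>I. real b)" using m by (intro sum_mono) auto
    also have "\<dots> = real b * card I" by simp
    also have "\<dots> \<le> real b * card I * total n" using mult_left_mono[OF t1, of "real b * card I"] by simp
    finally have "total (plus n m) \<le> (1 + real b * card I) * total n" by (simp add: total_plus algebra_simps)
    then have "total (plus n m) ^ k \<le> ((1 + real b * card I) * total n) ^ k"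
      using total_ge_1[of "plus n m"] by (intro power_mono) auto
    then have "C * total (plus n m) ^ k \<le> C * ((1 + real b * card I) * total n) ^ k" using C(1) by (intro mult_left_mono)
    moreover have "\<bar>u (plus n m)\<bar> \<le> C * total (plus n m) ^ k" using C(2) by blast
    ultimately show ?thesis by (simp add: power_mult_distrib mult.assoc)
  qed
  with C(1) that show ?thesis by blast
qed

lemma tame_plus [simp, intro]:
  assumes "tame u" shows "tame (\<lambda>n. u (plus n m))"
proof -
  obtain C k where C: "0 \<le> C" "\<And>n m b. (\<And>i. i \<in> I \<Longrightarrow> m i \<le> b) \<Longrightarrow> \<bar>u (plus n m)\<bar> \<le> C * (1 + real b * card I) ^ k * total n ^ k"
    using tame_plus_bound[OF assms] by blast
  define b where "b = Max (insert 0 (m ` I))"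
  have m: "m i \<le> b" if "i \<in> I" for i unfolding b_def using finite_I that by (intro Max_ge) auto
  show ?thesis
  proof (rule tameI)
    show "\<bar>u (plus n m)\<bar> \<le> (C * (1 + real b * card I) ^ k) * total n ^ k" for n
      using m by (rule C(2))
  qed
qed

text \<open>Iterating the adjointness relation along the word \<open>s\<close> turns a Charlier product into an
  alternating sum of shifts.\<close>

lemma integral_chr_word:
  assumes s: "\<And>j. j < q \<Longrightarrow> s j \<in> I" and "tame \<phi>"
  shows "(\<integral>n. \<phi> n * chr (counts_of s {..<q}) n \<partial>D) =
    (\<Prod>j<q. l (s j)) * (\<Sum>K\<in>Pow {..<q}. (-1) ^ (q - card K) * (\<integral>n. \<phi> (plus n (counts_of s K)) \<partial>D))"
  using assms
proof (induction q arbitrary: \<phi>)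
  case 0
  have "counts_of s {} = (\<lambda>_. 0)" by (simp add: counts_of_def fun_eq_iff)
  moreover have "plus n (\<lambda>_. 0) = n" for n by (simp add: plus_def fun_eq_iff)
  ultimately show ?case by simp
next
  case (Suc q)
  let ?a = "counts_of s {..<q}" and ?i = "s q"
  have i: "?i \<in> I" and sq: "\<And>j. j < q \<Longrightarrow> s j \<in> I" using Suc.prems by auto
  have cS: "{j \<in> {..<Suc q}. s j = c} = (if s q = c then insert q {j \<in> {..<q}. s j = c} else {j \<in> {..<q}. s j = c})" for c
    by (auto simp: less_Suc_eq)
  have a: "counts_of s {..<Suc q} = ?a(?i := Suc (?a ?i))"
    unfolding counts_of_def cS by (auto simp: fun_eq_iff)
  let ?F = "\<lambda>K. \<integral>n. \<phi> (plus n (counts_of s K)) \<partial>D"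
  have sh: "plus (n(?i := Suc (n ?i))) (counts_of s K) = plus n (counts_of s (insert q K))" if "K \<subseteq> {..<q}" for n K
  proof -
    have f: "finite K" "q \<notin> K" using that finite_subset by auto
    have cK: "{j \<in> insert q K. s j = c} = (if s q = c then insert q {j \<in> K. s j = c} else {j \<in> K. s j = c})" for c by auto
    show ?thesis unfolding plus_def counts_of_def cK using f by (auto simp: fun_eq_iff)
  qed
  have d: "(\<integral>n. diff ?i \<phi> (plus n (counts_of s K)) \<partial>D) = ?F (insert q K) - ?F K" if K: "K \<subseteq> {..<q}" for K
  proof -
    have "diff ?i \<phi> (plus n (counts_of s K)) = \<phi> (plus n (counts_of s (insert q K))) - \<phi> (plus n (counts_of s K))" for n
    proof -
      have "(plus n (counts_of s K))(?i := Suc (plus n (counts_of s K) ?i)) = plus (n(?i := Suc (n ?i))) (counts_of s K)"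
        by (auto simp: plus_def fun_eq_iff)
      then show ?thesis by (simp add: diff_def sh[OF K])
    qed
    then show ?thesis using Suc.prems(2) by simp
  qed
  have "(\<integral>n. \<phi> n * chr (counts_of s {..<Suc q}) n \<partial>D) = (\<integral>n. \<phi> n * skor ?i (chr ?a) n \<partial>D)"
    by (simp add: a skor_chr[OF i])
  also have "\<dots> = l ?i * (\<integral>n. diff ?i \<phi> n * chr ?a n \<partial>D)"
    by (rule adjoint) (use Suc.prems i in auto)
  also have "(\<integral>n. diff ?i \<phi> n * chr ?a n \<partial>D) = (\<Prod>j<q. l (s j)) *
     (\<Sum>K\<in>Pow {..<q}. (-1) ^ (q - card K) * (\<integral>n. diff ?i \<phi> (plus n (counts_of s K)) \<partial>D))"
    by (rule Suc.IH) (use sq Suc.prems i in auto)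
  also have "(\<Sum>K\<in>Pow {..<q}. (-1) ^ (q - card K) * (\<integral>n. diff ?i \<phi> (plus n (counts_of s K)) \<partial>D)) =
    (\<Sum>K\<in>Pow {..<q}. (-1) ^ (q - card K) * ?F (insert q K)) - (\<Sum>K\<in>Pow {..<q}. (-1) ^ (q - card K) * ?F K)"
    by (simp add: d right_diff_distrib sum_subtractf)
  also have "\<dots> = (\<Sum>K\<in>Pow {..<Suc q}. (-1) ^ (Suc q - card K) * ?F K)"
  proof -
    have P: "Pow {..<Suc q} = Pow {..<q} \<union> insert q ` Pow {..<q}"
      by (simp add: lessThan_Suc Pow_insert)
    have cq: "card K \<le> q" "finite K" "q \<notin> K" if "K \<in> Pow {..<q}" for K
      using that card_mono[of "{..<q}" K] finite_subset by auto
    have "(\<Sum>K\<in>Pow {..<Suc q}. (-1) ^ (Suc q - card K) * ?F K) =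
       (\<Sum>K\<in>Pow {..<q}. (-1) ^ (Suc q - card K) * ?F K) + (\<Sum>K\<in>insert q ` Pow {..<q}. (-1) ^ (Suc q - card K) * ?F K)"
      unfolding P by (rule sum.union_disjoint) auto
    also have "(\<Sum>K\<in>insert q ` Pow {..<q}. (-1) ^ (Suc q - card K) * ?F K) = (\<Sum>K\<in>Pow {..<q}. (-1) ^ (Suc q - card (insert q K)) * ?F (insert q K))"
      by (rule sum.reindex[unfolded comp_def]) (auto simp: inj_on_def)
    also have "\<dots> = (\<Sum>K\<in>Pow {..<q}. (-1) ^ (q - card K) * ?F (insert q K))"
      by (intro sum.cong refl) (use cq in simp)
    also have "(\<Sum>K\<in>Pow {..<q}. (-1) ^ (Suc q - card K) * ?F K) = - (\<Sum>K\<in>Pow {..<q}. (-1) ^ (q - card K) * ?F K)"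
      unfolding sum_negf[symmetric] by (intro sum.cong refl) (use cq in \<open>simp add: Suc_diff_le\<close>)
    finally show ?thesis by simp
  qed
  finally show ?case by (simp add: mult_ac)
qed

lemma counts_of_mi: "(\<And>j. j < q \<Longrightarrow> s j \<in> I) \<Longrightarrow> counts_of s {..<q} \<in> mi q"
proof -
  assume s: "\<And>j. j < q \<Longrightarrow> s j \<in> I"
  have "(\<Sum>c\<in>I. \<Sum>j\<in>{j \<in> {..<q}. s j = c}. 1::nat) = (\<Sum>j\<in>{..<q}. 1)"
    by (rule sum.group) (use s finite_I in auto)
  then have "sum (counts_of s {..<q}) I = q" by (simp add: counts_of_def)
  moreover have "counts_of s {..<q} i = 0" if "i \<notin> I" for i
    using s that by (auto simp: counts_of_def)
  ultimately show ?thesis by (simp add: multi_indices_def)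
qed

end

section \<open>The Campbell formula for measurable sets and functions\<close>

context poisson_process
begin

lemma campbell_set:
  assumes c: "cells L D" and C: "C < \<infinity>" "\<And>x. shifted L D \<phi> {..<k} x \<le> C" and E: "E \<in> sets (Mk k)"
  shows "(\<lambda>\<omega>. emeasure (factorial_at k \<omega>) E) \<in> borel_measurable cylinder_algebra"
    and "(\<integral>\<^sup>+\<omega>. \<phi> (counts L D \<omega>) * emeasure (factorial_at k \<omega>) E \<partial>P) = (\<integral>\<^sup>+x. shifted L D \<phi> {..<k} x * indicator E x \<partial>Mk k)"
proof -
  have cb: "(\<lambda>\<omega>. emeasure (factorial_at k \<omega>) (E \<inter> box k n)) \<in> borel_measurable cylinder_algebra"
    "(\<integral>\<^sup>+\<omega>. \<phi> (counts L D \<omega>) * emeasure (factorial_at k \<omega>) (E \<inter> box k n) \<partial>P) =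
    (\<integral>\<^sup>+x. shifted L D \<phi> {..<k} x * indicator (E \<inter> box k n) x \<partial>Mk k)" for n
    using campbell_box[OF c C(1) _ E, of \<phi> n] C(2) by auto
  have inc: "incseq (\<lambda>n. E \<inter> box k n)" using box_inc[of k] by (auto simp: incseq_def)
  have un: "(\<Union>n. E \<inter> box k n) = E" using box_UN[of k] sets.sets_into_space[OF E] by auto
  have N: "emeasure (factorial_at k \<omega>) E = (SUP n. emeasure (factorial_at k \<omega>) (E \<inter> box k n))" if w: "\<omega> \<in> space P" for \<omega>
    using SUP_emeasure_incseq[of "\<lambda>n. E \<inter> box k n" "factorial_at k \<omega>"] inc un sets_factorial_at[OF w] E box_sets by (auto simp: image_subset_iff)
  have "(\<lambda>\<omega>. SUP n. emeasure (factorial_at k \<omega>) (E \<inter> box k n)) \<in> borel_measurable cylinder_algebra" using cb(1) by (intro borel_measurable_SUP) auto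
  then show "(\<lambda>\<omega>. emeasure (factorial_at k \<omega>) E) \<in> borel_measurable cylinder_algebra" by (subst measurable_cong[OF N]) auto
  have sh: "shifted L D \<phi> {..<k} \<in> borel_measurable (Mk k)" using shifted_measurable[OF c, of "{..<k}" "{..<k}"] by simp
  have \<phi>m: "(\<lambda>\<omega>. \<phi> (counts L D \<omega>)) \<in> borel_measurable P" by (rule fun_counts_measurable[OF _ c]) simp
  have "(\<integral>\<^sup>+\<omega>. \<phi> (counts L D \<omega>) * emeasure (factorial_at k \<omega>) E \<partial>P) =
     (\<integral>\<^sup>+\<omega>. (SUP n. \<phi> (counts L D \<omega>) * emeasure (factorial_at k \<omega>) (E \<inter> box k n)) \<partial>P)"
    by (intro nn_integral_cong) (simp add: N SUP_mult_left_ennreal)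
  also have "\<dots> = (SUP n. \<integral>\<^sup>+\<omega>. \<phi> (counts L D \<omega>) * emeasure (factorial_at k \<omega>) (E \<inter> box k n) \<partial>P)"
  proof (rule nn_integral_monotone_convergence_SUP_AE)
    show "AE \<omega> in P. \<phi> (counts L D \<omega>) * emeasure (factorial_at k \<omega>) (E \<inter> box k n) \<le> \<phi> (counts L D \<omega>) * emeasure (factorial_at k \<omega>) (E \<inter> box k (Suc n))" for n
    proof (rule AE_I2)
      fix \<omega> assume w: "\<omega> \<in> space P"
      have "E \<inter> box k n \<subseteq> E \<inter> box k (Suc n)" using inc by (auto simp: incseq_Suc_iff)
      then show "\<phi> (counts L D \<omega>) * emeasure (factorial_at k \<omega>) (E \<inter> box k n) \<le> \<phi> (counts L D \<omega>) * emeasure (factorial_at k \<omega>) (E \<inter> box k (Suc n))"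
        using sets_factorial_at[OF w] E box_sets by (intro mult_left_mono emeasure_mono) auto
    qed
    show "(\<lambda>\<omega>. \<phi> (counts L D \<omega>) * emeasure (factorial_at k \<omega>) (E \<inter> box k n)) \<in> borel_measurable P" for n
      using \<phi>m cylinder_algebra_measurableD[OF cb(1)] by auto
  qed
  also have "\<dots> = (SUP n. \<integral>\<^sup>+x. shifted L D \<phi> {..<k} x * indicator (E \<inter> box k n) x \<partial>Mk k)" using cb(2) by simp
  also have "\<dots> = (\<integral>\<^sup>+x. (SUP n. shifted L D \<phi> {..<k} x * indicator (E \<inter> box k n) x) \<partial>Mk k)"
  proof (rule nn_integral_monotone_convergence_SUP[symmetric])
    show "incseq (\<lambda>n x. shifted L D \<phi> {..<k} x * indicator (E \<inter> box k n) x)"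
      using inc by (auto simp: incseq_def le_fun_def indicator_def)
    show "(\<lambda>x. shifted L D \<phi> {..<k} x * indicator (E \<inter> box k n) x) \<in> borel_measurable (Mk k)" for n
      using sh E box_sets by auto
  qed
  also have "\<dots> = (\<integral>\<^sup>+x. shifted L D \<phi> {..<k} x * indicator E x \<partial>Mk k)"
  proof (rule nn_integral_cong)
    fix x
    have "(SUP n. indicator (E \<inter> box k n) x :: ennreal) = indicator E x"
    proof (cases "x \<in> E")
      case True
      then obtain m where "x \<in> E \<inter> box k m" using un by blast
      then have "1 = (indicator (E \<inter> box k m) x :: ennreal)" by simp
      also have "\<dots> \<le> (SUP n. indicator (E \<inter> box k n) x)" by (rule SUP_upper) simp
      finally have "1 \<le> (SUP n. indicator (E \<inter> box k n) x :: ennreal)" .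
      moreover have "(SUP n. indicator (E \<inter> box k n) x :: ennreal) \<le> 1"
        by (rule SUP_least) (simp add: indicator_def)
      ultimately have "(SUP n. indicator (E \<inter> box k n) x :: ennreal) = 1" by (rule antisym[rotated])
      then show ?thesis using True by simp
    qed simp
    then show "(SUP n. shifted L D \<phi> {..<k} x * indicator (E \<inter> box k n) x) = shifted L D \<phi> {..<k} x * indicator E x"
      by (simp add: SUP_mult_left_ennreal[symmetric])
  qed
  finally show "(\<integral>\<^sup>+\<omega>. \<phi> (counts L D \<omega>) * emeasure (factorial_at k \<omega>) E \<partial>P) = (\<integral>\<^sup>+x. shifted L D \<phi> {..<k} x * indicator E x \<partial>Mk k)" .
qed

lemma sigma_finite_factorial_at: assumes w: "\<omega> \<in> space P" shows "sigma_finite_measure (factorial_at k \<omega>)"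
proof
  show "\<exists>A. countable A \<and> A \<subseteq> sets (factorial_at k \<omega>) \<and> \<Union> A = space (factorial_at k \<omega>) \<and> (\<forall>a\<in>A. emeasure (factorial_at k \<omega>) a \<noteq> \<infinity>)"
    using box_UN[of k] box_sets[of k] factorial_at_box_fin[OF w, of k] sets_factorial_at[OF w] space_factorial_at[OF w]
    by (intro exI[of _ "range (box k)"]) (auto simp: less_top[symmetric])
qed

text \<open>Monotone class argument for nonnegative functions. The factorial measures are not given
  as a measurable kernel, so measurability of their integrals in \<omega> is proved along with the
  identity.\<close>

lemma campbell_fun:
  assumes c: "cells L D" and C: "C < \<infinity>" "\<And>x. shifted L D \<phi> {..<k} x \<le> C" and f: "f \<in> borel_measurable (Mk k)"
  shows "(\<lambda>\<omega>. \<integral>\<^sup>+x. f x \<partial>factorial_at k \<omega>) \<in> borel_measurable cylinder_algebra \<and>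
    (\<integral>\<^sup>+\<omega>. \<phi> (counts L D \<omega>) * (\<integral>\<^sup>+x. f x \<partial>factorial_at k \<omega>) \<partial>P) = (\<integral>\<^sup>+x. shifted L D \<phi> {..<k} x * f x \<partial>Mk k)"
proof -
  define Q where "Q f \<longleftrightarrow> (\<lambda>\<omega>. \<integral>\<^sup>+x. f x \<partial>factorial_at k \<omega>) \<in> borel_measurable cylinder_algebra \<and>
    (\<integral>\<^sup>+\<omega>. \<phi> (counts L D \<omega>) * (\<integral>\<^sup>+x. f x \<partial>factorial_at k \<omega>) \<partial>P) = (\<integral>\<^sup>+x. shifted L D \<phi> {..<k} x * f x \<partial>Mk k)" for f
  have sh: "shifted L D \<phi> {..<k} \<in> borel_measurable (Mk k)" using shifted_measurable[OF c, of "{..<k}" "{..<k}"] by simp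
  have \<phi>m: "(\<lambda>\<omega>. \<phi> (counts L D \<omega>)) \<in> borel_measurable P" by (rule fun_counts_measurable[OF _ c]) simp
  have mN: "f \<in> borel_measurable (factorial_at k \<omega>)" if "f \<in> borel_measurable (Mk k)" "\<omega> \<in> space P" for f :: "_ \<Rightarrow> ennreal" and \<omega>
    using that measurable_cong_sets[OF sets_factorial_at[OF that(2)] refl] by blast
  have Q_cong: "Q f" if cong: "f \<in> borel_measurable (Mk k)" "g \<in> borel_measurable (Mk k)"
    "\<And>x. x \<in> space (Mk k) \<Longrightarrow> f x = g x" "Q g" for f g
  proof -
    have "(\<integral>\<^sup>+x. f x \<partial>factorial_at k \<omega>) = (\<integral>\<^sup>+x. g x \<partial>factorial_at k \<omega>)" if "\<omega> \<in> space P" for \<omega>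
      by (rule nn_integral_cong) (use cong(3) space_factorial_at[OF that] in auto)
    moreover from this have "(\<lambda>\<omega>. \<integral>\<^sup>+x. f x \<partial>factorial_at k \<omega>) \<in> borel_measurable cylinder_algebra \<longleftrightarrow> (\<lambda>\<omega>. \<integral>\<^sup>+x. g x \<partial>factorial_at k \<omega>) \<in> borel_measurable cylinder_algebra"
      by (intro measurable_cong) auto
    moreover have "(\<integral>\<^sup>+x. shifted L D \<phi> {..<k} x * f x \<partial>Mk k) = (\<integral>\<^sup>+x. shifted L D \<phi> {..<k} x * g x \<partial>Mk k)"
      by (rule nn_integral_cong) (use cong(3) in auto)
    moreover have "(\<integral>\<^sup>+\<omega>. \<phi> (counts L D \<omega>) * (\<integral>\<^sup>+x. f x \<partial>factorial_at k \<omega>) \<partial>P) = (\<integral>\<^sup>+\<omega>. \<phi> (counts L D \<omega>) * (\<integral>\<^sup>+x. g x \<partial>factorial_at k \<omega>) \<partial>P)"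
      by (rule nn_integral_cong) (use calculation(1) in auto)
    ultimately show ?thesis using cong(4) unfolding Q_def by auto
  qed
  have Q_set: "Q (indicator A)" if set: "A \<in> sets (Mk k)" for A
  proof -
    have e: "(\<integral>\<^sup>+x. indicator A x \<partial>factorial_at k \<omega>) = emeasure (factorial_at k \<omega>) A" if "\<omega> \<in> space P" for \<omega>
      by (rule nn_integral_indicator) (use sets_factorial_at[OF that] set in auto)
    have 1: "(\<lambda>\<omega>. \<integral>\<^sup>+x. indicator A x \<partial>factorial_at k \<omega>) \<in> borel_measurable cylinder_algebra"
      using campbell_set(1)[OF c C set] by (subst measurable_cong[OF e]) auto
    have "(\<integral>\<^sup>+\<omega>. \<phi> (counts L D \<omega>) * (\<integral>\<^sup>+x. indicator A x \<partial>factorial_at k \<omega>) \<partial>P) = (\<integral>\<^sup>+\<omega>. \<phi> (counts L D \<omega>) * emeasure (factorial_at k \<omega>) A \<partial>P)"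
      by (rule nn_integral_cong) (simp add: e)
    with 1 show ?thesis unfolding Q_def using campbell_set(2)[OF c C set] by simp
  qed
  have Q_mult: "Q (\<lambda>x. a * u x)" if mult: "a < top" "u \<in> borel_measurable (Mk k)" "Q u" for a u
  proof -
    have e: "(\<integral>\<^sup>+x. a * u x \<partial>factorial_at k \<omega>) = a * (\<integral>\<^sup>+x. u x \<partial>factorial_at k \<omega>)" if "\<omega> \<in> space P" for \<omega>
      by (rule nn_integral_cmult) (rule mN[OF mult(2) that])
    have um: "(\<lambda>\<omega>. \<integral>\<^sup>+x. u x \<partial>factorial_at k \<omega>) \<in> borel_measurable cylinder_algebra" using mult unfolding Q_def by blast
    have 1: "(\<lambda>\<omega>. \<integral>\<^sup>+x. a * u x \<partial>factorial_at k \<omega>) \<in> borel_measurable cylinder_algebra"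
      using um by (subst measurable_cong[OF e]) auto
    have "(\<integral>\<^sup>+\<omega>. \<phi> (counts L D \<omega>) * (\<integral>\<^sup>+x. a * u x \<partial>factorial_at k \<omega>) \<partial>P) = (\<integral>\<^sup>+\<omega>. a * (\<phi> (counts L D \<omega>) * (\<integral>\<^sup>+x. u x \<partial>factorial_at k \<omega>)) \<partial>P)"
      by (rule nn_integral_cong) (simp add: e mult.left_commute)
    also have "\<dots> = a * (\<integral>\<^sup>+\<omega>. \<phi> (counts L D \<omega>) * (\<integral>\<^sup>+x. u x \<partial>factorial_at k \<omega>) \<partial>P)"
      using \<phi>m cylinder_algebra_measurableD[OF um] by (intro nn_integral_cmult) auto
    also have "\<dots> = a * (\<integral>\<^sup>+x. shifted L D \<phi> {..<k} x * u x \<partial>Mk k)" using mult unfolding Q_def by simp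
    also have "\<dots> = (\<integral>\<^sup>+x. a * (shifted L D \<phi> {..<k} x * u x) \<partial>Mk k)"
      using sh mult by (intro nn_integral_cmult[symmetric]) auto
    finally have 2: "(\<integral>\<^sup>+\<omega>. \<phi> (counts L D \<omega>) * (\<integral>\<^sup>+x. a * u x \<partial>factorial_at k \<omega>) \<partial>P) = \<dots>" .
    have "(\<lambda>x. shifted L D \<phi> {..<k} x * (a * u x)) = (\<lambda>x. a * (shifted L D \<phi> {..<k} x * u x))"
      by (rule ext) (rule mult.left_commute)
    then have "(\<integral>\<^sup>+x. shifted L D \<phi> {..<k} x * (a * u x) \<partial>Mk k) = (\<integral>\<^sup>+x. a * (shifted L D \<phi> {..<k} x * u x) \<partial>Mk k)"
      by (rule arg_cong)
    with 2 have "(\<integral>\<^sup>+\<omega>. \<phi> (counts L D \<omega>) * (\<integral>\<^sup>+x. a * u x \<partial>factorial_at k \<omega>) \<partial>P) = (\<integral>\<^sup>+x. shifted L D \<phi> {..<k} x * (a * u x) \<partial>Mk k)"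
      by (rule trans[OF _ sym])
    with 1 have 3: "Q (\<lambda>x. a * u x)" unfolding Q_def by (rule conjI)
    show ?thesis by (rule 3)
  qed
  have Q_add: "Q (\<lambda>x. v x + u x)" if add: "u \<in> borel_measurable (Mk k)" "Q u" "v \<in> borel_measurable (Mk k)" "Q v" for u v
  proof -
    have e: "(\<integral>\<^sup>+x. v x + u x \<partial>factorial_at k \<omega>) = (\<integral>\<^sup>+x. v x \<partial>factorial_at k \<omega>) + (\<integral>\<^sup>+x. u x \<partial>factorial_at k \<omega>)" if "\<omega> \<in> space P" for \<omega>
      by (rule nn_integral_add[OF mN[OF add(3) that] mN[OF add(1) that]])
    have um: "(\<lambda>\<omega>. \<integral>\<^sup>+x. u x \<partial>factorial_at k \<omega>) \<in> borel_measurable cylinder_algebra" "(\<lambda>\<omega>. \<integral>\<^sup>+x. v x \<partial>factorial_at k \<omega>) \<in> borel_measurable cylinder_algebra" using add unfolding Q_def by blast+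
    have 1: "(\<lambda>\<omega>. \<integral>\<^sup>+x. v x + u x \<partial>factorial_at k \<omega>) \<in> borel_measurable cylinder_algebra"
      using um by (subst measurable_cong[OF e]) auto
    have "(\<integral>\<^sup>+\<omega>. \<phi> (counts L D \<omega>) * (\<integral>\<^sup>+x. v x + u x \<partial>factorial_at k \<omega>) \<partial>P) =
       (\<integral>\<^sup>+\<omega>. \<phi> (counts L D \<omega>) * (\<integral>\<^sup>+x. v x \<partial>factorial_at k \<omega>) + \<phi> (counts L D \<omega>) * (\<integral>\<^sup>+x. u x \<partial>factorial_at k \<omega>) \<partial>P)"
      by (rule nn_integral_cong) (simp add: e distrib_left)
    also have "\<dots> = (\<integral>\<^sup>+\<omega>. \<phi> (counts L D \<omega>) * (\<integral>\<^sup>+x. v x \<partial>factorial_at k \<omega>) \<partial>P) + (\<integral>\<^sup>+\<omega>. \<phi> (counts L D \<omega>) * (\<integral>\<^sup>+x. u x \<partial>factorial_at k \<omega>) \<partial>P)"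
      using \<phi>m um[THEN cylinder_algebra_measurableD] by (intro nn_integral_add) auto
    also have "\<dots> = (\<integral>\<^sup>+x. shifted L D \<phi> {..<k} x * v x \<partial>Mk k) + (\<integral>\<^sup>+x. shifted L D \<phi> {..<k} x * u x \<partial>Mk k)" using add unfolding Q_def by simp
    also have "\<dots> = (\<integral>\<^sup>+x. shifted L D \<phi> {..<k} x * v x + shifted L D \<phi> {..<k} x * u x \<partial>Mk k)"
      using sh add by (intro nn_integral_add[symmetric]) auto
    finally have 2: "(\<integral>\<^sup>+\<omega>. \<phi> (counts L D \<omega>) * (\<integral>\<^sup>+x. v x + u x \<partial>factorial_at k \<omega>) \<partial>P) = \<dots>" .
    have "(\<lambda>x. shifted L D \<phi> {..<k} x * (v x + u x)) = (\<lambda>x. shifted L D \<phi> {..<k} x * v x + shifted L D \<phi> {..<k} x * u x)"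
      by (rule ext) (rule distrib_left)
    then have "(\<integral>\<^sup>+x. shifted L D \<phi> {..<k} x * (v x + u x) \<partial>Mk k) = (\<integral>\<^sup>+x. shifted L D \<phi> {..<k} x * v x + shifted L D \<phi> {..<k} x * u x \<partial>Mk k)"
      by (rule arg_cong)
    with 2 have "(\<integral>\<^sup>+\<omega>. \<phi> (counts L D \<omega>) * (\<integral>\<^sup>+x. v x + u x \<partial>factorial_at k \<omega>) \<partial>P) = (\<integral>\<^sup>+x. shifted L D \<phi> {..<k} x * (v x + u x) \<partial>Mk k)"
      by (rule trans[OF _ sym])
    with 1 have 3: "Q (\<lambda>x. v x + u x)" unfolding Q_def by (rule conjI)
    show ?thesis by (rule 3)
  qed
  have Q_seq: "Q (SUP i. U i)" if seq: "\<And>i. U i \<in> borel_measurable (Mk k)" "\<And>i. U i \<in> borel_measurable (Mk k)" "\<And>i. Q (U i)" "incseq U" for U :: "nat \<Rightarrow> _"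
  proof -
    have incU: "incseq (\<lambda>i. U i x)" for x using seq(4) by (auto simp: incseq_def le_fun_def)
    have e: "(\<integral>\<^sup>+x. (SUP i. U i) x \<partial>factorial_at k \<omega>) = (SUP i. \<integral>\<^sup>+x. U i x \<partial>factorial_at k \<omega>)" if "\<omega> \<in> space P" for \<omega>
      unfolding SUP_apply by (rule nn_integral_monotone_convergence_SUP[OF seq(4) mN[OF seq(1) that]])
    have um: "(\<lambda>\<omega>. \<integral>\<^sup>+x. U i x \<partial>factorial_at k \<omega>) \<in> borel_measurable cylinder_algebra" for i using seq(3) unfolding Q_def by blast
    have "(\<lambda>\<omega>. SUP i. \<integral>\<^sup>+x. U i x \<partial>factorial_at k \<omega>) \<in> borel_measurable cylinder_algebra" using um by (intro borel_measurable_SUP) auto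
    then have 1: "(\<lambda>\<omega>. \<integral>\<^sup>+x. (SUP i. U i) x \<partial>factorial_at k \<omega>) \<in> borel_measurable cylinder_algebra"
      by (subst measurable_cong[OF e]) auto
    have "(\<integral>\<^sup>+\<omega>. \<phi> (counts L D \<omega>) * (\<integral>\<^sup>+x. (SUP i. U i) x \<partial>factorial_at k \<omega>) \<partial>P) =
       (\<integral>\<^sup>+\<omega>. (SUP i. \<phi> (counts L D \<omega>) * (\<integral>\<^sup>+x. U i x \<partial>factorial_at k \<omega>)) \<partial>P)"
      by (rule nn_integral_cong) (simp only: e SUP_mult_left_ennreal)
    also have "\<dots> = (SUP i. \<integral>\<^sup>+\<omega>. \<phi> (counts L D \<omega>) * (\<integral>\<^sup>+x. U i x \<partial>factorial_at k \<omega>) \<partial>P)"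
    proof (rule nn_integral_monotone_convergence_SUP)
      show "incseq (\<lambda>i \<omega>. \<phi> (counts L D \<omega>) * (\<integral>\<^sup>+x. U i x \<partial>factorial_at k \<omega>))"
        using seq(4) by (auto simp: incseq_def le_fun_def intro!: mult_left_mono nn_integral_mono)
      show "(\<lambda>\<omega>. \<phi> (counts L D \<omega>) * (\<integral>\<^sup>+x. U i x \<partial>factorial_at k \<omega>)) \<in> borel_measurable P" for i
        using \<phi>m um[THEN cylinder_algebra_measurableD] by auto
    qed
    also have "\<dots> = (SUP i. \<integral>\<^sup>+x. shifted L D \<phi> {..<k} x * U i x \<partial>Mk k)" using seq(3) unfolding Q_def by simp
    also have "\<dots> = (\<integral>\<^sup>+x. (SUP i. shifted L D \<phi> {..<k} x * U i x) \<partial>Mk k)"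
    proof (rule nn_integral_monotone_convergence_SUP[symmetric])
      show "incseq (\<lambda>i x. shifted L D \<phi> {..<k} x * U i x)"
        using seq(4) by (auto simp: incseq_def le_fun_def intro!: mult_left_mono)
    qed (use sh seq in auto)
    also have "\<dots> = (\<integral>\<^sup>+x. shifted L D \<phi> {..<k} x * (SUP i. U i) x \<partial>Mk k)"
      unfolding SUP_apply by (simp only: SUP_mult_left_ennreal)
    finally have 2: "(\<integral>\<^sup>+\<omega>. \<phi> (counts L D \<omega>) * (\<integral>\<^sup>+x. (SUP i. U i) x \<partial>factorial_at k \<omega>) \<partial>P) = \<dots>" .
    have 3: "Q (SUP i. U i)" unfolding Q_def using 1 2 by (rule conjI)
    show ?thesis by (rule 3)
  qed
  have "Q f"
    by (rule borel_measurable_induct[where P=Q, OF f])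
       (rule Q_cong, assumption+, erule Q_set, rule Q_mult, assumption+, rule Q_add, assumption+, rule Q_seq, blast, blast, blast, blast)
  then show ?thesis by (simp only: Q_def)
qed

end

section \<open>Pathwise multiple integrals\<close>

context poisson_process
begin

text \<open>The factorial measure is integrated last, the reverse of the order in
  \<open>pathwise_integral\<close>, so that the Campbell formula applies to the inner integral as a
  function of the first k arguments.\<close>

definition mixed_nn_integral :: "nat \<Rightarrow> nat \<Rightarrow> ((nat \<Rightarrow> 'z) \<Rightarrow> ennreal) \<Rightarrow> 'w \<Rightarrow> ennreal" where
  "mixed_nn_integral k q f \<omega> = (\<integral>\<^sup>+x. (\<integral>\<^sup>+y. f (merge {..<k} {k..<q} (x, y)) \<partial>PiM {k..<q} (\<lambda>_. M)) \<partial>factorial_at k \<omega>)"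

lemma psf: "product_sigma_finite (\<lambda>_::nat. M)" by (simp add: product_sigma_finite_def sf)

lemma sigma_finite_PiM: "finite I \<Longrightarrow> sigma_finite_measure (PiM I (\<lambda>_::nat. M))"
  by (rule product_sigma_finite.sigma_finite[OF psf])

lemma merge_meas:
  assumes "k \<le> q" "f \<in> measurable (Mk q) N"
  shows "(\<lambda>p. f (merge {..<k} {k..<q} p)) \<in> measurable (Mk k \<Otimes>\<^sub>M PiM {k..<q} (\<lambda>_. M)) N"
proof -
  have "{..<k} \<union> {k..<q} = {..<q}" using assms(1) by auto
  then have "merge {..<k} {k..<q} \<in> measurable (Mk k \<Otimes>\<^sub>M PiM {k..<q} (\<lambda>_. M)) (Mk q)"
    using measurable_merge[of "{..<k}" "{k..<q}" "\<lambda>_. M"] by simp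
  then show ?thesis using assms(2) by (rule measurable_compose)
qed

lemma point_counts_cong: "(\<And>j. j \<in> K \<Longrightarrow> x j = y j) \<Longrightarrow> point_counts L D K x = point_counts L D K y"
proof -
  assume "\<And>j. j \<in> K \<Longrightarrow> x j = y j"
  then have "{j \<in> K. x j \<in> D c} = {j \<in> K. y j \<in> D c}" for c by auto
  then show ?thesis by (simp add: point_counts_def fun_eq_iff)
qed

lemma mixed_nn_integral_campbell:
  assumes k: "k \<le> q" and c: "cells L D" and C: "C < \<infinity>" "\<And>x. shifted L D \<phi> {..<k} x \<le> C" and f: "f \<in> borel_measurable (Mk q)"
  shows "mixed_nn_integral k q f \<in> borel_measurable cylinder_algebra"
    "(\<integral>\<^sup>+\<omega>. \<phi> (counts L D \<omega>) * mixed_nn_integral k q f \<omega> \<partial>P) = (\<integral>\<^sup>+x. shifted L D \<phi> {..<k} x * f x \<partial>Mk q)"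
proof -
  interpret product_sigma_finite "\<lambda>_::nat. M" by (rule psf)
  interpret J: sigma_finite_measure "PiM {k..<q} (\<lambda>_. M)" by (rule sigma_finite_PiM) simp
  let ?m = "merge {..<k} {k..<q}"
  define F where "F x = (\<integral>\<^sup>+y. f (?m (x, y)) \<partial>PiM {k..<q} (\<lambda>_. M))" for x
  have un: "{..<k} \<union> {k..<q} = {..<q}" using k by auto
  have Fm: "F \<in> borel_measurable (Mk k)"
    unfolding F_def[abs_def] using merge_meas[OF k f] by (intro J.borel_measurable_nn_integral) (simp add: split_beta')
  note cf = campbell_fun[OF c C Fm]
  have JF: "mixed_nn_integral k q f = (\<lambda>\<omega>. \<integral>\<^sup>+x. F x \<partial>factorial_at k \<omega>)" by (simp add: mixed_nn_integral_def F_def fun_eq_iff)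
  show "mixed_nn_integral k q f \<in> borel_measurable cylinder_algebra" unfolding JF using cf by (rule conjunct1)
  have "(\<integral>\<^sup>+\<omega>. \<phi> (counts L D \<omega>) * mixed_nn_integral k q f \<omega> \<partial>P) = (\<integral>\<^sup>+x. shifted L D \<phi> {..<k} x * F x \<partial>Mk k)"
    unfolding JF using cf by (rule conjunct2)
  also have "\<dots> = (\<integral>\<^sup>+x. (\<integral>\<^sup>+y. shifted L D \<phi> {..<k} (?m (x, y)) * f (?m (x, y)) \<partial>PiM {k..<q} (\<lambda>_. M)) \<partial>Mk k)"
  proof (rule nn_integral_cong)
    fix x assume x: "x \<in> space (Mk k)"
    have "shifted L D \<phi> {..<k} (?m (x, y)) = shifted L D \<phi> {..<k} x" for y
      unfolding shifted_def by (subst point_counts_cong[of "{..<k}" "?m (x, y)" x]) (auto simp: merge_def)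
    moreover have "(\<lambda>y. f (?m (x, y))) \<in> borel_measurable (PiM {k..<q} (\<lambda>_. M))"
      using measurable_Pair2[OF merge_meas[OF k f] x] by simp
    ultimately show "shifted L D \<phi> {..<k} x * F x = (\<integral>\<^sup>+y. shifted L D \<phi> {..<k} (?m (x, y)) * f (?m (x, y)) \<partial>PiM {k..<q} (\<lambda>_. M))"
      by (simp add: F_def nn_integral_cmult)
  qed
  also have "\<dots> = (\<integral>\<^sup>+x. shifted L D \<phi> {..<k} x * f x \<partial>Mk q)"
  proof -
    have "(\<lambda>x. shifted L D \<phi> {..<k} x * f x) \<in> borel_measurable (PiM ({..<k} \<union> {k..<q}) (\<lambda>_. M))"
      unfolding un using shifted_measurable[OF c, of "{..<k}" "{..<q}" \<phi>] k f by auto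
    moreover have "{..<k} \<inter> {k..<q} = {}" by auto
    ultimately show ?thesis using product_nn_integral_fold[of "{..<k}" "{k..<q}"] unfolding un by simp
  qed
  finally show "(\<integral>\<^sup>+\<omega>. \<phi> (counts L D \<omega>) * mixed_nn_integral k q f \<omega> \<partial>P) = (\<integral>\<^sup>+x. shifted L D \<phi> {..<k} x * f x \<partial>Mk q)" .
qed

lemma mixed_nn_integral_mean:
  assumes k: "k \<le> q" and f: "f \<in> borel_measurable (Mk q)"
  shows "mixed_nn_integral k q f \<in> borel_measurable cylinder_algebra" "(\<integral>\<^sup>+\<omega>. mixed_nn_integral k q f \<omega> \<partial>P) = (\<integral>\<^sup>+x. f x \<partial>Mk q)"
proof -
  \<comment> \<open>The empty family of cells with \<phi> = 1 turns the weighted formula into a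
    plain expectation.\<close>
  have c: "cells ({} :: unit set) (\<lambda>_. {})" by (simp add: cells_def disjoint_family_on_def)
  have s: "shifted ({} :: unit set) (\<lambda>_. {}) (\<lambda>_. 1) {..<k} x = 1" for x
    by (simp add: shifted_def emeasure_space_1)
  show "mixed_nn_integral k q f \<in> borel_measurable cylinder_algebra" "(\<integral>\<^sup>+\<omega>. mixed_nn_integral k q f \<omega> \<partial>P) = (\<integral>\<^sup>+x. f x \<partial>Mk q)"
    using mixed_nn_integral_campbell[OF k c, of 1 "\<lambda>_. 1" f] f by (simp_all add: s)
qed

text \<open>The real counterpart of \<open>shifted\<close>, written with the law of the counts so
  that the calculus of Poisson vectors applies.\<close>

definition shift_mean :: "'c set \<Rightarrow> ('c \<Rightarrow> 'z set) \<Rightarrow> (('c \<Rightarrow> nat) \<Rightarrow> real) \<Rightarrow> nat set \<Rightarrow> (nat \<Rightarrow> 'z) \<Rightarrow> real" where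
  "shift_mean L D \<phi> K x = (\<integral>n. \<phi> (\<lambda>c. n c + point_counts L D K x c) \<partial>law L D)"

abbreviation tame_law :: "'c set \<Rightarrow> (('c \<Rightarrow> nat) \<Rightarrow> real) \<Rightarrow> bool" where
  "tame_law L \<equiv> poisson_vector.tame L"

lemma tame_law_plus: assumes "cells L D" "tame_law L \<phi>" shows "tame_law L (\<lambda>n. \<phi> (\<lambda>c. n c + m c))"
proof -
  interpret law: poisson_vector "law L D" L "\<lambda>c. measure M (D c)" by (rule poisson_vector_law[OF assms(1)])
  show ?thesis using law.tame_plus[OF assms(2), of m] unfolding law.plus_def .
qed

lemma shift_mean_measurable:
  assumes "cells L D" "finite K" "K \<subseteq> I" shows "shift_mean L D \<phi> K \<in> borel_measurable (PiM I (\<lambda>_. M))"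
  unfolding shift_mean_def
  by (rule measurable_compose[OF point_counts_measurable[OF assms], where g="\<lambda>m. \<integral>n. \<phi> (\<lambda>c. n c + m c) \<partial>law L D"]) simp

lemma shift_mean_bounded:
  assumes c: "cells L D" and t: "tame_law L \<phi>" and K: "finite K"
  obtains B where "0 \<le> B" "\<And>x. \<bar>shift_mean L D \<phi> K x\<bar> \<le> B"
proof -
  interpret law: poisson_vector "law L D" L "\<lambda>c. measure M (D c)" by (rule poisson_vector_law[OF c])
  obtain C k where C: "0 \<le> C" "\<And>n m b. (\<And>i. i \<in> L \<Longrightarrow> m i \<le> b) \<Longrightarrow> \<bar>\<phi> (law.plus n m)\<bar> \<le> C * (1 + real b * card L) ^ k * law.total n ^ k"
    using law.tame_plus_bound[OF t] by blast
  let ?b = "C * (1 + real (card K) * card L) ^ k"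
  have tt: "law.tame (\<lambda>n. law.total n ^ k)"
  proof (rule law.tameI)
    fix n
    have "0 \<le> law.total n" using law.total_ge_1[of n] by linarith
    then show "\<bar>law.total n ^ k\<bar> \<le> 1 * law.total n ^ k" by simp
  qed
  have b: "\<bar>shift_mean L D \<phi> K x\<bar> \<le> (\<integral>n. ?b * law.total n ^ k \<partial>law L D)" for x
  proof -
    have "\<bar>shift_mean L D \<phi> K x\<bar> \<le> (\<integral>n. \<bar>\<phi> (\<lambda>c. n c + point_counts L D K x c)\<bar> \<partial>law L D)"
      unfolding shift_mean_def by (rule integral_abs_bound)
    also have "\<dots> \<le> (\<integral>n. ?b * law.total n ^ k \<partial>law L D)"
    proof (rule integral_mono)
      show "integrable (law L D) (\<lambda>n. \<bar>\<phi> (\<lambda>c. n c + point_counts L D K x c)\<bar>)"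
        using tame_law_plus[OF c t] by (intro law.tame_integrable law.tame_abs)
      show "integrable (law L D) (\<lambda>n. ?b * law.total n ^ k)"
        using tt by (intro law.tame_integrable law.tame_mult law.tame_const)
      fix n
      have "point_counts L D K x i \<le> card K" for i using K by (auto simp: point_counts_def intro!: card_mono)
      then show "\<bar>\<phi> (\<lambda>c. n c + point_counts L D K x c)\<bar> \<le> ?b * law.total n ^ k"
        using C(2)[of "point_counts L D K x" "card K" n] by (simp add: law.plus_def[abs_def])
    qed
    finally show ?thesis .
  qed
  have "0 \<le> (\<integral>n. ?b * law.total n ^ k \<partial>law L D)" using b[of undefined] by linarith
  with b show ?thesis using that by blast
qed

lemma shifted_shift_mean:
  assumes c: "cells L D" and t: "tame_law L \<phi>" and nn: "\<And>n. 0 \<le> \<phi> n"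
  shows "shifted L D (\<lambda>n. ennreal (\<phi> n)) K x = ennreal (shift_mean L D \<phi> K x)"
proof -
  interpret law: poisson_vector "law L D" L "\<lambda>c. measure M (D c)" by (rule poisson_vector_law[OF c])
  have "shifted L D (\<lambda>n. ennreal (\<phi> n)) K x = (\<integral>\<^sup>+n. ennreal (\<phi> (\<lambda>c. n c + point_counts L D K x c)) \<partial>law L D)"
    unfolding shifted_def by (rule nn_integral_law[OF c, symmetric])
  also have "\<dots> = ennreal (shift_mean L D \<phi> K x)"
    unfolding shift_mean_def using nn tame_law_plus[OF c t] by (intro nn_integral_eq_integral law.tame_integrable) auto
  finally show ?thesis .
qed

lemma integral_law:
  fixes \<phi> :: "('c \<Rightarrow> nat) \<Rightarrow> real"
  assumes "cells L D" shows "(\<integral>n. \<phi> n \<partial>law L D) = (\<integral>\<omega>. \<phi> (counts L D \<omega>) \<partial>P)"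
  unfolding law_def by (rule integral_distr[OF counts_measurable[OF assms]]) simp

lemma integrable_law_iff:
  fixes \<phi> :: "('c \<Rightarrow> nat) \<Rightarrow> real"
  assumes "cells L D" shows "integrable (law L D) \<phi> \<longleftrightarrow> integrable P (\<lambda>\<omega>. \<phi> (counts L D \<omega>))"
  unfolding law_def by (rule integrable_distr_eq[OF counts_measurable[OF assms]]) simp

text \<open>The mean of the mixed integral is the finite integral of f, so the infinite value, which
  \<open>enn2real\<close> sends to 0, occurs on a null set. Boundedness of \<open>shift_mean\<close>
  supplies the constant for the Campbell formula.\<close>

lemma mixed_nn_integral_real_nonneg:
  fixes f :: "(nat \<Rightarrow> 'z) \<Rightarrow> real"
  assumes k: "k \<le> q" and c: "cells L D" and t: "tame_law L \<phi>" and nn: "\<And>n. 0 \<le> \<phi> n"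
    and f: "integrable (Mk q) f" "\<And>x. 0 \<le> f x"
  shows "has_bochner_integral P (\<lambda>\<omega>. \<phi> (counts L D \<omega>) * enn2real (mixed_nn_integral k q (\<lambda>x. ennreal (f x)) \<omega>))
     (\<integral>x. f x * shift_mean L D \<phi> {..<k} x \<partial>Mk q)"
proof -
  let ?J = "mixed_nn_integral k q (\<lambda>x. ennreal (f x))"
  have fm: "(\<lambda>x. ennreal (f x)) \<in> borel_measurable (Mk q)" using f by auto
  have Jm: "?J \<in> borel_measurable P" by (rule cylinder_algebra_measurableD[OF mixed_nn_integral_mean(1)[OF k fm]])
  have "(\<integral>\<^sup>+\<omega>. ?J \<omega> \<partial>P) = ennreal (\<integral>x. f x \<partial>Mk q)"
    unfolding mixed_nn_integral_mean(2)[OF k fm] using f by (intro nn_integral_eq_integral) auto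
  then have "(\<integral>\<^sup>+\<omega>. ?J \<omega> \<partial>P) \<noteq> \<infinity>" by simp
  with Jm have fin: "AE \<omega> in P. ?J \<omega> \<noteq> \<infinity>" by (intro nn_integral_noteq_infinite) auto
  obtain B where B: "0 \<le> B" "\<And>x. \<bar>shift_mean L D \<phi> {..<k} x\<bar> \<le> B" using shift_mean_bounded[OF c t, of "{..<k}"] by auto
  have sB: "shifted L D (\<lambda>n. ennreal (\<phi> n)) {..<k} x \<le> ennreal B" for x
    unfolding shifted_shift_mean[OF c t nn] using B(2)[of x] by (intro ennreal_leI) auto
  have wnn: "0 \<le> shift_mean L D \<phi> {..<k} x" for x unfolding shift_mean_def using nn by (intro Bochner_Integration.integral_nonneg) auto
  have wm: "shift_mean L D \<phi> {..<k} \<in> borel_measurable (Mk q)" using k by (intro shift_mean_measurable[OF c]) auto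
  have fw: "integrable (Mk q) (\<lambda>x. f x * shift_mean L D \<phi> {..<k} x)"
  proof (rule Bochner_Integration.integrable_bound)
    show "integrable (Mk q) (\<lambda>x. f x * B)" using f by simp
    show "AE x in Mk q. norm (f x * shift_mean L D \<phi> {..<k} x) \<le> norm (f x * B)"
      using B f by (intro AE_I2) (auto simp: abs_mult intro!: mult_left_mono)
  qed (use wm f in auto)
  have \<phi>m: "(\<lambda>\<omega>. \<phi> (counts L D \<omega>)) \<in> borel_measurable P" by (rule fun_counts_measurable[OF _ c]) simp
  have "(\<integral>\<^sup>+\<omega>. ennreal (\<phi> (counts L D \<omega>) * enn2real (?J \<omega>)) \<partial>P) = (\<integral>\<^sup>+\<omega>. ennreal (\<phi> (counts L D \<omega>)) * ?J \<omega> \<partial>P)"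
  proof (rule nn_integral_cong_AE)
    show "AE \<omega> in P. ennreal (\<phi> (counts L D \<omega>) * enn2real (?J \<omega>)) = ennreal (\<phi> (counts L D \<omega>)) * ?J \<omega>"
      using fin by eventually_elim (simp add: ennreal_mult nn less_top)
  qed
  also have "\<dots> = (\<integral>\<^sup>+x. ennreal (shift_mean L D \<phi> {..<k} x) * ennreal (f x) \<partial>Mk q)"
    using mixed_nn_integral_campbell(2)[OF k c _ sB fm] by (simp add: shifted_shift_mean[OF c t nn])
  also have "\<dots> = (\<integral>\<^sup>+x. ennreal (f x * shift_mean L D \<phi> {..<k} x) \<partial>Mk q)"
    using wnn f(2) by (simp add: ennreal_mult mult.commute)
  also have "\<dots> = ennreal (\<integral>x. f x * shift_mean L D \<phi> {..<k} x \<partial>Mk q)"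
    using fw wnn f(2) by (intro nn_integral_eq_integral) auto
  finally have e: "(\<integral>\<^sup>+\<omega>. ennreal (\<phi> (counts L D \<omega>) * enn2real (?J \<omega>)) \<partial>P) = ennreal (\<integral>x. f x * shift_mean L D \<phi> {..<k} x \<partial>Mk q)" .
  show ?thesis
  proof (rule has_bochner_integral_nn_integral[OF _ _ _ e])
    show "(\<lambda>\<omega>. \<phi> (counts L D \<omega>) * enn2real (?J \<omega>)) \<in> borel_measurable P" using \<phi>m Jm by auto
    show "0 \<le> (\<integral>x. f x * shift_mean L D \<phi> {..<k} x \<partial>Mk q)" using wnn f(2) by (intro Bochner_Integration.integral_nonneg) auto
  qed (use nn in auto)
qed

lemma shift_mean_diff:
  assumes "cells L D" "tame_law L \<phi>" "tame_law L \<psi>"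
  shows "shift_mean L D (\<lambda>n. \<phi> n - \<psi> n) K x = shift_mean L D \<phi> K x - shift_mean L D \<psi> K x"
proof -
  interpret law: poisson_vector "law L D" L "\<lambda>c. measure M (D c)" by (rule poisson_vector_law[OF assms(1)])
  show ?thesis unfolding shift_mean_def
    using tame_law_plus[OF assms(1)] assms by (intro Bochner_Integration.integral_diff law.tame_integrable) auto
qed

lemma shift_mean_times_integrable:
  assumes c: "cells L D" and t: "tame_law L \<phi>" and f: "integrable (Mk q) f" and K: "K \<subseteq> {..<q}"
  shows "integrable (Mk q) (\<lambda>x. f x * shift_mean L D \<phi> K x)"
proof -
  have fK: "finite K" using K finite_subset by blast
  obtain B where B: "0 \<le> B" "\<And>x. \<bar>shift_mean L D \<phi> K x\<bar> \<le> B" using shift_mean_bounded[OF c t fK] by auto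
  show ?thesis
  proof (rule Bochner_Integration.integrable_bound)
    show "integrable (Mk q) (\<lambda>x. f x * B)" using f by simp
    show "AE x in Mk q. norm (f x * shift_mean L D \<phi> K x) \<le> norm (f x * B)"
      using B by (intro AE_I2) (auto simp: abs_mult intro!: mult_left_mono)
    show "(\<lambda>x. f x * shift_mean L D \<phi> K x) \<in> borel_measurable (Mk q)"
      using shift_mean_measurable[OF c fK K] f by auto
  qed
qed

lemma mixed_nn_integral_real:
  fixes f :: "(nat \<Rightarrow> 'z) \<Rightarrow> real"
  assumes k: "k \<le> q" and c: "cells L D" and t: "tame_law L \<phi>" and f: "integrable (Mk q) f" "\<And>x. 0 \<le> f x"
  shows "has_bochner_integral P (\<lambda>\<omega>. \<phi> (counts L D \<omega>) * enn2real (mixed_nn_integral k q (\<lambda>x. ennreal (f x)) \<omega>))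
     (\<integral>x. f x * shift_mean L D \<phi> {..<k} x \<partial>Mk q)"
proof -
  interpret law: poisson_vector "law L D" L "\<lambda>c. measure M (D c)" by (rule poisson_vector_law[OF c])
  let ?p = "\<lambda>n. \<bar>\<phi> n\<bar> + \<phi> n" and ?m = "\<lambda>n. \<bar>\<phi> n\<bar>"
  have tp: "law.tame ?p" and tm: "law.tame ?m" using t by auto
  have 1: "has_bochner_integral P (\<lambda>\<omega>. ?p (counts L D \<omega>) * enn2real (mixed_nn_integral k q (\<lambda>x. ennreal (f x)) \<omega>)) (\<integral>x. f x * shift_mean L D ?p {..<k} x \<partial>Mk q)"
    by (rule mixed_nn_integral_real_nonneg[OF k c tp _ f]) auto
  have 2: "has_bochner_integral P (\<lambda>\<omega>. ?m (counts L D \<omega>) * enn2real (mixed_nn_integral k q (\<lambda>x. ennreal (f x)) \<omega>)) (\<integral>x. f x * shift_mean L D ?m {..<k} x \<partial>Mk q)"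
    by (rule mixed_nn_integral_real_nonneg[OF k c tm _ f]) auto
  have w: "shift_mean L D ?p {..<k} x - shift_mean L D ?m {..<k} x = shift_mean L D \<phi> {..<k} x" for x
    using shift_mean_diff[OF c tp tm] by simp
  have "(\<integral>x. f x * shift_mean L D ?p {..<k} x \<partial>Mk q) - (\<integral>x. f x * shift_mean L D ?m {..<k} x \<partial>Mk q) =
    (\<integral>x. f x * shift_mean L D ?p {..<k} x - f x * shift_mean L D ?m {..<k} x \<partial>Mk q)"
    using shift_mean_times_integrable[OF c tp f(1)] shift_mean_times_integrable[OF c tm f(1)] k by (intro Bochner_Integration.integral_diff[symmetric]) auto
  also have "\<dots> = (\<integral>x. f x * shift_mean L D \<phi> {..<k} x \<partial>Mk q)"
    by (simp only: right_diff_distrib[symmetric] w)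
  finally show ?thesis using has_bochner_integral_diff[OF 1 2] by (simp add: algebra_simps)
qed

definition mixed_integral :: "nat \<Rightarrow> nat \<Rightarrow> ((nat \<Rightarrow> 'z) \<Rightarrow> real) \<Rightarrow> 'w \<Rightarrow> real" where
  "mixed_integral k q g \<omega> = enn2real (mixed_nn_integral k q (\<lambda>x. ennreal (max 0 (g x))) \<omega>) - enn2real (mixed_nn_integral k q (\<lambda>x. ennreal (max 0 (- g x))) \<omega>)"

lemma mixed_integral_measurable: "k \<le> q \<Longrightarrow> g \<in> borel_measurable (Mk q) \<Longrightarrow> mixed_integral k q g \<in> borel_measurable cylinder_algebra"
  unfolding mixed_integral_def[abs_def] by (intro borel_measurable_diff borel_measurable_enn2real mixed_nn_integral_mean(1)) auto

lemma mixed_integral_campbell: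
  assumes k: "k \<le> q" and c: "cells L D" and t: "tame_law L \<phi>" and g: "integrable (Mk q) g"
  shows "has_bochner_integral P (\<lambda>\<omega>. \<phi> (counts L D \<omega>) * mixed_integral k q g \<omega>) (\<integral>x. g x * shift_mean L D \<phi> {..<k} x \<partial>Mk q)"
proof -
  have 1: "integrable (Mk q) (\<lambda>x. max 0 (g x))" and 2: "integrable (Mk q) (\<lambda>x. max 0 (- g x))" using g by auto
  note i = shift_mean_times_integrable[OF c t 1, of "{..<k}"] shift_mean_times_integrable[OF c t 2, of "{..<k}"]
  have "(\<integral>x. max 0 (g x) * shift_mean L D \<phi> {..<k} x \<partial>Mk q) - (\<integral>x. max 0 (- g x) * shift_mean L D \<phi> {..<k} x \<partial>Mk q) =
    (\<integral>x. max 0 (g x) * shift_mean L D \<phi> {..<k} x - max 0 (- g x) * shift_mean L D \<phi> {..<k} x \<partial>Mk q)"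
    using i k by (intro Bochner_Integration.integral_diff[symmetric]) auto
  also have "\<dots> = (\<integral>x. g x * shift_mean L D \<phi> {..<k} x \<partial>Mk q)"
    by (rule Bochner_Integration.integral_cong[OF refl]) (simp add: max_def)
  finally show ?thesis
    using has_bochner_integral_diff[OF mixed_nn_integral_real[OF k c t 1] mixed_nn_integral_real[OF k c t 2]]
    by (simp add: mixed_integral_def right_diff_distrib)
qed

text \<open>Fubini's theorem applies at those \<omega> where the integrals of the positive and of
  the negative part are both finite; it restores the order of integration of the pathwise
  formula.\<close>

lemma mixed_integral_pathwise:
  assumes k: "k \<le> q" and g: "integrable (Mk q) g"
  shows "AE \<omega> in P. (LINT y|PiM {k..<q} (\<lambda>_. M). LINT x|factorial_at k \<omega>. g (merge {..<k} {k..<q} (x, y))) = mixed_integral k q g \<omega>"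
proof -
  let ?m = "merge {..<k} {k..<q}" and ?MJ = "PiM {k..<q} (\<lambda>_. M)"
  have gm: "g \<in> borel_measurable (Mk q)" using g by simp
  \<comment> \<open>The signs s = 1 and s = -1 treat the positive and the negative part at
    once.\<close>
  have fin: "AE \<omega> in P. mixed_nn_integral k q (\<lambda>x. ennreal (max 0 (s * g x))) \<omega> \<noteq> \<infinity>" for s
  proof (rule nn_integral_noteq_infinite)
    have m: "(\<lambda>x. ennreal (max 0 (s * g x))) \<in> borel_measurable (Mk q)" using gm by simp
    show "mixed_nn_integral k q (\<lambda>x. ennreal (max 0 (s * g x))) \<in> borel_measurable P" by (rule cylinder_algebra_measurableD[OF mixed_nn_integral_mean(1)[OF k m]])
    have "(\<integral>\<^sup>+\<omega>. mixed_nn_integral k q (\<lambda>x. ennreal (max 0 (s * g x))) \<omega> \<partial>P) = (\<integral>\<^sup>+x. ennreal (max 0 (s * g x)) \<partial>Mk q)"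
      by (rule mixed_nn_integral_mean(2)[OF k m])
    also have "\<dots> = ennreal (\<integral>x. max 0 (s * g x) \<partial>Mk q)" using g by (intro nn_integral_eq_integral) auto
    finally show "(\<integral>\<^sup>+\<omega>. mixed_nn_integral k q (\<lambda>x. ennreal (max 0 (s * g x))) \<omega> \<partial>P) \<noteq> \<infinity>" by simp
  qed
  show ?thesis using fin[of 1] fin[of "-1"] AE_space
  proof eventually_elim
    case (elim \<omega>)
    interpret N: sigma_finite_measure "factorial_at k \<omega>" by (rule sigma_finite_factorial_at) (use elim in auto)
    interpret J: sigma_finite_measure ?MJ by (rule sigma_finite_PiM) simp
    interpret NJ: pair_sigma_finite "factorial_at k \<omega>" ?MJ ..
    define h where "h p = g (?m p)" for p
    have sN: "sets (factorial_at k \<omega> \<Otimes>\<^sub>M ?MJ) = sets (Mk k \<Otimes>\<^sub>M ?MJ)"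
      by (rule sets_pair_measure_cong[OF sets_factorial_at refl]) (use elim in auto)
    have hm: "h \<in> borel_measurable (factorial_at k \<omega> \<Otimes>\<^sub>M ?MJ)"
      using merge_meas[OF k gm] unfolding h_def[abs_def] by (subst measurable_cong_sets[OF sN refl])
    have J: "mixed_nn_integral k q (\<lambda>x. ennreal (max 0 (s * g x))) \<omega> = (\<integral>\<^sup>+p. ennreal (s * h p) \<partial>(factorial_at k \<omega> \<Otimes>\<^sub>M ?MJ))" for s
    proof -
      have "(\<integral>\<^sup>+p. ennreal (max 0 (s * h p)) \<partial>(factorial_at k \<omega> \<Otimes>\<^sub>M ?MJ)) = (\<integral>\<^sup>+x. (\<integral>\<^sup>+y. ennreal (max 0 (s * h (x, y))) \<partial>?MJ) \<partial>factorial_at k \<omega>)"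
        using hm by (intro J.nn_integral_fst[symmetric]) simp
      then show ?thesis by (simp add: mixed_nn_integral_def h_def)
    qed
    have int: "integrable (factorial_at k \<omega> \<Otimes>\<^sub>M ?MJ) h"
      unfolding real_integrable_def using hm J[of 1] J[of "-1"] elim by simp
    have "(LINT y|?MJ. LINT x|factorial_at k \<omega>. g (?m (x, y))) = integral\<^sup>L (factorial_at k \<omega> \<Otimes>\<^sub>M ?MJ) h"
    proof -
      have hh: "(\<lambda>(x, y). h (x, y)) = h" by (rule ext) auto
      have "(LINT y|?MJ. LINT x|factorial_at k \<omega>. h (x, y)) = integral\<^sup>L (factorial_at k \<omega> \<Otimes>\<^sub>M ?MJ) (\<lambda>(x, y). h (x, y))"
        by (rule NJ.integral_snd) (simp only: hh int)
      then show ?thesis unfolding hh by (simp only: h_def)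
    qed
    also have "\<dots> = mixed_integral k q g \<omega>"
      unfolding real_lebesgue_integral_def[OF int] mixed_integral_def using J[of 1] J[of "-1"] by simp
    finally show ?case .
  qed
qed

text \<open>A version of the pathwise integral that is measurable with respect to
  \<open>cylinder_algebra\<close>, obtained by assembling the mixed integrals.\<close>

definition pathwise_version :: "nat \<Rightarrow> ((nat \<Rightarrow> 'z) \<Rightarrow> real) \<Rightarrow> 'w \<Rightarrow> real" where
  "pathwise_version q g \<omega> = (\<Sum>k\<le>q. (-1) ^ (q - k) * real (q choose k) * mixed_integral k q g \<omega>)"

lemma pathwise_version_measurable: "g \<in> borel_measurable (Mk q) \<Longrightarrow> pathwise_version q g \<in> borel_measurable cylinder_algebra"
  unfolding pathwise_version_def[abs_def] by (intro borel_measurable_sum borel_measurable_times borel_measurable_const mixed_integral_measurable) auto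

lemma pathwise_version_eq_pathwise_integral:
  assumes g: "integrable (Mk q) g"
  shows "AE \<omega> in P. pathwise_integral q M (\<eta> \<omega>) g = pathwise_version q g \<omega>"
proof -
  have "AE \<omega> in P. \<forall>k\<in>{..q}. (LINT y|PiM {k..<q} (\<lambda>_. M). LINT x|factorial_at k \<omega>. g (merge {..<k} {k..<q} (x, y))) = mixed_integral k q g \<omega>"
    by (rule AE_finite_allI) (use mixed_integral_pathwise[OF _ g] in auto)
  then show ?thesis using AE_good
  proof eventually_elim
    case (elim \<omega>)
    then show ?case unfolding pathwise_integral_def pathwise_version_def
      by (intro sum.cong refl) (simp add: factorial_at_def)
  qed
qed

lemma pathwise_version_campbell:
  assumes c: "cells L D" and t: "tame_law L \<phi>" and g: "integrable (Mk q) g"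
  shows "has_bochner_integral P (\<lambda>\<omega>. \<phi> (counts L D \<omega>) * pathwise_version q g \<omega>)
    (\<Sum>k\<le>q. (-1) ^ (q - k) * real (q choose k) * (\<integral>x. g x * shift_mean L D \<phi> {..<k} x \<partial>Mk q))"
proof -
  have "has_bochner_integral P (\<lambda>\<omega>. \<Sum>k\<le>q. (-1) ^ (q - k) * real (q choose k) * (\<phi> (counts L D \<omega>) * mixed_integral k q g \<omega>))
    (\<Sum>k\<le>q. (-1) ^ (q - k) * real (q choose k) * (\<integral>x. g x * shift_mean L D \<phi> {..<k} x \<partial>Mk q))"
    by (intro has_bochner_integral_sum has_bochner_integral_mult_right mixed_integral_campbell c t g) auto
  then show ?thesis by (simp add: pathwise_version_def sum_distrib_left mult_ac)
qed

lemma pathwise_version_integrable: assumes "integrable (Mk q) g" shows "integrable P (pathwise_version q g)"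
proof -
  have c: "cells ({} :: unit set) (\<lambda>_. {})" by (simp add: cells_def disjoint_family_on_def)
  interpret law: poisson_vector "law ({} :: unit set) (\<lambda>_. {})" "{}" "\<lambda>c. measure M {}" by (rule poisson_vector_law[OF c])
  show ?thesis using pathwise_version_campbell[OF c law.tame_const[of 1] assms] by (auto simp: has_bochner_integral_iff)
qed

end

section \<open>Projection of a chaos onto finitely many counts\<close>

context poisson_process
begin

section \<open>Symmetric kernels and permutations of the coordinates\<close>

lemma comp_perm_measurable:
  assumes "\<pi> permutes {..<q}" shows "(\<lambda>x. x \<circ> \<pi>) \<in> measurable (Mk q) (Mk q)"
proof (rule measurable_PiM_single')
  have pi: "\<pi> i < q" if "i < q" for i using permutes_in_image[OF assms, of i] that by simp
  show "(\<lambda>x. (x \<circ> \<pi>) i) \<in> measurable (Mk q) M" if "i \<in> {..<q}" for i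
    unfolding comp_def using pi that by (intro measurable_component_singleton) auto
  show "(\<lambda>x. x \<circ> \<pi>) \<in> space (Mk q) \<rightarrow> (\<Pi>\<^sub>E i\<in>{..<q}. space M)"
    using pi permutes_not_in[OF assms] by (auto simp: space_PiM PiE_iff extensional_def)
qed

lemma distr_comp_perm:
  assumes p: "\<pi> permutes {..<q}" shows "distr (Mk q) (Mk q) (\<lambda>x. x \<circ> \<pi>) = Mk q"
proof -
  interpret product_sigma_finite "\<lambda>_::nat. M" by (rule psf)
  note m = comp_perm_measurable[OF p]
  have ip: "inv \<pi> permutes {..<q}" by (rule permutes_inv[OF p])
  have pi: "\<pi> i < q" "inv \<pi> i < q" if "i < q" for i using permutes_in_image[OF p, of i] permutes_in_image[OF ip, of i] that by auto
  show ?thesis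
  proof (rule PiM_eqI)
    fix A :: "nat \<Rightarrow> 'z set" assume A: "\<And>i. i \<in> {..<q} \<Longrightarrow> A i \<in> sets M"
    have "(\<lambda>x. x \<circ> \<pi>) -` Pi\<^sub>E {..<q} A \<inter> space (Mk q) = Pi\<^sub>E {..<q} (\<lambda>j. A (inv \<pi> j))"
    proof (intro equalityI subsetI)
      fix x assume x: "x \<in> (\<lambda>x. x \<circ> \<pi>) -` Pi\<^sub>E {..<q} A \<inter> space (Mk q)"
      have "x j \<in> A (inv \<pi> j)" if "j < q" for j
      proof -
        have "(x \<circ> \<pi>) (inv \<pi> j) \<in> A (inv \<pi> j)" using x pi(2)[OF that] by (auto simp: PiE_iff)
        then show ?thesis using permutes_inverses(1)[OF p] by simp
      qed
      then show "x \<in> Pi\<^sub>E {..<q} (\<lambda>j. A (inv \<pi> j))" using x by (auto simp: space_PiM PiE_iff)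
    next
      fix x assume x: "x \<in> Pi\<^sub>E {..<q} (\<lambda>j. A (inv \<pi> j))"
      have "x \<in> rect q (\<lambda>j. A (inv \<pi> j))" using x by (simp add: rect_def)
      then have xs: "x \<in> space (Mk q)" using sets.sets_into_space[OF rect_sets[of q "\<lambda>j. A (inv \<pi> j)"]] A pi(2) by auto
      have "x (\<pi> j) \<in> A j" if "j < q" for j
      proof -
        have "x (\<pi> j) \<in> A (inv \<pi> (\<pi> j))" using PiE_mem[OF x, of "\<pi> j"] pi(1)[OF that] by simp
        then show ?thesis using permutes_inverses(2)[OF p] by simp
      qed
      then show "x \<in> (\<lambda>x. x \<circ> \<pi>) -` Pi\<^sub>E {..<q} A \<inter> space (Mk q)"
        using xs measurable_space[OF m xs] by (auto simp: PiE_iff space_PiM)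
    qed
    then have "emeasure (distr (Mk q) (Mk q) (\<lambda>x. x \<circ> \<pi>)) (Pi\<^sub>E {..<q} A) = emeasure (Mk q) (Pi\<^sub>E {..<q} (\<lambda>j. A (inv \<pi> j)))"
      using A by (subst emeasure_distr[OF m]) (auto intro!: sets_PiM_I_finite)
    also have "\<dots> = (\<Prod>j<q. emeasure M (A (inv \<pi> j)))" using A pi by (intro emeasure_PiM) auto
    also have "\<dots> = (\<Prod>j<q. emeasure M (A j))"
      using prod.permute[OF ip, of "\<lambda>j. emeasure M (A j)"] by (simp add: comp_def)
    finally show "emeasure (distr (Mk q) (Mk q) (\<lambda>x. x \<circ> \<pi>)) (Pi\<^sub>E {..<q} A) = (\<Prod>j<q. emeasure M (A j))" .
  qed auto
qed

lemma integral_comp_perm: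
  fixes g :: "_ \<Rightarrow> real"
  assumes "\<pi> permutes {..<q}" "g \<in> borel_measurable (Mk q)"
  shows "(\<integral>x. g (x \<circ> \<pi>) \<partial>Mk q) = (\<integral>x. g x \<partial>Mk q)"
  using integral_distr[OF comp_perm_measurable[OF assms(1)] assms(2)] distr_comp_perm[OF assms(1)] by simp

lemma ex_permutes_initial:
  assumes "K \<subseteq> {..<q::nat}"
  obtains \<pi> where "\<pi> permutes {..<q}" "\<pi> ` {..<card K} = K"
proof -
  have fK: "finite K" and cK: "card K \<le> q" using assms finite_subset card_mono[of "{..<q}" K] by auto
  obtain f where f: "bij_betw f {..<card K} K"
    using finite_same_card_bij[of "{..<card K}" K] fK by auto
  obtain g where g: "bij_betw g {card K..<q} ({..<q} - K)"
    using finite_same_card_bij[of "{card K..<q}" "{..<q} - K"] assms fK by (auto simp: card_Diff_subset)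
  define \<pi> where "\<pi> i = (if i < card K then f i else if i < q then g i else i)" for i
  have 1: "bij_betw \<pi> {..<card K} K" using f by (rule bij_betw_cong[THEN iffD1, rotated]) (simp add: \<pi>_def)
  have 2: "bij_betw \<pi> {card K..<q} ({..<q} - K)" using g by (rule bij_betw_cong[THEN iffD1, rotated]) (simp add: \<pi>_def)
  have "bij_betw \<pi> ({..<card K} \<union> {card K..<q}) (K \<union> ({..<q} - K))"
    by (rule bij_betw_combine[OF 1 2]) auto
  moreover have "{..<card K} \<union> {card K..<q} = {..<q}" "K \<union> ({..<q} - K) = {..<q}" using cK assms by auto
  ultimately have "\<pi> permutes {..<q}" using cK by (intro bij_imp_permutes) (auto simp: \<pi>_def)
  moreover have "\<pi> ` {..<card K} = K" using 1 by (simp add: bij_betw_def)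
  ultimately show ?thesis by (rule that)
qed

text \<open>A permutation that carries the initial segment of the same size onto K preserves the
  product measure and the kernel. Thereby the binomial coefficients of the pathwise formula become a
  sum over subsets.\<close>

lemma symmetric_shift_card:
  assumes c: "cells L D" and g: "g \<in> borel_measurable (Mk q)" and s: "symmetric_kernel q M g" and K: "K \<subseteq> {..<q}"
  shows "(\<integral>x. g x * shift_mean L D \<phi> K x \<partial>Mk q) = (\<integral>x. g x * shift_mean L D \<phi> {..<card K} x \<partial>Mk q)"
proof -
  obtain \<pi> where p: "\<pi> permutes {..<q}" and pK: "\<pi> ` {..<card K} = K" using ex_permutes_initial[OF K] by blast
  have cK: "card K \<le> q" using K card_mono[of "{..<q}" K] by auto
  have inj: "inj_on \<pi> A" for A using permutes_inj[OF p] inj_on_subset by blast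
  have w: "shift_mean L D \<phi> K x = shift_mean L D \<phi> {..<card K} (x \<circ> \<pi>)" for x
  proof -
    have "card {j \<in> K. x j \<in> D c} = card {j \<in> {..<card K}. (x \<circ> \<pi>) j \<in> D c}" for c
    proof -
      have "{j \<in> K. x j \<in> D c} = \<pi> ` {j \<in> {..<card K}. (x \<circ> \<pi>) j \<in> D c}" using pK by auto
      then show ?thesis using card_image[OF inj] by metis
    qed
    then have "point_counts L D K x = point_counts L D {..<card K} (x \<circ> \<pi>)" by (simp add: point_counts_def fun_eq_iff)
    then show ?thesis by (simp add: shift_mean_def)
  qed
  have "(\<integral>x. g x * shift_mean L D \<phi> K x \<partial>Mk q) = (\<integral>x. g (x \<circ> \<pi>) * shift_mean L D \<phi> {..<card K} (x \<circ> \<pi>) \<partial>Mk q)"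
    by (rule Bochner_Integration.integral_cong[OF refl]) (use s p in \<open>simp add: w symmetric_kernel_def\<close>)
  also have "\<dots> = (\<integral>x. g x * shift_mean L D \<phi> {..<card K} x \<partial>Mk q)"
    by (rule integral_comp_perm[OF p]) (use g shift_mean_measurable[OF c, of "{..<card K}" "{..<q}"] cK in auto)
  finally show ?thesis .
qed

lemma sum_Pow_card:
  fixes f :: "nat \<Rightarrow> real"
  shows "(\<Sum>K\<in>Pow {..<q::nat}. f (card K)) = (\<Sum>k\<le>q. real (q choose k) * f k)"
proof -
  have 1: "(\<Sum>k\<in>{..q}. \<Sum>K\<in>{K \<in> Pow {..<q}. card K = k}. f (card K)) = (\<Sum>K\<in>Pow {..<q}. f (card K))"
    by (rule sum.group) (use card_mono[of "{..<q}"] in auto)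
  have 2: "(\<Sum>K\<in>{K \<in> Pow {..<q}. card K = k}. f (card K)) = real (q choose k) * f k" for k
  proof -
    have c: "card {K. K \<subseteq> {..<q} \<and> card K = k} = q choose k" using n_subsets[of "{..<q}" k] by simp
    have "(\<Sum>K\<in>{K \<in> Pow {..<q}. card K = k}. f (card K)) = (\<Sum>K\<in>{K. K \<subseteq> {..<q} \<and> card K = k}. f k)"
      by (intro sum.cong) auto
    also have "\<dots> = real (q choose k) * f k" unfolding sum_constant c ..
    finally show ?thesis .
  qed
  show ?thesis using 1 unfolding 2 by (rule sym)
qed

text \<open>The mean of the q-fold add-one difference of \<phi> at the points of x; up to the factor
  q! this is the kernel of order q in the chaos expansion of \<phi> evaluated at the counts.\<close>

definition alternating_shift :: "'c set \<Rightarrow> ('c \<Rightarrow> 'z set) \<Rightarrow> (('c \<Rightarrow> nat) \<Rightarrow> real) \<Rightarrow> nat \<Rightarrow> (nat \<Rightarrow> 'z) \<Rightarrow> real" where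
  "alternating_shift L D \<phi> q x = (\<Sum>K\<in>Pow {..<q}. (-1) ^ (q - card K) * shift_mean L D \<phi> K x)"

text \<open>A point outside all cells changes no count, so the subsets with and without it cancel in
  pairs.\<close>

lemma alternating_shift_zero:
  assumes j: "j < q" "\<And>c. c \<in> L \<Longrightarrow> x j \<notin> D c" shows "alternating_shift L D \<phi> q x = 0"
proof -
  let ?R = "{..<q} - {j}"
  have P: "Pow {..<q} = Pow ?R \<union> insert j ` Pow ?R"
  proof -
    have "{..<q} = insert j ?R" using j by auto
    then have "Pow {..<q} = Pow (insert j ?R)" by simp
    then show ?thesis by (simp only: Pow_insert)
  qed
  have fin: "finite K" "j \<notin> K" "card K < q" if "K \<in> Pow ?R" for K
  proof -
    show "finite K" "j \<notin> K" using that finite_subset by auto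
    have "card K \<le> card ?R" using that by (intro card_mono) auto
    also have "card ?R < q" using j by simp
    finally show "card K < q" .
  qed
  have w: "shift_mean L D \<phi> (insert j K) x = shift_mean L D \<phi> K x" for K
  proof -
    have "{i \<in> insert j K. x i \<in> D c} = {i \<in> K. x i \<in> D c}" if "c \<in> L" for c using j(2)[OF that] by auto
    then have "point_counts L D (insert j K) x = point_counts L D K x" by (auto simp: point_counts_def fun_eq_iff)
    then show ?thesis by (simp add: shift_mean_def)
  qed
  have "alternating_shift L D \<phi> q x = (\<Sum>K\<in>Pow ?R. (-1) ^ (q - card K) * shift_mean L D \<phi> K x) + (\<Sum>K\<in>insert j ` Pow ?R. (-1) ^ (q - card K) * shift_mean L D \<phi> K x)"
    unfolding alternating_shift_def P by (rule sum.union_disjoint) auto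
  also have "(\<Sum>K\<in>insert j ` Pow ?R. (-1) ^ (q - card K) * shift_mean L D \<phi> K x) = (\<Sum>K\<in>Pow ?R. (-1) ^ (q - card (insert j K)) * shift_mean L D \<phi> (insert j K) x)"
    by (rule sum.reindex[unfolded comp_def]) (auto simp: inj_on_def)
  also have "\<dots> = - (\<Sum>K\<in>Pow ?R. (-1) ^ (q - card K) * shift_mean L D \<phi> K x)"
    unfolding sum_negf[symmetric]
  proof (intro sum.cong refl)
    fix K assume K: "K \<in> Pow ?R"
    have "q - card K = Suc (q - card (insert j K))" using fin[OF K] by simp
    then show "(-1) ^ (q - card (insert j K)) * shift_mean L D \<phi> (insert j K) x = - ((-1) ^ (q - card K) * shift_mean L D \<phi> K x)"
      by (simp add: w)
  qed
  finally show ?thesis by simp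
qed

text \<open>The integral of \<phi> against the pathwise integral is that of g against
  \<open>alternating_shift\<close>, which is constant on products of cells and vanishes elsewhere.
  By \<open>integral_chr_word\<close> the constant for the word i, times the measure lw i of the
  product, is the integral of \<phi> against the Charlier product of the word. Hence the
  coefficients are the averages a i / lw i of g over products of cells, and they do not depend on
  \<phi>.\<close>

lemma pathwise_version_projection:
  fixes L :: "'c set"
  assumes c: "cells L D" and g: "integrable (Mk q) g" and s: "symmetric_kernel q M g"
  shows "\<exists>d. \<forall>\<phi>. tame_law L \<phi> \<longrightarrow> (\<integral>\<omega>. \<phi> (counts L D \<omega>) * pathwise_version q g \<omega> \<partial>P) =
    (\<integral>n. \<phi> n * (\<Sum>\<alpha>\<in>multi_indices L q. d \<alpha> * poisson_vector.chr L (\<lambda>c. measure M (D c)) \<alpha> n) \<partial>law L D)"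
proof -
  interpret law: poisson_vector "law L D" L "\<lambda>c. measure M (D c)" by (rule poisson_vector_law[OF c])
  have fL: "finite L" using c by (simp add: cells_def)
  have Db: "\<And>i. i \<in> L \<Longrightarrow> bdd (D i)" and Dd: "disjoint_family_on D L" using c by (auto simp: cells_def)
  let ?T = "Pi\<^sub>E {..<q} (\<lambda>_. L)"
  have fT: "finite ?T" using fL by (intro finite_PiE) auto
  define Wc where "Wc \<phi> i = (\<Sum>K\<in>Pow {..<q}. (-1) ^ (q - card K) * (\<integral>n. \<phi> (law.plus n (law.counts_of i K)) \<partial>law L D))" for \<phi> :: "('c \<Rightarrow> nat) \<Rightarrow> real" and i
  define R where "R i = rect q (\<lambda>j. D (i j))" for i
  define a where "a i = (\<integral>x. indicator (R i) x * g x \<partial>Mk q)" for i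
  define lw where "lw i = (\<Prod>j<q. measure M (D (i j)))" for i
  have Rs: "R i \<in> sets (Mk q)" if "i \<in> ?T" for i
    unfolding R_def using that Db by (intro rect_sets) (auto simp: bdd_def PiE_iff)
  \<comment> \<open>On a product of measure zero g has integral 0, which makes the value 0 of the
    quotient a i / lw i the right one.\<close>
  have a0: "a i = 0" if i: "i \<in> ?T" "lw i = 0" for i
  proof -
    have "emeasure (Mk q) (R i) = (\<Prod>j<q. emeasure M (D (i j)))"
      unfolding R_def using i Db by (intro emeasure_Mk_rect) (auto simp: bdd_def PiE_iff)
    also have "\<dots> = (\<Prod>j<q. ennreal (measure M (D (i j))))"
    proof (intro prod.cong refl)
      fix j assume "j \<in> {..<q}"
      then have "bdd (D (i j))" using i Db by (auto simp: PiE_iff)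
      from bdd_fin[OF this] show "emeasure M (D (i j)) = ennreal (measure M (D (i j)))"
        by (intro emeasure_eq_ennreal_measure) auto
    qed
    also have "\<dots> = ennreal (lw i)" unfolding lw_def by (rule prod_ennreal) simp
    finally have "R i \<in> null_sets (Mk q)" using i Rs by (auto simp: null_sets_def)
    then have "AE x in Mk q. indicator (R i) x * g x = 0"
      by (rule eventually_mono[OF AE_not_in]) (auto simp: indicator_def)
    then show ?thesis unfolding a_def by (rule integral_eq_zero_AE)
  qed
  \<comment> \<open>Words that are rearrangements of each other have the same Charlier product, so
    their averages are collected in one coefficient.\<close>
  define d where "d \<alpha> = (\<Sum>i\<in>?T. if law.counts_of i {..<q} = \<alpha> then a i / lw i else 0)" for \<alpha>
  define U where "U n = (\<Sum>\<alpha>\<in>multi_indices L q. d \<alpha> * law.chr \<alpha> n)" for n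
  have U: "U n = (\<Sum>i\<in>?T. a i / lw i * law.chr (law.counts_of i {..<q}) n)" for n
  proof -
    have "U n = (\<Sum>\<alpha>\<in>multi_indices L q. \<Sum>i\<in>?T. (if law.counts_of i {..<q} = \<alpha> then a i / lw i * law.chr \<alpha> n else 0))"
      unfolding U_def d_def sum_distrib_right by (intro sum.cong refl) auto
    also have "\<dots> = (\<Sum>i\<in>?T. \<Sum>\<alpha>\<in>multi_indices L q. (if law.counts_of i {..<q} = \<alpha> then a i / lw i * law.chr \<alpha> n else 0))"
      by (rule sum.swap)
    also have "\<dots> = (\<Sum>i\<in>?T. a i / lw i * law.chr (law.counts_of i {..<q}) n)"
    proof (intro sum.cong refl)
      fix i assume "i \<in> ?T"
      then have "law.counts_of i {..<q} \<in> multi_indices L q" by (intro law.counts_of_mi) (auto simp: PiE_iff)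
      then show "(\<Sum>\<alpha>\<in>multi_indices L q. (if law.counts_of i {..<q} = \<alpha> then a i / lw i * law.chr \<alpha> n else 0)) = a i / lw i * law.chr (law.counts_of i {..<q}) n"
        by (simp add: law.finite_mi)
    qed
    finally show ?thesis .
  qed
  have "(\<integral>\<omega>. \<phi> (counts L D \<omega>) * pathwise_version q g \<omega> \<partial>P) = (\<integral>n. \<phi> n * U n \<partial>law L D)" if t: "law.tame \<phi>" for \<phi>
  proof -
    have gw: "integrable (Mk q) (\<lambda>x. g x * shift_mean L D \<phi> K x)" if "K \<subseteq> {..<q}" for K
      by (rule shift_mean_times_integrable[OF c t g that])
    have alternating_shift: "g x * alternating_shift L D \<phi> q x = (\<Sum>i\<in>?T. Wc \<phi> i * (indicator (R i) x * g x))" if x: "x \<in> space (Mk q)" for x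
    \<comment> \<open>Either some coordinate of x lies in no cell, or x lies in exactly one product
      of cells.\<close>
    proof (cases "\<exists>j<q. \<forall>b\<in>L. x j \<notin> D b")
      case True
      then obtain j where j: "j < q" "\<And>b. b \<in> L \<Longrightarrow> x j \<notin> D b" by blast
      have "indicator (R i) x = (0::real)" if "i \<in> ?T" for i
        using j that by (auto simp: R_def rect_def PiE_iff indicator_def)
      then show ?thesis using alternating_shift_zero[of j q L x D \<phi>, OF j(1)] j(2) by simp
    next
      case False
      then have "\<forall>j<q. \<exists>b. b \<in> L \<and> x j \<in> D b" by blast
      then obtain s where s: "\<And>j. j < q \<Longrightarrow> s j \<in> L \<and> x j \<in> D (s j)" by metis
      define i0 where "i0 = restrict s {..<q}"
      have i0: "i0 \<in> ?T" "\<And>j. j < q \<Longrightarrow> x j \<in> D (i0 j)" using s by (auto simp: i0_def)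
      have xR: "x \<in> R i0" using i0 x by (auto simp: R_def rect_def space_PiM PiE_iff)
      have other: "x \<notin> R i" if i: "i \<in> ?T" "i \<noteq> i0" for i
      proof
        assume "x \<in> R i"
        have "i j = i0 j" if j: "j < q" for j
        proof (rule ccontr)
          assume "i j \<noteq> i0 j"
          then have "D (i j) \<inter> D (i0 j) = {}" using Dd i i0(1) j by (auto simp: disjoint_family_on_def PiE_iff)
          moreover have "x j \<in> D (i j)" using \<open>x \<in> R i\<close> j by (auto simp: R_def rect_def PiE_iff)
          ultimately show False using i0(2)[OF j] by blast
        qed
        then have "i = i0" using i i0 by (intro PiE_ext[of i _ _ i0]) auto
        with i show False by simp
      qed
      have w: "shift_mean L D \<phi> K x = (\<integral>n. \<phi> (law.plus n (law.counts_of i0 K)) \<partial>law L D)" if K: "K \<subseteq> {..<q}" for K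
      proof -
        have "point_counts L D K x b = law.counts_of i0 K b" for b
        proof (cases "b \<in> L")
          case True
          have "x j \<in> D b \<longleftrightarrow> i0 j = b" if "j \<in> K" for j
          proof -
            have j: "j < q" using that K by auto
            show ?thesis
            proof
              assume "x j \<in> D b"
              then show "i0 j = b" using i0(1) i0(2)[OF j] Dd j True by (auto simp: disjoint_family_on_def PiE_iff)
            qed (use i0(2)[OF j] in auto)
          qed
          then have "{j \<in> K. x j \<in> D b} = {j \<in> K. i0 j = b}" by auto
          then show ?thesis using True by (simp add: point_counts_def law.counts_of_def)
        next
          case False
          then have e: "{j \<in> K. i0 j = b} = {}" using i0(1) K by (auto simp: PiE_iff)
          have "law.counts_of i0 K b = 0" unfolding law.counts_of_def e by simp
          then show ?thesis using False by (simp add: point_counts_def)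
        qed
        then show ?thesis by (simp add: shift_mean_def law.plus_def[abs_def])
      qed
      have "(\<Sum>i\<in>?T. Wc \<phi> i * (indicator (R i) x * g x)) = (\<Sum>i\<in>{i0}. Wc \<phi> i * (indicator (R i) x * g x))"
        by (rule sum.mono_neutral_right) (use fT i0 other in auto)
      also have "\<dots> = g x * alternating_shift L D \<phi> q x" using xR by (simp add: Wc_def alternating_shift_def w)
      finally show ?thesis ..
    qed
    have "(\<integral>\<omega>. \<phi> (counts L D \<omega>) * pathwise_version q g \<omega> \<partial>P) = (\<Sum>k\<le>q. (-1) ^ (q - k) * real (q choose k) * (\<integral>x. g x * shift_mean L D \<phi> {..<k} x \<partial>Mk q))"
      by (rule has_bochner_integral_integral_eq[OF pathwise_version_campbell[OF c t g]])
    also have "\<dots> = (\<Sum>K\<in>Pow {..<q}. (-1) ^ (q - card K) * (\<integral>x. g x * shift_mean L D \<phi> {..<card K} x \<partial>Mk q))"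
      unfolding sum_Pow_card[of "\<lambda>k. (-1) ^ (q - k) * (\<integral>x. g x * shift_mean L D \<phi> {..<k} x \<partial>Mk q)"] by (simp add: mult_ac)
    also have "\<dots> = (\<Sum>K\<in>Pow {..<q}. (-1) ^ (q - card K) * (\<integral>x. g x * shift_mean L D \<phi> K x \<partial>Mk q))"
      by (intro sum.cong refl arg_cong[where f="\<lambda>y. _ * y"] symmetric_shift_card[OF c _ s, symmetric]) (use g in auto)
    also have "\<dots> = (\<integral>x. (\<Sum>K\<in>Pow {..<q}. (-1) ^ (q - card K) * (g x * shift_mean L D \<phi> K x)) \<partial>Mk q)"
      using gw by (subst Bochner_Integration.integral_sum) auto
    also have "\<dots> = (\<integral>x. g x * alternating_shift L D \<phi> q x \<partial>Mk q)"
      by (simp add: alternating_shift_def sum_distrib_left mult_ac)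
    also have "\<dots> = (\<integral>x. (\<Sum>i\<in>?T. Wc \<phi> i * (indicator (R i) x * g x)) \<partial>Mk q)"
      by (rule Bochner_Integration.integral_cong[OF refl alternating_shift])
    also have "\<dots> = (\<Sum>i\<in>?T. Wc \<phi> i * a i)"
    proof -
      have "integrable (Mk q) (\<lambda>x. indicator (R i) x * g x)" if "i \<in> ?T" for i
        using integrable_mult_indicator[OF Rs[OF that] g] by simp
      then show ?thesis unfolding a_def by (subst Bochner_Integration.integral_sum) auto
    qed
    also have "\<dots> = (\<Sum>i\<in>?T. a i / lw i * (\<integral>n. \<phi> n * law.chr (law.counts_of i {..<q}) n \<partial>law L D))"
    proof (intro sum.cong refl)
      fix i assume i: "i \<in> ?T"
      have "(\<integral>n. \<phi> n * law.chr (law.counts_of i {..<q}) n \<partial>law L D) = lw i * Wc \<phi> i"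
        unfolding lw_def Wc_def by (rule law.integral_chr_word) (use i t in \<open>auto simp: PiE_iff\<close>)
      then show "Wc \<phi> i * a i = a i / lw i * (\<integral>n. \<phi> n * law.chr (law.counts_of i {..<q}) n \<partial>law L D)"
        using a0[OF i] by (cases "lw i = 0") auto
    qed
    also have "\<dots> = (\<integral>n. (\<Sum>i\<in>?T. a i / lw i * (\<phi> n * law.chr (law.counts_of i {..<q}) n)) \<partial>law L D)"
      using law.tame_integrable[OF law.tame_mult[OF t law.tame_chr]]
      by (subst Bochner_Integration.integral_sum) auto
    also have "\<dots> = (\<integral>n. \<phi> n * U n \<partial>law L D)"
      by (simp add: U sum_distrib_left mult_ac)
    finally show ?thesis .
  qed
  then show ?thesis unfolding U_def by blast
qed

end

section \<open>Approximation by functions of finitely many counts\<close>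

context prob_space
begin

lemma integrable_mult_L2:
  fixes X Y :: "'a \<Rightarrow> real"
  assumes "X \<in> borel_measurable M" "Y \<in> borel_measurable M" "integrable M (\<lambda>x. (X x)\<^sup>2)" "integrable M (\<lambda>x. (Y x)\<^sup>2)"
  shows "integrable M (\<lambda>x. X x * Y x)"
proof (rule Bochner_Integration.integrable_bound)
  show "integrable M (\<lambda>x. (X x)\<^sup>2 + (Y x)\<^sup>2)" using assms by simp
  show "AE x in M. norm (X x * Y x) \<le> norm ((X x)\<^sup>2 + (Y x)\<^sup>2)"
  proof (rule AE_I2)
    fix x
    have "0 \<le> (\<bar>X x\<bar> - \<bar>Y x\<bar>)\<^sup>2" "0 \<le> \<bar>X x\<bar> * \<bar>Y x\<bar>" by auto
    then have "\<bar>X x\<bar> * \<bar>Y x\<bar> \<le> (X x)\<^sup>2 + (Y x)\<^sup>2" unfolding power2_diff power2_abs by linarith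
    then show "norm (X x * Y x) \<le> norm ((X x)\<^sup>2 + (Y x)\<^sup>2)" by (simp add: abs_mult)
  qed
qed (use assms in measurable)

lemma square_integrable_diff:
  assumes "square_integrable M X" "square_integrable M Y" shows "square_integrable M (\<lambda>x. X x - Y x)"
  using assms integrable_mult_L2[of X Y] by (auto simp: square_integrable_def power2_diff mult.assoc intro!: borel_measurable_diff)

lemma square_integrable_mult:
  assumes "square_integrable M X" "square_integrable M Y" shows "integrable M (\<lambda>x. X x * Y x)"
  using assms integrable_mult_L2[of X Y] by (simp add: square_integrable_def)

lemma square_integrable_bounded:
  assumes "X \<in> borel_measurable M" "\<And>x. \<bar>X x\<bar> \<le> K" shows "square_integrable M X"
  unfolding square_integrable_def
proof (intro conjI assms(1) integrable_const_bound[where B="K\<^sup>2"] AE_I2)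
  fix x show "norm ((X x)\<^sup>2) \<le> K\<^sup>2" using power_mono[OF assms(2), of x 2] by simp
qed (use assms in measurable)

lemma square_integrable_integrable: "square_integrable M X \<Longrightarrow> integrable M X"
  using square_integrable_mult[of X "\<lambda>_. 1"] by (simp add: square_integrable_def)

lemma integral_mult_le_L2:
  assumes X: "square_integrable M X" and Y: "square_integrable M Y"
  shows "\<bar>\<integral>x. X x * Y x \<partial>M\<bar> \<le> sqrt ((\<integral>x. (X x)\<^sup>2 \<partial>M) * (\<integral>x. (Y x)\<^sup>2 \<partial>M))"
proof -
  have "s * (\<integral>x. X x * Y x \<partial>M) \<le> sqrt ((\<integral>x. (X x)\<^sup>2 \<partial>M) * (\<integral>x. (Y x)\<^sup>2 \<partial>M))" if s: "s * s = (1::real)" for s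
  proof (rule quadratic_nonneg_imp)
    fix t
    have "0 \<le> (\<integral>x. (X x - s * t * Y x)\<^sup>2 \<partial>M)" by (rule Bochner_Integration.integral_nonneg) simp
    also have "\<dots> = (\<integral>x. (X x)\<^sup>2 - 2 * (s * t) * (X x * Y x) + (s * s) * t\<^sup>2 * (Y x)\<^sup>2 \<partial>M)"
      by (intro Bochner_Integration.integral_cong refl) (simp add: power2_eq_square algebra_simps)
    also have "\<dots> = (\<integral>x. (X x)\<^sup>2 \<partial>M) - 2 * (s * t) * (\<integral>x. X x * Y x \<partial>M) + t\<^sup>2 * (\<integral>x. (Y x)\<^sup>2 \<partial>M)"
      unfolding s using square_integrable_mult[OF X Y] X Y by (simp add: square_integrable_def)
    finally show "0 \<le> (\<integral>x. (X x)\<^sup>2 \<partial>M) - 2 * (s * (\<integral>x. X x * Y x \<partial>M)) * t + (\<integral>x. (Y x)\<^sup>2 \<partial>M) * t\<^sup>2"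
      by (simp add: mult_ac)
  qed simp
  from this[of 1] this[of "-1"] show ?thesis by simp
qed

lemma integral_abs_le_L2:
  assumes X: "square_integrable M X" shows "(\<integral>x. \<bar>X x\<bar> \<partial>M) \<le> sqrt (\<integral>x. (X x)\<^sup>2 \<partial>M)"
proof -
  have "square_integrable M (\<lambda>x. \<bar>X x\<bar>)" "square_integrable M (\<lambda>_. 1)" using X by (auto simp: square_integrable_def)
  from integral_mult_le_L2[OF this] show ?thesis by (simp add: prob_space)
qed

end

section \<open>Bounded functions of finitely many counts and their closure in L1\<close>

context poisson_process
begin

definition cylinder_function :: "('w \<Rightarrow> real) set" where
  "cylinder_function = {(\<lambda>\<omega>. \<psi> (counts J id \<omega>)) | J \<psi>. finite J \<and> (\<forall>B\<in>J. bdd B) \<and> (\<exists>K. \<forall>n. \<bar>\<psi> n\<bar> \<le> K)}"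

lemma cylfI: "finite J \<Longrightarrow> \<forall>B\<in>J. bdd B \<Longrightarrow> \<forall>n. \<bar>\<psi> n\<bar> \<le> K \<Longrightarrow> (\<lambda>\<omega>. \<psi> (counts J id \<omega>)) \<in> cylinder_function"
  by (auto simp: cylinder_function_def)

text \<open>Both functions are rewritten on the union of their index sets; the condition on f keeps
  the result bounded.\<close>

lemma cylinder_function_combine:
  assumes V: "V \<in> cylinder_function" and W: "W \<in> cylinder_function" and f: "\<forall>K. \<exists>K'. \<forall>x y. \<bar>x\<bar> \<le> K \<longrightarrow> \<bar>y\<bar> \<le> K \<longrightarrow> \<bar>f x y\<bar> \<le> K'"
  shows "(\<lambda>\<omega>. f (V \<omega>) (W \<omega>) :: real) \<in> cylinder_function"
proof -
  obtain J \<psi> K where J: "finite J" "\<forall>B\<in>J. bdd B" "\<forall>n. \<bar>\<psi> n\<bar> \<le> K" "V = (\<lambda>\<omega>. \<psi> (counts J id \<omega>))" using V by (auto simp: cylinder_function_def)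
  obtain J' \<psi>' K' where J': "finite J'" "\<forall>B\<in>J'. bdd B" "\<forall>n. \<bar>\<psi>' n\<bar> \<le> K'" "W = (\<lambda>\<omega>. \<psi>' (counts J' id \<omega>))" using W by (auto simp: cylinder_function_def)
  obtain C where C: "\<forall>x y. \<bar>x\<bar> \<le> max K K' \<longrightarrow> \<bar>y\<bar> \<le> max K K' \<longrightarrow> \<bar>f x y\<bar> \<le> C" using f by blast
  let ?r = "\<lambda>A n B. if B \<in> A then n B else (0::nat)"
  have r: "counts A id \<omega> = ?r A (counts (J \<union> J') id \<omega>)" if "A \<subseteq> J \<union> J'" for A \<omega>
    using that by (auto simp: counts_def fun_eq_iff)
  have "(\<lambda>\<omega>. f (V \<omega>) (W \<omega>)) = (\<lambda>\<omega>. f (\<psi> (?r J (counts (J \<union> J') id \<omega>))) (\<psi>' (?r J' (counts (J \<union> J') id \<omega>))))"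
    unfolding J(4) J'(4) by (subst r[of J], simp, subst r[of J'], simp, rule refl)
  moreover have "\<dots> \<in> cylinder_function"
  proof (rule cylfI[where \<psi>="\<lambda>n. f (\<psi> (?r J n)) (\<psi>' (?r J' n))" and J="J \<union> J'" and K=C])
    show "\<forall>n. \<bar>f (\<psi> (?r J n)) (\<psi>' (?r J' n))\<bar> \<le> C"
      using C J(3) J'(3) by (simp add: le_max_iff_disj)
  qed (use J J' in auto)
  ultimately show ?thesis by simp
qed

lemma cylinder_function_bounded:
  assumes "V \<in> cylinder_function" shows "\<exists>K. \<forall>\<omega>. \<bar>V \<omega>\<bar> \<le> K"
  using assms by (auto simp: cylinder_function_def)

lemma cylinder_function_measurable: assumes "V \<in> cylinder_function" shows "V \<in> borel_measurable P"
proof -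
  obtain J \<psi> where J: "finite J" "\<forall>B\<in>J. bdd B" "V = (\<lambda>\<omega>. \<psi> (counts J id \<omega>))" using assms by (auto simp: cylinder_function_def)
  show ?thesis unfolding J(3) by (rule measurable_compose[OF counts_id_measurable[OF J(1,2)]]) simp
qed

lemma cylinder_function_L2: "V \<in> cylinder_function \<Longrightarrow> square_integrable P V"
  using cylinder_function_bounded[of V] square_integrable_bounded[OF cylinder_function_measurable] by blast

lemma cylinder_function_integrable: "V \<in> cylinder_function \<Longrightarrow> integrable P V"
  by (rule square_integrable_integrable[OF cylinder_function_L2])

lemma cylinder_function_add: "V \<in> cylinder_function \<Longrightarrow> W \<in> cylinder_function \<Longrightarrow> (\<lambda>\<omega>. V \<omega> + W \<omega>) \<in> cylinder_function"
proof (rule cylinder_function_combine[where f="\<lambda>x y. x + y"])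
  show "\<forall>K. \<exists>K'. \<forall>x y::real. \<bar>x\<bar> \<le> K \<longrightarrow> \<bar>y\<bar> \<le> K \<longrightarrow> \<bar>x + y\<bar> \<le> K'"
    by (meson abs_triangle_ineq add_mono order_trans)
qed

lemma cylinder_function_cmult: "V \<in> cylinder_function \<Longrightarrow> (\<lambda>\<omega>. c * V \<omega>) \<in> cylinder_function"
proof (rule cylinder_function_combine[where f="\<lambda>x y. c * x"])
  show "\<forall>K. \<exists>K'. \<forall>x y::real. \<bar>x\<bar> \<le> K \<longrightarrow> \<bar>y\<bar> \<le> K \<longrightarrow> \<bar>c * x\<bar> \<le> K'"
  proof
    fix K
    show "\<exists>K'. \<forall>x y::real. \<bar>x\<bar> \<le> K \<longrightarrow> \<bar>y\<bar> \<le> K \<longrightarrow> \<bar>c * x\<bar> \<le> K'"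
      by (rule exI[of _ "\<bar>c\<bar> * K"]) (auto simp: abs_mult mult_left_mono)
  qed
qed

definition clip :: "real \<Rightarrow> real \<Rightarrow> real" where "clip K x = max (- K) (min K x)"

lemma clip_le: "0 \<le> K \<Longrightarrow> \<bar>clip K x\<bar> \<le> K" by (auto simp: clip_def)
lemma clip_lip: "\<bar>clip K x - clip K y\<bar> \<le> \<bar>x - y\<bar>" by (auto simp: clip_def)

lemma cylinder_function_clip: "V \<in> cylinder_function \<Longrightarrow> 0 \<le> K \<Longrightarrow> (\<lambda>\<omega>. clip K (V \<omega>)) \<in> cylinder_function"
  by (rule cylinder_function_combine[where f="\<lambda>x y. clip K x"]) (auto intro!: exI[of _ K] clip_le)

text \<open>The closure is taken in L1, where it is compatible with sums, disjoint unions and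
  dominated limits; truncation lifts the result to L2 afterwards.\<close>

definition approx :: "('w \<Rightarrow> real) \<Rightarrow> bool" where
  "approx W \<longleftrightarrow> integrable P W \<and> (\<forall>\<epsilon>>0. \<exists>V\<in>cylinder_function. (\<integral>\<omega>. \<bar>W \<omega> - V \<omega>\<bar> \<partial>P) < \<epsilon>)"

lemma integral_abs_triangle:
  fixes X Y W :: "'w \<Rightarrow> real"
  assumes "integrable P X" "integrable P Y" "integrable P W"
  shows "(\<integral>\<omega>. \<bar>X \<omega> - W \<omega>\<bar> \<partial>P) \<le> (\<integral>\<omega>. \<bar>X \<omega> - Y \<omega>\<bar> \<partial>P) + (\<integral>\<omega>. \<bar>Y \<omega> - W \<omega>\<bar> \<partial>P)"
proof -
  have "(\<integral>\<omega>. \<bar>X \<omega> - W \<omega>\<bar> \<partial>P) \<le> (\<integral>\<omega>. \<bar>X \<omega> - Y \<omega>\<bar> + \<bar>Y \<omega> - W \<omega>\<bar> \<partial>P)"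
    using assms by (intro Bochner_Integration.integral_mono) auto
  also have "\<dots> = (\<integral>\<omega>. \<bar>X \<omega> - Y \<omega>\<bar> \<partial>P) + (\<integral>\<omega>. \<bar>Y \<omega> - W \<omega>\<bar> \<partial>P)"
    using assms by (intro Bochner_Integration.integral_add) auto
  finally show ?thesis .
qed

lemma approx_limit:
  assumes W: "integrable P W" and l: "\<forall>\<epsilon>>0. \<exists>W'. approx W' \<and> (\<integral>\<omega>. \<bar>W \<omega> - W' \<omega>\<bar> \<partial>P) < \<epsilon>"
  shows "approx W"
  unfolding approx_def
proof (intro conjI W allI impI)
  fix \<epsilon> :: real assume e: "0 < \<epsilon>"
  obtain W' where W': "approx W'" "(\<integral>\<omega>. \<bar>W \<omega> - W' \<omega>\<bar> \<partial>P) < \<epsilon> / 2" using l e by (meson half_gt_zero)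
  obtain V where V: "V \<in> cylinder_function" "(\<integral>\<omega>. \<bar>W' \<omega> - V \<omega>\<bar> \<partial>P) < \<epsilon> / 2" using W'(1) e unfolding approx_def by (meson half_gt_zero)
  have "(\<integral>\<omega>. \<bar>W \<omega> - V \<omega>\<bar> \<partial>P) \<le> (\<integral>\<omega>. \<bar>W \<omega> - W' \<omega>\<bar> \<partial>P) + (\<integral>\<omega>. \<bar>W' \<omega> - V \<omega>\<bar> \<partial>P)"
    using W W'(1) cylinder_function_integrable[OF V(1)] by (intro integral_abs_triangle) (auto simp: approx_def)
  then show "\<exists>V\<in>cylinder_function. (\<integral>\<omega>. \<bar>W \<omega> - V \<omega>\<bar> \<partial>P) < \<epsilon>" using V W'(2) by (intro bexI[OF _ V(1)]) simp
qed

lemma approx_cylinder_function: assumes "V \<in> cylinder_function" shows "approx V"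
  unfolding approx_def using assms cylinder_function_integrable by (auto intro!: bexI[OF _ assms])

lemma approx_add:
  assumes V: "approx V" and W: "approx W" shows "approx (\<lambda>\<omega>. V \<omega> + W \<omega>)"
proof (rule approx_limit)
  have iV: "integrable P V" and iW: "integrable P W" using assms by (auto simp: approx_def)
  then show "integrable P (\<lambda>\<omega>. V \<omega> + W \<omega>)" by simp
  show "\<forall>\<epsilon>>0. \<exists>W'. approx W' \<and> (\<integral>\<omega>. \<bar>V \<omega> + W \<omega> - W' \<omega>\<bar> \<partial>P) < \<epsilon>"
  proof (intro allI impI)
    fix \<epsilon> :: real assume e: "0 < \<epsilon>"
    obtain X where X: "X \<in> cylinder_function" "(\<integral>\<omega>. \<bar>V \<omega> - X \<omega>\<bar> \<partial>P) < \<epsilon> / 2" using V e unfolding approx_def by (meson half_gt_zero)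
    obtain Y where Y: "Y \<in> cylinder_function" "(\<integral>\<omega>. \<bar>W \<omega> - Y \<omega>\<bar> \<partial>P) < \<epsilon> / 2" using W e unfolding approx_def by (meson half_gt_zero)
    note i = iV iW cylinder_function_integrable[OF X(1)] cylinder_function_integrable[OF Y(1)]
    have "(\<integral>\<omega>. \<bar>V \<omega> + W \<omega> - (X \<omega> + Y \<omega>)\<bar> \<partial>P) \<le> (\<integral>\<omega>. \<bar>V \<omega> - X \<omega>\<bar> + \<bar>W \<omega> - Y \<omega>\<bar> \<partial>P)"
      using i by (intro Bochner_Integration.integral_mono) auto
    also have "\<dots> = (\<integral>\<omega>. \<bar>V \<omega> - X \<omega>\<bar> \<partial>P) + (\<integral>\<omega>. \<bar>W \<omega> - Y \<omega>\<bar> \<partial>P)"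
      using i by (intro Bochner_Integration.integral_add) auto
    also have "\<dots> < \<epsilon>" using X(2) Y(2) by simp
    finally show "\<exists>W'. approx W' \<and> (\<integral>\<omega>. \<bar>V \<omega> + W \<omega> - W' \<omega>\<bar> \<partial>P) < \<epsilon>"
      using approx_cylinder_function[OF cylinder_function_add[OF X(1) Y(1)]] by blast
  qed
qed

lemma approx_cmult:
  assumes V: "approx V" shows "approx (\<lambda>\<omega>. c * V \<omega>)"
proof (rule approx_limit)
  have iV: "integrable P V" using assms by (auto simp: approx_def)
  then show "integrable P (\<lambda>\<omega>. c * V \<omega>)" by simp
  show "\<forall>\<epsilon>>0. \<exists>W'. approx W' \<and> (\<integral>\<omega>. \<bar>c * V \<omega> - W' \<omega>\<bar> \<partial>P) < \<epsilon>"
  proof (intro allI impI)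
    fix \<epsilon> :: real assume e: "0 < \<epsilon>"
    then have "0 < \<epsilon> / (\<bar>c\<bar> + 1)" by simp
    then obtain X where X: "X \<in> cylinder_function" "(\<integral>\<omega>. \<bar>V \<omega> - X \<omega>\<bar> \<partial>P) < \<epsilon> / (\<bar>c\<bar> + 1)" using V unfolding approx_def by meson
    have "(\<integral>\<omega>. \<bar>c * V \<omega> - c * X \<omega>\<bar> \<partial>P) = \<bar>c\<bar> * (\<integral>\<omega>. \<bar>V \<omega> - X \<omega>\<bar> \<partial>P)"
      unfolding right_diff_distrib[symmetric] abs_mult by simp
    also have "\<dots> \<le> (\<bar>c\<bar> + 1) * (\<integral>\<omega>. \<bar>V \<omega> - X \<omega>\<bar> \<partial>P)" by (intro mult_right_mono Bochner_Integration.integral_nonneg) auto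
    also have "\<dots> < (\<bar>c\<bar> + 1) * (\<epsilon> / (\<bar>c\<bar> + 1))" using X(2) by (intro mult_strict_left_mono) auto
    also have "\<dots> = \<epsilon>" by simp
    finally show "\<exists>W'. approx W' \<and> (\<integral>\<omega>. \<bar>c * V \<omega> - W' \<omega>\<bar> \<partial>P) < \<epsilon>"
      using approx_cylinder_function[OF cylinder_function_cmult[OF X(1)]] by blast
  qed
qed

lemma Int_stable_cylinder: "Int_stable cylinder"
proof (rule Int_stableI)
  fix A B assume "A \<in> cylinder" "B \<in> cylinder"
  then obtain J \<psi> J' \<psi>' where J: "finite J" "\<forall>B\<in>J. bdd B" "A = {\<omega>\<in>space P. \<psi> (counts J id \<omega>)}"
    and J': "finite J'" "\<forall>B\<in>J'. bdd B" "B = {\<omega>\<in>space P. \<psi>' (counts J' id \<omega>)}" by (auto simp: cylinder_def)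
  let ?r = "\<lambda>A n B. if B \<in> A then n B else (0::nat)"
  have r: "counts A id \<omega> = ?r A (counts (J \<union> J') id \<omega>)" if "A \<subseteq> J \<union> J'" for A \<omega>
    using that by (auto simp: counts_def fun_eq_iff)
  have "A \<inter> B = {\<omega>\<in>space P. \<psi> (counts J id \<omega>) \<and> \<psi>' (counts J' id \<omega>)}" using J J' by auto
  also have "\<dots> = {\<omega>\<in>space P. \<psi> (?r J (counts (J \<union> J') id \<omega>)) \<and> \<psi>' (?r J' (counts (J \<union> J') id \<omega>))}"
    by (subst r[of J], simp, subst r[of J'], simp, rule refl)
  also have "\<dots> \<in> cylinder" unfolding cylinder_def
    using J J' by (intro CollectI exI[of _ "J \<union> J'"] exI[of _ "\<lambda>n. \<psi> (?r J n) \<and> \<psi>' (?r J' n)"]) auto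
  finally show "A \<inter> B \<in> cylinder" .
qed

lemma approx_cong:
  assumes V: "approx V" and e: "\<And>\<omega>. \<omega> \<in> space P \<Longrightarrow> V \<omega> = W \<omega>" shows "approx W"
proof (rule approx_limit)
  show "integrable P W" using V e Bochner_Integration.integrable_cong[of P P V W] by (simp add: approx_def)
  have "(\<integral>\<omega>. \<bar>W \<omega> - V \<omega>\<bar> \<partial>P) = (\<integral>\<omega>. 0 \<partial>P)" using e by (intro Bochner_Integration.integral_cong) auto
  then show "\<forall>\<epsilon>>0. \<exists>W'. approx W' \<and> (\<integral>\<omega>. \<bar>W \<omega> - W' \<omega>\<bar> \<partial>P) < \<epsilon>" using V by (auto intro!: exI[of _ V])
qed

text \<open>Dynkin argument over the intersection-stable cylinders; for disjoint unions the partial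
  sums converge in L1 by continuity of the measure.\<close>

lemma approx_indicator:
  assumes "E \<in> sets cylinder_algebra" shows "approx (indicator E)"
  using assms[unfolded sets_cylinder_algebra]
proof (induction rule: sigma_sets_induct_disjoint[OF Int_stable_cylinder cylinder_Pow, consumes 1])
  case (1 A)
  then obtain J \<psi> where J: "finite J" "\<forall>B\<in>J. bdd B" "A = {\<omega>\<in>space P. \<psi> (counts J id \<omega>)}" by (auto simp: cylinder_def)
  have "(\<lambda>\<omega>. of_bool (\<psi> (counts J id \<omega>))) \<in> cylinder_function" using J by (intro cylfI[where K=1]) auto
  from approx_cylinder_function[OF this] show ?case by (rule approx_cong) (auto simp: J(3) indicator_def)
next
  case 2
  show ?case using approx_cmult[of "\<lambda>_. 0" 0] approx_cylinder_function[OF cylfI[of "{}" "\<lambda>_. 0" 0]] by (simp add: indicator_def)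
next
  case (3 A)
  have "approx (\<lambda>\<omega>. 1)" using approx_cylinder_function[OF cylfI[of "{}" "\<lambda>_. 1" 1]] by simp
  from approx_add[OF this approx_cmult[OF 3(2), of "-1"]] show ?case
    by (rule approx_cong) (auto simp: indicator_def)
next
  case (4 A)
  have A: "A i \<in> events" for i
    using 4(2) sets.sigma_sets_subset[OF cylinder_events] by auto
  have s: "approx (\<lambda>\<omega>. \<Sum>i<n. indicator (A i) \<omega>)" for n
  proof (induction n)
    case 0
    show ?case using approx_cylinder_function[OF cylfI[of "{}" "\<lambda>_. 0" 0]] by simp
  next
    case (Suc n)
    show ?case using approx_add[OF Suc 4(3)[of n]] by simp
  qed
  have inc: "incseq (\<lambda>n. \<Union>i<n. A i)" by (intro incseq_SucI UN_mono) auto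
  have "(\<lambda>n. prob (\<Union>i<n. A i)) \<longlonglongrightarrow> prob (\<Union>n. \<Union>i<n. A i)"
    using A inc by (intro finite_Lim_measure_incseq) auto
  moreover have "(\<Union>n. \<Union>i<n. A i) = (\<Union>i. A i)" by auto
  ultimately have lim: "(\<lambda>n. prob (\<Union>i<n. A i)) \<longlonglongrightarrow> prob (\<Union>i. A i)" by simp
  have d: "(\<integral>\<omega>. \<bar>indicator (\<Union>i. A i) \<omega> - (\<Sum>i<n. indicator (A i) \<omega> :: real)\<bar> \<partial>P) = prob (\<Union>i. A i) - prob (\<Union>i<n. A i)" for n
  proof -
    have ind: "(\<Sum>i<n. indicator (A i) \<omega>) = (indicator (\<Union>i<n. A i) \<omega> :: real)" for \<omega>
      using 4(1) by (subst indicator_UN_disjoint) (auto simp: disjoint_family_on_def)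
    have "(\<integral>\<omega>. \<bar>indicator (\<Union>i. A i) \<omega> - (\<Sum>i<n. indicator (A i) \<omega> :: real)\<bar> \<partial>P) = (\<integral>\<omega>. indicator ((\<Union>i. A i) - (\<Union>i<n. A i)) \<omega> \<partial>P)"
      unfolding ind by (intro Bochner_Integration.integral_cong refl) (auto simp: indicator_def)
    also have "\<dots> = prob ((\<Union>i. A i) - (\<Union>i<n. A i))" using A by (subst Bochner_Integration.integral_indicator) (auto simp: sets.Int_space_eq2)
    also have "\<dots> = prob (\<Union>i. A i) - prob (\<Union>i<n. A i)" using A by (intro finite_measure_Diff) auto
    finally show ?thesis .
  qed
  show ?case
  proof (rule approx_limit)
    show "integrable P (indicator (\<Union>i. A i) :: _ \<Rightarrow> real)" using A by (intro integrable_real_indicator) (auto simp: emeasure_eq_measure)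
    show "\<forall>\<epsilon>>0. \<exists>W'. approx W' \<and> (\<integral>\<omega>. \<bar>indicator (\<Union>i. A i) \<omega> - W' \<omega>\<bar> \<partial>P) < \<epsilon>"
    proof (intro allI impI)
      fix \<epsilon> :: real assume "0 < \<epsilon>"
      from LIMSEQ_D[OF lim this] obtain n where "norm (prob (\<Union>i<n. A i) - prob (\<Union>i. A i)) < \<epsilon>" by blast
      then show "\<exists>W'. approx W' \<and> (\<integral>\<omega>. \<bar>indicator (\<Union>i. A i) \<omega> - W' \<omega>\<bar> \<partial>P) < \<epsilon>"
        using s[of n] d[of n] by (intro exI[of _ "\<lambda>\<omega>. \<Sum>i<n. indicator (A i) \<omega>"]) auto
    qed
  qed
qed

lemma approx_cylinder_algebra:
  fixes f :: "'w \<Rightarrow> real"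
  assumes f: "f \<in> borel_measurable cylinder_algebra" and i: "integrable P f" shows "approx f"
proof -
  let ?R = "restr_to_subalg P cylinder_algebra"
  \<comment> \<open>Induction over the functions integrable for the restricted measure keeps all
    sets involved in \<open>cylinder_algebra\<close>.\<close>
  have "integrable ?R f" by (rule integrable_in_subalg[OF cylinder_algebra_subalgebra f i])
  then show ?thesis
  proof (induction rule: integrable_induct)
    case (base A c)
    then have "A \<in> sets cylinder_algebra" by (simp add: sets_restr_to_subalg[OF cylinder_algebra_subalgebra])
    from approx_cmult[OF approx_indicator[OF this], of c] show ?case by (simp add: mult.commute)
  next
    case (add f g)
    then show ?case by (intro approx_add)
  next
    case (lim f s)
    have iP: "integrable P g" if "integrable ?R g" for g :: "'w \<Rightarrow> real" by (rule integrable_from_subalg[OF cylinder_algebra_subalgebra that])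
    have sp: "space ?R = space P" by (simp add: space_restr_to_subalg)
    have "(\<lambda>i. \<integral>\<omega>. \<bar>f \<omega> - s i \<omega>\<bar> \<partial>P) \<longlonglongrightarrow> (\<integral>\<omega>. 0 \<partial>P)"
    proof (rule integral_dominated_convergence)
      show "integrable P (\<lambda>\<omega>. 3 * \<bar>f \<omega>\<bar>)" using iP[OF lim(4)] by simp
      show "(\<lambda>\<omega>. \<bar>f \<omega> - s i \<omega>\<bar>) \<in> borel_measurable P" for i using iP[OF lim(1)[of i]] iP[OF lim(4)] by simp
      show "AE \<omega> in P. (\<lambda>i. \<bar>f \<omega> - s i \<omega>\<bar>) \<longlonglongrightarrow> 0"
      proof (rule AE_I2)
        fix \<omega> assume "\<omega> \<in> space P"
        then have "(\<lambda>i. s i \<omega>) \<longlonglongrightarrow> f \<omega>" using lim(2) sp by simp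
        from tendsto_rabs[OF tendsto_diff[OF tendsto_const[of "f \<omega>"] this]] show "(\<lambda>i. \<bar>f \<omega> - s i \<omega>\<bar>) \<longlonglongrightarrow> 0" by simp
      qed
      show "AE \<omega> in P. norm \<bar>f \<omega> - s i \<omega>\<bar> \<le> 3 * \<bar>f \<omega>\<bar>" for i
      proof (rule AE_I2)
        fix \<omega> assume "\<omega> \<in> space P"
        then have "\<bar>s i \<omega>\<bar> \<le> 2 * \<bar>f \<omega>\<bar>" using lim(3)[of \<omega> i] sp by simp
        then show "norm \<bar>f \<omega> - s i \<omega>\<bar> \<le> 3 * \<bar>f \<omega>\<bar>" by simp
      qed
    qed simp
    then have l: "(\<lambda>i. \<integral>\<omega>. \<bar>f \<omega> - s i \<omega>\<bar> \<partial>P) \<longlonglongrightarrow> 0" by simp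
    show ?case
    proof (rule approx_limit[OF iP[OF lim(4)]], intro allI impI)
      fix \<epsilon> :: real assume "0 < \<epsilon>"
      from LIMSEQ_D[OF l this] obtain n where "norm ((\<integral>\<omega>. \<bar>f \<omega> - s n \<omega>\<bar> \<partial>P) - 0) < \<epsilon>" by blast
      then have "(\<integral>\<omega>. \<bar>f \<omega> - s n \<omega>\<bar> \<partial>P) < \<epsilon>" by simp
      with lim(5)[of n] show "\<exists>W'. approx W' \<and> (\<integral>\<omega>. \<bar>f \<omega> - W' \<omega>\<bar> \<partial>P) < \<epsilon>" by blast
    qed
  qed
qed

text \<open>F is truncated at a level where little of it is lost in L2, and an L1 approximation is
  truncated at the same level. The difference of the truncated values is at most 2 K and at most the
  original difference, so its square is controlled by 2 K times the L1 error.\<close>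

lemma approx_L2:
  assumes F: "square_integrable P F" and a: "approx F" and e: "0 < \<epsilon>"
  shows "\<exists>V\<in>cylinder_function. (\<integral>\<omega>. (F \<omega> - V \<omega>)\<^sup>2 \<partial>P) < \<epsilon>"
proof -
  have Fm [measurable]: "F \<in> borel_measurable P" and F2: "integrable P (\<lambda>\<omega>. (F \<omega>)\<^sup>2)" using F by (auto simp: square_integrable_def)
  have cm [measurable]: "clip K \<in> borel_measurable borel" for K unfolding clip_def by measurable
  have "(\<lambda>k::nat. \<integral>\<omega>. (F \<omega> - clip (real k) (F \<omega>))\<^sup>2 \<partial>P) \<longlonglongrightarrow> (\<integral>\<omega>. 0 \<partial>P)"
  proof (rule integral_dominated_convergence[OF _ _ F2])
    show "AE \<omega> in P. (\<lambda>k. (F \<omega> - clip (real k) (F \<omega>))\<^sup>2) \<longlonglongrightarrow> 0"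
    proof (rule AE_I2, rule tendsto_eventually)
      fix \<omega>
      obtain k0 where k0: "\<bar>F \<omega>\<bar> \<le> real k0" using real_arch_simple by blast
      show "\<forall>\<^sub>F k in sequentially. (F \<omega> - clip (real k) (F \<omega>))\<^sup>2 = 0"
        using eventually_ge_at_top[of k0]
      proof eventually_elim
        case (elim k)
        then have "\<bar>F \<omega>\<bar> \<le> real k" using k0 by simp
        then have "clip (real k) (F \<omega>) = F \<omega>" by (auto simp: clip_def)
        then show ?case by simp
      qed
    qed
    show "AE \<omega> in P. norm ((F \<omega> - clip (real k) (F \<omega>))\<^sup>2) \<le> (F \<omega>)\<^sup>2" for k
    proof (rule AE_I2)
      fix \<omega>
      have "\<bar>F \<omega> - clip (real k) (F \<omega>)\<bar> \<le> \<bar>F \<omega>\<bar>" by (auto simp: clip_def)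
      from power_mono[OF this, of 2] show "norm ((F \<omega> - clip (real k) (F \<omega>))\<^sup>2) \<le> (F \<omega>)\<^sup>2" by simp
    qed
  qed measurable
  then have l: "(\<lambda>k::nat. \<integral>\<omega>. (F \<omega> - clip (real k) (F \<omega>))\<^sup>2 \<partial>P) \<longlonglongrightarrow> 0" by simp
  have "0 < \<epsilon> / 4" using e by simp
  from LIMSEQ_D[OF l this] obtain k where "norm ((\<integral>\<omega>. (F \<omega> - clip (real k) (F \<omega>))\<^sup>2 \<partial>P) - 0) < \<epsilon> / 4" by blast
  then have k: "(\<integral>\<omega>. (F \<omega> - clip (real k) (F \<omega>))\<^sup>2 \<partial>P) < \<epsilon> / 4" by simp
  \<comment> \<open>The added 1 keeps the divisor below positive when k = 0.\<close>
  define K where "K = real k + 1"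
  have "0 < \<epsilon> / (8 * K)" using e by (simp add: K_def)
  then obtain V where V: "V \<in> cylinder_function" "(\<integral>\<omega>. \<bar>F \<omega> - V \<omega>\<bar> \<partial>P) < \<epsilon> / (8 * K)" using a unfolding approx_def by meson
  have iV: "integrable P V" and VL: "V \<in> borel_measurable P" by (rule cylinder_function_integrable[OF V(1)], rule cylinder_function_measurable[OF V(1)])
  have iF: "integrable P F" using a by (simp add: approx_def)
  let ?V = "\<lambda>\<omega>. clip (real k) (V \<omega>)"
  have cF: "square_integrable P (\<lambda>\<omega>. clip (real k) (F \<omega>))" by (rule square_integrable_bounded[where K="real k"]) (use clip_le in auto)
  have V': "?V \<in> cylinder_function" by (rule cylinder_function_clip[OF V(1)]) simp
  note L2 = square_integrable_diff[OF F cF] square_integrable_diff[OF cF cylinder_function_L2[OF V']] square_integrable_diff[OF F cylinder_function_L2[OF V']]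
  have 2: "(\<integral>\<omega>. (clip (real k) (F \<omega>) - ?V \<omega>)\<^sup>2 \<partial>P) \<le> (\<integral>\<omega>. 2 * K * \<bar>F \<omega> - V \<omega>\<bar> \<partial>P)"
  proof (rule Bochner_Integration.integral_mono)
    fix \<omega>
    let ?a = "\<bar>clip (real k) (F \<omega>) - ?V \<omega>\<bar>"
    have 1: "?a \<le> \<bar>F \<omega> - V \<omega>\<bar>" by (rule clip_lip)
    have 2: "?a \<le> 2 * K" using clip_le[of "real k" "F \<omega>"] clip_le[of "real k" "V \<omega>"] by (simp add: K_def)
    have "?a * ?a \<le> 2 * K * \<bar>F \<omega> - V \<omega>\<bar>" by (intro mult_mono 1 2) (auto simp: K_def)
    then show "(clip (real k) (F \<omega>) - ?V \<omega>)\<^sup>2 \<le> 2 * K * \<bar>F \<omega> - V \<omega>\<bar>" by (simp add: power2_eq_square)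
  qed (use L2 iF iV in \<open>auto simp: square_integrable_def\<close>)
  have "(\<integral>\<omega>. (F \<omega> - ?V \<omega>)\<^sup>2 \<partial>P) \<le> (\<integral>\<omega>. 2 * (F \<omega> - clip (real k) (F \<omega>))\<^sup>2 + 2 * (clip (real k) (F \<omega>) - ?V \<omega>)\<^sup>2 \<partial>P)"
  proof (rule Bochner_Integration.integral_mono)
    fix \<omega>
    have "0 \<le> ((F \<omega> - clip (real k) (F \<omega>)) - (clip (real k) (F \<omega>) - ?V \<omega>))\<^sup>2" by simp
    then show "(F \<omega> - ?V \<omega>)\<^sup>2 \<le> 2 * (F \<omega> - clip (real k) (F \<omega>))\<^sup>2 + 2 * (clip (real k) (F \<omega>) - ?V \<omega>)\<^sup>2"
      by (simp add: power2_eq_square algebra_simps)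
  qed (use L2 in \<open>auto simp: square_integrable_def\<close>)
  also have "\<dots> = 2 * (\<integral>\<omega>. (F \<omega> - clip (real k) (F \<omega>))\<^sup>2 \<partial>P) + 2 * (\<integral>\<omega>. (clip (real k) (F \<omega>) - ?V \<omega>)\<^sup>2 \<partial>P)"
    using L2 by (simp add: square_integrable_def)
  also have "\<dots> < 2 * (\<epsilon> / 4) + 2 * (2 * K * (\<epsilon> / (8 * K)))"
  proof (rule add_strict_mono)
    have "2 * K * (\<integral>\<omega>. \<bar>F \<omega> - V \<omega>\<bar> \<partial>P) < 2 * K * (\<epsilon> / (8 * K))" using V(2) by (intro mult_strict_left_mono) (auto simp: K_def)
    then show "2 * (\<integral>\<omega>. (clip (real k) (F \<omega>) - ?V \<omega>)\<^sup>2 \<partial>P) < 2 * (2 * K * (\<epsilon> / (8 * K)))" using 2 by simp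
  qed (use k in simp)
  also have "\<dots> = \<epsilon>" using K_def by (simp add: field_simps)
  finally show ?thesis by (rule bexI[OF _ V'])
qed

end

section \<open>The fourth moment bound\<close>

context poisson_process
begin

lemma law_L2:
  fixes L :: "'c set"
  assumes c: "cells L D" and t: "tame_law L \<phi>"
  shows "square_integrable P (\<lambda>\<omega>. \<phi> (counts L D \<omega>))" and "square_integrable (law L D) \<phi>"
proof -
  interpret law: poisson_vector "law L D" L "\<lambda>c. measure M (D c)" by (rule poisson_vector_law[OF c])
  have i: "integrable (law L D) (\<lambda>n. (\<phi> n)\<^sup>2)" by (intro law.tame_integrable law.tame_power t)
  then show "square_integrable (law L D) \<phi>" by (simp add: square_integrable_def)
  have "(\<lambda>\<omega>. \<phi> (counts L D \<omega>)) \<in> borel_measurable P" by (rule fun_counts_measurable[OF _ c]) simp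
  moreover have "integrable P (\<lambda>\<omega>. (\<phi> (counts L D \<omega>))\<^sup>2)" using i integrable_law_iff[OF c, of "\<lambda>n. (\<phi> n)\<^sup>2"] by simp
  ultimately show "square_integrable P (\<lambda>\<omega>. \<phi> (counts L D \<omega>))" by (simp add: square_integrable_def)
qed

text \<open>Each approximating integral has coefficients by
  \<open>pathwise_version_projection\<close>; multiplied by the norm they are integrals against
  Charlier products and therefore converge. Coefficients at norm 0 are not determined, but there the
  Charlier product vanishes in L2.\<close>

lemma chaos_projection:
  fixes L :: "'c set"
  assumes c: "cells L D" and F: "F \<in> poisson_chaos P M \<eta> q"
  shows "\<exists>d. \<forall>\<phi>. tame_law L \<phi> \<longrightarrow> (\<integral>\<omega>. \<phi> (counts L D \<omega>) * F \<omega> \<partial>P) =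
    (\<integral>n. \<phi> n * (\<Sum>\<alpha>\<in>multi_indices L q. d \<alpha> * poisson_vector.chr L (\<lambda>c. measure M (D c)) \<alpha> n) \<partial>law L D)"
proof -
  interpret law: poisson_vector "law L D" L "\<lambda>c. measure M (D c)" by (rule poisson_vector_law[OF c])
  obtain f where "is_multiple_integral P M \<eta> q f F" using F by (auto simp: poisson_chaos_def)
  then obtain g G where FL: "square_integrable P F"
    and sg: "\<And>n. symmetric_kernel q M (g n)" and ig: "\<And>n. integrable (Mk q) (g n)"
    and GL: "\<And>n. square_integrable P (G n)"
    and AE: "\<And>n. AE \<omega> in P. G n \<omega> = pathwise_integral q M (\<eta> \<omega>) (g n)"
    and lim: "(\<lambda>n. \<integral>\<omega>. (G n \<omega> - F \<omega>)\<^sup>2 \<partial>P) \<longlonglongrightarrow> 0"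
    unfolding is_multiple_integral_def by blast
  have GF: "(\<lambda>n. \<integral>\<omega>. \<phi> (counts L D \<omega>) * G n \<omega> \<partial>P) \<longlonglongrightarrow> (\<integral>\<omega>. \<phi> (counts L D \<omega>) * F \<omega> \<partial>P)" if t: "law.tame \<phi>" for \<phi>
  proof (rule LIM_zero_cancel, rule Lim_null_comparison)
    let ?X = "\<lambda>\<omega>. \<phi> (counts L D \<omega>)"
    have XL: "square_integrable P ?X" by (rule law_L2[OF c t])
    have "(\<lambda>n. sqrt ((\<integral>\<omega>. (?X \<omega>)\<^sup>2 \<partial>P) * (\<integral>\<omega>. (G n \<omega> - F \<omega>)\<^sup>2 \<partial>P))) \<longlonglongrightarrow> sqrt ((\<integral>\<omega>. (?X \<omega>)\<^sup>2 \<partial>P) * 0)"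
      by (intro tendsto_intros lim)
    then show "(\<lambda>n. sqrt ((\<integral>\<omega>. (?X \<omega>)\<^sup>2 \<partial>P) * (\<integral>\<omega>. (G n \<omega> - F \<omega>)\<^sup>2 \<partial>P))) \<longlonglongrightarrow> 0" by simp
    show "\<forall>\<^sub>F n in sequentially. norm ((\<integral>\<omega>. ?X \<omega> * G n \<omega> \<partial>P) - (\<integral>\<omega>. ?X \<omega> * F \<omega> \<partial>P)) \<le> sqrt ((\<integral>\<omega>. (?X \<omega>)\<^sup>2 \<partial>P) * (\<integral>\<omega>. (G n \<omega> - F \<omega>)\<^sup>2 \<partial>P))"
    proof (rule always_eventually, rule allI)
      fix n
      have "(\<integral>\<omega>. ?X \<omega> * G n \<omega> \<partial>P) - (\<integral>\<omega>. ?X \<omega> * F \<omega> \<partial>P) = (\<integral>\<omega>. ?X \<omega> * (G n \<omega> - F \<omega>) \<partial>P)"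
        using square_integrable_mult[OF XL GL[of n]] square_integrable_mult[OF XL FL] by (simp add: right_diff_distrib)
      then show "norm ((\<integral>\<omega>. ?X \<omega> * G n \<omega> \<partial>P) - (\<integral>\<omega>. ?X \<omega> * F \<omega> \<partial>P)) \<le> sqrt ((\<integral>\<omega>. (?X \<omega>)\<^sup>2 \<partial>P) * (\<integral>\<omega>. (G n \<omega> - F \<omega>)\<^sup>2 \<partial>P))"
        using integral_mult_le_L2[OF XL square_integrable_diff[OF GL[of n] FL]] by simp
    qed
  qed
  have "\<forall>n. \<exists>d. \<forall>\<phi>. law.tame \<phi> \<longrightarrow> (\<integral>\<omega>. \<phi> (counts L D \<omega>) * G n \<omega> \<partial>P) = (\<integral>k. \<phi> k * (\<Sum>\<alpha>\<in>law.mi q. d \<alpha> * law.chr \<alpha> k) \<partial>law L D)"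
  proof
    fix n
    obtain d where d: "\<forall>\<phi>. law.tame \<phi> \<longrightarrow> (\<integral>\<omega>. \<phi> (counts L D \<omega>) * pathwise_version q (g n) \<omega> \<partial>P) = (\<integral>k. \<phi> k * (\<Sum>\<alpha>\<in>law.mi q. d \<alpha> * law.chr \<alpha> k) \<partial>law L D)"
      using pathwise_version_projection[OF c ig[of n] sg[of n]] by (elim exE)
    have "(\<integral>\<omega>. \<phi> (counts L D \<omega>) * G n \<omega> \<partial>P) = (\<integral>\<omega>. \<phi> (counts L D \<omega>) * pathwise_version q (g n) \<omega> \<partial>P)" for \<phi> :: "('c \<Rightarrow> nat) \<Rightarrow> real"
    proof (rule integral_cong_AE)
      have m: "(\<lambda>\<omega>. \<phi> (counts L D \<omega>)) \<in> borel_measurable P" by (rule fun_counts_measurable[OF _ c]) simp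
      show "(\<lambda>\<omega>. \<phi> (counts L D \<omega>) * G n \<omega>) \<in> borel_measurable P" using m GL[of n] by (intro borel_measurable_times) (auto simp: square_integrable_def)
      show "(\<lambda>\<omega>. \<phi> (counts L D \<omega>) * pathwise_version q (g n) \<omega>) \<in> borel_measurable P"
        using m ig[of n] by (intro borel_measurable_times cylinder_algebra_measurableD[OF pathwise_version_measurable]) auto
      show "AE \<omega> in P. \<phi> (counts L D \<omega>) * G n \<omega> = \<phi> (counts L D \<omega>) * pathwise_version q (g n) \<omega>"
        using AE[of n] pathwise_version_eq_pathwise_integral[OF ig[of n]] by eventually_elim simp
    qed
    with d show "\<exists>d. \<forall>\<phi>. law.tame \<phi> \<longrightarrow> (\<integral>\<omega>. \<phi> (counts L D \<omega>) * G n \<omega> \<partial>P) = (\<integral>k. \<phi> k * (\<Sum>\<alpha>\<in>law.mi q. d \<alpha> * law.chr \<alpha> k) \<partial>law L D)"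
      by (intro exI[of _ d]) simp
  qed
  from choice[OF this] obtain d where d: "\<forall>n. \<forall>\<phi>. law.tame \<phi> \<longrightarrow> (\<integral>\<omega>. \<phi> (counts L D \<omega>) * G n \<omega> \<partial>P) = (\<integral>k. \<phi> k * (\<Sum>\<alpha>\<in>law.mi q. d n \<alpha> * law.chr \<alpha> k) \<partial>law L D)"
    by (elim exE)
  have d': "(\<integral>\<omega>. \<phi> (counts L D \<omega>) * G n \<omega> \<partial>P) = (\<Sum>\<alpha>\<in>law.mi q. d n \<alpha> * (\<integral>k. \<phi> k * law.chr \<alpha> k \<partial>law L D))" if t: "law.tame \<phi>" for n \<phi>
  proof -
    have "(\<integral>\<omega>. \<phi> (counts L D \<omega>) * G n \<omega> \<partial>P) = (\<integral>k. (\<Sum>\<alpha>\<in>law.mi q. d n \<alpha> * (\<phi> k * law.chr \<alpha> k)) \<partial>law L D)"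
      using d t by (simp add: sum_distrib_left mult_ac)
    also have "\<dots> = (\<Sum>\<alpha>\<in>law.mi q. d n \<alpha> * (\<integral>k. \<phi> k * law.chr \<alpha> k \<partial>law L D))"
      using law.tame_integrable[OF law.tame_mult[OF t law.tame_chr]] by (subst Bochner_Integration.integral_sum) auto
    finally show ?thesis .
  qed
  define C where "C \<alpha> n = (\<integral>\<omega>. law.chr \<alpha> (counts L D \<omega>) * G n \<omega> \<partial>P)" for \<alpha> n
  have C: "C \<alpha> n = d n \<alpha> * law.nrm \<alpha>" if a: "\<alpha> \<in> law.mi q" for \<alpha> n
  proof -
    have "C \<alpha> n = (\<Sum>\<beta>\<in>law.mi q. d n \<beta> * (if \<alpha> = \<beta> then law.nrm \<alpha> else 0))"
      unfolding C_def d'[OF law.tame_chr] by (intro sum.cong refl) (simp add: law.chr_orth[OF a])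
    also have "\<dots> = d n \<alpha> * law.nrm \<alpha>" using a by (simp add: if_distrib cong: if_cong)
    finally show ?thesis .
  qed
  have zero: "(\<integral>k. \<phi> k * law.chr \<alpha> k \<partial>law L D) = 0" if t: "law.tame \<phi>" and a: "\<alpha> \<in> law.mi q" "law.nrm \<alpha> = 0" for \<phi> \<alpha>
  proof -
    have "(\<integral>k. (law.chr \<alpha> k)\<^sup>2 \<partial>law L D) = 0" using law.chr_orth[OF a(1) a(1)] a(2) by (simp add: power2_eq_square)
    with law.integral_mult_le_L2[OF law_L2(2)[OF c t] law_L2(2)[OF c law.tame_chr[of \<alpha>]]] show ?thesis by simp
  qed
  \<comment> \<open>At norm 0 the quotient is 0, an admissible choice by
    \<open>zero\<close>.\<close>
  define b where "b \<alpha> = (\<integral>\<omega>. law.chr \<alpha> (counts L D \<omega>) * F \<omega> \<partial>P) / law.nrm \<alpha>" for \<alpha>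
  have "(\<integral>\<omega>. \<phi> (counts L D \<omega>) * F \<omega> \<partial>P) = (\<integral>n. \<phi> n * (\<Sum>\<alpha>\<in>law.mi q. b \<alpha> * law.chr \<alpha> n) \<partial>law L D)" if t: "law.tame \<phi>" for \<phi>
  proof (rule LIMSEQ_unique[OF GF[OF t]])
    have "(\<integral>\<omega>. \<phi> (counts L D \<omega>) * G n \<omega> \<partial>P) = (\<Sum>\<alpha>\<in>law.mi q. C \<alpha> n / law.nrm \<alpha> * (\<integral>k. \<phi> k * law.chr \<alpha> k \<partial>law L D))" for n
      unfolding d'[OF t]
    proof (intro sum.cong refl)
      fix \<alpha> assume a: "\<alpha> \<in> law.mi q"
      show "d n \<alpha> * (\<integral>k. \<phi> k * law.chr \<alpha> k \<partial>law L D) = C \<alpha> n / law.nrm \<alpha> * (\<integral>k. \<phi> k * law.chr \<alpha> k \<partial>law L D)"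
        using zero[OF t a] by (cases "law.nrm \<alpha> = 0") (auto simp: C[OF a])
    qed
    moreover have "(\<lambda>n. \<Sum>\<alpha>\<in>law.mi q. C \<alpha> n / law.nrm \<alpha> * (\<integral>k. \<phi> k * law.chr \<alpha> k \<partial>law L D)) \<longlonglongrightarrow> (\<Sum>\<alpha>\<in>law.mi q. b \<alpha> * (\<integral>k. \<phi> k * law.chr \<alpha> k \<partial>law L D))"
    proof (rule tendsto_sum, rule tendsto_mult[OF _ tendsto_const])
      fix \<alpha>
      have "(\<lambda>n. C \<alpha> n * inverse (law.nrm \<alpha>)) \<longlonglongrightarrow> (\<integral>\<omega>. law.chr \<alpha> (counts L D \<omega>) * F \<omega> \<partial>P) * inverse (law.nrm \<alpha>)"
        unfolding C_def by (rule tendsto_mult[OF GF[OF law.tame_chr] tendsto_const])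
      then show "(\<lambda>n. C \<alpha> n / law.nrm \<alpha>) \<longlonglongrightarrow> b \<alpha>" by (simp add: b_def divide_inverse)
    qed
    moreover have "(\<Sum>\<alpha>\<in>law.mi q. b \<alpha> * (\<integral>k. \<phi> k * law.chr \<alpha> k \<partial>law L D)) = (\<integral>n. \<phi> n * (\<Sum>\<alpha>\<in>law.mi q. b \<alpha> * law.chr \<alpha> n) \<partial>law L D)"
    proof -
      have "(\<integral>n. \<phi> n * (\<Sum>\<alpha>\<in>law.mi q. b \<alpha> * law.chr \<alpha> n) \<partial>law L D) = (\<integral>k. (\<Sum>\<alpha>\<in>law.mi q. b \<alpha> * (\<phi> k * law.chr \<alpha> k)) \<partial>law L D)"
        by (simp add: sum_distrib_left mult_ac)
      also have "\<dots> = (\<Sum>\<alpha>\<in>law.mi q. b \<alpha> * (\<integral>k. \<phi> k * law.chr \<alpha> k \<partial>law L D))"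
        using law.tame_integrable[OF law.tame_mult[OF t law.tame_chr]] by (subst Bochner_Integration.integral_sum) auto
      finally show ?thesis by simp
    qed
    ultimately show "(\<lambda>n. \<integral>\<omega>. \<phi> (counts L D \<omega>) * G n \<omega> \<partial>P) \<longlonglongrightarrow> (\<integral>n. \<phi> n * (\<Sum>\<alpha>\<in>law.mi q. b \<alpha> * law.chr \<alpha> n) \<partial>law L D)"
      by simp
  qed
  then show ?thesis by (intro exI[of _ b]) simp
qed

text \<open>F itself is not assumed measurable with respect to \<open>cylinder_algebra\<close>; it
  inherits approximability as an L2 limit of versions of pathwise integrals.\<close>

lemma approx_chaos:
  assumes F: "F \<in> poisson_chaos P M \<eta> q" shows "approx F"
proof -
  obtain f where "is_multiple_integral P M \<eta> q f F" using F by (auto simp: poisson_chaos_def)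
  then obtain g G where FL: "square_integrable P F"
    and ig: "\<And>n. integrable (Mk q) (g n)"
    and GL: "\<And>n. square_integrable P (G n)"
    and AE: "\<And>n. AE \<omega> in P. G n \<omega> = pathwise_integral q M (\<eta> \<omega>) (g n)"
    and lim: "(\<lambda>n. \<integral>\<omega>. (G n \<omega> - F \<omega>)\<^sup>2 \<partial>P) \<longlonglongrightarrow> 0"
    unfolding is_multiple_integral_def by blast
  show ?thesis
  proof (rule approx_limit[OF square_integrable_integrable[OF FL]], intro allI impI)
    fix \<epsilon> :: real assume e: "0 < \<epsilon>"
    then have "0 < \<epsilon>\<^sup>2" by simp
    from LIMSEQ_D[OF lim this] obtain n where "norm ((\<integral>\<omega>. (G n \<omega> - F \<omega>)\<^sup>2 \<partial>P) - 0) < \<epsilon>\<^sup>2" by blast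
    then have n: "(\<integral>\<omega>. (G n \<omega> - F \<omega>)\<^sup>2 \<partial>P) < \<epsilon>\<^sup>2" by simp
    have "(\<integral>\<omega>. \<bar>F \<omega> - pathwise_version q (g n) \<omega>\<bar> \<partial>P) = (\<integral>\<omega>. \<bar>G n \<omega> - F \<omega>\<bar> \<partial>P)"
    proof (rule integral_cong_AE)
      show "(\<lambda>\<omega>. \<bar>F \<omega> - pathwise_version q (g n) \<omega>\<bar>) \<in> borel_measurable P" using pathwise_version_integrable[OF ig[of n]] square_integrable_integrable[OF FL] by simp
      show "(\<lambda>\<omega>. \<bar>G n \<omega> - F \<omega>\<bar>) \<in> borel_measurable P" using square_integrable_integrable[OF FL] square_integrable_integrable[OF GL[of n]] by simp
      show "AE \<omega> in P. \<bar>F \<omega> - pathwise_version q (g n) \<omega>\<bar> = \<bar>G n \<omega> - F \<omega>\<bar>"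
        using AE[of n] pathwise_version_eq_pathwise_integral[OF ig[of n]] by eventually_elim (simp add: abs_minus_commute)
    qed
    also have "\<dots> \<le> sqrt (\<integral>\<omega>. (G n \<omega> - F \<omega>)\<^sup>2 \<partial>P)" by (rule integral_abs_le_L2[OF square_integrable_diff[OF GL FL]])
    also have "\<dots> < \<epsilon>" using n e by (simp add: real_less_lsqrt)
    finally have "(\<integral>\<omega>. \<bar>F \<omega> - pathwise_version q (g n) \<omega>\<bar> \<partial>P) < \<epsilon>" .
    moreover have "approx (pathwise_version q (g n))" using ig[of n] by (intro approx_cylinder_algebra pathwise_version_measurable pathwise_version_integrable) auto
    ultimately show "\<exists>W'. approx W' \<and> (\<integral>\<omega>. \<bar>F \<omega> - W' \<omega>\<bar> \<partial>P) < \<epsilon>" by blast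
  qed
qed

text \<open>Let Y be the projection u evaluated at the counts, so that E(\<phi> F) = E(\<phi> Y) for
  every \<phi> of polynomial growth. Taking \<phi> = u shows that e is \<sigma>^2 minus the second
  moment of Y, \<phi> = u^3 that the fourth moment of Y is at most that of F, and \<phi> = \<psi>
  that e is at most the error of the competitor \<psi>. The bound for Y is thus stated in terms of F
  and e, ready for e to tend to 0.\<close>

lemma cells_stein_bound:
  fixes L :: "'c set"
  assumes c: "cells L D" and F: "F \<in> poisson_chaos P M \<eta> q" and q: "1 \<le> q" and \<sigma>: "0 < \<sigma>"
    and s: "\<sigma>\<^sup>2 = (\<integral>\<omega>. (F \<omega>)\<^sup>2 \<partial>P)" and F4: "integrable P (\<lambda>\<omega>. F \<omega> ^ 4)" and \<psi>: "\<forall>n. \<bar>\<psi> n\<bar> \<le> K"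
  shows "\<exists>e. 0 \<le> e \<and> e \<le> (\<integral>\<omega>. (F \<omega> - \<psi> (counts L D \<omega>))\<^sup>2 \<partial>P) \<and> 0 \<le> (\<integral>\<omega>. F \<omega> ^ 4 \<partial>P) - 3 * (\<sigma>\<^sup>2 - e)\<^sup>2 \<and>
    (\<forall>h. 1-lipschitz_on UNIV h \<longrightarrow> \<bar>(\<integral>\<omega>. h (F \<omega>) \<partial>P) - (\<integral>z. h (\<sigma> * z) * std_normal_density z \<partial>lborel)\<bar> \<le>
      sqrt e + (sqrt (2 / pi) / \<sigma> * (e + (2 * real q - 1) / (2 * real q) * sqrt ((\<integral>\<omega>. F \<omega> ^ 4 \<partial>P) - 3 * (\<sigma>\<^sup>2 - e)\<^sup>2))
      + 2 / (3 * \<sigma>\<^sup>2) * \<sigma> * sqrt ((4 * real q - 3) / real q) * sqrt ((\<integral>\<omega>. F \<omega> ^ 4 \<partial>P) - 3 * (\<sigma>\<^sup>2 - e)\<^sup>2)))"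
proof -
  interpret law: poisson_vector "law L D" L "\<lambda>c. measure M (D c)" by (rule poisson_vector_law[OF c])
  obtain d where d: "\<forall>\<phi>. law.tame \<phi> \<longrightarrow> (\<integral>\<omega>. \<phi> (counts L D \<omega>) * F \<omega> \<partial>P) = (\<integral>n. \<phi> n * (\<Sum>\<alpha>\<in>law.mi q. d \<alpha> * law.chr \<alpha> n) \<partial>law L D)"
    using chaos_projection[OF c F] by (elim exE)
  define u where "u n = (\<Sum>\<alpha>\<in>law.mi q. d \<alpha> * law.chr \<alpha> n)" for n
  define Y where "Y \<omega> = u (counts L D \<omega>)" for \<omega>
  define V where "V \<omega> = \<psi> (counts L D \<omega>)" for \<omega>
  have tu: "law.tame u" unfolding u_def[abs_def] by (intro law.tame_sum law.tame_mult law.tame_const law.tame_chr)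
  have t\<psi>: "law.tame \<psi>" by (rule law.tame_bound[OF law.tame_const[of K]]) (use \<psi> in \<open>force intro: order_trans[OF _ abs_ge_self]\<close>)
  have pr: "(\<integral>\<omega>. \<phi> (counts L D \<omega>) * F \<omega> \<partial>P) = (\<integral>n. \<phi> n * u n \<partial>law L D)" if "law.tame \<phi>" for \<phi>
    using d that unfolding u_def by blast
  have FL: "square_integrable P F" using F by (auto simp: poisson_chaos_def is_multiple_integral_def)
  have YL: "square_integrable P Y" unfolding Y_def by (rule law_L2[OF c tu])
  have VL: "square_integrable P V" unfolding V_def by (rule law_L2[OF c t\<psi>])
  define s2 where "s2 = (\<integral>n. (u n)\<^sup>2 \<partial>law L D)"
  define e where "e = (\<integral>\<omega>. (F \<omega> - Y \<omega>)\<^sup>2 \<partial>P)"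
  define A where "A = (\<integral>\<omega>. F \<omega> ^ 4 \<partial>P)"
  define \<Delta> where "\<Delta> = (\<integral>n. u n ^ 4 \<partial>law L D) - 3 * s2\<^sup>2"
  have e0: "0 \<le> e" unfolding e_def by (rule Bochner_Integration.integral_nonneg) simp
  have YF: "(\<integral>\<omega>. Y \<omega> * F \<omega> \<partial>P) = s2" unfolding Y_def pr[OF tu] s2_def by (simp add: power2_eq_square)
  have YY: "(\<integral>\<omega>. (Y \<omega>)\<^sup>2 \<partial>P) = s2" unfolding Y_def s2_def by (rule integral_law[OF c, symmetric])
  have es: "e = \<sigma>\<^sup>2 - s2"
  proof -
    have "e = (\<integral>\<omega>. (F \<omega>)\<^sup>2 - 2 * (Y \<omega> * F \<omega>) + (Y \<omega>)\<^sup>2 \<partial>P)" unfolding e_def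
      by (intro Bochner_Integration.integral_cong refl) (simp add: power2_diff)
    also have "\<dots> = \<sigma>\<^sup>2 - 2 * s2 + s2"
      using FL YL square_integrable_mult[OF YL FL] by (simp add: square_integrable_def YF YY s)
    finally show ?thesis by simp
  qed
  have eV: "e \<le> (\<integral>\<omega>. (F \<omega> - V \<omega>)\<^sup>2 \<partial>P)"
  proof -
    have VF: "(\<integral>\<omega>. V \<omega> * F \<omega> \<partial>P) = (\<integral>n. \<psi> n * u n \<partial>law L D)" unfolding V_def by (rule pr[OF t\<psi>])
    have VV: "(\<integral>\<omega>. (V \<omega>)\<^sup>2 \<partial>P) = (\<integral>n. (\<psi> n)\<^sup>2 \<partial>law L D)" unfolding V_def by (rule integral_law[OF c, symmetric])
    have "(\<integral>\<omega>. (F \<omega> - V \<omega>)\<^sup>2 \<partial>P) = (\<integral>\<omega>. (F \<omega>)\<^sup>2 - 2 * (V \<omega> * F \<omega>) + (V \<omega>)\<^sup>2 \<partial>P)"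
      by (intro Bochner_Integration.integral_cong refl) (simp add: power2_diff)
    also have "\<dots> = \<sigma>\<^sup>2 - 2 * (\<integral>n. \<psi> n * u n \<partial>law L D) + (\<integral>n. (\<psi> n)\<^sup>2 \<partial>law L D)"
      using FL VL square_integrable_mult[OF VL FL] by (simp add: square_integrable_def VF VV s)
    finally have 1: "(\<integral>\<omega>. (F \<omega> - V \<omega>)\<^sup>2 \<partial>P) = \<sigma>\<^sup>2 - 2 * (\<integral>n. \<psi> n * u n \<partial>law L D) + (\<integral>n. (\<psi> n)\<^sup>2 \<partial>law L D)" .
    have "0 \<le> (\<integral>n. (\<psi> n - u n)\<^sup>2 \<partial>law L D)" by (rule Bochner_Integration.integral_nonneg) simp
    also have "\<dots> = (\<integral>n. (\<psi> n)\<^sup>2 - 2 * (\<psi> n * u n) + (u n)\<^sup>2 \<partial>law L D)"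
      by (intro Bochner_Integration.integral_cong refl) (simp add: power2_diff)
    also have "\<dots> = (\<integral>n. (\<psi> n)\<^sup>2 \<partial>law L D) - 2 * (\<integral>n. \<psi> n * u n \<partial>law L D) + s2"
      using law.tame_integrable[OF law.tame_power[OF tu, of 2]] law.tame_integrable[OF law.tame_power[OF t\<psi>, of 2]] law.tame_integrable[OF law.tame_mult[OF t\<psi> tu]]
      by (simp add: s2_def)
    finally show ?thesis using 1 es by simp
  qed
  have u4: "(\<integral>n. u n ^ 4 \<partial>law L D) \<le> A"
  proof -
    have t3: "law.tame (\<lambda>n. u n ^ 3)" by (rule law.tame_power[OF tu])
    have i3: "integrable P (\<lambda>\<omega>. Y \<omega> ^ 3 * F \<omega>)" unfolding Y_def
      by (rule square_integrable_mult[OF law_L2(1)[OF c t3] FL])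
    have i4: "integrable P (\<lambda>\<omega>. Y \<omega> ^ 4)" unfolding Y_def
      using integrable_law_iff[OF c, of "\<lambda>n. u n ^ 4"] law.tame_integrable[OF law.tame_power[OF tu, of 4]] by simp
    have Y4: "(\<integral>\<omega>. Y \<omega> ^ 4 \<partial>P) = (\<integral>n. u n ^ 4 \<partial>law L D)" unfolding Y_def by (rule integral_law[OF c, symmetric])
    have Y3: "(\<integral>\<omega>. Y \<omega> ^ 3 * F \<omega> \<partial>P) = (\<integral>n. u n ^ 4 \<partial>law L D)"
      unfolding Y_def pr[OF t3] by (simp add: power3_eq_cube power4_eq_xxxx mult.assoc)
    \<comment> \<open>The tangent inequality x^4 - 4 y^3 x + 3 y^4 \<ge> 0 of the fourth power, used
      in place of Jensen's inequality for conditional expectations.\<close>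
    have "0 \<le> (\<integral>\<omega>. F \<omega> ^ 4 - 4 * (Y \<omega> ^ 3 * F \<omega>) + 3 * Y \<omega> ^ 4 \<partial>P)"
    proof (rule Bochner_Integration.integral_nonneg)
      fix \<omega>
      have "F \<omega> ^ 4 - 4 * (Y \<omega> ^ 3 * F \<omega>) + 3 * Y \<omega> ^ 4 = ((F \<omega>)\<^sup>2 - (Y \<omega>)\<^sup>2)\<^sup>2 + 2 * (Y \<omega>)\<^sup>2 * (F \<omega> - Y \<omega>)\<^sup>2"
        by algebra
      also have "\<dots> \<ge> 0" by simp
      finally show "0 \<le> F \<omega> ^ 4 - 4 * (Y \<omega> ^ 3 * F \<omega>) + 3 * Y \<omega> ^ 4" .
    qed
    also have "\<dots> = A - 4 * (\<integral>\<omega>. Y \<omega> ^ 3 * F \<omega> \<partial>P) + 3 * (\<integral>\<omega>. Y \<omega> ^ 4 \<partial>P)"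
      using i3 i4 F4 by (simp add: A_def)
    finally show ?thesis using Y3 Y4 by simp
  qed
  have D0: "0 \<le> \<Delta>" using law.chaos_moments(1)[OF q, of d] by (simp add: \<Delta>_def s2_def u_def)
  have DA: "\<Delta> \<le> A - 3 * (\<sigma>\<^sup>2 - e)\<^sup>2" using u4 es by (simp add: \<Delta>_def)
  have s20: "0 \<le> s2" unfolding s2_def by (rule Bochner_Integration.integral_nonneg) simp
  have s2s: "sqrt s2 \<le> \<sigma>" using es e0 \<sigma> by (intro real_le_lsqrt) auto
  define B where "B = sqrt (A - 3 * (\<sigma>\<^sup>2 - e)\<^sup>2)"
  have DB: "sqrt \<Delta> \<le> B" unfolding B_def using DA by (rule real_sqrt_le_mono)
  have "\<bar>(\<integral>\<omega>. h (F \<omega>) \<partial>P) - (\<integral>z. h (\<sigma> * z) * std_normal_density z \<partial>lborel)\<bar> \<le>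
      sqrt e + (sqrt (2 / pi) / \<sigma> * (e + (2 * real q - 1) / (2 * real q) * B)
      + 2 / (3 * \<sigma>\<^sup>2) * \<sigma> * sqrt ((4 * real q - 3) / real q) * B)" if lip: "1-lipschitz_on UNIV h" for h
  proof -
    have hm [measurable]: "h \<in> borel_measurable borel"
      using lipschitz_on_continuous_on[OF lip] by (rule borel_measurable_continuous_onI)
    have hl: "\<bar>h x - h y\<bar> \<le> \<bar>x - y\<bar>" for x y
      using lipschitz_onD[OF lip, of x y] by (simp add: dist_real_def)
    have hi: "integrable P (\<lambda>\<omega>. h (X \<omega>))" if X: "square_integrable P X" for X
    proof (rule Bochner_Integration.integrable_bound)
      show "integrable P (\<lambda>\<omega>. \<bar>h 0\<bar> + \<bar>X \<omega>\<bar>)" using square_integrable_integrable[OF X] by simp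
      show "(\<lambda>\<omega>. h (X \<omega>)) \<in> borel_measurable P"
        using X by (intro measurable_compose[OF _ hm]) (simp add: square_integrable_def)
      have "\<bar>h (X \<omega>)\<bar> \<le> \<bar>\<bar>h 0\<bar> + \<bar>X \<omega>\<bar>\<bar>" for \<omega> using hl[of "X \<omega>" 0] by simp
      then show "AE \<omega> in P. norm (h (X \<omega>)) \<le> norm (\<bar>h 0\<bar> + \<bar>X \<omega>\<bar>)" by simp
    qed
    have "\<bar>(\<integral>\<omega>. h (F \<omega>) \<partial>P) - (\<integral>\<omega>. h (Y \<omega>) \<partial>P)\<bar> = \<bar>\<integral>\<omega>. h (F \<omega>) - h (Y \<omega>) \<partial>P\<bar>"
      using hi[OF FL] hi[OF YL] by simp
    also have "\<dots> \<le> (\<integral>\<omega>. \<bar>h (F \<omega>) - h (Y \<omega>)\<bar> \<partial>P)" by (rule integral_abs_bound)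
    also have "\<dots> \<le> (\<integral>\<omega>. \<bar>F \<omega> - Y \<omega>\<bar> \<partial>P)"
      using hi[OF FL] hi[OF YL] square_integrable_integrable[OF FL] square_integrable_integrable[OF YL]
      by (intro Bochner_Integration.integral_mono hl) auto
    also have "\<dots> \<le> sqrt e" unfolding e_def by (rule integral_abs_le_L2[OF square_integrable_diff[OF FL YL]])
    finally have 1: "\<bar>(\<integral>\<omega>. h (F \<omega>) \<partial>P) - (\<integral>\<omega>. h (Y \<omega>) \<partial>P)\<bar> \<le> sqrt e" .
    have hY: "(\<integral>\<omega>. h (Y \<omega>) \<partial>P) = (\<integral>n. h (u n) \<partial>law L D)" unfolding Y_def by (rule integral_law[OF c, symmetric])
    have "\<bar>(\<integral>n. h (u n) \<partial>law L D) - (\<integral>z. h (\<sigma> * z) * std_normal_density z \<partial>lborel)\<bar> \<le>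
      sqrt (2 / pi) / \<sigma> * (\<bar>\<sigma>\<^sup>2 - s2\<bar> + (2 * real q - 1) / (2 * real q) * sqrt \<Delta>)
      + 2 / (3 * \<sigma>\<^sup>2) * sqrt s2 * sqrt ((4 * real q - 3) / real q) * sqrt \<Delta>"
      unfolding u_def s2_def \<Delta>_def by (rule law.chaos_stein_bound[OF q lip \<sigma>])
    also have "\<dots> \<le> sqrt (2 / pi) / \<sigma> * (e + (2 * real q - 1) / (2 * real q) * B)
      + 2 / (3 * \<sigma>\<^sup>2) * \<sigma> * sqrt ((4 * real q - 3) / real q) * B"
    proof (rule add_mono)
      have "\<bar>\<sigma>\<^sup>2 - s2\<bar> = e" using es e0 by simp
      then show "sqrt (2 / pi) / \<sigma> * (\<bar>\<sigma>\<^sup>2 - s2\<bar> + (2 * real q - 1) / (2 * real q) * sqrt \<Delta>) \<le> sqrt (2 / pi) / \<sigma> * (e + (2 * real q - 1) / (2 * real q) * B)"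
        using DB \<sigma> q by (intro mult_left_mono add_mono) auto
      show "2 / (3 * \<sigma>\<^sup>2) * sqrt s2 * sqrt ((4 * real q - 3) / real q) * sqrt \<Delta> \<le> 2 / (3 * \<sigma>\<^sup>2) * \<sigma> * sqrt ((4 * real q - 3) / real q) * B"
        using DB s2s \<sigma> q D0 s20 by (intro mult_mono mult_nonneg_nonneg mult_left_mono mult_right_mono) auto
    qed
    finally show ?thesis using 1 unfolding hY by linarith
  qed
  then show ?thesis using e0 eV D0 DA unfolding B_def A_def V_def by (intro exI[of _ e]) auto
qed

text \<open>The sets on which an approximating cylinder function depends may overlap; refining them
  to cells makes it a competitor in \<open>cells_stein_bound\<close>.\<close>

lemma cylinder_function_stein_bound:
  assumes F: "F \<in> poisson_chaos P M \<eta> q" and q: "1 \<le> q" and \<sigma>: "0 < \<sigma>"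
    and s: "\<sigma>\<^sup>2 = (\<integral>\<omega>. (F \<omega>)\<^sup>2 \<partial>P)" and F4: "integrable P (\<lambda>\<omega>. F \<omega> ^ 4)" and \<epsilon>: "0 < \<epsilon>"
  shows "\<exists>e. 0 \<le> e \<and> e \<le> \<epsilon> \<and> 0 \<le> (\<integral>\<omega>. F \<omega> ^ 4 \<partial>P) - 3 * (\<sigma>\<^sup>2 - e)\<^sup>2 \<and>
    (\<forall>h. 1-lipschitz_on UNIV h \<longrightarrow> \<bar>(\<integral>\<omega>. h (F \<omega>) \<partial>P) - (\<integral>z. h (\<sigma> * z) * std_normal_density z \<partial>lborel)\<bar> \<le>
      sqrt e + (sqrt (2 / pi) / \<sigma> * (e + (2 * real q - 1) / (2 * real q) * sqrt ((\<integral>\<omega>. F \<omega> ^ 4 \<partial>P) - 3 * (\<sigma>\<^sup>2 - e)\<^sup>2))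
      + 2 / (3 * \<sigma>\<^sup>2) * \<sigma> * sqrt ((4 * real q - 3) / real q) * sqrt ((\<integral>\<omega>. F \<omega> ^ 4 \<partial>P) - 3 * (\<sigma>\<^sup>2 - e)\<^sup>2)))"
proof -
  have FL: "square_integrable P F" using F by (auto simp: poisson_chaos_def is_multiple_integral_def)
  obtain V where V: "V \<in> cylinder_function" "(\<integral>\<omega>. (F \<omega> - V \<omega>)\<^sup>2 \<partial>P) < \<epsilon>" using approx_L2[OF FL approx_chaos[OF F] \<epsilon>] by (elim bexE)
  obtain J \<psi> K where J: "finite J" "\<forall>B\<in>J. bdd B" "\<forall>n. \<bar>\<psi> n\<bar> \<le> K" "V = (\<lambda>\<omega>. \<psi> (counts J id \<omega>))" using V(1) by (auto simp: cylinder_function_def)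
  define \<psi>' where "\<psi>' n = \<psi> (\<lambda>B. if B \<in> J then (\<Sum>S\<in>{S \<in> cell_ids J. B \<in> S}. n S) else 0)" for n
  have "V = (\<lambda>\<omega>. \<psi>' (counts (cell_ids J) (cell J) \<omega>))"
    unfolding J(4) \<psi>'_def using cnt_refine[OF J(1,2)]
    by (intro ext arg_cong[where f=\<psi>]) (auto simp: counts_def[of J])
  moreover have "\<forall>n. \<bar>\<psi>' n\<bar> \<le> K" using J(3) by (simp add: \<psi>'_def)
  ultimately show ?thesis
    using cells_stein_bound[OF cells_cell[OF J(1,2)] F q \<sigma> s F4, of \<psi>' K] V(2) by (auto intro: order_trans)
qed

text \<open>The projection error tends to 0 along a sequence, and the bounds pass to the limit
  because they are continuous in e.\<close>

lemma chaos_wasserstein_bound: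
  assumes F: "F \<in> poisson_chaos P M \<eta> q" and q: "1 \<le> q" and \<sigma>: "0 < \<sigma>"
    and s: "\<sigma>\<^sup>2 = (\<integral>\<omega>. (F \<omega>)\<^sup>2 \<partial>P)" and F4: "integrable P (\<lambda>\<omega>. F \<omega> ^ 4)"
  shows "0 \<le> (\<integral>\<omega>. F \<omega> ^ 4 \<partial>P) - 3 * \<sigma> ^ 4"
    and "1-lipschitz_on UNIV h \<Longrightarrow> \<bar>(\<integral>\<omega>. h (F \<omega>) \<partial>P) - (\<integral>z. h (\<sigma> * z) * std_normal_density z \<partial>lborel)\<bar> \<le>
      ((2 * real q - 1) / (\<sigma> * real q * sqrt (2 * pi)) + 2 / (3 * \<sigma>) * sqrt ((4 * real q - 3) / real q)) *
      sqrt ((\<integral>\<omega>. F \<omega> ^ 4 \<partial>P) - 3 * \<sigma> ^ 4)"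
proof -
  define A where "A = (\<integral>\<omega>. F \<omega> ^ 4 \<partial>P)"
  define R where "R e = sqrt e + (sqrt (2 / pi) / \<sigma> * (e + (2 * real q - 1) / (2 * real q) * sqrt (A - 3 * (\<sigma>\<^sup>2 - e)\<^sup>2))
      + 2 / (3 * \<sigma>\<^sup>2) * \<sigma> * sqrt ((4 * real q - 3) / real q) * sqrt (A - 3 * (\<sigma>\<^sup>2 - e)\<^sup>2))" for e
  have "\<forall>m::nat. \<exists>e. 0 \<le> e \<and> e \<le> inverse (real (Suc m)) \<and> 0 \<le> A - 3 * (\<sigma>\<^sup>2 - e)\<^sup>2 \<and>
    (\<forall>h. 1-lipschitz_on UNIV h \<longrightarrow> \<bar>(\<integral>\<omega>. h (F \<omega>) \<partial>P) - (\<integral>z. h (\<sigma> * z) * std_normal_density z \<partial>lborel)\<bar> \<le> R e)"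
    unfolding A_def R_def by (intro allI cylinder_function_stein_bound[OF F q \<sigma> s F4]) simp
  from choice[OF this] obtain e where e: "\<forall>m. 0 \<le> e m \<and> e m \<le> inverse (real (Suc m)) \<and> 0 \<le> A - 3 * (\<sigma>\<^sup>2 - e m)\<^sup>2 \<and>
    (\<forall>h. 1-lipschitz_on UNIV h \<longrightarrow> \<bar>(\<integral>\<omega>. h (F \<omega>) \<partial>P) - (\<integral>z. h (\<sigma> * z) * std_normal_density z \<partial>lborel)\<bar> \<le> R (e m))"
    by (elim exE)
  have el: "e \<longlonglongrightarrow> 0"
    by (rule tendsto_sandwich[OF _ _ tendsto_const LIMSEQ_inverse_real_of_nat]) (use e in auto)
  have "(\<lambda>m. A - 3 * (\<sigma>\<^sup>2 - e m)\<^sup>2) \<longlonglongrightarrow> A - 3 * (\<sigma>\<^sup>2 - 0)\<^sup>2" by (intro tendsto_intros el)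
  then have "0 \<le> A - 3 * (\<sigma>\<^sup>2 - 0)\<^sup>2" by (rule LIMSEQ_le_const) (use e in auto)
  moreover have s4: "A - 3 * (\<sigma>\<^sup>2 - 0)\<^sup>2 = A - 3 * \<sigma> ^ 4" by simp
  ultimately show "0 \<le> (\<integral>\<omega>. F \<omega> ^ 4 \<partial>P) - 3 * \<sigma> ^ 4" unfolding A_def by simp
  assume lip: "1-lipschitz_on UNIV h"
  have "(\<lambda>m. R (e m)) \<longlonglongrightarrow> R 0" unfolding R_def by (intro tendsto_intros el)
  then have le: "\<bar>(\<integral>\<omega>. h (F \<omega>) \<partial>P) - (\<integral>z. h (\<sigma> * z) * std_normal_density z \<partial>lborel)\<bar> \<le> R 0"
    by (rule LIMSEQ_le_const) (use e lip in auto)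
  have "sqrt (2 / pi) = 2 / sqrt (2 * pi)"
  proof -
    have "sqrt (2 * pi) * sqrt (2 / pi) = 2" by (simp flip: real_sqrt_mult)
    then show ?thesis by (simp add: field_simps)
  qed
  then have "R 0 = ((2 * real q - 1) / (\<sigma> * real q * sqrt (2 * pi)) + 2 / (3 * \<sigma>) * sqrt ((4 * real q - 3) / real q)) * sqrt (A - 3 * \<sigma> ^ 4)"
    unfolding R_def s4 using \<sigma> q by (simp add: power2_eq_square distrib_right)
  with le show "\<bar>(\<integral>\<omega>. h (F \<omega>) \<partial>P) - (\<integral>z. h (\<sigma> * z) * std_normal_density z \<partial>lborel)\<bar> \<le>
      ((2 * real q - 1) / (\<sigma> * real q * sqrt (2 * pi)) + 2 / (3 * \<sigma>) * sqrt ((4 * real q - 3) / real q)) *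
      sqrt ((\<integral>\<omega>. F \<omega> ^ 4 \<partial>P) - 3 * \<sigma> ^ 4)" unfolding A_def by simp
qed

end

section \<open>Passage to the Wasserstein distance\<close>

theorem theorem1p2:
  fixes P :: "'w measure" and M :: "'z measure" and \<eta> :: "'w \<Rightarrow> 'z measure"
    and Q :: "'v measure" and N :: "'v \<Rightarrow> real"
    and F :: "'w \<Rightarrow> real" and q :: nat and \<sigma> :: real
  assumes "prob_space P"
    and "sigma_finite_measure M"
    and "poisson_random_measure P M \<eta>"
    and "q \<ge> 1"
    and "F \<in> poisson_chaos P M \<eta> q"
    and "\<sigma> > 0"
    and "\<sigma>\<^sup>2 = (LINT \<omega>|P. (F \<omega>)\<^sup>2)"
    and "integrable P (\<lambda>\<omega>. (F \<omega>) ^ 4)"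
    and "prob_space Q"
    and "distributed Q lborel N std_normal_density"
  shows "wasserstein_dist P F Q (\<lambda>\<omega>. \<sigma> * N \<omega>) \<le>
      ereal (((2 * real q - 1) / (\<sigma> * real q * sqrt (2 * pi)) +
              2 / (3 * \<sigma>) * sqrt ((4 * real q - 3) / real q)) *
             sqrt ((LINT \<omega>|P. (F \<omega>) ^ 4) - 3 * \<sigma> ^ 4))
    \<and> ((2 * real q - 1) / (\<sigma> * real q * sqrt (2 * pi)) +
              2 / (3 * \<sigma>) * sqrt ((4 * real q - 3) / real q)) *
             sqrt ((LINT \<omega>|P. (F \<omega>) ^ 4) - 3 * \<sigma> ^ 4)
      \<le> (1 / \<sigma> * sqrt (2 / pi) + 4 / (3 * \<sigma>)) *
             sqrt ((LINT \<omega>|P. (F \<omega>) ^ 4) - 3 * \<sigma> ^ 4)"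
proof -
  have "\<exists>Z :: nat \<Rightarrow> 'z set. range Z \<subseteq> sets M \<and> (\<Union>i. Z i) = space M \<and> (\<forall>i. emeasure M (Z i) \<noteq> \<infinity>) \<and> incseq Z"
  proof (rule sigma_finite_measure.sigma_finite_incseq[OF assms(2)])
    fix A :: "nat \<Rightarrow> 'z set"
    assume "range A \<subseteq> sets M" "(\<Union>i. A i) = space M" "\<And>i. emeasure M (A i) \<noteq> \<infinity>" "incseq A"
    then show ?thesis by (intro exI[of _ A]) simp
  qed
  then obtain Z :: "nat \<Rightarrow> 'z set" where Z: "range Z \<subseteq> sets M \<and> (\<Union>i. Z i) = space M \<and> (\<forall>i. emeasure M (Z i) \<noteq> \<infinity>) \<and> incseq Z"
    by (elim exE)
  interpret poisson_process P M \<eta> Z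
  proof (intro poisson_process.intro poisson_process_axioms.intro assms)
    show "Z n \<in> sets M" for n using Z by blast
    show "incseq Z" "(\<Union>n. Z n) = space M" using Z by simp_all
    show "emeasure M (Z n) < \<infinity>" for n using Z by (simp add: less_top)
  qed
  note b = chaos_wasserstein_bound[OF assms(5,4,6,7,8)]
  \<comment> \<open>The constants free of q come from (2q - 1)/q \<le> 2 and, below, (4q - 3)/q
    \<le> 4, together with sqrt(2/pi) = 2/sqrt(2 pi).\<close>
  have qs: "(2 * real q - 1) / (\<sigma> * real q * sqrt (2 * pi)) \<le> 1 / \<sigma> * sqrt (2 / pi)"
  proof -
    have "sqrt (2 * pi) * sqrt (2 / pi) = 2" by (simp flip: real_sqrt_mult)
    then have S: "sqrt (2 / pi) = 2 / sqrt (2 * pi)" by (simp add: field_simps)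
    have "(2 * real q - 1) / real q \<le> 2" using assms(4) by (simp add: field_simps)
    then have "(2 * real q - 1) / real q * (1 / (\<sigma> * sqrt (2 * pi))) \<le> 2 * (1 / (\<sigma> * sqrt (2 * pi)))"
      using assms(6) by (intro mult_right_mono) auto
    then show ?thesis unfolding S by (simp add: ac_simps)
  qed
  have "(4 * real q - 3) / real q \<le> 2\<^sup>2" using assms(4) by (simp add: field_simps)
  then have "sqrt ((4 * real q - 3) / real q) \<le> 2" by (intro real_le_lsqrt) auto
  then have "2 / (3 * \<sigma>) * sqrt ((4 * real q - 3) / real q) \<le> 2 / (3 * \<sigma>) * 2" using assms(6) by (intro mult_left_mono) auto
  then have "2 / (3 * \<sigma>) * sqrt ((4 * real q - 3) / real q) \<le> 4 / (3 * \<sigma>)" by simp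
  note 2 = mult_right_mono[OF add_mono[OF qs this], of "sqrt ((LINT \<omega>|P. (F \<omega>) ^ 4) - 3 * \<sigma> ^ 4)"]
  have "(LINT \<omega>|Q. h (\<sigma> * N \<omega>)) = (\<integral>z. h (\<sigma> * z) * std_normal_density z \<partial>lborel)" if "1-lipschitz_on UNIV h" for h :: "real \<Rightarrow> real"
  proof -
    have [measurable]: "h \<in> borel_measurable borel"
      using lipschitz_on_continuous_on[OF that] by (rule borel_measurable_continuous_onI)
    have "(\<integral>z. std_normal_density z * h (\<sigma> * z) \<partial>lborel) = (LINT \<omega>|Q. h (\<sigma> * N \<omega>))"
      by (rule distributed_integral[OF assms(10), of "\<lambda>z. h (\<sigma> * z)"]) auto
    then show ?thesis by (simp add: mult.commute)
  qed
  then have "wasserstein_dist P F Q (\<lambda>\<omega>. \<sigma> * N \<omega>) \<le>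
      ereal (((2 * real q - 1) / (\<sigma> * real q * sqrt (2 * pi)) + 2 / (3 * \<sigma>) * sqrt ((4 * real q - 3) / real q)) *
             sqrt ((LINT \<omega>|P. (F \<omega>) ^ 4) - 3 * \<sigma> ^ 4))"
    unfolding wasserstein_dist_def using b(2) by (intro SUP_least) simp
  then show ?thesis using 2 b(1) by simp
qed

end
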